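(* Let $\Omega\subset\mathbb{R}^N$ be a bounded domain, $\alpha>0$, $\varepsilon>0$ and $0<m<|\Omega|$. Let $F:\mathcal{U}_{ad}\to\mathbb{R}$ be $$F(\chi)=\alpha\int_\Omega\chi\,\bigl(\nabla u_0+\varepsilon\nabla v(\chi)\bigr)\cdot\nabla u_0 ,$$ and for $\theta\in\overline{\mathcal{U}_{ad}}$ let $$\bar F(\theta)=\inf\Bigl\{\liminf_{n\to\infty}F(\chi_n)\;:\;\chi_n\in\mathcal{U}_{ad},\ \chi_n\rightharpoonup\theta\ \text{weakly-}*\text{ in }L^\infty(\Omega)\Bigr\}.$$ Then for every $\theta\in\overline{\mathcal{U}_{ad}}$, $$\bar F(\theta)=\alpha\int_\Omega\Bigl(\theta\,\bigl[\nabla u_0+\varepsilon\nabla v_\infty(\theta)\bigr]\cdot\nabla u_0-\varepsilon\,\theta(1-\theta)|\nabla u_0|^2\Bigr)\,dx,$$ where $v_\infty(\theta)\in H^1_0(\Omega)$ is the solution $v$ of $$-\alpha\Delta v-\lambda_0v=\lambda_1(\theta)u_0+\mathrm{div}(\alpha\theta\nabla u_0)\ \text{ in }\Omega,\qquad \lambda_1(\theta):=\int_\Omega\alpha\theta|\nabla u_0|^2,\qquad v\perp u_0\ \text{in }L^2(\Omega).$$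
   Context: $\lambda_0$ is the first eigenvalue of $-\alpha\Delta$ on $H^1_0(\Omega)$ and $u_0$ is the associated positive eigenfunction with $\int_\Omega u_0^2=1$. The admissible set is $$\mathcal{U}_{ad}=\{\chi_B:\ B\subseteq\Omega\ \text{measurable},\ |B|=m\}\subset L^\infty(\Omega),$$ with $\chi_B$ the characteristic function of $B$, and its weak-$*$ closure in $L^\infty(\Omega)$ is $$\overline{\mathcal{U}_{ad}}=\Bigl\{\theta\in L^\infty(\Omega):\ 0\le\theta\le1,\ \int_\Omega\theta=m\Bigr\}.$$ For $\chi\in\mathcal{U}_{ad}$, $v(\chi)\in H^1_0(\Omega)$ is the unique weak solution $v$ of $-\alpha\Delta v-\lambda_0v=\lambda_1(\chi)u_0+\mathrm{div}(\alpha\chi\nabla u_0)$ in $\Omega$ with $\lambda_1(\chi)=\int_\Omega\alpha\chi|\nabla u_0|^2$ and $v\perp u_0$ in $L^2(\Omega)$. *)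

theory Defs
  imports "HOL-Analysis.Analysis"
begin

section \<open>Test functions\<close>

definition grad :: "('a::euclidean_space \<Rightarrow> real) \<Rightarrow> 'a \<Rightarrow> 'a" where
  "grad f x = (THE D. GDERIV f x :> D)"

primrec C_k :: "nat \<Rightarrow> ('a::euclidean_space \<Rightarrow> real) \<Rightarrow> bool" where
  "C_k 0 f \<longleftrightarrow> continuous_on UNIV f"
| "C_k (Suc k) f \<longleftrightarrow>
     (\<forall>x. f differentiable (at x)) \<and> (\<forall>b\<in>Basis. C_k k (\<lambda>x. grad f x \<bullet> b))"

definition test_functions :: "'a::euclidean_space set \<Rightarrow> ('a \<Rightarrow> real) set" where
  "test_functions \<Omega> =
     {\<phi>. (\<forall>k. C_k k \<phi>) \<and> compact (closure {x. \<phi> x \<noteq> 0}) \<and> closure {x. \<phi> x \<noteq> 0} \<subseteq> \<Omega>}"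

section \<open>Lebesgue and Sobolev spaces\<close>

text \<open>
  Elements of the function spaces are represented by functions on the whole space; only their
  values on \<open>\<Omega>\<close>, up to Lebesgue-null sets, matter.
\<close>

definition L2 :: "'a::euclidean_space set \<Rightarrow> ('a \<Rightarrow> 'b::euclidean_space) set" where
  "L2 \<Omega> = {f. f \<in> borel_measurable (lebesgue_on \<Omega>) \<and>
              integrable (lebesgue_on \<Omega>) (\<lambda>x. (norm (f x))\<^sup>2)}"

definition has_weak_gradient ::
    "'a::euclidean_space set \<Rightarrow> ('a \<Rightarrow> real) \<Rightarrow> ('a \<Rightarrow> 'a) \<Rightarrow> bool" where
  "has_weak_gradient \<Omega> u g \<longleftrightarrow>
     (\<forall>\<phi>\<in>test_functions \<Omega>. \<forall>b\<in>Basis.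
        (\<integral>x. u x * (grad \<phi> x \<bullet> b) \<partial>lebesgue_on \<Omega>) = - (\<integral>x. (g x \<bullet> b) * \<phi> x \<partial>lebesgue_on \<Omega>))"

definition H1 :: "'a::euclidean_space set \<Rightarrow> ('a \<Rightarrow> real) set" where
  "H1 \<Omega> = {u \<in> L2 \<Omega>. \<exists>g \<in> L2 \<Omega>. has_weak_gradient \<Omega> u g}"

text \<open>
  The weak gradient is determined only up to null sets, whence \<open>SOME\<close> rather than \<open>THE\<close>.
\<close>

definition wgrad :: "'a::euclidean_space set \<Rightarrow> ('a \<Rightarrow> real) \<Rightarrow> 'a \<Rightarrow> 'a" where
  "wgrad \<Omega> u = (SOME g. g \<in> L2 \<Omega> \<and> has_weak_gradient \<Omega> u g)"

text \<open>
  The closure of the test functions in \<open>H1\<close>; the sequence below is the squared \<open>H1\<close>-distance.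
\<close>

definition H10 :: "'a::euclidean_space set \<Rightarrow> ('a \<Rightarrow> real) set" where
  "H10 \<Omega> = {u \<in> H1 \<Omega>. \<exists>\<phi>. (\<forall>n. \<phi> n \<in> test_functions \<Omega>) \<and>
     (\<lambda>n. (\<integral>x. (u x - \<phi> n x)\<^sup>2 \<partial>lebesgue_on \<Omega>)
        + (\<integral>x. (norm (wgrad \<Omega> u x - grad (\<phi> n) x))\<^sup>2 \<partial>lebesgue_on \<Omega>)) \<longlonglongrightarrow> 0}"

section \<open>The eigenvalue problem\<close>

text \<open>Eigenfunctions of \<open>-\<alpha>\<Delta>\<close> on \<open>H10\<close>, in the weak sense.\<close>

definition eigenfunction ::
    "'a::euclidean_space set \<Rightarrow> real \<Rightarrow> real \<Rightarrow> ('a \<Rightarrow> real) \<Rightarrow> bool" where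
  "eigenfunction \<Omega> \<alpha> l u \<longleftrightarrow>
     u \<in> H10 \<Omega> \<and> \<not> (AE x in lebesgue_on \<Omega>. u x = 0) \<and>
     (\<forall>\<phi>\<in>H10 \<Omega>. \<alpha> * (\<integral>x. wgrad \<Omega> u x \<bullet> wgrad \<Omega> \<phi> x \<partial>lebesgue_on \<Omega>)
                 = l * (\<integral>x. u x * \<phi> x \<partial>lebesgue_on \<Omega>))"

definition first_eigenvalue :: "'a::euclidean_space set \<Rightarrow> real \<Rightarrow> real \<Rightarrow> bool" where
  "first_eigenvalue \<Omega> \<alpha> l \<longleftrightarrow>
     (\<exists>u. eigenfunction \<Omega> \<alpha> l u) \<and> (\<forall>l' u. eigenfunction \<Omega> \<alpha> l' u \<longrightarrow> l \<le> l')"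

section \<open>Admissible designs\<close>

definition U_ad :: "'a::euclidean_space set \<Rightarrow> real \<Rightarrow> ('a \<Rightarrow> real) set" where
  "U_ad \<Omega> m = {indicat_real B | B. B \<subseteq> \<Omega> \<and> B \<in> sets lebesgue \<and> measure lebesgue B = m}"

definition U_ad_closure :: "'a::euclidean_space set \<Rightarrow> real \<Rightarrow> ('a \<Rightarrow> real) set" where
  "U_ad_closure \<Omega> m =
     {\<theta>. \<theta> \<in> borel_measurable (lebesgue_on \<Omega>) \<and>
         (AE x in lebesgue_on \<Omega>. 0 \<le> \<theta> x \<and> \<theta> x \<le> 1) \<and>
         (\<integral>x. \<theta> x \<partial>lebesgue_on \<Omega>) = m}"

text \<open>Weak-* convergence in \<open>L\<^sup>\<infinity>\<close>, regarded as the dual of \<open>L\<^sup>1\<close>.\<close>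

definition weak_star_tendsto ::
    "'a::euclidean_space set \<Rightarrow> (nat \<Rightarrow> 'a \<Rightarrow> real) \<Rightarrow> ('a \<Rightarrow> real) \<Rightarrow> bool" where
  "weak_star_tendsto \<Omega> X \<theta> \<longleftrightarrow>
     (\<forall>g. integrable (lebesgue_on \<Omega>) g \<longrightarrow>
        (\<lambda>n. \<integral>x. X n x * g x \<partial>lebesgue_on \<Omega>) \<longlonglongrightarrow> (\<integral>x. \<theta> x * g x \<partial>lebesgue_on \<Omega>))"

section \<open>The state equation and the relaxed functional\<close>

definition lambda1 ::
    "'a::euclidean_space set \<Rightarrow> real \<Rightarrow> ('a \<Rightarrow> real) \<Rightarrow> ('a \<Rightarrow> real) \<Rightarrow> real" where
  "lambda1 \<Omega> \<alpha> u0 \<theta> = (\<integral>x. \<alpha> * \<theta> x * (norm (wgrad \<Omega> u0 x))\<^sup>2 \<partial>lebesgue_on \<Omega>)"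

text \<open>
  Weak formulation of \<open>-\<alpha>\<Delta>v - \<lambda>\<^sub>0v = \<lambda>\<^sub>1(\<theta>)u\<^sub>0 + div(\<alpha>\<theta>\<nabla>u\<^sub>0)\<close> with \<open>v \<bottom> u\<^sub>0\<close>;
  integrating the divergence by parts against \<open>\<phi>\<close> produces the minus sign.
\<close>

definition state_solution ::
    "'a::euclidean_space set \<Rightarrow> real \<Rightarrow> real \<Rightarrow> ('a \<Rightarrow> real) \<Rightarrow> ('a \<Rightarrow> real) \<Rightarrow> ('a \<Rightarrow> real) \<Rightarrow> bool" where
  "state_solution \<Omega> \<alpha> l0 u0 \<theta> v \<longleftrightarrow>
     v \<in> H10 \<Omega> \<and>
     (\<forall>\<phi>\<in>H10 \<Omega>.
        \<alpha> * (\<integral>x. wgrad \<Omega> v x \<bullet> wgrad \<Omega> \<phi> x \<partial>lebesgue_on \<Omega>)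
          - l0 * (\<integral>x. v x * \<phi> x \<partial>lebesgue_on \<Omega>)
        = lambda1 \<Omega> \<alpha> u0 \<theta> * (\<integral>x. u0 x * \<phi> x \<partial>lebesgue_on \<Omega>)
          - (\<integral>x. \<alpha> * \<theta> x * (wgrad \<Omega> u0 x \<bullet> wgrad \<Omega> \<phi> x) \<partial>lebesgue_on \<Omega>)) \<and>
     (\<integral>x. v x * u0 x \<partial>lebesgue_on \<Omega>) = 0"

text \<open>
  The solution is unique as an element of \<open>H10\<close>, i.e. up to null sets. This is both \<open>v(\<chi>)\<close> for
  \<open>\<chi>\<close> in \<open>U_ad\<close> and \<open>v\<^sub>\<infinity>(\<theta>)\<close> for \<open>\<theta>\<close> in \<open>U_ad_closure\<close>.
\<close>

definition state ::
    "'a::euclidean_space set \<Rightarrow> real \<Rightarrow> real \<Rightarrow> ('a \<Rightarrow> real) \<Rightarrow> ('a \<Rightarrow> real) \<Rightarrow> 'a \<Rightarrow> real" where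
  "state \<Omega> \<alpha> l0 u0 \<theta> = (SOME v. state_solution \<Omega> \<alpha> l0 u0 \<theta> v)"

definition F ::
    "'a::euclidean_space set \<Rightarrow> real \<Rightarrow> real \<Rightarrow> ('a \<Rightarrow> real) \<Rightarrow> real \<Rightarrow> ('a \<Rightarrow> real) \<Rightarrow> real" where
  "F \<Omega> \<alpha> l0 u0 \<epsilon> X =
     \<alpha> * (\<integral>x. X x * ((wgrad \<Omega> u0 x + \<epsilon> *\<^sub>R wgrad \<Omega> (state \<Omega> \<alpha> l0 u0 X) x) \<bullet> wgrad \<Omega> u0 x)
            \<partial>lebesgue_on \<Omega>)"

definition F_bar ::
    "'a::euclidean_space set \<Rightarrow> real \<Rightarrow> real \<Rightarrow> ('a \<Rightarrow> real) \<Rightarrow> real \<Rightarrow> real \<Rightarrow> ('a \<Rightarrow> real) \<Rightarrow> ereal" where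
  "F_bar \<Omega> \<alpha> l0 u0 \<epsilon> m \<theta> =
     Inf {liminf (\<lambda>n. ereal (F \<Omega> \<alpha> l0 u0 \<epsilon> (X n))) | X.
            (\<forall>n. X n \<in> U_ad \<Omega> m) \<and> weak_star_tendsto \<Omega> X \<theta>}"

end

theory Submission
  imports Defs "HOL-Complex_Analysis.Great_Picard" "HOL-Library.Diagonal_Subsequence"
begin

text \<open>
  The energy \<open>\<alpha> \<integral>\<nabla>u \<bullet> \<nabla>v - l0 \<integral>u v\<close> is coercive on the orthogonal complement of \<open>u0\<close>: by Rellich's theorem
  this reduces to the simplicity of \<open>l0\<close>, which holds because the modulus of a minimiser is a minimiser and, being
  superharmonic, cannot vanish on a set of positive measure without vanishing almost everywhere.

  Testing the state equation with the state gives \<open>F X = \<lambda>1(X) - \<epsilon> energy (v X) (v X)\<close>. Let \<open>X n\<close> tend to \<open>\<theta>\<close> weakly-*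
  and put \<open>w n = v (X n) - v \<theta>\<close>. Then \<open>w n\<close> tends to zero in \<open>L2\<close>, and up to \<open>o(1)\<close> the gradient \<open>\<nabla>(w n)\<close> is the
  negative of the projection of \<open>(X n - \<theta>) \<nabla>u0\<close> onto gradients. Hence
  \<open>limsup energy (w n) (w n) \<le> \<alpha> lim \<integral>(X n - \<theta>)\<^sup>2 |\<nabla>u0|\<^sup>2 = \<alpha> \<integral>\<theta> (1 - \<theta>) |\<nabla>u0|\<^sup>2\<close>, because \<open>(X n)\<^sup>2 = X n\<close>.

  Equality is reached by laminates whose layers are the level sets of \<open>u0\<close>: if \<open>S\<close> is the small primitive of
  \<open>1\<^bsub>frac (k t) < \<theta>\<^esub> - \<theta>\<close>, then \<open>\<nabla>(S (u0)) = (X - \<theta>) \<nabla>u0\<close>.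
\<close>

section \<open>Smooth functions\<close>

text \<open>\<open>H10\<close> is a closure of test functions and \<open>wgrad\<close> a choice up
  to null sets, so facts about them are proved for test functions and carried over by
  \<open>L2\<close> limits. Nonlinear operations are therefore done with polynomials: for the
  modulus and for the layers it is the derivative that Weierstrass' theorem approximates, so that
  values and gradients are controlled together.

  Four obstacles shape the rest. \<open>first_eigenvalue\<close> only makes \<open>l0\<close> least
  among eigenvalues; nonnegativity of the energy needs a minimiser of the Rayleigh quotient.
  Simplicity needs a strong maximum principle for functions without pointwise values; the barrier
  argument is averaged over the zero set, and an \<open>L2\<close> translation estimate takes the
  place of continuity. A measurable \<theta> has no constant density, so it is rounded to multiples
  of \<open>1 / K\<close> and layered on each slice. Finally the layered sets miss the volume
  \<open>m\<close> by a vanishing amount, repaired on sets of small measure, which disturbs neither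
  the weak limit nor the gradient relation.

  The sign of \<epsilon> makes the upper bound for the energy a lower bound for
  \<open>F\<close>.\<close>

lemma gderiv_unique:
  fixes f :: "'a::euclidean_space \<Rightarrow> real"
  assumes "GDERIV f x :> D" "GDERIV f x :> E"
  shows "D = E"
proof -
  have "(\<lambda>h. h \<bullet> D) = (\<lambda>h. h \<bullet> E)"
    using assms unfolding gderiv_def by (rule has_derivative_unique)
  then have "h \<bullet> D = h \<bullet> E" for h by metis
  then show ?thesis by (metis inner_commute vector_eq_rdot)
qed

lemma grad_eqI:
  fixes f :: "'a::euclidean_space \<Rightarrow> real"
  assumes "GDERIV f x :> D" shows "grad f x = D"
  unfolding grad_def using assms gderiv_unique by blast

lemma gderiv_differentiable: "GDERIV f x :> D \<Longrightarrow> f differentiable (at x)"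
  unfolding gderiv_def differentiable_def by blast

lemma GDERIV_grad:
  fixes f :: "'a::euclidean_space \<Rightarrow> real"
  assumes "f differentiable (at x)" shows "GDERIV f x :> grad f x"
proof -
  obtain f' where f': "(f has_derivative f') (at x)"
    using assms by (auto simp: differentiable_def)
  let ?D = "\<Sum>b\<in>Basis. f' b *\<^sub>R b"
  have lin: "linear f'" using f' by (rule has_derivative_linear)
  have "f' h = h \<bullet> ?D" for h
  proof -
    have "f' h = f' (\<Sum>b\<in>Basis. (h \<bullet> b) *\<^sub>R b)" by (simp add: euclidean_representation)
    also have "\<dots> = (\<Sum>b\<in>Basis. (h \<bullet> b) * f' b)"
      by (simp add: linear_sum[OF lin] linear_scale[OF lin])
    also have "\<dots> = h \<bullet> ?D" by (simp only: inner_sum_right inner_scaleR_right mult.commute)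
    finally show ?thesis .
  qed
  then have "f' = (\<lambda>h. h \<bullet> ?D)" by (rule ext)
  then have "GDERIV f x :> ?D" using f' unfolding gderiv_def by (simp only:)
  then show ?thesis by (simp add: grad_eqI)
qed

text \<open>The gradient is supplied as an explicit \<open>D\<close>, so an induction on the order
  never has to unfold the description operator behind \<open>grad\<close>.\<close>

lemma C_k_Suc_I:
  fixes f :: "'a::euclidean_space \<Rightarrow> real"
  assumes "\<And>x. GDERIV f x :> D x" "\<And>b. b \<in> Basis \<Longrightarrow> C_k k (\<lambda>x. D x \<bullet> b)"
  shows "C_k (Suc k) f"
proof -
  have "grad f = D" using assms(1) grad_eqI by blast
  then show ?thesis using assms gderiv_differentiable[OF assms(1)] by simp
qed

lemma C_k_mono: "C_k (Suc k) f \<Longrightarrow> C_k k f"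
proof (induction k arbitrary: f)
  case 0
  then show ?case
    by (simp add: continuous_at_imp_continuous_on differentiable_imp_continuous_within)
qed auto

lemma C_k_gderiv: "C_k (Suc k) f \<Longrightarrow> GDERIV f x :> grad f x"
  by (simp add: GDERIV_grad)

lemma C_k_continuous: "C_k k f \<Longrightarrow> continuous_on UNIV f"
  by (induction k) (auto dest: C_k_mono simp del: C_k.simps(2))

lemma C_k_const: "C_k k (\<lambda>x. c)"
proof (induction k arbitrary: c)
  case (Suc k)
  show ?case by (rule C_k_Suc_I[OF GDERIV_const]) (use Suc in simp)
qed simp

lemma C_k_add: "C_k k f \<Longrightarrow> C_k k g \<Longrightarrow> C_k k (\<lambda>x. f x + g x)"
proof (induction k arbitrary: f g)
  case 0 then show ?case by (simp add: continuous_on_add)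
next
  case (Suc k)
  show ?case
    by (rule C_k_Suc_I[OF GDERIV_add[OF C_k_gderiv[OF Suc.prems(1)] C_k_gderiv[OF Suc.prems(2)]]])
       (use Suc in \<open>auto simp: inner_add_left\<close>)
qed

lemma C_k_mult: "C_k k f \<Longrightarrow> C_k k g \<Longrightarrow> C_k k (\<lambda>x. f x * g x)"
proof (induction k arbitrary: f g)
  case 0 then show ?case by (simp add: continuous_on_mult)
next
  case (Suc k)
  have "C_k k f" "C_k k g" using Suc.prems C_k_mono by blast+
  then show ?case
    by (intro C_k_Suc_I[OF GDERIV_mult[OF C_k_gderiv[OF Suc.prems(1)] C_k_gderiv[OF Suc.prems(2)]]])
       (use Suc in \<open>auto simp: inner_add_left intro!: C_k_add\<close>)
qed

text \<open>The whole chain \<open>D\<close> of derivatives is supplied at once and the induction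
  generalises over \<open>j\<close>, since the gradient of \<open>D j (f x)\<close> is
  \<open>D (Suc j) (f x)\<close> times that of \<open>f\<close>. Derivatives are asked for only on
  the range of \<open>f\<close>, which lets \<open>powr\<close> be composed with positive
  functions.\<close>

lemma C_k_compose:
  assumes "\<And>j x. (D j has_real_derivative D (Suc j) (f x)) (at (f x))" "C_k k f"
  shows "C_k k (\<lambda>x. D j (f x))"
  using assms(2)
proof (induction k arbitrary: j)
  case 0
  have "isCont (D j) (f x)" for x using assms(1) DERIV_isCont by blast
  then show ?case using 0
    by (auto simp: continuous_on_eq_continuous_at intro!: isCont_o2[of _ f "D j"])
next
  case (Suc k)
  have "C_k k f" using Suc.prems C_k_mono by blast
  with Suc show ?case
    by (intro C_k_Suc_I[OF GDERIV_DERIV_compose[OF C_k_gderiv[OF Suc.prems] assms(1)]])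
       (auto intro!: C_k_mult)
qed

lemma C_k_translate: "C_k k f \<Longrightarrow> C_k k (\<lambda>x. f (x + a))"
proof (induction k arbitrary: f)
  case 0
  then show ?case by (auto intro!: continuous_on_compose2[of UNIV f] continuous_intros)
next
  case (Suc k)
  have "GDERIV (\<lambda>x. f (x + a)) x :> grad f (x + a)" for x
    using C_k_gderiv[OF Suc.prems, of "x + a"] unfolding gderiv_def
    by (rule has_derivative_compose[rotated, where f="\<lambda>x. x + a", simplified]) (auto intro!: derivative_eq_intros)
  then show ?case by (rule C_k_Suc_I) (use Suc in auto)
qed

definition smooth :: "('a::euclidean_space \<Rightarrow> real) \<Rightarrow> bool" where
  "smooth f \<longleftrightarrow> (\<forall>k. C_k k f)"

lemma smooth_gderiv: "smooth f \<Longrightarrow> GDERIV f x :> grad f x"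
  unfolding smooth_def using C_k_gderiv by blast

lemma smooth_partial: "smooth f \<Longrightarrow> b \<in> Basis \<Longrightarrow> smooth (\<lambda>x. grad f x \<bullet> b)"
  unfolding smooth_def using C_k.simps(2) by blast

lemma smooth_const: "smooth (\<lambda>x. c)" by (simp add: smooth_def C_k_const)

lemma smooth_add: "smooth f \<Longrightarrow> smooth g \<Longrightarrow> smooth (\<lambda>x. f x + g x)" by (simp add: smooth_def C_k_add)

lemma smooth_mult: "smooth f \<Longrightarrow> smooth g \<Longrightarrow> smooth (\<lambda>x. f x * g x)" by (simp add: smooth_def C_k_mult)

lemma smooth_cmult: "smooth f \<Longrightarrow> smooth (\<lambda>x. c * f x)" by (simp add: smooth_def C_k_mult C_k_const)

lemma smooth_diff: "smooth f \<Longrightarrow> smooth g \<Longrightarrow> smooth (\<lambda>x. f x - g x)"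
  using smooth_add[OF _ smooth_cmult[where c="-1"], of f g] by simp

lemma smooth_sum: "finite A \<Longrightarrow> (\<And>i. i \<in> A \<Longrightarrow> smooth (f i)) \<Longrightarrow> smooth (\<lambda>x. \<Sum>i\<in>A. f i x)"
  by (induction rule: finite_induct) (simp_all add: smooth_const smooth_add)

lemma GDERIV_inner: "GDERIV (\<lambda>x. x \<bullet> a) x :> a"
  unfolding gderiv_def by (auto intro!: derivative_eq_intros)

lemma smooth_inner: "smooth (\<lambda>x. x \<bullet> a)"
  unfolding smooth_def
proof
  fix k show "C_k k (\<lambda>x. x \<bullet> a)"
  proof (cases k)
    case 0 then show ?thesis by (auto intro!: continuous_intros)
  next
    case (Suc n)
    then show ?thesis
      using C_k_Suc_I[of "\<lambda>x. x \<bullet> a" "\<lambda>x. a" n, OF GDERIV_inner C_k_const] by simp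
  qed
qed

lemma smooth_norm_power2: "smooth (\<lambda>x. (norm x)\<^sup>2)"
proof -
  have "(norm x)\<^sup>2 = (\<Sum>b\<in>Basis. (x \<bullet> b) * (x \<bullet> b))" for x :: 'a
    by (subst power2_norm_eq_inner, subst euclidean_inner) simp
  then show ?thesis using smooth_sum[OF finite_Basis smooth_mult[OF smooth_inner smooth_inner]] by simp
qed

lemma smooth_polynomial:
  fixes p :: "real \<Rightarrow> real"
  assumes "real_polynomial_function p" "smooth f"
  shows "smooth (\<lambda>x. p (f x))"
  using assms(1)
proof induction
  case (linear h)
  then have "h y = h 1 * y" for y
    using linear_scale[of h y 1] by (simp add: bounded_linear.linear mult.commute)
  then have "(\<lambda>x. h (f x)) = (\<lambda>x. h 1 * f x)" by blast
  then show ?case using smooth_cmult[OF assms(2)] by metis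
qed (simp_all add: smooth_const smooth_add smooth_mult)

lemma smooth_translate: "smooth f \<Longrightarrow> smooth (\<lambda>x. f (x + a))" by (simp add: smooth_def C_k_translate)

lemma grad_translate:
  assumes "smooth f" shows "grad (\<lambda>x. f (x + a)) x = grad f (x + a)"
proof (rule grad_eqI)
  show "GDERIV (\<lambda>x. f (x + a)) x :> grad f (x + a)"
    using smooth_gderiv[OF assms, of "x + a"] unfolding gderiv_def
    by (rule has_derivative_compose[rotated, where f="\<lambda>x. x + a", simplified]) (auto intro!: derivative_eq_intros)
qed

lemma grad_add: "smooth f \<Longrightarrow> smooth g \<Longrightarrow> grad (\<lambda>x. f x + g x) x = grad f x + grad g x"
  by (intro grad_eqI GDERIV_add smooth_gderiv)

lemma grad_mult: "smooth f \<Longrightarrow> smooth g \<Longrightarrow> grad (\<lambda>x. f x * g x) x = f x *\<^sub>R grad g x + g x *\<^sub>R grad f x"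
  by (intro grad_eqI GDERIV_mult smooth_gderiv)

lemma grad_cmult: "smooth f \<Longrightarrow> grad (\<lambda>x. c * f x) x = c *\<^sub>R grad f x"
  using grad_mult[OF smooth_const, of f c x] grad_eqI[OF GDERIV_const, of c x] by simp

lemma grad_sum:
  assumes "finite A" "\<And>i. i \<in> A \<Longrightarrow> smooth (f i)"
  shows "grad (\<lambda>x. \<Sum>i\<in>A. f i x) x = (\<Sum>i\<in>A. grad (f i) x)"
  using assms
proof (induction rule: finite_induct)
  case empty then show ?case using grad_eqI[OF GDERIV_const, of 0 x] by simp
next
  case (insert i A)
  then show ?case using grad_add[OF _ smooth_sum, of "f i" A f] by simp
qed

lemma grad_compose: "smooth f \<Longrightarrow> DERIV g (f x) :> d \<Longrightarrow> grad (\<lambda>x. g (f x)) x = d *\<^sub>R grad f x"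
  by (intro grad_eqI GDERIV_DERIV_compose smooth_gderiv)

lemma grad_norm_power2: "grad (\<lambda>x. (norm x)\<^sup>2) x = 2 *\<^sub>R x"
proof (rule grad_eqI)
  show "GDERIV (\<lambda>x. (norm x)\<^sup>2) x :> 2 *\<^sub>R x"
    unfolding gderiv_def power2_norm_eq_inner
    by (auto intro!: derivative_eq_intros simp: inner_commute)
qed

lemma continuous_on_grad:
  assumes "smooth f" shows "continuous_on S (grad f)"
proof -
  have "continuous_on UNIV (\<lambda>x. grad f x \<bullet> b)" if "b \<in> Basis" for b
    using smooth_partial[OF assms that] C_k_continuous unfolding smooth_def by blast
  then have "continuous_on UNIV (\<lambda>x. \<Sum>b\<in>Basis. (grad f x \<bullet> b) *\<^sub>R b)"
    by (intro continuous_on_sum continuous_on_scaleR continuous_on_const)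
  then show ?thesis unfolding euclidean_representation by (rule continuous_on_subset) simp
qed

lemma smooth_continuous_on: "smooth f \<Longrightarrow> continuous_on S f"
  unfolding smooth_def using C_k_continuous continuous_on_subset by blast

subsection \<open>Test functions\<close>

text \<open>Vanishing off some compact \<open>K\<close> confines the support to \<open>K\<close>, so
  the support itself need never be computed.\<close>

lemma test_functionI:
  assumes "smooth \<phi>" "compact K" "K \<subseteq> \<Omega>" "\<And>x. x \<notin> K \<Longrightarrow> \<phi> x = 0"
  shows "\<phi> \<in> test_functions \<Omega>"
proof -
  have "closure {x. \<phi> x \<noteq> 0} \<subseteq> K"
    using assms(2,4) by (intro closure_minimal compact_imp_closed) auto
  moreover from this have "compact (closure {x. \<phi> x \<noteq> 0})"
    using assms(2) by (meson closed_closure compact_closure compact_imp_bounded bounded_subset closure_subset)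
  ultimately show ?thesis using assms by (auto simp: test_functions_def smooth_def)
qed

lemma test_smooth: "\<phi> \<in> test_functions \<Omega> \<Longrightarrow> smooth \<phi>"
  by (simp add: test_functions_def smooth_def)

definition supp :: "('a::euclidean_space \<Rightarrow> real) \<Rightarrow> 'a set" where
  "supp \<phi> = closure {x. \<phi> x \<noteq> 0}"

lemma test_supp:
  assumes "\<phi> \<in> test_functions \<Omega>" shows "compact (supp \<phi>)" "supp \<phi> \<subseteq> \<Omega>"
  using assms by (auto simp: test_functions_def supp_def)

lemma supp_zero: "x \<notin> supp \<phi> \<Longrightarrow> \<phi> x = 0"
  using closure_subset[of "{x. \<phi> x \<noteq> 0}"] by (auto simp: supp_def)

lemma supp_grad_zero:
  assumes "x \<notin> supp \<phi>" shows "grad \<phi> x = 0"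
proof (rule grad_eqI)
  have "((\<lambda>_. 0) has_derivative (\<lambda>h. 0)) (at x)" by simp
  moreover have "open (- supp \<phi>)" unfolding supp_def by (rule open_Compl[OF closed_closure])
  moreover have "x \<in> - supp \<phi>" using assms by simp
  moreover have "0 = \<phi> y" if "y \<in> - supp \<phi>" for y
    by (rule supp_zero[symmetric]) (rule ComplD[OF that])
  ultimately have "(\<phi> has_derivative (\<lambda>h. 0)) (at x)"
    by (rule has_derivative_transform_within_open)
  then show "GDERIV \<phi> x :> 0" unfolding gderiv_def inner_zero_right .
qed

lemma test_mono: "\<phi> \<in> test_functions \<Omega> \<Longrightarrow> \<Omega> \<subseteq> \<Omega>' \<Longrightarrow> \<phi> \<in> test_functions \<Omega>'"
  by (auto simp: test_functions_def)

lemma test_mult_smooth: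
  assumes "\<phi> \<in> test_functions \<Omega>" "smooth f"
  shows "(\<lambda>x. \<phi> x * f x) \<in> test_functions \<Omega>"
  by (rule test_functionI[OF smooth_mult[OF test_smooth[OF assms(1)] assms(2)] test_supp[OF assms(1)]])
     (simp add: supp_zero)

lemma test_cmult: "\<phi> \<in> test_functions \<Omega> \<Longrightarrow> (\<lambda>x. c * \<phi> x) \<in> test_functions \<Omega>"
  using test_mult_smooth[OF _ smooth_const, of \<phi> \<Omega> c] by (simp add: mult.commute)

lemma test_zero: "(\<lambda>x. 0) \<in> test_functions \<Omega>"
  by (rule test_functionI[where K="{}"]) (auto simp: smooth_const)

lemma test_add:
  assumes "\<phi> \<in> test_functions \<Omega>" "\<psi> \<in> test_functions \<Omega>"
  shows "(\<lambda>x. \<phi> x + \<psi> x) \<in> test_functions \<Omega>"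
  by (rule test_functionI[OF smooth_add[OF assms[THEN test_smooth]] compact_Un[OF assms[THEN test_supp(1)]]])
     (use assms[THEN test_supp(2)] in \<open>auto simp: supp_zero\<close>)

lemma test_sum:
  "finite A \<Longrightarrow> (\<And>i. i \<in> A \<Longrightarrow> f i \<in> test_functions \<Omega>) \<Longrightarrow> (\<lambda>x. \<Sum>i\<in>A. f i x) \<in> test_functions \<Omega>"
  by (induction rule: finite_induct) (auto simp: test_zero intro!: test_add)

text \<open>\<open>p 0 = 0\<close> keeps the composite zero wherever the test function is zero. By
  this device a nonlinear map, once approximated by polynomials, acts on test functions.\<close>

lemma test_polynomial:
  fixes p :: "real \<Rightarrow> real"
  assumes "\<phi> \<in> test_functions \<Omega>" "real_polynomial_function p" "p 0 = 0"
  shows "(\<lambda>x. p (\<phi> x)) \<in> test_functions \<Omega>"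
  by (rule test_functionI[OF smooth_polynomial[OF assms(2) test_smooth[OF assms(1)]] test_supp[OF assms(1)]])
     (simp add: supp_zero assms(3))

lemma test_partial:
  assumes "\<phi> \<in> test_functions \<Omega>" "b \<in> Basis"
  shows "(\<lambda>x. grad \<phi> x \<bullet> b) \<in> test_functions \<Omega>"
  by (rule test_functionI[OF smooth_partial[OF test_smooth[OF assms(1)] assms(2)] test_supp[OF assms(1)]])
     (simp add: supp_grad_zero)

lemma test_bounded:
  assumes "\<phi> \<in> test_functions \<Omega>"
  obtains C where "C > 0" "\<And>x. \<bar>\<phi> x\<bar> \<le> C" "\<And>x. norm (grad \<phi> x) \<le> C"
proof -
  have "bounded (\<phi> ` supp \<phi>)" "bounded (grad \<phi> ` supp \<phi>)"
    using test_supp(1)[OF assms] test_smooth[OF assms]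
    by (auto intro!: compact_imp_bounded compact_continuous_image smooth_continuous_on continuous_on_grad)
  then obtain A B where "\<forall>x\<in>supp \<phi>. \<bar>\<phi> x\<bar> \<le> A" "\<forall>x\<in>supp \<phi>. norm (grad \<phi> x) \<le> B"
    unfolding bounded_iff by auto
  then have "\<bar>\<phi> x\<bar> \<le> \<bar>A\<bar> + \<bar>B\<bar> + 1" "norm (grad \<phi> x) \<le> \<bar>A\<bar> + \<bar>B\<bar> + 1" for x
    using supp_zero[of x \<phi>] supp_grad_zero[of x \<phi>] by (cases "x \<in> supp \<phi>"; force)+
  then show ?thesis by (intro that[of "\<bar>A\<bar> + \<bar>B\<bar> + 1"]) auto
qed

subsection \<open>A smooth bump\<close>

text \<open>\<open>flat 1\<close> is the classical smooth function exp (-1/t) that vanishes on the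
  nonpositive axis. The polynomial in \<open>inverse t\<close> makes the family closed under
  differentiation, so smoothness of all orders is one application of
  \<open>C_k_compose\<close>.\<close>

definition flat :: "real poly \<Rightarrow> real \<Rightarrow> real" where
  "flat p t = (if t > 0 then poly p (inverse t) * exp (- inverse t) else 0)"

lemma poly_exp_tendsto_0: "((\<lambda>y. poly p y * exp (- y)) \<longlongrightarrow> 0) at_top" for p :: "real poly"
proof -
  have "((\<lambda>y. \<Sum>i\<le>degree p. coeff p i * (y ^ i / exp y)) \<longlongrightarrow> (\<Sum>i\<le>degree p. coeff p i * 0)) at_top"
    by (intro tendsto_intros tendsto_power_div_exp_0)
  then show ?thesis
    by (simp add: poly_altdef sum_distrib_right exp_minus divide_inverse mult.assoc)
qed

text \<open>With y = 1/t the derivative of p(y) exp(-y) is y^2 (p - p')(y) exp(-y); the factor y^2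
  is \<open>[:0, 0, 1:]\<close>. At zero the exponential beats every polynomial in 1/t.\<close>

lemma flat_DERIV:
  "(flat p has_real_derivative flat ([:0, 0, 1:] * (p - pderiv p)) t) (at t)"
proof (cases "t = 0")
  case True
  have L: "((\<lambda>h. flat p h / h) \<longlongrightarrow> 0) (at_left 0)"
    by (rule tendsto_eventually) (auto simp: flat_def eventually_at_left_field intro!: exI[of _ "-1"])
  \<comment> \<open>Dividing by \<open>h\<close> is one more factor \<open>inverse h\<close>, which
    \<open>pCons 0\<close> puts into the polynomial.\<close>
  have "((\<lambda>h. poly (pCons 0 p) (inverse h) * exp (- inverse h)) \<longlongrightarrow> 0) (at_right 0)"
    by (rule filterlim_compose[OF poly_exp_tendsto_0 filterlim_inverse_at_top_right])
  then have "((\<lambda>h. flat p h / h) \<longlongrightarrow> 0) (at_right (0::real))"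
    by (rule Lim_transform_eventually)
       (auto simp: flat_def eventually_at_right_field divide_inverse intro!: exI[of _ 1])
  with L have "((\<lambda>h. flat p h / h) \<longlongrightarrow> 0) (at 0)" by (simp add: filterlim_split_at)
  with True show ?thesis by (simp add: DERIV_def flat_def)
next
  case False
  show ?thesis
  proof (cases "t > 0")
    case True
    have "((\<lambda>t. poly p (inverse t) * exp (- inverse t)) has_real_derivative
        flat ([:0, 0, 1:] * (p - pderiv p)) t) (at t)"
      using True by (auto intro!: derivative_eq_intros DERIV_chain2[OF poly_DERIV]
          simp: flat_def field_simps power2_eq_square)
    then show ?thesis
      by (rule has_field_derivative_transform_within_open[where S="{0<..}"])
         (use True in \<open>auto simp: flat_def\<close>)
  next
    case neg: False
    have "((\<lambda>t. 0) has_real_derivative 0) (at t)" by simp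
    then have "(flat p has_real_derivative 0) (at t)"
      by (rule has_field_derivative_transform_within_open[where S="{..<0}"])
         (use False neg in \<open>auto simp: flat_def\<close>)
    then show ?thesis using neg by (simp add: flat_def)
  qed
qed

lemma smooth_flat:
  assumes "smooth f" shows "smooth (\<lambda>x. flat p (f x))"
  unfolding smooth_def
proof
  fix k
  define D where "D j = flat (((\<lambda>p. [:0, 0, 1:] * (p - pderiv p)) ^^ j) p)" for j
  have "(D j has_real_derivative D (Suc j) (f x)) (at (f x))" for j x
    using flat_DERIV[of "((\<lambda>p. [:0, 0, 1:] * (p - pderiv p)) ^^ j) p" "f x"]
    unfolding D_def funpow.simps o_apply .
  moreover have "C_k k f" using assms unfolding smooth_def by (rule spec)
  ultimately have "C_k k (\<lambda>x. D 0 (f x))" by (rule C_k_compose)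
  then show "C_k k (\<lambda>x. flat p (f x))" unfolding D_def funpow_0 .
qed

text \<open>The squared norm keeps the argument of \<open>flat\<close> a polynomial in the
  coordinates, so the bump is smooth at its centre as well as at the sphere.\<close>

definition bump :: "'a::euclidean_space \<Rightarrow> real \<Rightarrow> 'a \<Rightarrow> real" where
  "bump c r x = flat 1 (r\<^sup>2 - (norm (x - c))\<^sup>2)"

lemma bump_pos_iff: "r > 0 \<Longrightarrow> bump c r x > 0 \<longleftrightarrow> x \<in> ball c r"
  using power2_less_imp_less[of "norm (x - c)" r] power_strict_mono[of "norm (x - c)" r 2]
  by (auto simp: bump_def flat_def dist_norm norm_minus_commute)

lemma bump_nonneg: "bump c r x \<ge> 0" by (simp add: bump_def flat_def)

lemma bump_le_1: "bump c r x \<le> 1" by (simp add: bump_def flat_def)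

lemma smooth_bump: "smooth (bump c r)"
proof -
  have "smooth (\<lambda>x. (norm (x - c))\<^sup>2)"
    using smooth_translate[OF smooth_norm_power2, of "- c"] by simp
  then have "smooth (\<lambda>x. r\<^sup>2 - (norm (x - c))\<^sup>2)" using smooth_const smooth_diff by blast
  then show ?thesis unfolding bump_def[abs_def] by (rule smooth_flat)
qed

lemma bump_test:
  assumes "r > 0" "cball c r \<subseteq> \<Omega>" shows "bump c r \<in> test_functions \<Omega>"
proof (rule test_functionI[OF smooth_bump compact_cball assms(2)])
  fix x assume "x \<notin> cball c r"
  then have "x \<notin> ball c r" by auto
  then show "bump c r x = 0" using bump_pos_iff[OF assms(1), of c x] bump_nonneg[of c r x] by auto
qed

section \<open>Square-integrable functions\<close>

definition l2_inner :: "'a::euclidean_space set \<Rightarrow> ('a \<Rightarrow> 'b::euclidean_space) \<Rightarrow> ('a \<Rightarrow> 'b) \<Rightarrow> real" where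
  "l2_inner \<Omega> f g = (\<integral>x. f x \<bullet> g x \<partial>lebesgue_on \<Omega>)"

definition l2_norm :: "'a::euclidean_space set \<Rightarrow> ('a \<Rightarrow> 'b::euclidean_space) \<Rightarrow> real" where
  "l2_norm \<Omega> f = sqrt (l2_inner \<Omega> f f)"

text \<open>For positive \<open>c\<close> evaluate at the vertex \<open>t = - b / c\<close>; for
  \<open>c = 0\<close> an affine function bounded below has slope zero. The degenerate case is kept
  because the forms involved are only semidefinite: besides Cauchy-Schwarz, this gives kernel
  membership in \<open>energy_zero_orthogonal\<close> and the Euler equation in
  \<open>energy_solvable\<close>.\<close>

lemma quadratic_nonneg_discriminant:
  fixes a b c :: real
  assumes "\<And>t. 0 \<le> a + 2 * t * b + t\<^sup>2 * c" "0 \<le> c"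
  shows "b\<^sup>2 \<le> a * c"
proof (cases "c = 0")
  case True
  have "b = 0"
  proof (rule ccontr)
    assume "b \<noteq> 0"
    then have "a + 2 * (- (a + 1) / (2 * b)) * b = -1" by (simp add: field_simps)
    then show False using assms(1)[of "- (a + 1) / (2 * b)"] True by simp
  qed
  then show ?thesis using True by simp
next
  case False
  then have c: "c > 0" using assms(2) by simp
  have "a + 2 * (- b / c) * b + (- b / c)\<^sup>2 * c = a - b\<^sup>2 / c"
    using c by (simp add: field_simps power2_eq_square)
  then have "b\<^sup>2 / c \<le> a" using assms(1)[of "- b / c"] by simp
  then show ?thesis using c by (simp add: field_simps)
qed

lemma L2_measurable: "f \<in> L2 \<Omega> \<Longrightarrow> f \<in> borel_measurable (lebesgue_on \<Omega>)"
  by (simp add: L2_def)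

lemma L2_power2_integrable: "f \<in> L2 \<Omega> \<Longrightarrow> integrable (lebesgue_on \<Omega>) (\<lambda>x. (norm (f x))\<^sup>2)"
  by (simp add: L2_def)

lemma L2_I_bound:
  assumes "f \<in> borel_measurable (lebesgue_on \<Omega>)" "integrable (lebesgue_on \<Omega>) w"
    "AE x in lebesgue_on \<Omega>. (norm (f x))\<^sup>2 \<le> w x"
  shows "f \<in> L2 \<Omega>"
  unfolding L2_def
proof (intro CollectI conjI assms(1))
  have [measurable]: "f \<in> borel_measurable (lebesgue_on \<Omega>)" by (fact assms(1))
  show "integrable (lebesgue_on \<Omega>) (\<lambda>x. (norm (f x))\<^sup>2)"
    by (rule Bochner_Integration.integrable_bound[OF assms(2)]) (use assms(3) in auto)
qed

lemma norm_power2_le_double: "(norm (a + b))\<^sup>2 \<le> 2 * (norm a)\<^sup>2 + 2 * (norm (b::'b::real_normed_vector))\<^sup>2"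
proof -
  have "(norm (a + b))\<^sup>2 \<le> (norm a + norm b)\<^sup>2" by (simp add: norm_triangle_ineq power_mono)
  also have "\<dots> \<le> 2 * (norm a)\<^sup>2 + 2 * (norm b)\<^sup>2"
    using zero_le_power2[of "norm a - norm b"] by (simp add: power2_eq_square algebra_simps)
  finally show ?thesis .
qed

lemma L2_add:
  assumes "f \<in> L2 \<Omega>" "g \<in> L2 \<Omega>" shows "(\<lambda>x. f x + g x) \<in> L2 \<Omega>"
proof (rule L2_I_bound)
  show "(\<lambda>x. f x + g x) \<in> borel_measurable (lebesgue_on \<Omega>)"
    by (rule borel_measurable_add[OF assms[THEN L2_measurable]])
  show "integrable (lebesgue_on \<Omega>) (\<lambda>x. 2 * (norm (f x))\<^sup>2 + 2 * (norm (g x))\<^sup>2)"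
    using assms[THEN L2_power2_integrable] by simp
qed (simp add: norm_power2_le_double)

lemma L2_mult_bounded:
  assumes "f \<in> L2 \<Omega>" "h \<in> borel_measurable (lebesgue_on \<Omega>)" "AE x in lebesgue_on \<Omega>. \<bar>h x\<bar> \<le> C"
  shows "(\<lambda>x. h x *\<^sub>R f x) \<in> L2 \<Omega>"
proof (rule L2_I_bound)
  show "(\<lambda>x. h x *\<^sub>R f x) \<in> borel_measurable (lebesgue_on \<Omega>)"
    using assms(2) L2_measurable[OF assms(1)] by measurable
  show "integrable (lebesgue_on \<Omega>) (\<lambda>x. C\<^sup>2 * (norm (f x))\<^sup>2)"
    using L2_power2_integrable[OF assms(1)] by simp
  show "AE x in lebesgue_on \<Omega>. (norm (h x *\<^sub>R f x))\<^sup>2 \<le> C\<^sup>2 * (norm (f x))\<^sup>2"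
    using assms(3)
  proof eventually_elim
    case (elim x)
    then have "\<bar>h x\<bar>\<^sup>2 \<le> C\<^sup>2" by (intro power_mono) auto
    then show ?case by (simp add: power_mult_distrib mult_right_mono)
  qed
qed

lemma L2_scaleR: "f \<in> L2 \<Omega> \<Longrightarrow> (\<lambda>x. c *\<^sub>R f x) \<in> L2 \<Omega>"
  by (rule L2_mult_bounded[where C="\<bar>c\<bar>"]) auto

lemma L2_cmult: "f \<in> L2 \<Omega> \<Longrightarrow> (\<lambda>x. c * f x) \<in> L2 \<Omega>" for f :: "_ \<Rightarrow> real"
  using L2_scaleR[of f \<Omega> c] by simp

lemma L2_diff: "f \<in> L2 \<Omega> \<Longrightarrow> g \<in> L2 \<Omega> \<Longrightarrow> (\<lambda>x. f x - g x) \<in> L2 \<Omega>"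
  using L2_add[OF _ L2_scaleR, of f \<Omega> g "-1"] by simp

lemma L2_inner_integrable:
  assumes "f \<in> L2 \<Omega>" "g \<in> L2 \<Omega>"
  shows "integrable (lebesgue_on \<Omega>) (\<lambda>x. f x \<bullet> g x)"
proof (rule Bochner_Integration.integrable_bound)
  show "integrable (lebesgue_on \<Omega>) (\<lambda>x. (norm (f x))\<^sup>2 + (norm (g x))\<^sup>2)"
    using assms by (intro Bochner_Integration.integrable_add L2_power2_integrable)
  show "(\<lambda>x. f x \<bullet> g x) \<in> borel_measurable (lebesgue_on \<Omega>)"
    using assms[THEN L2_measurable] by measurable
  have "\<bar>a \<bullet> b\<bar> \<le> \<bar>(norm a)\<^sup>2 + (norm b)\<^sup>2\<bar>" for a b :: 'b
  proof -
    have "\<bar>a \<bullet> b\<bar> \<le> norm a * norm b" by (rule Cauchy_Schwarz_ineq2)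
    also have "\<dots> \<le> (norm a)\<^sup>2 + (norm b)\<^sup>2"
      using zero_le_power2[of "norm a - norm b"] mult_nonneg_nonneg[OF norm_ge_zero[of a] norm_ge_zero[of b]]
      unfolding power2_diff by linarith
    finally show ?thesis by simp
  qed
  then show "AE x in lebesgue_on \<Omega>. norm (f x \<bullet> g x) \<le> norm ((norm (f x))\<^sup>2 + (norm (g x))\<^sup>2)"
    by simp
qed

lemma L2_mult_integrable:
  "f \<in> L2 \<Omega> \<Longrightarrow> g \<in> L2 \<Omega> \<Longrightarrow> integrable (lebesgue_on \<Omega>) (\<lambda>x. f x * g x)" for f :: "_ \<Rightarrow> real"
  using L2_inner_integrable[of f \<Omega> g] by simp

lemma l2_inner_commute: "l2_inner \<Omega> f g = l2_inner \<Omega> g f"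
  by (simp add: l2_inner_def inner_commute)

lemma l2_inner_add_left:
  "f \<in> L2 \<Omega> \<Longrightarrow> g \<in> L2 \<Omega> \<Longrightarrow> h \<in> L2 \<Omega> \<Longrightarrow>
    l2_inner \<Omega> (\<lambda>x. f x + g x) h = l2_inner \<Omega> f h + l2_inner \<Omega> g h"
  by (simp add: l2_inner_def inner_add_left L2_inner_integrable)

lemma l2_inner_scaleR_left: "l2_inner \<Omega> (\<lambda>x. c *\<^sub>R f x) h = c * l2_inner \<Omega> f h"
  by (simp add: l2_inner_def)

lemma l2_inner_diff_left:
  "f \<in> L2 \<Omega> \<Longrightarrow> g \<in> L2 \<Omega> \<Longrightarrow> h \<in> L2 \<Omega> \<Longrightarrow>
    l2_inner \<Omega> (\<lambda>x. f x - g x) h = l2_inner \<Omega> f h - l2_inner \<Omega> g h"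
  by (simp add: l2_inner_def inner_diff_left L2_inner_integrable)

lemma l2_inner_add_right:
  "f \<in> L2 \<Omega> \<Longrightarrow> g \<in> L2 \<Omega> \<Longrightarrow> h \<in> L2 \<Omega> \<Longrightarrow>
    l2_inner \<Omega> h (\<lambda>x. f x + g x) = l2_inner \<Omega> h f + l2_inner \<Omega> h g"
  using l2_inner_add_left[of f \<Omega> g h] by (simp add: l2_inner_commute)

lemma l2_inner_diff_right:
  "f \<in> L2 \<Omega> \<Longrightarrow> g \<in> L2 \<Omega> \<Longrightarrow> h \<in> L2 \<Omega> \<Longrightarrow>
    l2_inner \<Omega> h (\<lambda>x. f x - g x) = l2_inner \<Omega> h f - l2_inner \<Omega> h g"
  using l2_inner_diff_left[of f \<Omega> g h] by (simp add: l2_inner_commute)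

lemma l2_inner_scaleR_right: "l2_inner \<Omega> h (\<lambda>x. c *\<^sub>R f x) = c * l2_inner \<Omega> h f"
  by (simp add: l2_inner_def)

lemma l2_inner_self: "l2_inner \<Omega> f f = (\<integral>x. (norm (f x))\<^sup>2 \<partial>lebesgue_on \<Omega>)"
  by (simp add: l2_inner_def power2_norm_eq_inner)

lemma l2_inner_self_nonneg: "l2_inner \<Omega> f f \<ge> 0"
  by (simp add: l2_inner_self)

lemma l2_norm_nonneg: "l2_norm \<Omega> f \<ge> 0"
  by (simp add: l2_norm_def l2_inner_self_nonneg)

lemma l2_norm_power2: "(l2_norm \<Omega> f)\<^sup>2 = l2_inner \<Omega> f f"
  by (simp add: l2_norm_def l2_inner_self_nonneg)

lemma l2_norm_scaleR: "l2_norm \<Omega> (\<lambda>x. c *\<^sub>R f x) = \<bar>c\<bar> * l2_norm \<Omega> f"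
  by (simp add: l2_norm_def l2_inner_scaleR_left l2_inner_scaleR_right real_sqrt_mult)

lemma l2_norm_commute: "l2_norm \<Omega> (\<lambda>x. f x - g x) = l2_norm \<Omega> (\<lambda>x. g x - f x)"
  by (simp add: l2_norm_def l2_inner_self norm_minus_commute)

lemma l2_norm_cong_AE:
  assumes "f \<in> borel_measurable (lebesgue_on \<Omega>)" "g \<in> borel_measurable (lebesgue_on \<Omega>)"
    "AE x in lebesgue_on \<Omega>. f x = g x"
  shows "l2_norm \<Omega> f = l2_norm \<Omega> g"
proof -
  have "(\<integral>x. f x \<bullet> f x \<partial>lebesgue_on \<Omega>) = (\<integral>x. g x \<bullet> g x \<partial>lebesgue_on \<Omega>)"
    by (rule integral_cong_AE) (use assms in auto)
  then show ?thesis by (simp add: l2_norm_def l2_inner_def)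
qed

lemma l2_inner_cong_AE:
  assumes "f \<in> borel_measurable (lebesgue_on \<Omega>)" "g \<in> borel_measurable (lebesgue_on \<Omega>)"
    "h \<in> borel_measurable (lebesgue_on \<Omega>)"
    "AE x in lebesgue_on \<Omega>. f x = g x"
  shows "l2_inner \<Omega> f h = l2_inner \<Omega> g h"
  unfolding l2_inner_def by (rule integral_cong_AE) (use assms in auto)

lemma l2_Cauchy_Schwarz:
  assumes "f \<in> L2 \<Omega>" "g \<in> L2 \<Omega>"
  shows "\<bar>l2_inner \<Omega> f g\<bar> \<le> l2_norm \<Omega> f * l2_norm \<Omega> g"
proof -
  have "0 \<le> l2_inner \<Omega> f f + 2 * t * l2_inner \<Omega> f g + t\<^sup>2 * l2_inner \<Omega> g g" for t
  proof -
    have tg: "(\<lambda>x. t *\<^sub>R g x) \<in> L2 \<Omega>" "(\<lambda>x. f x + t *\<^sub>R g x) \<in> L2 \<Omega>"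
      using assms L2_scaleR L2_add by blast+
    have "0 \<le> l2_inner \<Omega> (\<lambda>x. f x + t *\<^sub>R g x) (\<lambda>x. f x + t *\<^sub>R g x)" by (rule l2_inner_self_nonneg)
    also have "\<dots> = l2_inner \<Omega> f f + 2 * t * l2_inner \<Omega> f g + t\<^sup>2 * l2_inner \<Omega> g g"
      using assms tg l2_inner_commute[of \<Omega> f g]
      by (simp add: l2_inner_add_left l2_inner_add_right l2_inner_scaleR_left l2_inner_scaleR_right
          power2_eq_square algebra_simps)
    finally show ?thesis .
  qed
  then have "(l2_inner \<Omega> f g)\<^sup>2 \<le> l2_inner \<Omega> f f * l2_inner \<Omega> g g"
    by (rule quadratic_nonneg_discriminant) (rule l2_inner_self_nonneg)
  then have "(l2_inner \<Omega> f g)\<^sup>2 \<le> (l2_norm \<Omega> f * l2_norm \<Omega> g)\<^sup>2"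
    by (simp add: power_mult_distrib l2_norm_power2)
  then show ?thesis using abs_le_square_iff[of "l2_inner \<Omega> f g" "l2_norm \<Omega> f * l2_norm \<Omega> g"]
    by (simp add: l2_norm_nonneg)
qed

lemma l2_norm_triangle:
  assumes "f \<in> L2 \<Omega>" "g \<in> L2 \<Omega>"
  shows "l2_norm \<Omega> (\<lambda>x. f x + g x) \<le> l2_norm \<Omega> f + l2_norm \<Omega> g"
proof -
  have "(l2_norm \<Omega> (\<lambda>x. f x + g x))\<^sup>2 = (l2_norm \<Omega> f)\<^sup>2 + 2 * l2_inner \<Omega> f g + (l2_norm \<Omega> g)\<^sup>2"
    using assms L2_add[OF assms] l2_inner_commute[of \<Omega> f g]
    by (simp add: l2_norm_power2 l2_inner_add_left l2_inner_add_right)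
  also have "\<dots> \<le> (l2_norm \<Omega> f + l2_norm \<Omega> g)\<^sup>2"
    using l2_Cauchy_Schwarz[OF assms] by (simp add: power2_sum)
  finally show ?thesis by (rule power2_le_imp_le) (simp add: l2_norm_nonneg)
qed

lemma l2_norm_triangle_diff:
  assumes "f \<in> L2 \<Omega>" "g \<in> L2 \<Omega>" "h \<in> L2 \<Omega>"
  shows "l2_norm \<Omega> (\<lambda>x. f x - h x) \<le> l2_norm \<Omega> (\<lambda>x. f x - g x) + l2_norm \<Omega> (\<lambda>x. g x - h x)"
  using l2_norm_triangle[OF L2_diff[OF assms(1,2)] L2_diff[OF assms(2,3)]] by simp

lemma l2_norm_le_add_diff:
  assumes "f \<in> L2 \<Omega>" "g \<in> L2 \<Omega>"
  shows "l2_norm \<Omega> f \<le> l2_norm \<Omega> g + l2_norm \<Omega> (\<lambda>x. f x - g x)"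
  using l2_norm_triangle[OF assms(2) L2_diff[OF assms]] by simp

lemma l2_norm_tendsto:
  assumes "\<And>n. f n \<in> L2 \<Omega>" "g \<in> L2 \<Omega>" "(\<lambda>n. l2_norm \<Omega> (\<lambda>x. f n x - g x)) \<longlonglongrightarrow> 0"
  shows "(\<lambda>n. l2_norm \<Omega> (f n)) \<longlonglongrightarrow> l2_norm \<Omega> g"
proof (rule metric_LIMSEQ_I)
  fix e :: real assume "e > 0"
  then obtain N where N: "\<And>n. n \<ge> N \<Longrightarrow> \<bar>l2_norm \<Omega> (\<lambda>x. f n x - g x)\<bar> < e"
    using LIMSEQ_D[OF assms(3)] by force
  have "\<bar>l2_norm \<Omega> (f n) - l2_norm \<Omega> g\<bar> < e" if "n \<ge> N" for n
    using N[OF that] l2_norm_le_add_diff[OF assms(1)[of n] assms(2)] l2_norm_le_add_diff[OF assms(2) assms(1)[of n]]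
      l2_norm_commute[of \<Omega> "f n" g] by linarith
  then show "\<exists>N. \<forall>n\<ge>N. dist (l2_norm \<Omega> (f n)) (l2_norm \<Omega> g) < e" by (auto simp: dist_real_def)
qed

lemma l2_inner_tendsto:
  assumes "\<And>n. f n \<in> L2 \<Omega>" "g \<in> L2 \<Omega>" "h \<in> L2 \<Omega>" "(\<lambda>n. l2_norm \<Omega> (\<lambda>x. f n x - g x)) \<longlonglongrightarrow> 0"
  shows "(\<lambda>n. l2_inner \<Omega> (f n) h) \<longlonglongrightarrow> l2_inner \<Omega> g h"
proof -
  have "(\<lambda>n. l2_inner \<Omega> (f n) h - l2_inner \<Omega> g h) \<longlonglongrightarrow> 0"
  proof (rule Lim_null_comparison)
    show "\<forall>\<^sub>F n in sequentially. norm (l2_inner \<Omega> (f n) h - l2_inner \<Omega> g h)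
        \<le> l2_norm \<Omega> (\<lambda>x. f n x - g x) * l2_norm \<Omega> h"
      using l2_Cauchy_Schwarz[OF L2_diff[OF assms(1,2)] assms(3)] assms
      by (intro always_eventually) (simp add: l2_inner_diff_left)
    show "(\<lambda>n. l2_norm \<Omega> (\<lambda>x. f n x - g x) * l2_norm \<Omega> h) \<longlonglongrightarrow> 0"
      using tendsto_mult_right[OF assms(4), of "l2_norm \<Omega> h"] by simp
  qed
  then show ?thesis by (rule LIM_zero_cancel)
qed

lemma l2_inner_zeroI: "f \<in> L2 \<Omega> \<Longrightarrow> l2_norm \<Omega> f = 0 \<Longrightarrow> AE x in lebesgue_on \<Omega>. f x = 0"
proof -
  assume f: "f \<in> L2 \<Omega>" "l2_norm \<Omega> f = 0"
  then have "(\<integral>x. (norm (f x))\<^sup>2 \<partial>lebesgue_on \<Omega>) = 0"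
    using l2_norm_power2[of \<Omega> f] by (simp add: l2_inner_self)
  then show ?thesis
    using integral_nonneg_eq_0_iff_AE[OF L2_power2_integrable[OF f(1)]] by auto
qed

text \<open>Interpreted not only at the given domain but also at \<open>{0<..<1}\<close> and at
  balls, where \<open>jensen_nn\<close> is wanted for integrals along segments and for
  averages.\<close>

locale bounded_open =
  fixes \<Omega> :: "'a::euclidean_space set"
  assumes open_dom: "open \<Omega>" and bounded_dom: "bounded \<Omega>"
begin

abbreviation "M \<equiv> lebesgue_on \<Omega>"

lemma dom_lmeasurable: "\<Omega> \<in> lmeasurable"
  using open_dom bounded_dom by (simp add: lmeasurable_open)

lemma dom_sets [simp]: "\<Omega> \<in> sets lebesgue"
  using dom_lmeasurable by (simp add: fmeasurableD)

lemma space_M: "space M = \<Omega>" by simp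

lemma finite_measure_M: "finite_measure M"
  by (rule finite_measureI)
     (use dom_lmeasurable in \<open>simp add: emeasure_restrict_space fmeasurable_def\<close>)

sublocale M: finite_measure M by (rule finite_measure_M)

lemma borel_measurable_M: "f \<in> borel_measurable borel \<Longrightarrow> f \<in> borel_measurable M"
  by (simp add: measurable_restrict_space1 measurable_completion)

lemma bounded_integrable:
  fixes f :: "'a \<Rightarrow> 'b::{banach, second_countable_topology}"
  assumes "f \<in> borel_measurable M" "AE x in M. norm (f x) \<le> C"
  shows "integrable M f"
  using assms M.integrable_const_bound by blast

lemma bounded_L2:
  assumes "f \<in> borel_measurable M" "AE x in M. norm (f x) \<le> C"
  shows "f \<in> L2 \<Omega>"
proof (rule L2_I_bound[OF assms(1)])
  show "AE x in M. (norm (f x))\<^sup>2 \<le> C\<^sup>2" using assms(2) by eventually_elim (simp add: power_mono)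
qed simp

lemma L2_integrable:
  assumes "f \<in> L2 \<Omega>" shows "integrable M f"
proof (rule Bochner_Integration.integrable_bound)
  show "integrable M (\<lambda>x. 1 + (norm (f x))\<^sup>2)" using L2_power2_integrable[OF assms] by simp
  have "t \<le> 1 + t\<^sup>2" for t :: real
    using zero_le_power2[of "t - 1"] zero_le_power2[of t] unfolding power2_diff power_one mult_1_right by linarith
  then show "AE x in M. norm (f x) \<le> norm (1 + (norm (f x))\<^sup>2)" by (simp add: abs_of_nonneg)
qed (use L2_measurable[OF assms] in simp)

lemma L1_le_l2_norm:
  assumes "f \<in> L2 \<Omega>"
  shows "(\<integral>x. norm (f x) \<partial>M) \<le> sqrt (measure lebesgue \<Omega>) * l2_norm \<Omega> f"
proof -
  have 1: "(\<lambda>x. 1::real) \<in> L2 \<Omega>" by (rule bounded_L2[where C=1]) auto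
  have n: "(\<lambda>x. norm (f x)) \<in> L2 \<Omega>" using assms by (auto simp: L2_def)
  have "(\<integral>x. norm (f x) \<partial>M) = l2_inner \<Omega> (\<lambda>x. 1) (\<lambda>x. norm (f x))" by (simp add: l2_inner_def)
  also have "\<dots> \<le> l2_norm \<Omega> (\<lambda>x. 1::real) * l2_norm \<Omega> (\<lambda>x. norm (f x))"
    using l2_Cauchy_Schwarz[OF 1 n] by linarith
  also have "l2_norm \<Omega> (\<lambda>x. 1::real) = sqrt (measure lebesgue \<Omega>)"
    by (simp add: l2_norm_def l2_inner_def measure_restrict_space)
  also have "l2_norm \<Omega> (\<lambda>x. norm (f x)) = l2_norm \<Omega> f"
    by (simp add: l2_norm_def l2_inner_self)
  finally show ?thesis .
qed

lemma AE_M_iff: "(AE x in M. P x) \<longleftrightarrow> (AE x in lebesgue. x \<in> \<Omega> \<longrightarrow> P x)"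
  by (simp add: AE_restrict_space_iff)

text \<open>Riesz-Fischer. A subsequence whose increments are below \<open>(1/2)^k\<close> in
  \<open>L2\<close>, hence summable in \<open>L1\<close> on a domain of finite measure, converges
  almost everywhere; Fatou's lemma then upgrades this to norm convergence.\<close>

lemma L2_complete:
  fixes f :: "nat \<Rightarrow> 'a \<Rightarrow> 'b::euclidean_space"
  assumes f: "\<And>n. f n \<in> L2 \<Omega>"
    and cauchy: "\<And>e. e > 0 \<Longrightarrow> \<exists>N. \<forall>m\<ge>N. \<forall>n\<ge>N. l2_norm \<Omega> (\<lambda>x. f m x - f n x) < e"
  obtains g where "g \<in> L2 \<Omega>" "(\<lambda>n. l2_norm \<Omega> (\<lambda>x. f n x - g x)) \<longlonglongrightarrow> 0"
proof -
  have [measurable]: "f n \<in> borel_measurable M" for n using f L2_measurable by blast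
  have "\<exists>r. strict_mono r \<and> (\<forall>k. \<forall>m\<ge>r k. \<forall>n\<ge>r k. l2_norm \<Omega> (\<lambda>x. f m x - f n x) < (1/2)^k)"
  proof -
    define h where "h k L = (SOME N. N > L \<and> (\<forall>m\<ge>N. \<forall>n\<ge>N. l2_norm \<Omega> (\<lambda>x. f m x - f n x) < (1/2)^k))"
      for k :: nat and L :: nat
    have h: "h k L > L \<and> (\<forall>m\<ge>h k L. \<forall>n\<ge>h k L. l2_norm \<Omega> (\<lambda>x. f m x - f n x) < (1/2)^k)" for k L
      unfolding h_def
    proof (rule someI_ex)
      obtain N where N: "\<forall>m\<ge>N. \<forall>n\<ge>N. l2_norm \<Omega> (\<lambda>x. f m x - f n x) < (1/2)^k"
        using cauchy[of "(1/2)^k"] by auto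
      then show "\<exists>N. N > L \<and> (\<forall>m\<ge>N. \<forall>n\<ge>N. l2_norm \<Omega> (\<lambda>x. f m x - f n x) < (1/2)^k)"
        by (intro exI[of _ "max N (Suc L)"]) auto
    qed
    define r where "r = rec_nat (h 0 0) (\<lambda>k. h (Suc k))"
    have rS: "r (Suc k) = h (Suc k) (r k)" "r 0 = h 0 0" for k by (simp_all add: r_def)
    have "strict_mono r" by (simp add: strict_mono_Suc_iff rS h)
    moreover have "\<forall>m\<ge>r k. \<forall>n\<ge>r k. l2_norm \<Omega> (\<lambda>x. f m x - f n x) < (1/2)^k" for k
    proof (cases k)
      case 0
      show ?thesis unfolding 0 rS using h[of 0 0] by (rule conjunct2)
    next
      case (Suc n)
      show ?thesis unfolding Suc rS by (rule conjunct2[OF h])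
    qed
    ultimately show ?thesis by blast
  qed
  then obtain r where r: "strict_mono r"
    "\<And>k m n. m \<ge> r k \<Longrightarrow> n \<ge> r k \<Longrightarrow> l2_norm \<Omega> (\<lambda>x. f m x - f n x) < (1/2)^k" by blast
  define d where "d k x = norm (f (r (Suc k)) x - f (r k) x)" for k x
  have [measurable]: "d k \<in> borel_measurable M" for k unfolding d_def by measurable
  have dL: "(\<lambda>x. f (r (Suc k)) x - f (r k) x) \<in> L2 \<Omega>" for k by (intro L2_diff f)
  have dint: "integrable M (d k)" for k
    unfolding d_def by (intro integrable_norm L2_integrable dL)
  define C where "C = sqrt (measure lebesgue \<Omega>)"
  have C: "C \<ge> 0" by (simp add: C_def)
  have dle: "(\<integral>x. d k x \<partial>M) \<le> C * (1/2)^k" for k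
  proof -
    have "l2_norm \<Omega> (\<lambda>x. f (r (Suc k)) x - f (r k) x) \<le> (1/2)^k"
      using r(2)[of k "r (Suc k)" "r k"] strict_mono_leD[OF r(1), of k "Suc k"] by simp
    then show ?thesis using L1_le_l2_norm[OF dL, of k] C
      unfolding d_def C_def[symmetric] by (meson mult_left_mono order_trans)
  qed
  have "(\<integral>\<^sup>+x. (\<Sum>k. ennreal (d k x)) \<partial>M) = (\<Sum>k. \<integral>\<^sup>+x. ennreal (d k x) \<partial>M)"
    by (rule nn_integral_suminf) measurable
  also have "\<dots> = (\<Sum>k. ennreal (\<integral>x. d k x \<partial>M))"
    by (intro suminf_cong nn_integral_eq_integral dint) (auto simp: d_def)
  also have "\<dots> \<le> (\<Sum>k. ennreal (C * (1/2)^k))"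
    by (intro suminf_le ennreal_leI dle) auto
  also have "\<dots> = ennreal (\<Sum>k. C * (1/2)^k)"
    using C by (intro suminf_ennreal2) (auto intro!: summable_mult summable_geometric)
  also have "\<dots> < \<infinity>" by simp
  finally have "AE x in M. (\<Sum>k. ennreal (d k x)) \<noteq> \<infinity>"
    by (intro nn_integral_PInf_AE) auto
  then have conv: "AE x in M. convergent (\<lambda>k. f (r k) x)"
  proof eventually_elim
    case (elim x)
    then have "summable (\<lambda>k. norm (f (r (Suc k)) x - f (r k) x))"
      unfolding d_def by (intro summable_suminf_not_top) auto
    then have "summable (\<lambda>k. f (r (Suc k)) x - f (r k) x)" by (rule summable_norm_cancel)
    then obtain s where "(\<lambda>k. f (r (Suc k)) x - f (r k) x) sums s" by (auto simp: summable_def)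
    then have "(\<lambda>n. f (r n) x - f (r 0) x) \<longlonglongrightarrow> s"
      unfolding sums_def by (simp add: sum_lessThan_telescope[of "\<lambda>k. f (r k) x"])
    then have "(\<lambda>n. (f (r n) x - f (r 0) x) + f (r 0) x) \<longlonglongrightarrow> s + f (r 0) x"
      by (intro tendsto_add tendsto_const)
    then show ?case by (auto simp: convergent_def)
  qed
  define g where "g x = lim (\<lambda>k. f (r k) x)" for x
  have [measurable]: "g \<in> borel_measurable M" unfolding g_def by measurable
  have lim: "AE x in M. (\<lambda>k. f (r k) x) \<longlonglongrightarrow> g x"
    using conv by eventually_elim (simp add: g_def convergent_LIMSEQ_iff)
  \<comment> \<open>Fatou along \<open>r\<close> with \<open>n\<close> fixed. The bound depends on
    \<open>K\<close> alone, so it yields both integrability and a rate for every \<open>n\<close>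
    beyond \<open>r K\<close>, not only along the subsequence.\<close>
  have bound: "integrable M (\<lambda>x. (norm (f n x - g x))\<^sup>2) \<and> (\<integral>x. (norm (f n x - g x))\<^sup>2 \<partial>M) \<le> ((1/2)^K)\<^sup>2"
    if n: "n \<ge> r K" for n K
  proof -
    have "(\<integral>\<^sup>+x. ennreal ((norm (f n x - g x))\<^sup>2) \<partial>M)
        = (\<integral>\<^sup>+x. liminf (\<lambda>k. ennreal ((norm (f n x - f (r k) x))\<^sup>2)) \<partial>M)"
    proof (rule nn_integral_cong_AE, use lim in eventually_elim)
      case (elim x)
      have "(\<lambda>k. ennreal ((norm (f n x - f (r k) x))\<^sup>2)) \<longlonglongrightarrow> ennreal ((norm (f n x - g x))\<^sup>2)"
        by (intro tendsto_intros elim) 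
      then show ?case by (intro lim_imp_Liminf[symmetric]) simp_all
    qed
    also have "\<dots> \<le> liminf (\<lambda>k. \<integral>\<^sup>+x. ennreal ((norm (f n x - f (r k) x))\<^sup>2) \<partial>M)"
      by (rule nn_integral_liminf) measurable
    also have "\<dots> \<le> limsup (\<lambda>k. \<integral>\<^sup>+x. ennreal ((norm (f n x - f (r k) x))\<^sup>2) \<partial>M)"
      by (rule Liminf_le_Limsup) simp
    also have "\<dots> \<le> ennreal (((1/2)^K)\<^sup>2)"
    proof (rule Limsup_bounded)
      have "(\<integral>\<^sup>+x. ennreal ((norm (f n x - f (r k) x))\<^sup>2) \<partial>M) \<le> ennreal (((1/2)^K)\<^sup>2)" if "k \<ge> K" for k
      proof -
        have L: "(\<lambda>x. f n x - f (r k) x) \<in> L2 \<Omega>" by (intro L2_diff f)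
        have "(\<integral>\<^sup>+x. ennreal ((norm (f n x - f (r k) x))\<^sup>2) \<partial>M) = ennreal ((l2_norm \<Omega> (\<lambda>x. f n x - f (r k) x))\<^sup>2)"
          using L2_power2_integrable[OF L] by (simp add: nn_integral_eq_integral l2_norm_power2 l2_inner_self)
        also have "\<dots> \<le> ennreal (((1/2)^K)\<^sup>2)"
          using r(2)[of K n "r k"] n strict_mono_leD[OF r(1) that]
          by (intro ennreal_leI power_mono l2_norm_nonneg) auto
        finally show ?thesis .
      qed
      then show "\<forall>\<^sub>F k in sequentially. (\<integral>\<^sup>+x. ennreal ((norm (f n x - f (r k) x))\<^sup>2) \<partial>M) \<le> ennreal (((1/2)^K)\<^sup>2)"
        using eventually_sequentially by blast
    qed
    finally have le: "(\<integral>\<^sup>+x. ennreal ((norm (f n x - g x))\<^sup>2) \<partial>M) \<le> ennreal (((1/2)^K)\<^sup>2)" .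
    then have int: "integrable M (\<lambda>x. (norm (f n x - g x))\<^sup>2)"
      by (intro integrableI_bounded) (auto simp: le_less_trans[OF _ ennreal_less_top])
    with le have "ennreal (\<integral>x. (norm (f n x - g x))\<^sup>2 \<partial>M) \<le> ennreal (((1/2)^K)\<^sup>2)"
      by (simp add: nn_integral_eq_integral)
    then have "(\<integral>x. (norm (f n x - g x))\<^sup>2 \<partial>M) \<le> ((1/2)^K)\<^sup>2"
      by (subst (asm) ennreal_le_iff) auto
    then show ?thesis using int by blast
  qed
  have L: "(\<lambda>x. f (r 0) x - g x) \<in> L2 \<Omega>" using bound[of 0 "r 0"] by (simp add: L2_def)
  have gL: "g \<in> L2 \<Omega>" using L2_diff[OF f L, of "r 0"] by simp
  have "(\<lambda>n. l2_norm \<Omega> (\<lambda>x. f n x - g x)) \<longlonglongrightarrow> 0"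
  proof (rule metric_LIMSEQ_I)
    fix e :: real assume "e > 0"
    then obtain K where K: "(1/2)^K < e" using real_arch_pow_inv[of e "1/2"] by auto
    have "l2_norm \<Omega> (\<lambda>x. f n x - g x) < e" if "n \<ge> r K" for n
    proof -
      have "(l2_norm \<Omega> (\<lambda>x. f n x - g x))\<^sup>2 \<le> ((1/2)^K)\<^sup>2"
        using bound[OF that] by (simp add: l2_norm_power2 l2_inner_self)
      then have "l2_norm \<Omega> (\<lambda>x. f n x - g x) \<le> (1/2)^K" by (rule power2_le_imp_le) simp
      then show ?thesis using K by simp
    qed
    then show "\<exists>N. \<forall>n\<ge>N. dist (l2_norm \<Omega> (\<lambda>x. f n x - g x)) 0 < e"
      by (auto simp: dist_real_def l2_norm_nonneg)
  qed
  then show ?thesis using gL that by blast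
qed

end

section \<open>Density of test functions\<close>

text \<open>Countably many bumps whose balls exhaust \<open>T\<close> are summed; the partial sums
  are eventually bounded below by a positive number at each point of \<open>T\<close> and are zero
  outside. Polynomials push the sums towards 1 without leaving the test functions.\<close>

lemma open_indicator_test_limit:
  fixes T :: "'a::euclidean_space set"
  assumes "open T"
  obtains \<eta> where "\<And>n. \<eta> n \<in> test_functions T" "\<And>n x. 0 \<le> \<eta> n x" "\<And>n x. \<eta> n x \<le> 1"
    "\<And>x. (\<lambda>n. \<eta> n x) \<longlonglongrightarrow> indicator T x"
proof (cases "T = {}")
  case True
  show ?thesis by (rule that[of "\<lambda>n x. 0"]) (auto simp: test_zero True)
next
  case False
  define F where "F = {ball c r | c r. r > 0 \<and> cball c r \<subseteq> T}"
  have UF: "\<Union>F = T"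
  proof
    show "\<Union>F \<subseteq> T" unfolding F_def using ball_subset_cball by blast
    show "T \<subseteq> \<Union>F"
    proof
      fix x assume "x \<in> T"
      then obtain e where "e > 0" "cball x e \<subseteq> T" using assms open_contains_cball by blast
      then show "x \<in> \<Union>F" unfolding F_def by (auto intro!: exI[of _ "ball x e"])
    qed
  qed
  obtain F' where F': "F' \<subseteq> F" "countable F'" "\<Union>F' = \<Union>F"
  proof (rule Lindelof[of F])
    show "open S" if "S \<in> F" for S using that by (auto simp: F_def)
  qed (rule that)
  have ne: "F' \<noteq> {}" using F'(3) UF False by auto
  have "\<exists>c r. r > 0 \<and> cball c r \<subseteq> T \<and> from_nat_into F' i = ball c r" for i
  proof -
    have "from_nat_into F' i \<in> F" using from_nat_into[OF ne, of i] F'(1) by blast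
    then show ?thesis unfolding F_def by blast
  qed
  then obtain c r where cr: "\<And>i. r i > 0" "\<And>i. cball (c i) (r i) \<subseteq> T"
    "\<And>i. from_nat_into F' i = ball (c i) (r i)" by metis
  define S where "S n x = (\<Sum>i<n. bump (c i) (r i) x)" for n x
  have S_test: "S n \<in> test_functions T" for n
    unfolding S_def[abs_def] by (intro test_sum bump_test cr) auto
  have S_nonneg: "0 \<le> S n x" for n x unfolding S_def by (intro sum_nonneg bump_nonneg)
  have S_le: "S n x \<le> real n" for n x
    unfolding S_def using sum_mono[of "{..<n}" "\<lambda>i. bump (c i) (r i) x" "\<lambda>i. 1"] by (simp add: bump_le_1)
  \<comment> \<open>\<open>S n x \<le> real n\<close> puts t / (n+1) into the unit interval. Of the
    two factors in the exponent (n+1)^2, one undoes this division and the other produces the decay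
    \<open>exp (- s * real (Suc n))\<close> wherever the sum is at least \<open>s\<close>.\<close>
  define p where "p n t = 1 - (1 - t / real (Suc n)) ^ ((Suc n)\<^sup>2)" for n t
  have poly: "real_polynomial_function (p n)" for n
    unfolding p_def[abs_def]
    by (intro real_polynomial_function_diff real_polynomial_function_power real_polynomial_function_divide
        real_polynomial_function.intros(1,2) bounded_linear_ident)
  have y: "0 \<le> S n x / real (Suc n)" "S n x / real (Suc n) \<le> 1" for n x
    using S_nonneg[of n x] S_le[of n x] by (auto simp: field_simps)
  show ?thesis
  proof (rule that[of "\<lambda>n x. p n (S n x)"])
    show "(\<lambda>x. p n (S n x)) \<in> test_functions T" for n
      by (rule test_polynomial[OF S_test poly]) (simp add: p_def)
    show "0 \<le> p n (S n x)" for n x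
      using y[of n x] power_le_one[of "1 - S n x / real (Suc n)" "(Suc n)\<^sup>2"] by (simp add: p_def)
    show "p n (S n x) \<le> 1" for n x using y[of n x] by (simp add: p_def)
    show "(\<lambda>n. p n (S n x)) \<longlonglongrightarrow> indicator T x" for x
    proof (cases "x \<in> T")
      case False
      have "bump (c i) (r i) x = 0" for i
      proof -
        have "x \<notin> ball (c i) (r i)" using cr(2)[of i] False ball_subset_cball by blast
        then show ?thesis using bump_pos_iff[OF cr(1)[of i], of "c i" x] bump_nonneg[of "c i" "r i" x] by auto
      qed
      then show ?thesis using False by (simp add: S_def p_def)
    next
      case True
      then obtain B where "B \<in> F'" "x \<in> B" using UF F'(3) by blast
      then obtain i where i: "x \<in> ball (c i) (r i)"
        using from_nat_into_surj[OF F'(2)] cr(3) by metis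
      define s where "s = bump (c i) (r i) x"
      have s: "s > 0" using bump_pos_iff[OF cr(1)[of i], of "c i" x] i unfolding s_def by blast
      have "(\<lambda>n. 1 - p n (S n x)) \<longlonglongrightarrow> 0"
      proof (rule Lim_null_comparison)
        show "\<forall>\<^sub>F n in sequentially. norm (1 - p n (S n x)) \<le> exp (- s * real (Suc n))"
          unfolding eventually_sequentially
        proof (intro exI allI impI)
          fix n assume "Suc i \<le> n"
          then have "s \<le> S n x" unfolding s_def S_def
            by (intro member_le_sum) (auto simp: bump_nonneg)
          have "norm (1 - p n (S n x)) = (1 - S n x / real (Suc n)) ^ ((Suc n)\<^sup>2)"
            using y[of n x] by (simp add: p_def)
          also have "\<dots> \<le> exp (- (S n x / real (Suc n))) ^ ((Suc n)\<^sup>2)"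
            using y[of n x] exp_ge_add_one_self[of "- (S n x / real (Suc n))"] by (intro power_mono) auto
          also have "\<dots> = exp (- S n x * real (Suc n))"
          proof -
            have "real ((Suc n)\<^sup>2) = real (Suc n) * real (Suc n)" by (simp only: of_nat_mult power2_eq_square)
            then show ?thesis by (simp only: exp_of_nat_mult[symmetric]) (simp del: of_nat_Suc)
          qed
          also have "\<dots> \<le> exp (- s * real (Suc n))"
            using \<open>s \<le> S n x\<close> by (simp add: mult_right_mono)
          finally show "norm (1 - p n (S n x)) \<le> exp (- s * real (Suc n))" .
        qed
        have "filterlim (\<lambda>n. - s * real (Suc n)) at_bot sequentially"
          using s by real_asymp
        then show "(\<lambda>n. exp (- s * real (Suc n))) \<longlonglongrightarrow> 0"
          by (rule filterlim_compose[OF exp_at_bot])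
      qed
      then have "(\<lambda>n. 1 - (1 - p n (S n x))) \<longlonglongrightarrow> 1 - 0" by (intro tendsto_intros)
      then show ?thesis using True by simp
    qed
  qed
qed

section \<open>Translation invariance and integration by parts\<close>

lemma integral_lborel_translate:
  fixes f :: "'a::euclidean_space \<Rightarrow> 'b::{banach, second_countable_topology}"
  assumes [measurable]: "f \<in> borel_measurable borel"
  shows "(\<integral>x. f (x + a) \<partial>lborel) = (\<integral>x. f x \<partial>lborel)"
proof -
  have "(\<integral>x. f x \<partial>lborel) = (\<integral>x. f x \<partial>distr lborel borel ((+) a))" by (simp only: lborel_distr_plus)
  also have "\<dots> = (\<integral>x. f (a + x) \<partial>lborel)" by (rule integral_distr) auto
  finally show ?thesis by (simp add: add.commute)
qed

lemma nn_integral_lborel_translate: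
  fixes f :: "'a::euclidean_space \<Rightarrow> ennreal"
  assumes [measurable]: "f \<in> borel_measurable borel"
  shows "(\<integral>\<^sup>+x. f (x + a) \<partial>lborel) = (\<integral>\<^sup>+x. f x \<partial>lborel)"
proof -
  have "(\<integral>\<^sup>+x. f x \<partial>lborel) = (\<integral>\<^sup>+x. f x \<partial>distr lborel borel ((+) a))" by (simp only: lborel_distr_plus)
  also have "\<dots> = (\<integral>\<^sup>+x. f (a + x) \<partial>lborel)" by (rule nn_integral_distr) auto
  finally show ?thesis by (simp add: add.commute)
qed

lemma integrable_lborel_translate:
  fixes f :: "'a::euclidean_space \<Rightarrow> 'b::{banach, second_countable_topology}"
  assumes "integrable lborel f"
  shows "integrable lborel (\<lambda>x. f (x + a))"
proof -
  have "integrable (distr lborel borel ((+) a)) f" using assms by (simp only: lborel_distr_plus)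
  then have "integrable lborel (\<lambda>x. f (a + x))"
    using assms by (subst (asm) integrable_distr_eq) auto
  then show ?thesis by (simp add: add.commute)
qed

lemma smooth_DERIV_line:
  assumes "smooth f"
  shows "((\<lambda>t. f (x + t *\<^sub>R v)) has_real_derivative (grad f (x + t *\<^sub>R v) \<bullet> v)) (at t)"
proof -
  have "((\<lambda>t. x + t *\<^sub>R v) has_derivative (\<lambda>h. h *\<^sub>R v)) (at t)"
    by (auto intro!: derivative_eq_intros)
  moreover have "(f has_derivative (\<lambda>h. h \<bullet> grad f (x + t *\<^sub>R v))) (at (x + t *\<^sub>R v))"
    using smooth_gderiv[OF assms] by (simp add: gderiv_def)
  ultimately have "((\<lambda>t. f (x + t *\<^sub>R v)) has_derivative (\<lambda>h. (h *\<^sub>R v) \<bullet> grad f (x + t *\<^sub>R v))) (at t)"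
    by (rule has_derivative_compose)
  moreover have "(\<lambda>h. (h *\<^sub>R v) \<bullet> grad f (x + t *\<^sub>R v)) = (*) (grad f (x + t *\<^sub>R v) \<bullet> v)"
    by (auto simp: inner_commute mult.commute)
  ultimately show ?thesis unfolding has_field_derivative_def by (simp only:)
qed

lemma smooth_Lipschitz:
  fixes f :: "'a::euclidean_space \<Rightarrow> real"
  assumes "smooth f" "\<And>x. norm (grad f x) \<le> C"
  shows "\<bar>f x - f y\<bar> \<le> C * norm (x - y)"
proof -
  have "norm (f x - f y) \<le> C * norm (x - y)"
  proof (rule differentiable_bound[of UNIV f "\<lambda>x h. h \<bullet> grad f x"])
    show "(f has_derivative (\<lambda>h. h \<bullet> grad f z)) (at z within UNIV)" for z
      using smooth_gderiv[OF assms(1), of z] by (simp add: gderiv_def)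
    have "norm (h \<bullet> grad f z) \<le> C * norm h" for z h
    proof -
      have "\<bar>h \<bullet> grad f z\<bar> \<le> norm h * norm (grad f z)" by (rule Cauchy_Schwarz_ineq2)
      also have "\<dots> \<le> norm h * C" using assms(2) by (intro mult_left_mono) auto
      finally show ?thesis by (simp add: mult.commute)
    qed
    then show "onorm (\<lambda>h. h \<bullet> grad f z) \<le> C" for z by (rule onorm_le)
  qed auto
  then show ?thesis by simp
qed

lemma smooth_borel_measurable: "smooth f \<Longrightarrow> f \<in> borel_measurable borel"
  by (intro borel_measurable_continuous_onI smooth_continuous_on)

lemma grad_borel_measurable: "smooth f \<Longrightarrow> grad f \<in> borel_measurable borel"
  by (intro borel_measurable_continuous_onI continuous_on_grad)

lemma test_integrable_lborel:
  fixes \<phi> :: "'a::euclidean_space \<Rightarrow> real"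
  assumes "\<phi> \<in> test_functions \<Omega>" shows "integrable lborel \<phi>"
proof -
  have "integrable lborel (\<lambda>x. indicator (supp \<phi>) x *\<^sub>R \<phi> x)"
    using test_supp(1)[OF assms] test_smooth[OF assms]
    by (intro borel_integrable_compact smooth_continuous_on)
  also have "(\<lambda>x. indicator (supp \<phi>) x *\<^sub>R \<phi> x) = \<phi>"
    using supp_zero[of _ \<phi>] by (auto simp: indicator_def fun_eq_iff)
  finally show ?thesis .
qed

text \<open>By translation invariance each difference quotient integrates to zero, and the quotients
  converge to the partial derivative under a compactly supported majorant.\<close>

lemma integral_partial_zero:
  fixes \<phi> :: "'a::euclidean_space \<Rightarrow> real"
  assumes \<phi>: "\<phi> \<in> test_functions \<Omega>" and b: "b \<in> Basis"
  shows "(\<integral>x. grad \<phi> x \<bullet> b \<partial>lborel) = 0"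
proof -
  have s: "smooth \<phi>" using test_smooth[OF \<phi>] .
  have [measurable]: "\<phi> \<in> borel_measurable borel" "grad \<phi> \<in> borel_measurable borel"
    using smooth_borel_measurable grad_borel_measurable s by auto
  obtain C where C: "C > 0" "\<And>x. norm (grad \<phi> x) \<le> C" using test_bounded[OF \<phi>] by metis
  obtain R where R: "supp \<phi> \<subseteq> cball 0 R"
    using bounded_subset_ballD[OF compact_imp_bounded[OF test_supp(1)[OF \<phi>]], of 0] ball_subset_cball
    by blast
  define h where "h n = inverse (real (Suc n))" for n
  have h: "0 < h n" "h n \<le> 1" for n by (auto simp: h_def field_simps)
  define D where "D n x = (\<phi> (x + h n *\<^sub>R b) - \<phi> x) / h n" for n x
  have "(\<lambda>n. \<integral>x. D n x \<partial>lborel) \<longlonglongrightarrow> (\<integral>x. grad \<phi> x \<bullet> b \<partial>lborel)"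
  proof (rule integral_dominated_convergence[where w="\<lambda>x. C * indicator (cball 0 (R + 1)) x"])
    \<comment> \<open>Steps \<open>h n \<le> 1\<close> in a unit direction enlarge the ball around
      the support by at most 1, hence the radius \<open>R + 1\<close>; the factor \<open>C\<close>
      is the Lipschitz constant.\<close>
    show "integrable lborel (\<lambda>x. C * indicator (cball (0::'a) (R + 1)) x)"
      using emeasure_compact_finite[of "cball (0::'a) (R + 1)"] by simp
    show "AE x in lborel. (\<lambda>n. D n x) \<longlonglongrightarrow> grad \<phi> x \<bullet> b"
    proof (rule AE_I2)
      fix x
      have "((\<lambda>t. (\<phi> (x + (0 + t) *\<^sub>R b) - \<phi> (x + 0 *\<^sub>R b)) / t) \<longlongrightarrow> grad \<phi> (x + 0 *\<^sub>R b) \<bullet> b) (at 0)"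
        using smooth_DERIV_line[OF s, of x b 0] unfolding DERIV_def .
      moreover have "filterlim h (at 0) sequentially"
        unfolding h_def using LIMSEQ_inverse_real_of_nat by (intro filterlim_atI) auto
      ultimately have "(\<lambda>n. (\<phi> (x + (0 + h n) *\<^sub>R b) - \<phi> (x + 0 *\<^sub>R b)) / h n) \<longlonglongrightarrow> grad \<phi> (x + 0 *\<^sub>R b) \<bullet> b"
        by (rule filterlim_compose)
      then show "(\<lambda>n. D n x) \<longlonglongrightarrow> grad \<phi> x \<bullet> b" by (simp add: D_def)
    qed
    show "AE x in lborel. norm (D n x) \<le> C * indicator (cball 0 (R + 1)) x" for n
    proof (rule AE_I2)
      fix x
      show "norm (D n x) \<le> C * indicator (cball 0 (R + 1)) x"
      proof (cases "x \<in> cball 0 (R + 1)")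
        case True
        have "\<bar>\<phi> (x + h n *\<^sub>R b) - \<phi> x\<bar> \<le> C * norm (x + h n *\<^sub>R b - x)"
          by (rule smooth_Lipschitz[OF s C(2)])
        then show ?thesis using True h[of n] b by (simp add: D_def field_simps)
      next
        case False
        have "norm x \<le> norm (x + h n *\<^sub>R b) + norm (h n *\<^sub>R b)"
          using norm_triangle_ineq4[of "x + h n *\<^sub>R b" "h n *\<^sub>R b"] by simp
        then have "x \<notin> cball 0 R" "x + h n *\<^sub>R b \<notin> cball 0 R" using False h[of n] b by auto
        then have "\<phi> x = 0" "\<phi> (x + h n *\<^sub>R b) = 0" using R supp_zero by blast+
        then show ?thesis using C(1) by (simp add: D_def)
      qed
    qed
  qed (auto simp: D_def)
  moreover have "(\<integral>x. D n x \<partial>lborel) = 0" for n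
  proof -
    have i: "integrable lborel \<phi>" "integrable lborel (\<lambda>x. \<phi> (x + h n *\<^sub>R b))"
      using test_integrable_lborel[OF \<phi>] integrable_lborel_translate by auto
    show ?thesis unfolding D_def using i integral_lborel_translate[of \<phi> "h n *\<^sub>R b"] by simp
  qed
  ultimately show ?thesis by (simp add: LIMSEQ_const_iff)
qed

lemma integral_by_parts_lborel:
  fixes \<phi> :: "'a::euclidean_space \<Rightarrow> real"
  assumes \<phi>: "\<phi> \<in> test_functions \<Omega>" and f: "smooth f" and b: "b \<in> Basis"
  shows "(\<integral>x. f x * (grad \<phi> x \<bullet> b) \<partial>lborel) = - (\<integral>x. (grad f x \<bullet> b) * \<phi> x \<partial>lborel)"
proof -
  have "grad (\<lambda>x. \<phi> x * f x) x \<bullet> b = f x * (grad \<phi> x \<bullet> b) + (grad f x \<bullet> b) * \<phi> x" for x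
    using grad_mult[OF test_smooth[OF \<phi>] f, of x] by (simp add: inner_add_left)
  then have "(\<integral>x. f x * (grad \<phi> x \<bullet> b) + (grad f x \<bullet> b) * \<phi> x \<partial>lborel) = 0"
    using integral_partial_zero[OF test_mult_smooth[OF \<phi> f] b] by simp
  moreover have "integrable lborel (\<lambda>x. f x * (grad \<phi> x \<bullet> b))"
    using test_integrable_lborel[OF test_mult_smooth[OF test_partial[OF \<phi> b] f]] by (simp add: mult.commute)
  moreover have "integrable lborel (\<lambda>x. (grad f x \<bullet> b) * \<phi> x)"
    using test_integrable_lborel[OF test_mult_smooth[OF \<phi> smooth_partial[OF f b]]] by (simp add: mult.commute)
  ultimately show ?thesis by simp
qed

context bounded_open
begin

lemma integral_M_eq_lborel:
  fixes f :: "'a \<Rightarrow> 'b::{banach, second_countable_topology}"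
  assumes "f \<in> borel_measurable borel" "\<And>x. x \<notin> \<Omega> \<Longrightarrow> f x = 0"
  shows "integral\<^sup>L M f = integral\<^sup>L lborel f"
proof -
  have "(\<lambda>x. indicator \<Omega> x *\<^sub>R f x) = f" using assms(2) by (auto simp: indicator_def)
  then have "integral\<^sup>L M f = integral\<^sup>L lebesgue f" by (simp add: integral_restrict_space)
  also have "\<dots> = integral\<^sup>L lborel f" by (rule integral_completion) (simp add: assms)
  finally show ?thesis .
qed

lemma test_zero_outside: "\<phi> \<in> test_functions \<Omega> \<Longrightarrow> x \<notin> \<Omega> \<Longrightarrow> \<phi> x = 0"
  using test_supp(2) supp_zero by blast

lemma test_grad_zero_outside: "\<phi> \<in> test_functions \<Omega> \<Longrightarrow> x \<notin> \<Omega> \<Longrightarrow> grad \<phi> x = 0"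
  using test_supp(2) supp_grad_zero by blast

lemma smooth_measurable_M: "smooth f \<Longrightarrow> f \<in> borel_measurable M"
  by (intro borel_measurable_M smooth_borel_measurable)

lemma grad_measurable_M: "smooth f \<Longrightarrow> grad f \<in> borel_measurable M"
  by (intro borel_measurable_M grad_borel_measurable)

lemma test_L2: "\<phi> \<in> test_functions \<Omega> \<Longrightarrow> \<phi> \<in> L2 \<Omega>"
proof -
  assume \<phi>: "\<phi> \<in> test_functions \<Omega>"
  then obtain C where "\<And>x. \<bar>\<phi> x\<bar> \<le> C" using test_bounded by metis
  then show ?thesis by (intro bounded_L2[where C=C] smooth_measurable_M test_smooth[OF \<phi>]) auto
qed

lemma test_grad_L2: "\<phi> \<in> test_functions \<Omega> \<Longrightarrow> grad \<phi> \<in> L2 \<Omega>"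
proof -
  assume \<phi>: "\<phi> \<in> test_functions \<Omega>"
  then obtain C where "\<And>x. norm (grad \<phi> x) \<le> C" using test_bounded by metis
  then show ?thesis by (intro bounded_L2[where C=C] grad_measurable_M test_smooth[OF \<phi>]) auto
qed

lemma sets_M_iff: "A \<in> sets M \<longleftrightarrow> A \<subseteq> \<Omega> \<and> A \<in> sets lebesgue"
  by (simp add: sets_restrict_space_iff)

lemma abs_indicator_diff_le_1: "0 \<le> t \<Longrightarrow> t \<le> 1 \<Longrightarrow> \<bar>indicator S x - t\<bar> \<le> (1::real)"
  by (auto simp: indicator_def)

lemma indicator_diff_integrable:
  fixes \<eta> :: "'a \<Rightarrow> real"
  assumes "A \<in> sets M" "\<eta> \<in> borel_measurable M" "\<And>x. 0 \<le> \<eta> x" "\<And>x. \<eta> x \<le> 1"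
  shows "integrable M (\<lambda>x. indicator A x - \<eta> x)"
proof (rule bounded_integrable)
  show "(\<lambda>x. indicator A x - \<eta> x) \<in> borel_measurable M" using assms(1,2) by simp
  show "AE x in M. norm (indicator A x - \<eta> x) \<le> 1"
    by (intro AE_I2) (simp add: abs_indicator_diff_le_1 assms(3,4))
qed

text \<open>Outer regularity encloses \<open>A\<close> in an open \<open>U\<close> with little
  excess; for \<open>U\<close> the pointwise limits of \<open>open_indicator_test_limit\<close>
  converge in \<open>L1\<close> by domination.\<close>

lemma indicator_test_approx:
  assumes "A \<in> sets lebesgue" "A \<subseteq> \<Omega>" "e > 0"
  obtains \<eta> where "\<eta> \<in> test_functions \<Omega>" "\<And>x. 0 \<le> \<eta> x" "\<And>x. \<eta> x \<le> 1"
    "(\<integral>x. \<bar>indicator A x - \<eta> x\<bar> \<partial>M) < e"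
proof -
  obtain T where T: "open T" "A \<subseteq> T" "(T - A) \<in> lmeasurable" "emeasure lebesgue (T - A) < ennreal (e/2)"
    using sets_lebesgue_outer_open[OF assms(1), of "e/2"] assms(3) by auto
  define U where "U = T \<inter> \<Omega>"
  have U: "open U" "A \<subseteq> U" "U \<subseteq> \<Omega>" using T open_dom assms(2) by (auto simp: U_def)
  obtain \<eta> where \<eta>: "\<And>n. \<eta> n \<in> test_functions U" "\<And>n x. 0 \<le> \<eta> n x" "\<And>n x. \<eta> n x \<le> 1"
    "\<And>x. (\<lambda>n. \<eta> n x) \<longlonglongrightarrow> indicator U x"
    using open_indicator_test_limit[OF U(1)] by blast
  have t: "\<eta> n \<in> test_functions \<Omega>" for n using \<eta>(1) U(3) test_mono by blast
  have [measurable]: "\<eta> n \<in> borel_measurable M" for n by (intro smooth_measurable_M test_smooth[OF t])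
  have UM: "U \<in> sets M" "A \<in> sets M" using U assms by (auto simp: sets_M_iff)
  then have [measurable]: "(indicator U :: _ \<Rightarrow> real) \<in> borel_measurable M" "(indicator A :: _ \<Rightarrow> real) \<in> borel_measurable M"
    by auto
  have "(\<lambda>n. \<integral>x. \<bar>indicator U x - \<eta> n x\<bar> \<partial>M) \<longlonglongrightarrow> (\<integral>x. 0 \<partial>M)"
  proof (rule integral_dominated_convergence[where w="\<lambda>x. 1"])
    show "AE x in M. (\<lambda>n. \<bar>indicator U x - \<eta> n x\<bar>) \<longlonglongrightarrow> 0"
    proof (rule AE_I2)
      fix x
      have "(\<lambda>n. \<bar>indicator U x - \<eta> n x\<bar>) \<longlonglongrightarrow> \<bar>indicator U x - indicator U x\<bar>"
        by (intro tendsto_intros \<eta>(4))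
      then show "(\<lambda>n. \<bar>indicator U x - \<eta> n x\<bar>) \<longlonglongrightarrow> 0" by simp
    qed
    show "AE x in M. norm \<bar>indicator U x - \<eta> n x\<bar> \<le> 1" for n
      by (intro AE_I2) (simp add: abs_indicator_diff_le_1 \<eta>(2,3))
  qed auto
  then have "\<forall>\<^sub>F n in sequentially. (\<integral>x. \<bar>indicator U x - \<eta> n x\<bar> \<partial>M) < e/2"
    using assms(3) by (intro order_tendstoD) auto
  then obtain n where n: "(\<integral>x. \<bar>indicator U x - \<eta> n x\<bar> \<partial>M) < e/2"
    using eventually_happens by fastforce
  have b: "integrable M (\<lambda>x. \<bar>indicator U x - \<eta> n x\<bar>)" "integrable M (\<lambda>x. \<bar>indicator A x - \<eta> n x\<bar>)"
    by (intro integrable_abs indicator_diff_integrable UM \<eta>(2,3); simp)+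
  have UA: "U - A \<in> sets M" using UM by auto
  have m: "measure M (U - A) < e / 2"
  proof -
    have "emeasure M (U - A) = emeasure lebesgue (U - A)" using UA sets_M_iff
      by (intro emeasure_restrict_space) auto
    also have "\<dots> \<le> emeasure lebesgue (T - A)"
      by (rule emeasure_mono) (use T(3) in \<open>auto simp: U_def fmeasurableD\<close>)
    also have "\<dots> < ennreal (e/2)" by (rule T(4))
    finally show ?thesis using assms(3) by (simp add: M.emeasure_eq_measure ennreal_less_iff)
  qed
  have i3: "integrable M (indicator (U - A) :: _ \<Rightarrow> real)" using UA by (simp add: M.emeasure_finite less_top[symmetric])
  have "(\<integral>x. \<bar>indicator A x - \<eta> n x\<bar> \<partial>M) \<le> (\<integral>x. \<bar>indicator U x - \<eta> n x\<bar> + indicator (U - A) x \<partial>M)"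
  proof (rule integral_mono[OF b(2) Bochner_Integration.integrable_add[OF b(1) i3]])
    show "\<bar>indicator A x - \<eta> n x\<bar> \<le> \<bar>indicator U x - \<eta> n x\<bar> + indicator (U - A) x" for x
      using U(2) \<eta>(2,3)[of n x] by (auto simp: indicator_def)
  qed
  also have "\<dots> = (\<integral>x. \<bar>indicator U x - \<eta> n x\<bar> \<partial>M) + (\<integral>x. indicator (U - A) x \<partial>M)"
    by (rule Bochner_Integration.integral_add[OF b(1) i3])
  also have "\<dots> < e"
    using n m sets.sets_into_space[OF UA] by (simp add: Int_absorb2)
  finally show ?thesis using that t \<eta>(2,3) by blast
qed

lemma indicator_test_AE_limit:
  assumes "A \<in> sets lebesgue" "A \<subseteq> \<Omega>"
  obtains \<eta> where "\<And>n. \<eta> n \<in> test_functions \<Omega>" "\<And>n x. 0 \<le> \<eta> n x" "\<And>n x. \<eta> n x \<le> 1"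
    "AE x in M. (\<lambda>n. \<eta> n x) \<longlonglongrightarrow> indicator A x"
proof -
  have "\<exists>\<eta>. \<eta> \<in> test_functions \<Omega> \<and> (\<forall>x. 0 \<le> \<eta> x \<and> \<eta> x \<le> 1) \<and>
      (\<integral>x. \<bar>indicator A x - \<eta> x\<bar> \<partial>M) < inverse (real (Suc n))" for n
    by (rule indicator_test_approx[OF assms, of "inverse (real (Suc n))"]) auto
  then obtain \<eta> where \<eta>: "\<And>n. \<eta> n \<in> test_functions \<Omega>" "\<And>n x. 0 \<le> \<eta> n x" "\<And>n x. \<eta> n x \<le> 1"
    "\<And>n. (\<integral>x. \<bar>indicator A x - \<eta> n x\<bar> \<partial>M) < inverse (real (Suc n))" by metis
  have [measurable]: "\<eta> n \<in> borel_measurable M" for n by (intro smooth_measurable_M test_smooth[OF \<eta>(1)])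
  have "A \<in> sets M" using assms by (simp only: sets_M_iff)
  then have [measurable]: "(indicator A :: _ \<Rightarrow> real) \<in> borel_measurable M" by (rule borel_measurable_indicator)
  have "\<exists>r::nat\<Rightarrow>nat. strict_mono r \<and> (AE x in M. (\<lambda>n. indicator A x - \<eta> (r n) x) \<longlonglongrightarrow> 0)"
  proof (rule tendsto_L1_AE_subseq)
    show "integrable M (\<lambda>x. indicator A x - \<eta> n x)" for n
      by (rule indicator_diff_integrable[OF \<open>A \<in> sets M\<close> _ \<eta>(2,3)]) simp
    show "(\<lambda>n. \<integral>x. norm (indicator A x - \<eta> n x) \<partial>M) \<longlonglongrightarrow> 0"
      by (rule Lim_null_comparison[OF _ LIMSEQ_inverse_real_of_nat])
         (use \<eta>(4) in \<open>auto intro!: always_eventually less_imp_le simp del: of_nat_Suc\<close>)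
  qed
  then obtain r :: "nat \<Rightarrow> nat" where r: "AE x in M. (\<lambda>n. indicator A x - \<eta> (r n) x) \<longlonglongrightarrow> 0" by blast
  show ?thesis
  proof (rule that[of "\<lambda>n. \<eta> (r n)"])
    show "AE x in M. (\<lambda>n. \<eta> (r n) x) \<longlonglongrightarrow> indicator A x"
      using r
    proof eventually_elim
      case (elim x)
      have "(\<lambda>n. indicator A x - (indicator A x - \<eta> (r n) x)) \<longlonglongrightarrow> indicator A x - 0"
        by (intro tendsto_diff tendsto_const elim)
      then show ?case by simp
    qed
  qed (use \<eta> in auto)
qed

text \<open>The fundamental lemma of the calculus of variations. Almost everywhere limits of test
  functions between 0 and 1 reach every indicator, and testing with the sets where \<open>f\<close>
  is positive or negative leaves no mass.\<close>

lemma test_orthogonal_AE_zero: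
  assumes f: "integrable M f" and 0: "\<And>\<eta>. \<eta> \<in> test_functions \<Omega> \<Longrightarrow> (\<integral>x. f x * \<eta> x \<partial>M) = 0"
  shows "AE x in M. f x = (0::real)"
proof -
  have [measurable]: "f \<in> borel_measurable M" using f by auto
  have A0: "(\<integral>x. f x * indicator A x \<partial>M) = 0" if A: "A \<in> sets M" for A
  proof -
    obtain \<eta> where \<eta>: "\<And>n. \<eta> n \<in> test_functions \<Omega>" "\<And>n x. 0 \<le> \<eta> n x" "\<And>n x. \<eta> n x \<le> 1"
      "AE x in M. (\<lambda>n. \<eta> n x) \<longlonglongrightarrow> indicator A x"
      using indicator_test_AE_limit[of A] A by (auto simp: sets_M_iff)
    have [measurable]: "\<eta> n \<in> borel_measurable M" for n by (intro smooth_measurable_M test_smooth[OF \<eta>(1)])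
    have "(\<lambda>n. \<integral>x. f x * \<eta> n x \<partial>M) \<longlonglongrightarrow> (\<integral>x. f x * indicator A x \<partial>M)"
    proof (rule integral_dominated_convergence[where w="\<lambda>x. \<bar>f x\<bar>"])
      show "AE x in M. (\<lambda>n. f x * \<eta> n x) \<longlonglongrightarrow> f x * indicator A x"
        using \<eta>(4) by eventually_elim (intro tendsto_intros)
      show "AE x in M. norm (f x * \<eta> n x) \<le> \<bar>f x\<bar>" for n
        using \<eta>(2,3)[of n] by (auto simp: abs_mult mult_left_le)
    qed (use f A in auto)
    then show ?thesis by (simp add: 0[OF \<eta>(1)] LIMSEQ_const_iff)
  qed
  define P where "P = {x \<in> space M. f x > 0}"
  define N where "N = {x \<in> space M. f x < 0}"
  have PN: "P \<in> sets M" "N \<in> sets M" unfolding P_def N_def by measurable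
  have N0: "(\<integral>x. - (f x * indicator N x) \<partial>M) = 0" using A0[OF PN(2)] by simp
  have int: "integrable M (\<lambda>x. f x * indicator P x)" "integrable M (\<lambda>x. - (f x * indicator N x))"
    by (intro Bochner_Integration.integrable_minus integrable_real_mult_indicator f PN)+
  have "AE x in M. f x * indicator P x = 0"
    by (rule integral_nonneg_eq_0_iff_AE[THEN iffD1, OF int(1) _ A0[OF PN(1)]])
       (auto simp: P_def indicator_def intro!: AE_I2)
  moreover have "AE x in M. - (f x * indicator N x) = 0"
    by (rule integral_nonneg_eq_0_iff_AE[THEN iffD1, OF int(2) _ N0])
       (auto simp: N_def indicator_def intro!: AE_I2)
  ultimately show ?thesis
    using AE_space by eventually_elim (auto simp: P_def N_def indicator_def split: if_splits)
qed

end

section \<open>Weak gradients\<close>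

context bounded_open
begin

lemma has_weak_gradient_iff:
  "has_weak_gradient \<Omega> u g \<longleftrightarrow>
    (\<forall>\<phi>\<in>test_functions \<Omega>. \<forall>b\<in>Basis. l2_inner \<Omega> u (\<lambda>x. grad \<phi> x \<bullet> b) = - l2_inner \<Omega> g (\<lambda>x. \<phi> x *\<^sub>R b))"
  by (simp add: has_weak_gradient_def l2_inner_def mult.commute)

lemma test_scaleR_L2: "\<phi> \<in> test_functions \<Omega> \<Longrightarrow> (\<lambda>x. \<phi> x *\<^sub>R b) \<in> L2 \<Omega>"
proof -
  assume \<phi>: "\<phi> \<in> test_functions \<Omega>"
  then obtain C where "\<And>x. \<bar>\<phi> x\<bar> \<le> C" using test_bounded by metis
  then have "\<And>x. norm (\<phi> x *\<^sub>R b) \<le> C * norm b" by (simp add: mult_right_mono)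
  then show ?thesis
    by (intro bounded_L2[where C="C * norm b"] AE_I2 borel_measurable_scaleR smooth_measurable_M test_smooth[OF \<phi>]) auto
qed

lemma weak_gradient_unique:
  assumes g: "g \<in> L2 \<Omega>" "h \<in> L2 \<Omega>" and wg: "has_weak_gradient \<Omega> u g" "has_weak_gradient \<Omega> u h"
  shows "AE x in M. g x = h x"
proof -
  have d: "(\<lambda>x. g x - h x) \<in> L2 \<Omega>" using g by (rule L2_diff)
  have "AE x in M. (g x - h x) \<bullet> b = 0" if b: "b \<in> Basis" for b
  proof (rule test_orthogonal_AE_zero)
    show "integrable M (\<lambda>x. (g x - h x) \<bullet> b)" using L2_integrable[OF d] by simp
    fix \<eta> assume \<eta>: "\<eta> \<in> test_functions \<Omega>"
    have "l2_inner \<Omega> (\<lambda>x. g x - h x) (\<lambda>x. \<eta> x *\<^sub>R b) = 0"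
      using wg \<eta> b g test_scaleR_L2[OF \<eta>, of b] by (simp add: has_weak_gradient_iff l2_inner_diff_left)
    then show "(\<integral>x. ((g x - h x) \<bullet> b) * \<eta> x \<partial>M) = 0" by (simp add: l2_inner_def mult.commute)
  qed
  then have "AE x in M. \<forall>b\<in>Basis. (g x - h x) \<bullet> b = 0" by (simp add: AE_finite_all)
  then show ?thesis by eventually_elim (simp add: euclidean_eq_iff[where 'a='a] inner_diff_left)
qed

lemma H1_wgrad:
  assumes "u \<in> H1 \<Omega>" shows "wgrad \<Omega> u \<in> L2 \<Omega>" "has_weak_gradient \<Omega> u (wgrad \<Omega> u)"
proof -
  have "\<exists>g. g \<in> L2 \<Omega> \<and> has_weak_gradient \<Omega> u g" using assms by (auto simp: H1_def)
  then have "wgrad \<Omega> u \<in> L2 \<Omega> \<and> has_weak_gradient \<Omega> u (wgrad \<Omega> u)"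
    unfolding wgrad_def by (rule someI_ex)
  then show "wgrad \<Omega> u \<in> L2 \<Omega>" "has_weak_gradient \<Omega> u (wgrad \<Omega> u)" by auto
qed

lemma wgrad_AE_eq:
  assumes "u \<in> L2 \<Omega>" "g \<in> L2 \<Omega>" "has_weak_gradient \<Omega> u g"
  shows "u \<in> H1 \<Omega>" "AE x in M. wgrad \<Omega> u x = g x"
proof -
  show "u \<in> H1 \<Omega>" using assms by (auto simp: H1_def)
  then show "AE x in M. wgrad \<Omega> u x = g x"
    using weak_gradient_unique[OF H1_wgrad(1) assms(2) H1_wgrad(2) assms(3)] by blast
qed

lemma has_weak_gradient_test:
  assumes f: "smooth f" shows "has_weak_gradient \<Omega> f (grad f)"
  unfolding has_weak_gradient_def
proof (intro ballI)
  fix \<phi> :: "'a \<Rightarrow> real" and b :: 'a assume \<phi>: "\<phi> \<in> test_functions \<Omega>" and b: "b \<in> Basis"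
  have [measurable]: "f \<in> borel_measurable borel" "grad f \<in> borel_measurable borel"
    "\<phi> \<in> borel_measurable borel" "grad \<phi> \<in> borel_measurable borel"
    using smooth_borel_measurable grad_borel_measurable f test_smooth[OF \<phi>] by auto
  have "(\<integral>x. f x * (grad \<phi> x \<bullet> b) \<partial>M) = (\<integral>x. f x * (grad \<phi> x \<bullet> b) \<partial>lborel)"
    by (rule integral_M_eq_lborel) (auto simp: test_grad_zero_outside[OF \<phi>])
  moreover have "(\<integral>x. (grad f x \<bullet> b) * \<phi> x \<partial>M) = (\<integral>x. (grad f x \<bullet> b) * \<phi> x \<partial>lborel)"
    by (rule integral_M_eq_lborel) (auto simp: test_zero_outside[OF \<phi>])
  ultimately show "(\<integral>x. f x * (grad \<phi> x \<bullet> b) \<partial>M) = - (\<integral>x. (grad f x \<bullet> b) * \<phi> x \<partial>M)"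
    using integral_by_parts_lborel[OF \<phi> f b] by simp
qed

lemma has_weak_gradient_limit:
  assumes L: "\<And>n. u n \<in> L2 \<Omega>" "\<And>n. g n \<in> L2 \<Omega>" "v \<in> L2 \<Omega>" "h \<in> L2 \<Omega>"
    and wg: "\<And>n. has_weak_gradient \<Omega> (u n) (g n)"
    and lim: "(\<lambda>n. l2_norm \<Omega> (\<lambda>x. u n x - v x)) \<longlonglongrightarrow> 0" "(\<lambda>n. l2_norm \<Omega> (\<lambda>x. g n x - h x)) \<longlonglongrightarrow> 0"
  shows "has_weak_gradient \<Omega> v h"
  unfolding has_weak_gradient_iff
proof (intro ballI)
  fix \<phi> :: "'a \<Rightarrow> real" and b :: 'a assume \<phi>: "\<phi> \<in> test_functions \<Omega>" and b: "b \<in> Basis"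
  have "(\<lambda>n. l2_inner \<Omega> (u n) (\<lambda>x. grad \<phi> x \<bullet> b)) \<longlonglongrightarrow> l2_inner \<Omega> v (\<lambda>x. grad \<phi> x \<bullet> b)"
    by (rule l2_inner_tendsto[OF L(1,3) test_L2[OF test_partial[OF \<phi> b]] lim(1)])
  moreover have "(\<lambda>n. - l2_inner \<Omega> (g n) (\<lambda>x. \<phi> x *\<^sub>R b)) \<longlonglongrightarrow> - l2_inner \<Omega> h (\<lambda>x. \<phi> x *\<^sub>R b)"
    by (intro tendsto_minus l2_inner_tendsto[OF L(2,4) test_scaleR_L2[OF \<phi>] lim(2)])
  moreover have "(\<lambda>n. l2_inner \<Omega> (u n) (\<lambda>x. grad \<phi> x \<bullet> b)) = (\<lambda>n. - l2_inner \<Omega> (g n) (\<lambda>x. \<phi> x *\<^sub>R b))"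
    using wg \<phi> b by (auto simp: has_weak_gradient_iff)
  ultimately show "l2_inner \<Omega> v (\<lambda>x. grad \<phi> x \<bullet> b) = - l2_inner \<Omega> h (\<lambda>x. \<phi> x *\<^sub>R b)"
    using LIMSEQ_unique by metis
qed

section \<open>The space \<open>H10\<close>\<close>

definition h1_dist :: "('a \<Rightarrow> real) \<Rightarrow> ('a \<Rightarrow> real) \<Rightarrow> real" where
  "h1_dist u v = l2_norm \<Omega> (\<lambda>x. u x - v x) + l2_norm \<Omega> (\<lambda>x. wgrad \<Omega> u x - wgrad \<Omega> v x)"

lemma H10_H1: "u \<in> H10 \<Omega> \<Longrightarrow> u \<in> H1 \<Omega>" by (simp add: H10_def)

lemma H10_L2: "u \<in> H10 \<Omega> \<Longrightarrow> u \<in> L2 \<Omega>" by (simp add: H10_def H1_def)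

lemma H10_wgrad: "u \<in> H10 \<Omega> \<Longrightarrow> wgrad \<Omega> u \<in> L2 \<Omega>" by (simp add: H10_H1 H1_wgrad)

lemma l2_norm_tendsto_0_iff:
  "((\<lambda>n. l2_norm \<Omega> (f n)) \<longlonglongrightarrow> 0) \<longleftrightarrow> (\<lambda>n. \<integral>x. (norm (f n x))\<^sup>2 \<partial>M) \<longlonglongrightarrow> 0"
proof
  assume "(\<lambda>n. l2_norm \<Omega> (f n)) \<longlonglongrightarrow> 0"
  then have "(\<lambda>n. (l2_norm \<Omega> (f n))\<^sup>2) \<longlonglongrightarrow> 0\<^sup>2" by (intro tendsto_intros)
  then show "(\<lambda>n. \<integral>x. (norm (f n x))\<^sup>2 \<partial>M) \<longlonglongrightarrow> 0" by (simp add: l2_norm_power2 l2_inner_self)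
next
  assume "(\<lambda>n. \<integral>x. (norm (f n x))\<^sup>2 \<partial>M) \<longlonglongrightarrow> 0"
  then have "(\<lambda>n. sqrt (\<integral>x. (norm (f n x))\<^sup>2 \<partial>M)) \<longlonglongrightarrow> sqrt 0" by (intro tendsto_intros)
  then show "(\<lambda>n. l2_norm \<Omega> (f n)) \<longlonglongrightarrow> 0" by (simp add: l2_norm_def l2_inner_self)
qed

lemma H10_E:
  assumes "u \<in> H10 \<Omega>"
  obtains \<phi> where "\<And>n. \<phi> n \<in> test_functions \<Omega>"
    "(\<lambda>n. l2_norm \<Omega> (\<lambda>x. \<phi> n x - u x)) \<longlonglongrightarrow> 0"
    "(\<lambda>n. l2_norm \<Omega> (\<lambda>x. grad (\<phi> n) x - wgrad \<Omega> u x)) \<longlonglongrightarrow> 0"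
proof -
  obtain \<phi> where \<phi>: "\<And>n. \<phi> n \<in> test_functions \<Omega>"
    and lim: "(\<lambda>n. (\<integral>x. (u x - \<phi> n x)\<^sup>2 \<partial>M) + (\<integral>x. (norm (wgrad \<Omega> u x - grad (\<phi> n) x))\<^sup>2 \<partial>M)) \<longlonglongrightarrow> 0"
    using assms by (auto simp: H10_def)
  have "(\<lambda>n. (\<integral>x. (u x - \<phi> n x)\<^sup>2 \<partial>M)) \<longlonglongrightarrow> 0"
    by (rule Lim_null_comparison[OF _ lim]) auto
  then have 1: "(\<lambda>n. l2_norm \<Omega> (\<lambda>x. u x - \<phi> n x)) \<longlonglongrightarrow> 0" by (simp add: l2_norm_tendsto_0_iff)
  have "(\<lambda>n. (\<integral>x. (norm (wgrad \<Omega> u x - grad (\<phi> n) x))\<^sup>2 \<partial>M)) \<longlonglongrightarrow> 0"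
    by (rule Lim_null_comparison[OF _ lim]) auto
  then have 2: "(\<lambda>n. l2_norm \<Omega> (\<lambda>x. wgrad \<Omega> u x - grad (\<phi> n) x)) \<longlonglongrightarrow> 0" by (simp add: l2_norm_tendsto_0_iff)
  show ?thesis using that[OF \<phi>] 1 2 by (simp add: l2_norm_commute)
qed

text \<open>The working criterion for \<open>H10\<close>. A limit of gradients is a weak gradient of
  the limit, so the value chosen by \<open>SOME\<close> in \<open>wgrad\<close> agrees with it
  almost everywhere, and the distance in the definition of \<open>H10\<close> may be measured with
  either.\<close>

lemma H10_I:
  assumes u: "u \<in> L2 \<Omega>" "g \<in> L2 \<Omega>" and \<phi>: "\<And>n. \<phi> n \<in> test_functions \<Omega>"
    and lim: "(\<lambda>n. l2_norm \<Omega> (\<lambda>x. \<phi> n x - u x)) \<longlonglongrightarrow> 0"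
    "(\<lambda>n. l2_norm \<Omega> (\<lambda>x. grad (\<phi> n) x - g x)) \<longlonglongrightarrow> 0"
  shows "u \<in> H10 \<Omega>" "AE x in M. wgrad \<Omega> u x = g x"
proof -
  have wg: "has_weak_gradient \<Omega> u g"
    by (rule has_weak_gradient_limit[OF test_L2[OF \<phi>] test_grad_L2[OF \<phi>] u has_weak_gradient_test[OF test_smooth[OF \<phi>]] lim])
  note H = wgrad_AE_eq[OF u wg]
  show "AE x in M. wgrad \<Omega> u x = g x" by (rule H)
  have "l2_norm \<Omega> (\<lambda>x. wgrad \<Omega> u x - grad (\<phi> n) x) = l2_norm \<Omega> (\<lambda>x. g x - grad (\<phi> n) x)" for n
    using H(2) H1_wgrad(1)[OF H(1)] u(2) test_grad_L2[OF \<phi>, of n]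
    by (intro l2_norm_cong_AE borel_measurable_diff L2_measurable) auto
  then have "(\<lambda>n. l2_norm \<Omega> (\<lambda>x. wgrad \<Omega> u x - grad (\<phi> n) x)) \<longlonglongrightarrow> 0"
    "(\<lambda>n. l2_norm \<Omega> (\<lambda>x. u x - \<phi> n x)) \<longlonglongrightarrow> 0"
    using lim by (simp_all add: l2_norm_commute)
  then have "(\<lambda>n. \<integral>x. (u x - \<phi> n x)\<^sup>2 \<partial>M) \<longlonglongrightarrow> 0"
    "(\<lambda>n. \<integral>x. (norm (wgrad \<Omega> u x - grad (\<phi> n) x))\<^sup>2 \<partial>M) \<longlonglongrightarrow> 0"
    by (simp_all add: l2_norm_tendsto_0_iff)
  from tendsto_add[OF this] show "u \<in> H10 \<Omega>"
    using \<phi> H(1) by (auto simp: H10_def)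
qed

lemma H10_test:
  assumes "\<phi> \<in> test_functions \<Omega>"
  shows "\<phi> \<in> H10 \<Omega>" "AE x in M. wgrad \<Omega> \<phi> x = grad \<phi> x"
proof -
  have "l2_norm \<Omega> (\<lambda>x. \<phi> x - \<phi> x) = 0" "l2_norm \<Omega> (\<lambda>x. grad \<phi> x - grad \<phi> x) = 0"
    by (simp_all add: l2_norm_def l2_inner_def)
  then show "\<phi> \<in> H10 \<Omega>" "AE x in M. wgrad \<Omega> \<phi> x = grad \<phi> x"
    using H10_I[OF test_L2[OF assms] test_grad_L2[OF assms], of "\<lambda>n. \<phi>"] assms by simp_all
qed

text \<open>The shape \<open>u x + c * v x\<close> serves sums, differences and multiples at once,
  which is why later arguments write coefficients such as \<open>1 * v x\<close> and
  \<open>(c - 1) * u x\<close>.\<close>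

lemma H10_lin:
  assumes u: "u \<in> H10 \<Omega>" and v: "v \<in> H10 \<Omega>"
  shows "(\<lambda>x. u x + c * v x) \<in> H10 \<Omega>"
    "AE x in M. wgrad \<Omega> (\<lambda>x. u x + c * v x) x = wgrad \<Omega> u x + c *\<^sub>R wgrad \<Omega> v x"
proof -
  obtain \<phi> where \<phi>: "\<And>n. \<phi> n \<in> test_functions \<Omega>" "(\<lambda>n. l2_norm \<Omega> (\<lambda>x. \<phi> n x - u x)) \<longlonglongrightarrow> 0"
    "(\<lambda>n. l2_norm \<Omega> (\<lambda>x. grad (\<phi> n) x - wgrad \<Omega> u x)) \<longlonglongrightarrow> 0" using H10_E[OF u] by blast
  obtain \<psi> where \<psi>: "\<And>n. \<psi> n \<in> test_functions \<Omega>" "(\<lambda>n. l2_norm \<Omega> (\<lambda>x. \<psi> n x - v x)) \<longlonglongrightarrow> 0"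
    "(\<lambda>n. l2_norm \<Omega> (\<lambda>x. grad (\<psi> n) x - wgrad \<Omega> v x)) \<longlonglongrightarrow> 0" using H10_E[OF v] by blast
  have key: "(\<lambda>n. l2_norm \<Omega> (\<lambda>x. (f n x + c *\<^sub>R g n x) - (f' x + c *\<^sub>R g' x))) \<longlonglongrightarrow> 0"
    if "\<And>n. f n \<in> L2 \<Omega>" "\<And>n. g n \<in> L2 \<Omega>" "f' \<in> L2 \<Omega>" "g' \<in> L2 \<Omega>"
      "(\<lambda>n. l2_norm \<Omega> (\<lambda>x. f n x - f' x)) \<longlonglongrightarrow> 0" "(\<lambda>n. l2_norm \<Omega> (\<lambda>x. g n x - g' x)) \<longlonglongrightarrow> 0"
    for f g :: "nat \<Rightarrow> 'a \<Rightarrow> 'b::euclidean_space" and f' g'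
  proof (rule Lim_null_comparison)
    have "l2_norm \<Omega> (\<lambda>x. (f n x + c *\<^sub>R g n x) - (f' x + c *\<^sub>R g' x))
        \<le> l2_norm \<Omega> (\<lambda>x. f n x - f' x) + \<bar>c\<bar> * l2_norm \<Omega> (\<lambda>x. g n x - g' x)" for n
    proof -
      have "(\<lambda>x. (f n x + c *\<^sub>R g n x) - (f' x + c *\<^sub>R g' x)) = (\<lambda>x. (f n x - f' x) + c *\<^sub>R (g n x - g' x))"
        by (auto simp: algebra_simps)
      then show ?thesis
        using l2_norm_triangle[OF L2_diff[OF that(1,3)] L2_scaleR[OF L2_diff[OF that(2,4)], of c], of n n]
        by (simp only: l2_norm_scaleR)
    qed
    then show "\<forall>\<^sub>F n in sequentially. norm (l2_norm \<Omega> (\<lambda>x. (f n x + c *\<^sub>R g n x) - (f' x + c *\<^sub>R g' x)))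
        \<le> l2_norm \<Omega> (\<lambda>x. f n x - f' x) + \<bar>c\<bar> * l2_norm \<Omega> (\<lambda>x. g n x - g' x)"
      by (simp add: l2_norm_nonneg)
    show "(\<lambda>n. l2_norm \<Omega> (\<lambda>x. f n x - f' x) + \<bar>c\<bar> * l2_norm \<Omega> (\<lambda>x. g n x - g' x)) \<longlonglongrightarrow> 0"
      using tendsto_add[OF that(5) tendsto_mult_left[OF that(6), of "\<bar>c\<bar>"]] by simp
  qed
  have g: "grad (\<lambda>x. \<phi> n x + c * \<psi> n x) = (\<lambda>x. grad (\<phi> n) x + c *\<^sub>R grad (\<psi> n) x)" for n
    using grad_add[OF test_smooth[OF \<phi>(1)] smooth_cmult[OF test_smooth[OF \<psi>(1)]]] grad_cmult[OF test_smooth[OF \<psi>(1)]]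
    by auto
  note * = H10_I[of "\<lambda>x. u x + c * v x" "\<lambda>x. wgrad \<Omega> u x + c *\<^sub>R wgrad \<Omega> v x" "\<lambda>n x. \<phi> n x + c * \<psi> n x"]
  have a: "(\<lambda>x. u x + c * v x) \<in> L2 \<Omega>" "(\<lambda>x. wgrad \<Omega> u x + c *\<^sub>R wgrad \<Omega> v x) \<in> L2 \<Omega>"
    "(\<lambda>x. \<phi> n x + c * \<psi> n x) \<in> test_functions \<Omega>" for n
    by (fact L2_add[OF H10_L2[OF u] L2_cmult[OF H10_L2[OF v]]],
        fact L2_add[OF H10_wgrad[OF u] L2_scaleR[OF H10_wgrad[OF v]]],
        fact test_add[OF \<phi>(1) test_cmult[OF \<psi>(1)]])
  have b: "(\<lambda>n. l2_norm \<Omega> (\<lambda>x. (\<phi> n x + c * \<psi> n x) - (u x + c * v x))) \<longlonglongrightarrow> 0"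
    using key[OF test_L2[OF \<phi>(1)] test_L2[OF \<psi>(1)] H10_L2[OF u] H10_L2[OF v] \<phi>(2) \<psi>(2)] by simp
  have c: "(\<lambda>n. l2_norm \<Omega> (\<lambda>x. grad (\<lambda>x. \<phi> n x + c * \<psi> n x) x - (wgrad \<Omega> u x + c *\<^sub>R wgrad \<Omega> v x))) \<longlonglongrightarrow> 0"
    using key[OF test_grad_L2[OF \<phi>(1)] test_grad_L2[OF \<psi>(1)] H10_wgrad[OF u] H10_wgrad[OF v] \<phi>(3) \<psi>(3)]
    unfolding g .
  show "(\<lambda>x. u x + c * v x) \<in> H10 \<Omega>"
    "AE x in M. wgrad \<Omega> (\<lambda>x. u x + c * v x) x = wgrad \<Omega> u x + c *\<^sub>R wgrad \<Omega> v x"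
    by (rule *[OF a b c])+
qed

lemma H10_diff:
  assumes "u \<in> H10 \<Omega>" "v \<in> H10 \<Omega>"
  shows "(\<lambda>x. u x - v x) \<in> H10 \<Omega>" "AE x in M. wgrad \<Omega> (\<lambda>x. u x - v x) x = wgrad \<Omega> u x - wgrad \<Omega> v x"
  using H10_lin[OF assms, of "-1"] by simp_all

lemma H10_cmult:
  assumes "u \<in> H10 \<Omega>"
  shows "(\<lambda>x. c * u x) \<in> H10 \<Omega>" "AE x in M. wgrad \<Omega> (\<lambda>x. c * u x) x = c *\<^sub>R wgrad \<Omega> u x"
proof -
  have *: "(\<lambda>x. u x + (c - 1) * u x) = (\<lambda>x. c * u x)" by (auto simp: algebra_simps)
  show "(\<lambda>x. c * u x) \<in> H10 \<Omega>" using H10_lin(1)[OF assms assms, of "c - 1"] by (simp only: *)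
  show "AE x in M. wgrad \<Omega> (\<lambda>x. c * u x) x = c *\<^sub>R wgrad \<Omega> u x"
    using H10_lin(2)[OF assms assms, of "c - 1"] unfolding * by eventually_elim (simp add: scaleR_diff_left)
qed

definition dirichlet :: "('a \<Rightarrow> real) \<Rightarrow> ('a \<Rightarrow> real) \<Rightarrow> real" where
  "dirichlet u v = l2_inner \<Omega> (wgrad \<Omega> u) (wgrad \<Omega> v)"

lemma dirichlet_commute: "dirichlet u v = dirichlet v u"
  by (simp add: dirichlet_def l2_inner_commute)

lemma dirichlet_lin_left:
  assumes "u \<in> H10 \<Omega>" "v \<in> H10 \<Omega>" "w \<in> H10 \<Omega>"
  shows "dirichlet (\<lambda>x. u x + c * v x) w = dirichlet u w + c * dirichlet v w"
proof -
  have "dirichlet (\<lambda>x. u x + c * v x) w = l2_inner \<Omega> (\<lambda>x. wgrad \<Omega> u x + c *\<^sub>R wgrad \<Omega> v x) (wgrad \<Omega> w)"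
    unfolding dirichlet_def using H10_lin[OF assms(1,2), of c] assms
    by (intro l2_inner_cong_AE L2_measurable L2_add L2_scaleR H10_wgrad) auto
  also have "\<dots> = dirichlet u w + c * dirichlet v w"
    unfolding dirichlet_def
    by (simp only: l2_inner_add_left[OF H10_wgrad[OF assms(1)] L2_scaleR[OF H10_wgrad[OF assms(2)]] H10_wgrad[OF assms(3)]] l2_inner_scaleR_left)
  finally show ?thesis .
qed

lemma dirichlet_lin_right:
  assumes "u \<in> H10 \<Omega>" "v \<in> H10 \<Omega>" "w \<in> H10 \<Omega>"
  shows "dirichlet w (\<lambda>x. u x + c * v x) = dirichlet w u + c * dirichlet w v"
  using dirichlet_lin_left[OF assms] by (simp add: dirichlet_commute)

lemma l2_inner_lin_left:
  assumes "u \<in> L2 \<Omega>" "v \<in> L2 \<Omega>" "w \<in> L2 \<Omega>"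
  shows "l2_inner \<Omega> (\<lambda>x. u x + c * v x) w = l2_inner \<Omega> u w + c * l2_inner \<Omega> v (w :: 'a \<Rightarrow> real)"
  using l2_inner_add_left[OF assms(1) L2_scaleR[OF assms(2)] assms(3), of c] l2_inner_scaleR_left[of \<Omega> c v w] by simp

lemma l2_inner_lin_right:
  assumes "u \<in> L2 \<Omega>" "v \<in> L2 \<Omega>" "w \<in> L2 \<Omega>"
  shows "l2_inner \<Omega> w (\<lambda>x. u x + c * v x) = l2_inner \<Omega> w u + c * l2_inner \<Omega> w (v :: 'a \<Rightarrow> real)"
  using l2_inner_lin_left[OF assms] by (simp add: l2_inner_commute)

lemma dirichlet_self: "dirichlet u u = (l2_norm \<Omega> (wgrad \<Omega> u))\<^sup>2"
  by (simp add: dirichlet_def l2_norm_power2)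

lemma l2_norm_wgrad_diff:
  assumes "u \<in> H10 \<Omega>" "v \<in> H10 \<Omega>"
  shows "l2_norm \<Omega> (wgrad \<Omega> (\<lambda>x. u x - v x)) = l2_norm \<Omega> (\<lambda>x. wgrad \<Omega> u x - wgrad \<Omega> v x)"
  using H10_diff[OF assms] assms by (intro l2_norm_cong_AE L2_measurable L2_diff H10_wgrad) auto

lemma h1_dist_ge: "l2_norm \<Omega> (\<lambda>x. u x - v x) \<le> h1_dist u v"
  "l2_norm \<Omega> (\<lambda>x. wgrad \<Omega> u x - wgrad \<Omega> v x) \<le> h1_dist u v"
  by (simp_all add: h1_dist_def l2_norm_nonneg)

lemma h1_dist_tendsto_D:
  assumes "(\<lambda>n. h1_dist (u n) v) \<longlonglongrightarrow> 0"
  shows "(\<lambda>n. l2_norm \<Omega> (\<lambda>x. u n x - v x)) \<longlonglongrightarrow> 0"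
    "(\<lambda>n. l2_norm \<Omega> (\<lambda>x. wgrad \<Omega> (u n) x - wgrad \<Omega> v x)) \<longlonglongrightarrow> 0"
  by (rule Lim_null_comparison[OF _ assms]; simp add: l2_norm_nonneg h1_dist_ge)+

lemma H10_test_approx:
  assumes u: "u \<in> H10 \<Omega>" and e: "e > 0"
  obtains \<phi> where "\<phi> \<in> test_functions \<Omega>" "h1_dist \<phi> u < e"
    "l2_norm \<Omega> (\<lambda>x. grad \<phi> x - wgrad \<Omega> u x) < e"
proof -
  obtain \<phi> where \<phi>: "\<And>n. \<phi> n \<in> test_functions \<Omega>" "(\<lambda>n. l2_norm \<Omega> (\<lambda>x. \<phi> n x - u x)) \<longlonglongrightarrow> 0"
    "(\<lambda>n. l2_norm \<Omega> (\<lambda>x. grad (\<phi> n) x - wgrad \<Omega> u x)) \<longlonglongrightarrow> 0" using H10_E[OF u] by blast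
  have "\<forall>\<^sub>F n in sequentially. l2_norm \<Omega> (\<lambda>x. \<phi> n x - u x) < e / 2 \<and>
      l2_norm \<Omega> (\<lambda>x. grad (\<phi> n) x - wgrad \<Omega> u x) < e / 2"
    using e by (intro eventually_conj order_tendstoD(2)[OF \<phi>(2)] order_tendstoD(2)[OF \<phi>(3)]) auto
  then obtain n where n: "l2_norm \<Omega> (\<lambda>x. \<phi> n x - u x) < e / 2"
    "l2_norm \<Omega> (\<lambda>x. grad (\<phi> n) x - wgrad \<Omega> u x) < e / 2"
    using eventually_happens by fastforce
  have "l2_norm \<Omega> (\<lambda>x. wgrad \<Omega> (\<phi> n) x - wgrad \<Omega> u x) = l2_norm \<Omega> (\<lambda>x. grad (\<phi> n) x - wgrad \<Omega> u x)"
    using H10_test[OF \<phi>(1)] test_grad_L2[OF \<phi>(1)] u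
    by (intro l2_norm_cong_AE L2_measurable L2_diff H10_wgrad) auto
  with n have "h1_dist (\<phi> n) u < e" by (simp add: h1_dist_def)
  then show ?thesis using that \<phi>(1) n(2) e by fastforce
qed

text \<open>Values and gradients have separate limits in \<open>L2\<close>. That the pair comes from
  \<open>H10\<close> follows by replacing each term by a test function at distance below 1/(n+1), a
  sequence with the same limits to which \<open>H10_I\<close> applies.\<close>

theorem H10_complete:
  assumes u: "\<And>n. u n \<in> H10 \<Omega>"
    and cauchy: "\<And>e. e > 0 \<Longrightarrow> \<exists>N. \<forall>m\<ge>N. \<forall>n\<ge>N. h1_dist (u m) (u n) < e"
  obtains v where "v \<in> H10 \<Omega>" "(\<lambda>n. h1_dist (u n) v) \<longlonglongrightarrow> 0"
proof -
  have "\<exists>N. \<forall>m\<ge>N. \<forall>n\<ge>N. l2_norm \<Omega> (\<lambda>x. u m x - u n x) < e" if "e > 0" for e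
    using cauchy[OF that] h1_dist_ge(1) le_less_trans by meson
  from L2_complete[OF H10_L2[OF u] this]
  obtain v where v: "v \<in> L2 \<Omega>" "(\<lambda>n. l2_norm \<Omega> (\<lambda>x. u n x - v x)) \<longlonglongrightarrow> 0" .
  have "\<exists>N. \<forall>m\<ge>N. \<forall>n\<ge>N. l2_norm \<Omega> (\<lambda>x. wgrad \<Omega> (u m) x - wgrad \<Omega> (u n) x) < e" if "e > 0" for e
    using cauchy[OF that] h1_dist_ge(2) le_less_trans by meson
  from L2_complete[OF H10_wgrad[OF u] this]
  obtain g where g: "g \<in> L2 \<Omega>" "(\<lambda>n. l2_norm \<Omega> (\<lambda>x. wgrad \<Omega> (u n) x - g x)) \<longlonglongrightarrow> 0" .
  have "\<exists>\<phi>. \<phi> \<in> test_functions \<Omega> \<and> h1_dist \<phi> (u n) < inverse (real (Suc n)) \<and>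
      l2_norm \<Omega> (\<lambda>x. grad \<phi> x - wgrad \<Omega> (u n) x) < inverse (real (Suc n))" for n
    by (rule H10_test_approx[OF u[of n], of "inverse (real (Suc n))"]) auto
  then obtain \<phi> where \<phi>: "\<And>n. \<phi> n \<in> test_functions \<Omega>" "\<And>n. h1_dist (\<phi> n) (u n) < inverse (real (Suc n))"
     "\<And>n. l2_norm \<Omega> (\<lambda>x. grad (\<phi> n) x - wgrad \<Omega> (u n) x) < inverse (real (Suc n))" by metis
  have 1: "(\<lambda>n. l2_norm \<Omega> (\<lambda>x. \<phi> n x - v x)) \<longlonglongrightarrow> 0"
  proof (rule Lim_null_comparison)
    have "l2_norm \<Omega> (\<lambda>x. \<phi> n x - v x) \<le> inverse (real (Suc n)) + l2_norm \<Omega> (\<lambda>x. u n x - v x)" for n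
      using l2_norm_triangle_diff[OF test_L2[OF \<phi>(1)] H10_L2[OF u] v(1), of n n] h1_dist_ge(1)[of "\<phi> n" "u n"] \<phi>(2)[of n]
      by linarith
    then show "\<forall>\<^sub>F n in sequentially. norm (l2_norm \<Omega> (\<lambda>x. \<phi> n x - v x)) \<le> inverse (real (Suc n)) + l2_norm \<Omega> (\<lambda>x. u n x - v x)"
      by (simp add: l2_norm_nonneg del: of_nat_Suc)
    show "(\<lambda>n. inverse (real (Suc n)) + l2_norm \<Omega> (\<lambda>x. u n x - v x)) \<longlonglongrightarrow> 0"
      using tendsto_add[OF LIMSEQ_inverse_real_of_nat v(2)] by simp
  qed
  have 2: "(\<lambda>n. l2_norm \<Omega> (\<lambda>x. grad (\<phi> n) x - g x)) \<longlonglongrightarrow> 0"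
  proof (rule Lim_null_comparison)
    have "l2_norm \<Omega> (\<lambda>x. grad (\<phi> n) x - g x) \<le> inverse (real (Suc n)) + l2_norm \<Omega> (\<lambda>x. wgrad \<Omega> (u n) x - g x)" for n
      using l2_norm_triangle_diff[OF test_grad_L2[OF \<phi>(1)] H10_wgrad[OF u] g(1), of n n] \<phi>(3)[of n]
      by linarith
    then show "\<forall>\<^sub>F n in sequentially. norm (l2_norm \<Omega> (\<lambda>x. grad (\<phi> n) x - g x)) \<le> inverse (real (Suc n)) + l2_norm \<Omega> (\<lambda>x. wgrad \<Omega> (u n) x - g x)"
      by (simp add: l2_norm_nonneg del: of_nat_Suc)
    show "(\<lambda>n. inverse (real (Suc n)) + l2_norm \<Omega> (\<lambda>x. wgrad \<Omega> (u n) x - g x)) \<longlonglongrightarrow> 0"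
      using tendsto_add[OF LIMSEQ_inverse_real_of_nat g(2)] by simp
  qed
  note H = H10_I[OF v(1) g(1) \<phi>(1) 1 2]
  have "l2_norm \<Omega> (\<lambda>x. wgrad \<Omega> (u n) x - wgrad \<Omega> v x) = l2_norm \<Omega> (\<lambda>x. wgrad \<Omega> (u n) x - g x)" for n
    using H u g(1) by (intro l2_norm_cong_AE L2_measurable L2_diff H10_wgrad) auto
  then have "(\<lambda>n. h1_dist (u n) v) \<longlonglongrightarrow> 0"
    using tendsto_add[OF v(2) g(2)] by (simp add: h1_dist_def)
  then show ?thesis using H(1) that by blast
qed

end

section \<open>Rellich's theorem\<close>

context bounded_open
begin

lemma nn_integral_M_eq_lborel:
  assumes [measurable]: "f \<in> borel_measurable borel"
  shows "(\<integral>\<^sup>+x. f x \<partial>M) = (\<integral>\<^sup>+x. f x * indicator \<Omega> x \<partial>lborel)"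
proof -
  have "\<Omega> \<in> sets borel" using open_dom by simp
  then have "(\<integral>\<^sup>+x. f x * indicator \<Omega> x \<partial>lebesgue) = (\<integral>\<^sup>+x. f x * indicator \<Omega> x \<partial>lborel)"
    by (subst nn_integral_completion) auto
  then show ?thesis by (simp add: nn_integral_restrict_space)
qed

text \<open>Cauchy-Schwarz against the constant 1. The extended nonnegative form over
  \<open>lborel\<close> lets Tonelli's theorem be applied later with no integrability
  condition.\<close>

lemma jensen_nn:
  assumes g[measurable]: "g \<in> borel_measurable borel" and b: "\<And>x. \<bar>g x\<bar> \<le> C"
  shows "ennreal ((\<integral>x. g x \<partial>M)\<^sup>2) \<le> ennreal (measure lebesgue \<Omega>) * (\<integral>\<^sup>+x. ennreal ((g x)\<^sup>2) * indicator \<Omega> x \<partial>lborel)"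
proof -
  have L: "g \<in> L2 \<Omega>" by (rule bounded_L2[where C=C]) (use b in \<open>auto intro: borel_measurable_M\<close>)
  have "\<bar>\<integral>x. g x \<partial>M\<bar> \<le> (\<integral>x. \<bar>g x\<bar> \<partial>M)" by (rule integral_abs_bound)
  also have "\<dots> \<le> sqrt (measure lebesgue \<Omega>) * l2_norm \<Omega> g" using L1_le_l2_norm[OF L] by simp
  finally have "\<bar>\<integral>x. g x \<partial>M\<bar>\<^sup>2 \<le> (sqrt (measure lebesgue \<Omega>) * l2_norm \<Omega> g)\<^sup>2" by (intro power_mono) auto
  then have "(\<integral>x. g x \<partial>M)\<^sup>2 \<le> measure lebesgue \<Omega> * (\<integral>x. (g x)\<^sup>2 \<partial>M)"
    by (simp add: power_mult_distrib l2_norm_power2 l2_inner_self)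
  then have "ennreal ((\<integral>x. g x \<partial>M)\<^sup>2) \<le> ennreal (measure lebesgue \<Omega> * (\<integral>x. (g x)\<^sup>2 \<partial>M))" by (rule ennreal_leI)
  also have "\<dots> = ennreal (measure lebesgue \<Omega>) * ennreal (\<integral>x. (g x)\<^sup>2 \<partial>M)" by (simp add: ennreal_mult)
  also have "ennreal (\<integral>x. (g x)\<^sup>2 \<partial>M) = (\<integral>\<^sup>+x. ennreal ((g x)\<^sup>2) \<partial>M)"
    using L2_power2_integrable[OF L] by (simp add: nn_integral_eq_integral)
  also have "\<dots> = (\<integral>\<^sup>+x. ennreal ((g x)\<^sup>2) * indicator \<Omega> x \<partial>lborel)" by (rule nn_integral_M_eq_lborel) simp
  finally show ?thesis .
qed

lemma nn_integral_norm_power2: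
  fixes f :: "'a \<Rightarrow> 'b::euclidean_space"
  assumes [measurable]: "f \<in> borel_measurable borel" and L: "f \<in> L2 \<Omega>" and z: "\<And>x. x \<notin> \<Omega> \<Longrightarrow> f x = 0"
  shows "(\<integral>\<^sup>+x. ennreal ((norm (f x))\<^sup>2) \<partial>lborel) = ennreal ((l2_norm \<Omega> f)\<^sup>2)"
proof -
  have "(\<integral>\<^sup>+x. ennreal ((norm (f x))\<^sup>2) \<partial>lborel) = (\<integral>\<^sup>+x. ennreal ((norm (f x))\<^sup>2) * indicator \<Omega> x \<partial>lborel)"
    using z by (intro nn_integral_cong) (auto simp: indicator_def)
  also have "\<dots> = (\<integral>\<^sup>+x. ennreal ((norm (f x))\<^sup>2) \<partial>M)" by (rule nn_integral_M_eq_lborel[symmetric]) simp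
  also have "\<dots> = ennreal ((l2_norm \<Omega> f)\<^sup>2)"
    using L2_power2_integrable[OF L] by (simp add: nn_integral_eq_integral l2_norm_power2 l2_inner_self)
  finally show ?thesis .
qed

end

lemma test_increment_integral:
  fixes \<phi> :: "'a::euclidean_space \<Rightarrow> real"
  assumes \<phi>: "smooth \<phi>"
  shows "\<phi> (x + h) - \<phi> x = (\<integral>t. grad \<phi> (x + t *\<^sub>R h) \<bullet> h \<partial>lebesgue_on {0<..<1::real})"
proof -
  interpret U: bounded_open "{0<..<1::real}" by unfold_locales auto
  define g where "g t = grad \<phi> (x + t *\<^sub>R h) \<bullet> h" for t
  have cont: "continuous_on UNIV g"
    unfolding g_def
    by (intro continuous_intros continuous_on_compose2[OF continuous_on_grad[OF \<phi>, of UNIV]]) auto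
  then have [measurable]: "g \<in> borel_measurable borel" by (rule borel_measurable_continuous_onI)
  have "(\<integral>t. g t * indicator {0..1} t \<partial>lborel) = \<phi> (x + 1 *\<^sub>R h) - \<phi> (x + 0 *\<^sub>R h)"
    using cont smooth_DERIV_line[OF \<phi>]
    by (intro integral_FTC_Icc_real) (auto simp: g_def continuous_on_eq_continuous_at)
  moreover have "(\<integral>t. g t \<partial>lebesgue_on {0<..<1}) = (\<integral>t. g t * indicator {0<..<1} t \<partial>lborel)"
  proof -
    have "(\<integral>t. g t \<partial>lebesgue_on {0<..<1}) = (\<integral>t. g t * indicator {0<..<1} t \<partial>lebesgue_on {0<..<1})"
      by (rule Bochner_Integration.integral_cong) auto
    also have "\<dots> = (\<integral>t. g t * indicator {0<..<1} t \<partial>lborel)"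
      by (rule U.integral_M_eq_lborel) auto
    finally show ?thesis .
  qed
  moreover have "(\<integral>t. g t * indicator {0<..<1} t \<partial>lborel) = (\<integral>t. g t * indicator {0..1} t \<partial>lborel)"
  proof (rule integral_cong_AE)
    show "AE t in lborel. g t * indicator {0<..<1} t = g t * indicator {0..1} t"
      using AE_lborel_singleton[of 0] AE_lborel_singleton[of 1]
      by eventually_elim (auto simp: indicator_def)
  qed auto
  ultimately show ?thesis by (simp add: g_def)
qed

text \<open>The increment is an integral along a segment; \<open>jensen_nn\<close> on the unit
  interval and an exchange of integrals leave an inner integral that, by translation invariance, is
  the same for each \<open>t\<close>.\<close>

lemma test_translation_nn:
  fixes \<phi> :: "'a::euclidean_space \<Rightarrow> real"
  assumes \<phi>: "\<phi> \<in> test_functions \<Omega>"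
  shows "(\<integral>\<^sup>+x. ennreal ((\<phi> (x + h) - \<phi> x)\<^sup>2) \<partial>lborel)
    \<le> ennreal ((norm h)\<^sup>2) * (\<integral>\<^sup>+x. ennreal ((norm (grad \<phi> x))\<^sup>2) \<partial>lborel)"
proof -
  interpret U: bounded_open "{0<..<1::real}" by unfold_locales auto
  have s: "smooth \<phi>" using \<phi> by (rule test_smooth)
  have [measurable]: "\<phi> \<in> borel_measurable borel" "grad \<phi> \<in> borel_measurable borel"
    using s smooth_borel_measurable grad_borel_measurable by auto
  obtain C where C: "\<And>x. norm (grad \<phi> x) \<le> C" using test_bounded[OF \<phi>] by metis
  let ?I = "\<integral>\<^sup>+x. ennreal ((norm (grad \<phi> x))\<^sup>2) \<partial>lborel"
  have *: "ennreal ((\<phi> (x + h) - \<phi> x)\<^sup>2)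
      \<le> (\<integral>\<^sup>+t. ennreal ((norm h)\<^sup>2 * (norm (grad \<phi> (x + t *\<^sub>R h)))\<^sup>2) * indicator {0<..<1} t \<partial>lborel)" for x
  proof -
    have le: "\<bar>grad \<phi> y \<bullet> h\<bar> \<le> norm h * norm (grad \<phi> y)" for y
      using Cauchy_Schwarz_ineq2[of "grad \<phi> y" h] by (simp add: mult.commute)
    have "ennreal ((\<phi> (x + h) - \<phi> x)\<^sup>2) = ennreal ((\<integral>t. grad \<phi> (x + t *\<^sub>R h) \<bullet> h \<partial>lebesgue_on {0<..<1::real})\<^sup>2)"
      by (simp only: test_increment_integral[OF s])
    also have "\<dots> \<le> ennreal (measure lebesgue {0<..<1::real})
        * (\<integral>\<^sup>+t. ennreal ((grad \<phi> (x + t *\<^sub>R h) \<bullet> h)\<^sup>2) * indicator {0<..<1} t \<partial>lborel)"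
    proof (rule U.jensen_nn)
      show "\<bar>grad \<phi> (x + t *\<^sub>R h) \<bullet> h\<bar> \<le> norm h * C" for t
        using le[of "x + t *\<^sub>R h"] mult_left_mono[OF C[of "x + t *\<^sub>R h"] norm_ge_zero[of h]] by linarith
    qed measurable
    also have "\<dots> = (\<integral>\<^sup>+t. ennreal ((grad \<phi> (x + t *\<^sub>R h) \<bullet> h)\<^sup>2) * indicator {0<..<1} t \<partial>lborel)" by simp
    also have "\<dots> \<le> (\<integral>\<^sup>+t. ennreal ((norm h)\<^sup>2 * (norm (grad \<phi> (x + t *\<^sub>R h)))\<^sup>2) * indicator {0<..<1} t \<partial>lborel)"
    proof (intro nn_integral_mono mult_right_mono ennreal_leI)
      show "(grad \<phi> (x + t *\<^sub>R h) \<bullet> h)\<^sup>2 \<le> (norm h)\<^sup>2 * (norm (grad \<phi> (x + t *\<^sub>R h)))\<^sup>2" for t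
        using power_mono[OF le[of "x + t *\<^sub>R h"], of 2] by (simp add: power_mult_distrib)
    qed simp
    finally show ?thesis .
  qed
  have "(\<integral>\<^sup>+x. ennreal ((\<phi> (x + h) - \<phi> x)\<^sup>2) \<partial>lborel) \<le>
      (\<integral>\<^sup>+x. (\<integral>\<^sup>+t. ennreal ((norm h)\<^sup>2 * (norm (grad \<phi> (x + t *\<^sub>R h)))\<^sup>2) * indicator {0<..<1} t \<partial>lborel) \<partial>lborel)"
    by (intro nn_integral_mono *)
  also have "\<dots> = (\<integral>\<^sup>+t. (\<integral>\<^sup>+x. ennreal ((norm h)\<^sup>2 * (norm (grad \<phi> (x + t *\<^sub>R h)))\<^sup>2) * indicator {0<..<1} t \<partial>lborel) \<partial>lborel)"
    by (rule lborel_pair.Fubini') measurable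
  also have "\<dots> = (\<integral>\<^sup>+t. (ennreal ((norm h)\<^sup>2) * ?I) * indicator {0<..<1::real} t \<partial>lborel)"
  proof (intro nn_integral_cong)
    fix t :: real
    have "(\<integral>\<^sup>+x. ennreal ((norm h)\<^sup>2 * (norm (grad \<phi> (x + t *\<^sub>R h)))\<^sup>2) * indicator {0<..<1} t \<partial>lborel)
        = (\<integral>\<^sup>+x. (ennreal ((norm h)\<^sup>2) * ennreal ((norm (grad \<phi> (x + t *\<^sub>R h)))\<^sup>2)) * indicator {0<..<1} t \<partial>lborel)"
      by (simp add: ennreal_mult)
    also have "\<dots> = (ennreal ((norm h)\<^sup>2) * (\<integral>\<^sup>+x. ennreal ((norm (grad \<phi> (x + t *\<^sub>R h)))\<^sup>2) \<partial>lborel)) * indicator {0<..<1} t"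
      by (subst nn_integral_multc, measurable, subst nn_integral_cmult, measurable)
    also have "(\<integral>\<^sup>+x. ennreal ((norm (grad \<phi> (x + t *\<^sub>R h)))\<^sup>2) \<partial>lborel) = ?I"
      by (rule nn_integral_lborel_translate[of "\<lambda>x. ennreal ((norm (grad \<phi> x))\<^sup>2)"]) measurable
    finally show "(\<integral>\<^sup>+x. ennreal ((norm h)\<^sup>2 * (norm (grad \<phi> (x + t *\<^sub>R h)))\<^sup>2) * indicator {0<..<1} t \<partial>lborel)
        = (ennreal ((norm h)\<^sup>2) * ?I) * indicator {0<..<1::real} t" .
  qed
  also have "\<dots> = ennreal ((norm h)\<^sup>2) * ?I" by (subst nn_integral_cmult) auto
  finally show ?thesis .
qed

text \<open>Convolution with the normalised indicator of a ball. For a fixed radius it turns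
  \<open>L2\<close> bounds on values and gradients into uniform bounds and a common Lipschitz
  constant, which is what Arzela-Ascoli asks for.\<close>

definition ball_avg :: "real \<Rightarrow> ('a::euclidean_space \<Rightarrow> real) \<Rightarrow> 'a \<Rightarrow> real" where
  "ball_avg r \<phi> x = (\<integral>h. \<phi> (x + h) \<partial>lebesgue_on (ball 0 r)) / measure lebesgue (ball (0::'a) r)"

lemma bounded_open_ball: "bounded_open (ball c r)" by unfold_locales auto

lemma measure_ball_0_pos: "r > 0 \<Longrightarrow> measure lebesgue (ball (0::'a::euclidean_space) r) > 0"
  using content_ball_pos[of r "0::'a"] by (simp add: measure_completion)

lemma nn_square_div_le:
  assumes "V > 0" "ennreal (a\<^sup>2) \<le> ennreal V * I"
  shows "ennreal ((a / V)\<^sup>2) \<le> ennreal (1 / V) * I"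
proof -
  have "ennreal ((a / V)\<^sup>2) = ennreal (1 / V\<^sup>2) * ennreal (a\<^sup>2)"
    by (simp add: ennreal_mult[symmetric] power_divide)
  also have "\<dots> \<le> ennreal (1 / V\<^sup>2) * (ennreal V * I)" by (intro mult_left_mono assms) auto
  also have "\<dots> = ennreal (1 / V) * I"
    using assms(1) by (simp add: mult.assoc[symmetric] ennreal_mult[symmetric] power2_eq_square)
  finally show ?thesis .
qed

lemma ball_avg_diff_nn:
  fixes \<phi> :: "'a::euclidean_space \<Rightarrow> real"
  assumes \<phi>: "\<phi> \<in> test_functions \<Omega>" and r: "r > 0"
  shows "ennreal ((ball_avg r \<phi> x - ball_avg r \<phi> y)\<^sup>2)
      \<le> ennreal (1 / measure lebesgue (ball (0::'a) r)) * (\<integral>\<^sup>+h. ennreal ((\<phi> (x + h) - \<phi> (y + h))\<^sup>2) * indicator (ball 0 r) h \<partial>lborel)"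
    and "ennreal ((ball_avg r \<phi> x)\<^sup>2)
      \<le> ennreal (1 / measure lebesgue (ball (0::'a) r)) * (\<integral>\<^sup>+h. ennreal ((\<phi> (x + h))\<^sup>2) * indicator (ball 0 r) h \<partial>lborel)"
    and "ennreal ((ball_avg r \<phi> x - \<phi> x)\<^sup>2)
      \<le> ennreal (1 / measure lebesgue (ball (0::'a) r)) * (\<integral>\<^sup>+h. ennreal ((\<phi> (x + h) - \<phi> x)\<^sup>2) * indicator (ball 0 r) h \<partial>lborel)"
proof -
  interpret B: bounded_open "ball (0::'a) r" by (rule bounded_open_ball)
  let ?V = "measure lebesgue (ball (0::'a) r)"
  have V: "?V > 0" using measure_ball_0_pos[OF r] .
  have [measurable]: "\<phi> \<in> borel_measurable borel"
    using \<phi> test_smooth smooth_borel_measurable by blast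
  obtain C where C: "\<And>x. \<bar>\<phi> x\<bar> \<le> C" using test_bounded[OF \<phi>] by metis
  have int: "integrable (lebesgue_on (ball 0 r)) (\<lambda>h. \<phi> (x + h))" for x
    by (rule B.bounded_integrable[where C=C]) (use C in \<open>auto intro: B.borel_measurable_M\<close>)
  have C2: "\<bar>\<phi> a - \<phi> b\<bar> \<le> 2 * C" for a b using C[of a] C[of b] by linarith
  have "ball_avg r \<phi> x - ball_avg r \<phi> y = (\<integral>h. \<phi> (x + h) - \<phi> (y + h) \<partial>lebesgue_on (ball 0 r)) / ?V"
    using int by (simp add: ball_avg_def diff_divide_distrib)
  then show "ennreal ((ball_avg r \<phi> x - ball_avg r \<phi> y)\<^sup>2)
      \<le> ennreal (1 / ?V) * (\<integral>\<^sup>+h. ennreal ((\<phi> (x + h) - \<phi> (y + h))\<^sup>2) * indicator (ball 0 r) h \<partial>lborel)"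
    using nn_square_div_le[OF V B.jensen_nn[of "\<lambda>h. \<phi> (x + h) - \<phi> (y + h)" "2 * C"]] C2 by simp
  show "ennreal ((ball_avg r \<phi> x)\<^sup>2) \<le> ennreal (1 / ?V) * (\<integral>\<^sup>+h. ennreal ((\<phi> (x + h))\<^sup>2) * indicator (ball 0 r) h \<partial>lborel)"
    unfolding ball_avg_def using nn_square_div_le[OF V B.jensen_nn[of "\<lambda>h. \<phi> (x + h)" C]] C by simp
  have "(\<integral>h. \<phi> (x + h) - \<phi> x \<partial>lebesgue_on (ball 0 r)) = (\<integral>h. \<phi> (x + h) \<partial>lebesgue_on (ball 0 r)) - \<phi> x * ?V"
    using int by (simp add: measure_restrict_space)
  then have "ball_avg r \<phi> x - \<phi> x = (\<integral>h. \<phi> (x + h) - \<phi> x \<partial>lebesgue_on (ball 0 r)) / ?V"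
    using V by (simp add: ball_avg_def diff_divide_distrib)
  then show "ennreal ((ball_avg r \<phi> x - \<phi> x)\<^sup>2)
      \<le> ennreal (1 / ?V) * (\<integral>\<^sup>+h. ennreal ((\<phi> (x + h) - \<phi> x)\<^sup>2) * indicator (ball 0 r) h \<partial>lborel)"
    using nn_square_div_le[OF V B.jensen_nn[of "\<lambda>h. \<phi> (x + h) - \<phi> x" "2 * C"]] C2 by simp
qed

context bounded_open
begin

lemma test_norm_nn:
  assumes \<phi>: "\<phi> \<in> test_functions \<Omega>"
  shows "(\<integral>\<^sup>+x. ennreal ((norm (grad \<phi> x))\<^sup>2) \<partial>lborel) = ennreal ((l2_norm \<Omega> (grad \<phi>))\<^sup>2)"
    "(\<integral>\<^sup>+x. ennreal ((\<phi> x)\<^sup>2) \<partial>lborel) = ennreal ((l2_norm \<Omega> \<phi>)\<^sup>2)"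
  using nn_integral_norm_power2[OF grad_borel_measurable[OF test_smooth[OF \<phi>]] test_grad_L2[OF \<phi>] test_grad_zero_outside[OF \<phi>]]
    nn_integral_norm_power2[OF smooth_borel_measurable[OF test_smooth[OF \<phi>]] test_L2[OF \<phi>] test_zero_outside[OF \<phi>]]
  by auto

text \<open>After Jensen the squared increment may be integrated over the whole space instead of the
  ball, where the translation estimate applies. The constant sees \<open>\<phi>\<close> only through
  its gradient norm, whence equicontinuity of bounded families.\<close>

lemma ball_avg_Lipschitz:
  assumes \<phi>: "\<phi> \<in> test_functions \<Omega>" and r: "r > 0"
  shows "\<bar>ball_avg r \<phi> x - ball_avg r \<phi> y\<bar> \<le> l2_norm \<Omega> (grad \<phi>) / sqrt (measure lebesgue (ball (0::'a) r)) * norm (x - y)"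
proof -
  let ?V = "measure lebesgue (ball (0::'a) r)"
  have V: "?V > 0" using measure_ball_0_pos[OF r] .
  have [measurable]: "\<phi> \<in> borel_measurable borel"
    using \<phi> test_smooth smooth_borel_measurable by blast
  have "(\<integral>\<^sup>+h. ennreal ((\<phi> (x + h) - \<phi> (y + h))\<^sup>2) * indicator (ball 0 r) h \<partial>lborel)
      \<le> (\<integral>\<^sup>+h. ennreal ((\<phi> (x + h) - \<phi> (y + h))\<^sup>2) \<partial>lborel)"
    by (intro nn_integral_mono) (auto simp: indicator_def)
  also have "\<dots> = (\<integral>\<^sup>+h. ennreal ((\<phi> (h + (x - y)) - \<phi> h)\<^sup>2) \<partial>lborel)"
    using nn_integral_lborel_translate[of "\<lambda>h. ennreal ((\<phi> (h + (x - y)) - \<phi> h)\<^sup>2)" y]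
    by (simp add: algebra_simps)
  also have "\<dots> \<le> ennreal ((norm (x - y))\<^sup>2) * ennreal ((l2_norm \<Omega> (grad \<phi>))\<^sup>2)"
    using test_translation_nn[OF \<phi>, of "x - y"] by (simp add: test_norm_nn[OF \<phi>])
  finally have I: "(\<integral>\<^sup>+h. ennreal ((\<phi> (x + h) - \<phi> (y + h))\<^sup>2) * indicator (ball 0 r) h \<partial>lborel)
      \<le> ennreal ((norm (x - y))\<^sup>2) * ennreal ((l2_norm \<Omega> (grad \<phi>))\<^sup>2)" .
  have "ennreal ((ball_avg r \<phi> x - ball_avg r \<phi> y)\<^sup>2)
      \<le> ennreal (1 / ?V) * (ennreal ((norm (x - y))\<^sup>2) * ennreal ((l2_norm \<Omega> (grad \<phi>))\<^sup>2))"
    by (rule order_trans[OF ball_avg_diff_nn(1)[OF \<phi> r] mult_left_mono[OF I zero_le]])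
  then have "(ball_avg r \<phi> x - ball_avg r \<phi> y)\<^sup>2 \<le> 1 / ?V * ((norm (x - y))\<^sup>2 * (l2_norm \<Omega> (grad \<phi>))\<^sup>2)"
    using V by (simp add: ennreal_mult[symmetric])
  also have "\<dots> = (l2_norm \<Omega> (grad \<phi>) / sqrt ?V * norm (x - y))\<^sup>2"
    using V by (simp add: power_mult_distrib power_divide)
  finally have "\<bar>ball_avg r \<phi> x - ball_avg r \<phi> y\<bar>\<^sup>2 \<le> (l2_norm \<Omega> (grad \<phi>) / sqrt ?V * norm (x - y))\<^sup>2" by simp
  then show ?thesis by (rule power2_le_imp_le) (simp add: l2_norm_nonneg)
qed

lemma ball_avg_bound:
  assumes \<phi>: "\<phi> \<in> test_functions \<Omega>" and r: "r > 0"
  shows "\<bar>ball_avg r \<phi> x\<bar> \<le> l2_norm \<Omega> \<phi> / sqrt (measure lebesgue (ball (0::'a) r))"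
proof -
  let ?V = "measure lebesgue (ball (0::'a) r)"
  have V: "?V > 0" using measure_ball_0_pos[OF r] .
  have [measurable]: "\<phi> \<in> borel_measurable borel"
    using \<phi> test_smooth smooth_borel_measurable by blast
  have "(\<integral>\<^sup>+h. ennreal ((\<phi> (x + h))\<^sup>2) * indicator (ball 0 r) h \<partial>lborel) \<le> (\<integral>\<^sup>+h. ennreal ((\<phi> (x + h))\<^sup>2) \<partial>lborel)"
    by (intro nn_integral_mono) (auto simp: indicator_def)
  also have "\<dots> = (\<integral>\<^sup>+h. ennreal ((\<phi> h)\<^sup>2) \<partial>lborel)"
    using nn_integral_lborel_translate[of "\<lambda>h. ennreal ((\<phi> h)\<^sup>2)" x]
    by (simp add: algebra_simps)
  also have "\<dots> = ennreal ((l2_norm \<Omega> \<phi>)\<^sup>2)" by (simp add: test_norm_nn[OF \<phi>])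
  finally have I: "(\<integral>\<^sup>+h. ennreal ((\<phi> (x + h))\<^sup>2) * indicator (ball 0 r) h \<partial>lborel) \<le> ennreal ((l2_norm \<Omega> \<phi>)\<^sup>2)" .
  have "ennreal ((ball_avg r \<phi> x)\<^sup>2) \<le> ennreal (1 / ?V) * ennreal ((l2_norm \<Omega> \<phi>)\<^sup>2)"
    by (rule order_trans[OF ball_avg_diff_nn(2)[OF \<phi> r] mult_left_mono[OF I zero_le]])
  then have "(ball_avg r \<phi> x)\<^sup>2 \<le> 1 / ?V * (l2_norm \<Omega> \<phi>)\<^sup>2"
    using V by (simp add: ennreal_mult[symmetric])
  also have "\<dots> = (l2_norm \<Omega> \<phi> / sqrt ?V)\<^sup>2"
    using V by (simp add: power_divide)
  finally have "\<bar>ball_avg r \<phi> x\<bar>\<^sup>2 \<le> (l2_norm \<Omega> \<phi> / sqrt ?V)\<^sup>2" by simp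
  then show ?thesis by (rule power2_le_imp_le) (simp add: l2_norm_nonneg)
qed

lemma ball_avg_continuous:
  assumes \<phi>: "\<phi> \<in> test_functions \<Omega>" and r: "r > 0"
  shows "continuous_on UNIV (ball_avg r \<phi>)"
proof -
  let ?L = "l2_norm \<Omega> (grad \<phi>) / sqrt (measure lebesgue (ball (0::'a) r))"
  have "?L-lipschitz_on UNIV (ball_avg r \<phi>)"
    using ball_avg_Lipschitz[OF assms]
    by (intro lipschitz_onI) (auto simp: dist_norm l2_norm_nonneg)
  then show ?thesis by (rule lipschitz_on_continuous_on)
qed

lemma ball_avg_L2:
  assumes \<phi>: "\<phi> \<in> test_functions \<Omega>" and r: "r > 0"
  shows "ball_avg r \<phi> \<in> L2 \<Omega>"
  by (rule bounded_L2[where C="l2_norm \<Omega> \<phi> / sqrt (measure lebesgue (ball (0::'a) r))"])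
     (use ball_avg_bound[OF assms] ball_avg_continuous[OF assms]
      in \<open>auto intro!: borel_measurable_M borel_measurable_continuous_onI AE_I2\<close>)

text \<open>After Tonelli the inner integral is a translation by some \<open>h\<close> in the ball,
  costing at most r^2 times the squared gradient norm; the volume of the ball cancels. The error is
  thus uniform over families with bounded gradients.\<close>

lemma ball_avg_close:
  assumes \<phi>: "\<phi> \<in> test_functions \<Omega>" and r: "r > 0"
  shows "l2_norm \<Omega> (\<lambda>x. ball_avg r \<phi> x - \<phi> x) \<le> r * l2_norm \<Omega> (grad \<phi>)"
proof -
  let ?V = "measure lebesgue (ball (0::'a) r)"
  let ?G = "ennreal ((l2_norm \<Omega> (grad \<phi>))\<^sup>2)"
  have V: "?V > 0" using measure_ball_0_pos[OF r] .
  have [measurable]: "ball (0::'a) r \<in> sets borel" by simp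
  have [measurable]: "\<phi> \<in> borel_measurable borel" "ball_avg r \<phi> \<in> borel_measurable borel"
    using \<phi> test_smooth smooth_borel_measurable borel_measurable_continuous_onI ball_avg_continuous[OF assms] by blast+
  have L: "(\<lambda>x. ball_avg r \<phi> x - \<phi> x) \<in> L2 \<Omega>" by (intro L2_diff ball_avg_L2 test_L2 assms)
  have "ennreal ((l2_norm \<Omega> (\<lambda>x. ball_avg r \<phi> x - \<phi> x))\<^sup>2) = (\<integral>\<^sup>+x. ennreal ((ball_avg r \<phi> x - \<phi> x)\<^sup>2) \<partial>M)"
    using L2_power2_integrable[OF L] by (simp add: nn_integral_eq_integral l2_norm_power2 l2_inner_self)
  also have "\<dots> = (\<integral>\<^sup>+x. ennreal ((ball_avg r \<phi> x - \<phi> x)\<^sup>2) * indicator \<Omega> x \<partial>lborel)"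
    by (rule nn_integral_M_eq_lborel) measurable
  also have "\<dots> \<le> (\<integral>\<^sup>+x. ennreal ((ball_avg r \<phi> x - \<phi> x)\<^sup>2) \<partial>lborel)"
    by (intro nn_integral_mono) (auto simp: indicator_def)
  also have "\<dots> \<le> (\<integral>\<^sup>+x. ennreal (1 / ?V) * (\<integral>\<^sup>+h. ennreal ((\<phi> (x + h) - \<phi> x)\<^sup>2) * indicator (ball 0 r) h \<partial>lborel) \<partial>lborel)"
    by (intro nn_integral_mono ball_avg_diff_nn(3)[OF assms])
  also have "\<dots> = ennreal (1 / ?V) * (\<integral>\<^sup>+x. (\<integral>\<^sup>+h. ennreal ((\<phi> (x + h) - \<phi> x)\<^sup>2) * indicator (ball 0 r) h \<partial>lborel) \<partial>lborel)"
    by (rule nn_integral_cmult) measurable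
  also have "(\<integral>\<^sup>+x. (\<integral>\<^sup>+h. ennreal ((\<phi> (x + h) - \<phi> x)\<^sup>2) * indicator (ball 0 r) h \<partial>lborel) \<partial>lborel)
     = (\<integral>\<^sup>+h. (\<integral>\<^sup>+x. ennreal ((\<phi> (x + h) - \<phi> x)\<^sup>2) * indicator (ball 0 r) h \<partial>lborel) \<partial>lborel)"
    by (rule lborel_pair.Fubini') measurable
  also have "\<dots> \<le> (\<integral>\<^sup>+h. (ennreal (r\<^sup>2) * ?G) * indicator (ball (0::'a) r) h \<partial>lborel)"
  proof (intro nn_integral_mono)
    fix h :: 'a
    show "(\<integral>\<^sup>+x. ennreal ((\<phi> (x + h) - \<phi> x)\<^sup>2) * indicator (ball 0 r) h \<partial>lborel) \<le> (ennreal (r\<^sup>2) * ?G) * indicator (ball 0 r) h"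
    proof (cases "h \<in> ball 0 r")
      case True
      have "(\<integral>\<^sup>+x. ennreal ((\<phi> (x + h) - \<phi> x)\<^sup>2) \<partial>lborel) \<le> ennreal ((norm h)\<^sup>2) * ?G"
        using test_translation_nn[OF \<phi>, of h] by (simp add: test_norm_nn[OF \<phi>])
      also have "\<dots> \<le> ennreal (r\<^sup>2) * ?G"
        using True by (intro mult_right_mono ennreal_leI power_mono) auto
      finally show ?thesis using True by simp
    qed simp
  qed
  also have "\<dots> = (ennreal (r\<^sup>2) * ?G) * emeasure lborel (ball (0::'a) r)"
    by (rule nn_integral_cmult_indicator) simp
  also have "emeasure lborel (ball (0::'a) r) = ennreal ?V"
    using emeasure_eq_ennreal_measure[of lborel "ball (0::'a) r"] emeasure_bounded_finite[of "ball (0::'a) r"]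
    by (simp add: measure_completion)
  finally have "ennreal ((l2_norm \<Omega> (\<lambda>x. ball_avg r \<phi> x - \<phi> x))\<^sup>2) \<le> ennreal (1 / ?V) * ((ennreal (r\<^sup>2) * ?G) * ennreal ?V)"
    by (meson mult_left_mono order_trans zero_le)
  also have "\<dots> = ennreal (1 / ?V * (r\<^sup>2 * (l2_norm \<Omega> (grad \<phi>))\<^sup>2 * ?V))"
    by (simp only: ennreal_mult[symmetric] zero_le_power2 measure_nonneg zero_le_divide_1_iff mult_nonneg_nonneg)
  also have "\<dots> = ennreal ((r * l2_norm \<Omega> (grad \<phi>))\<^sup>2)" using V by (simp add: power_mult_distrib)
  finally have "(l2_norm \<Omega> (\<lambda>x. ball_avg r \<phi> x - \<phi> x))\<^sup>2 \<le> (r * l2_norm \<Omega> (grad \<phi>))\<^sup>2" by simp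
  then show ?thesis by (rule power2_le_imp_le) (use r in \<open>simp add: l2_norm_nonneg\<close>)
qed

lemma l2_norm_le_sup:
  fixes f :: "'a \<Rightarrow> 'b::euclidean_space"
  assumes [measurable]: "f \<in> borel_measurable M" and "AE x in M. norm (f x) \<le> c" "c \<ge> 0"
  shows "l2_norm \<Omega> f \<le> c * sqrt (measure lebesgue \<Omega>)"
proof -
  have "(\<integral>x. (norm (f x))\<^sup>2 \<partial>M) \<le> (\<integral>x. c\<^sup>2 \<partial>M)"
  proof (rule integral_mono_AE)
    show "AE x in M. (norm (f x))\<^sup>2 \<le> c\<^sup>2" using assms(2) by eventually_elim (simp add: power_mono)
  qed (use L2_power2_integrable[OF bounded_L2[OF assms(1,2)]] in auto)
  then have "l2_norm \<Omega> f \<le> sqrt (c\<^sup>2 * measure lebesgue \<Omega>)"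
    by (simp add: l2_norm_def l2_inner_self measure_restrict_space mult.commute)
  then show ?thesis using assms(3) by (simp add: real_sqrt_mult)
qed

text \<open>For a fixed radius the averages converge uniformly along a subsequence, so its tail is
  mutually close, and replacing functions by averages costs little. Only closeness up to the given
  \<open>e\<close> results, since the radius depends on \<open>e\<close>; a diagonal argument has to
  follow.\<close>

lemma test_subseq_close:
  assumes \<phi>: "\<And>n. \<phi> n \<in> test_functions \<Omega>"
    and C: "\<And>n. l2_norm \<Omega> (\<phi> n) \<le> C" "\<And>n. l2_norm \<Omega> (grad (\<phi> n)) \<le> C" and e: "e > 0"
  obtains k :: "nat \<Rightarrow> nat" where "strict_mono k" "\<And>m n. l2_norm \<Omega> (\<lambda>x. \<phi> (k m) x - \<phi> (k n) x) < e"
proof -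
  \<comment> \<open>Makes the averaging error \<open>r * l2_norm \<Omega> (grad (\<phi> n))\<close>
    at most e/4; the summand 1 keeps the denominator positive.\<close>
  define r where "r = e / (4 * (\<bar>C\<bar> + 1))"
  have r: "r > 0" using e by (simp add: r_def)
  have rC: "r * l2_norm \<Omega> (grad (\<phi> n)) \<le> e / 4" for n
  proof -
    have "r * l2_norm \<Omega> (grad (\<phi> n)) \<le> r * (\<bar>C\<bar> + 1)" using C(2)[of n] r by (intro mult_left_mono) auto
    also have "\<dots> = e / 4"
    proof -
      have "\<bar>C\<bar> + 1 \<noteq> 0" using abs_ge_zero[of C] by linarith
      then show ?thesis unfolding r_def by (metis mult.commute divide_divide_eq_left nonzero_eq_divide_eq)
    qed
    finally show ?thesis .
  qed
  define s where "s = sqrt (measure lebesgue (ball (0::'a) r))"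
  have s: "s > 0" using measure_ball_0_pos[OF r] by (simp add: s_def)
  have cl: "compact (closure \<Omega>)" using bounded_dom by simp
  obtain g k where k: "strict_mono (k :: nat \<Rightarrow> nat)"
    "\<And>e. 0 < e \<Longrightarrow> \<exists>N. \<forall>n x. n \<ge> N \<and> x \<in> closure \<Omega> \<longrightarrow> norm (ball_avg r (\<phi> (k n)) x - g x) < e"
  proof (rule Arzela_Ascoli[OF cl, of "\<lambda>n. ball_avg r (\<phi> n)" "C / s"])
    show "norm (ball_avg r (\<phi> n) x) \<le> C / s" for n x
    proof -
      have "\<bar>ball_avg r (\<phi> n) x\<bar> \<le> l2_norm \<Omega> (\<phi> n) / s" using ball_avg_bound[OF \<phi> r] by (simp add: s_def)
      also have "\<dots> \<le> C / s" using C(1) s by (simp add: divide_right_mono)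
      finally show ?thesis by simp
    qed
    show "\<exists>d. 0 < d \<and> (\<forall>n y. y \<in> closure \<Omega> \<and> norm (x - y) < d \<longrightarrow> norm (ball_avg r (\<phi> n) x - ball_avg r (\<phi> n) y) < e')"
      if "0 < e'" for x and e' :: real
    proof (intro exI[of _ "e' / ((\<bar>C\<bar> + 1) / s)"] conjI allI impI)
      show "0 < e' / ((\<bar>C\<bar> + 1) / s)" using that s by simp
      fix n y assume y: "y \<in> closure \<Omega> \<and> norm (x - y) < e' / ((\<bar>C\<bar> + 1) / s)"
      have "\<bar>ball_avg r (\<phi> n) x - ball_avg r (\<phi> n) y\<bar> \<le> l2_norm \<Omega> (grad (\<phi> n)) / s * norm (x - y)"
        using ball_avg_Lipschitz[OF \<phi> r] by (simp add: s_def)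
      also have "\<dots> \<le> (\<bar>C\<bar> + 1) / s * norm (x - y)"
        using C(2)[of n] s by (intro mult_right_mono divide_right_mono) auto
      also have "\<dots> < e'"
      proof -
        have p: "(\<bar>C\<bar> + 1) / s > 0" using s by simp
        show ?thesis using conjunct2[OF y] by (simp only: pos_less_divide_eq[OF p] mult.commute)
      qed
      finally show "norm (ball_avg r (\<phi> n) x - ball_avg r (\<phi> n) y) < e'" by simp
    qed
  qed blast
  \<comment> \<open>A uniform distance of \<open>2 * q\<close> between averages must cost at most
    e/4 in \<open>L2\<close>, hence the division by the root of the volume.\<close>
  define q where "q = e / (8 * (sqrt (measure lebesgue \<Omega>) + 1))"
  have q: "q > 0" using e by (simp add: q_def add_nonneg_pos)
  obtain N where N: "\<And>n x. n \<ge> N \<Longrightarrow> x \<in> closure \<Omega> \<Longrightarrow> norm (ball_avg r (\<phi> (k n)) x - g x) < q"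
    using k(2)[OF q] by blast
  have close: "l2_norm \<Omega> (\<lambda>x. \<phi> (k m) x - \<phi> (k n) x) < e" if mn: "m \<ge> N" "n \<ge> N" for m n
  proof -
    let ?A = "ball_avg r (\<phi> (k m))" and ?B = "ball_avg r (\<phi> (k n))"
    note L = test_L2[OF \<phi>] ball_avg_L2[OF \<phi> r]
    have 1: "l2_norm \<Omega> (\<lambda>x. ?A x - ?B x) \<le> 2 * q * sqrt (measure lebesgue \<Omega>)"
    proof (rule l2_norm_le_sup)
      show "(\<lambda>x. ?A x - ?B x) \<in> borel_measurable M" using L2_measurable[OF L2_diff[OF L(2) L(2)]] .
      show "AE x in M. norm (?A x - ?B x) \<le> 2 * q"
      proof (rule AE_I2)
        fix x assume "x \<in> space M"
        then have "x \<in> closure \<Omega>" using closure_subset by auto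
        then show "norm (?A x - ?B x) \<le> 2 * q" using N[OF mn(1)] N[OF mn(2)] by force
      qed
    qed (use q in simp)
    also have "\<dots> \<le> 2 * q * (sqrt (measure lebesgue \<Omega>) + 1)" using q by simp
    also have "\<dots> = e / 4"
    proof -
      have "2 * (e / (8 * t)) * t = e / 4" if "t > 0" for t :: real using that by simp
      then show ?thesis unfolding q_def by (metis add_nonneg_pos real_sqrt_ge_zero measure_nonneg zero_less_one)
    qed
    finally have 1: "l2_norm \<Omega> (\<lambda>x. ?A x - ?B x) \<le> e / 4" .
    have 2: "l2_norm \<Omega> (\<lambda>x. \<phi> (k m) x - ?A x) \<le> e / 4" "l2_norm \<Omega> (\<lambda>x. ?B x - \<phi> (k n) x) \<le> e / 4"
      using ball_avg_close[OF \<phi> r, of "k m"] ball_avg_close[OF \<phi> r, of "k n"] rC[of "k m"] rC[of "k n"]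
      by (simp_all add: l2_norm_commute[of \<Omega> "\<phi> (k m)"])
    have "l2_norm \<Omega> (\<lambda>x. \<phi> (k m) x - \<phi> (k n) x)
        \<le> l2_norm \<Omega> (\<lambda>x. \<phi> (k m) x - ?A x) + (l2_norm \<Omega> (\<lambda>x. ?A x - ?B x) + l2_norm \<Omega> (\<lambda>x. ?B x - \<phi> (k n) x))"
      using l2_norm_triangle_diff[OF L(1)[of "k m"] L(2)[of "k m"] L(1)[of "k n"]]
        l2_norm_triangle_diff[OF L(2)[of "k m"] L(2)[of "k n"] L(1)[of "k n"]] by linarith
    then show ?thesis using 1 2 e by linarith
  qed
  show ?thesis
  proof (rule that[of "\<lambda>n. k (N + n)"])
    show "strict_mono (\<lambda>n. k (N + n))" using k(1) by (auto simp: strict_mono_def)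
    show "l2_norm \<Omega> (\<lambda>x. \<phi> (k (N + m)) x - \<phi> (k (N + n)) x) < e" for m n by (rule close) auto
  qed
qed

lemma Rellich_test:
  assumes \<phi>: "\<And>n. \<phi> n \<in> test_functions \<Omega>"
    and C: "\<And>n. l2_norm \<Omega> (\<phi> n) \<le> C" "\<And>n. l2_norm \<Omega> (grad (\<phi> n)) \<le> C"
  obtains k :: "nat \<Rightarrow> nat" where "strict_mono k"
    "\<forall>e>0. \<exists>N. \<forall>m\<ge>N. \<forall>n\<ge>N. l2_norm \<Omega> (\<lambda>x. \<phi> (k m) x - \<phi> (k n) x) < e"
proof -
  \<comment> \<open>The condition is imposed on all indices, so it passes to subsequences, and the
    diagonal sequence satisfies the j-th condition from index \<open>Suc j\<close> on.\<close>
  define P where "P j s \<longleftrightarrow> (\<forall>m n. l2_norm \<Omega> (\<lambda>x. \<phi> (s m) x - \<phi> (s n) x) < inverse (real (Suc j)))"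
    for j and s :: "nat \<Rightarrow> nat"
  interpret S: subseqs P
  proof
    fix j and s :: "nat \<Rightarrow> nat" assume "strict_mono s"
    obtain k :: "nat \<Rightarrow> nat" where "strict_mono k" "\<And>m n. l2_norm \<Omega> (\<lambda>x. \<phi> (s (k m)) x - \<phi> (s (k n)) x) < inverse (real (Suc j))"
      by (rule test_subseq_close[of "\<lambda>n. \<phi> (s n)" C "inverse (real (Suc j))"]) (use \<phi> C in auto)
    then show "\<exists>r'. strict_mono r' \<and> P j (s \<circ> r')" by (auto simp: P_def)
  qed
  have P: "P j (S.diagseq \<circ> ((+) (Suc j)))" for j
    by (rule S.diagseq_holds) (auto simp: P_def)
  show ?thesis
  proof (rule that[OF S.subseq_diagseq], intro allI impI)
    fix e :: real assume "e > 0"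
    then obtain j where j: "inverse (real (Suc j)) < e" using reals_Archimedean by blast
    show "\<exists>N. \<forall>m\<ge>N. \<forall>n\<ge>N. l2_norm \<Omega> (\<lambda>x. \<phi> (S.diagseq m) x - \<phi> (S.diagseq n) x) < e"
    proof (intro exI[of _ "Suc j"] allI impI)
      fix m n assume "Suc j \<le> m" "Suc j \<le> n"
      then obtain m' n' where "m = Suc j + m'" "n = Suc j + n'" by (auto dest!: le_Suc_ex)
      then have "l2_norm \<Omega> (\<lambda>x. \<phi> (S.diagseq m) x - \<phi> (S.diagseq n) x) < inverse (real (Suc j))"
        using P[of j] unfolding P_def o_def by simp
      then show "l2_norm \<Omega> (\<lambda>x. \<phi> (S.diagseq m) x - \<phi> (S.diagseq n) x) < e" using j by linarith
    qed
  qed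
qed

text \<open>Each function is replaced by a test function within 1/(n+1). The conclusion is left in
  Cauchy form: a limit in \<open>H10\<close> appears only once the gradients are controlled too, as
  in \<open>minimising_subsequence\<close>.\<close>

theorem Rellich:
  assumes u: "\<And>n. u n \<in> H10 \<Omega>"
    and C: "\<And>n. l2_norm \<Omega> (u n) \<le> C" "\<And>n. l2_norm \<Omega> (wgrad \<Omega> (u n)) \<le> C"
  obtains k :: "nat \<Rightarrow> nat" where "strict_mono k"
    "\<forall>e>0. \<exists>N. \<forall>m\<ge>N. \<forall>n\<ge>N. l2_norm \<Omega> (\<lambda>x. u (k m) x - u (k n) x) < e"
proof -
  have "\<exists>\<phi>. \<phi> \<in> test_functions \<Omega> \<and> h1_dist \<phi> (u n) < inverse (real (Suc n)) \<and>
      l2_norm \<Omega> (\<lambda>x. grad \<phi> x - wgrad \<Omega> (u n) x) < inverse (real (Suc n))" for n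
    by (rule H10_test_approx[OF u[of n], of "inverse (real (Suc n))"]) auto
  then obtain \<phi> where \<phi>: "\<And>n. \<phi> n \<in> test_functions \<Omega>" "\<And>n. h1_dist (\<phi> n) (u n) < inverse (real (Suc n))"
     "\<And>n. l2_norm \<Omega> (\<lambda>x. grad (\<phi> n) x - wgrad \<Omega> (u n) x) < inverse (real (Suc n))" by metis
  have i1: "inverse (real (Suc n)) \<le> 1" for n by (simp add: field_simps)
  have d: "l2_norm \<Omega> (\<lambda>x. \<phi> n x - u n x) < inverse (real (Suc n))" for n
    using h1_dist_ge(1)[of "\<phi> n" "u n"] \<phi>(2)[of n] by linarith
  have "l2_norm \<Omega> (\<phi> n) \<le> C + 1" "l2_norm \<Omega> (grad (\<phi> n)) \<le> C + 1" for n
    using l2_norm_le_add_diff[OF test_L2[OF \<phi>(1)] H10_L2[OF u], of n n] d[of n] C(1)[of n] i1[of n]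
      l2_norm_le_add_diff[OF test_grad_L2[OF \<phi>(1)] H10_wgrad[OF u], of n n] \<phi>(3)[of n] C(2)[of n]
    by linarith+
  from Rellich_test[of \<phi> "C + 1", OF \<phi>(1) this] obtain k :: "nat \<Rightarrow> nat" where k: "strict_mono k"
    "\<forall>e>0. \<exists>N. \<forall>m\<ge>N. \<forall>n\<ge>N. l2_norm \<Omega> (\<lambda>x. \<phi> (k m) x - \<phi> (k n) x) < e" .
  show ?thesis
  proof (rule that[OF k(1)], intro allI impI)
    fix e :: real assume e: "e > 0"
    then obtain N where N: "\<And>m n. m \<ge> N \<Longrightarrow> n \<ge> N \<Longrightarrow> l2_norm \<Omega> (\<lambda>x. \<phi> (k m) x - \<phi> (k n) x) < e / 3"
      using k(2)[rule_format, of "e / 3"] by auto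
    obtain j where j: "inverse (real (Suc j)) < e / 3" using reals_Archimedean[of "e / 3"] e by auto
    have "l2_norm \<Omega> (\<lambda>x. u (k m) x - u (k n) x) < e" if "m \<ge> max N j" "n \<ge> max N j" for m n
    proof -
      have "inverse (real (Suc (k i))) \<le> inverse (real (Suc j))" if "i \<ge> j" for i
        using seq_suble[OF k(1), of i] that by (intro le_imp_inverse_le) auto
      then have a: "inverse (real (Suc (k m))) < e / 3" "inverse (real (Suc (k n))) < e / 3"
        using that j by (meson le_less_trans max.boundedE)+
      have "l2_norm \<Omega> (\<lambda>x. u (k m) x - u (k n) x)
        \<le> l2_norm \<Omega> (\<lambda>x. u (k m) x - \<phi> (k m) x) + (l2_norm \<Omega> (\<lambda>x. \<phi> (k m) x - \<phi> (k n) x) + l2_norm \<Omega> (\<lambda>x. \<phi> (k n) x - u (k n) x))"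
      using l2_norm_triangle_diff[OF H10_L2[OF u[of "k m"]] test_L2[OF \<phi>(1)[of "k m"]] H10_L2[OF u[of "k n"]]]
        l2_norm_triangle_diff[OF test_L2[OF \<phi>(1)[of "k m"]] test_L2[OF \<phi>(1)[of "k n"]] H10_L2[OF u[of "k n"]]] by linarith
      then show ?thesis
        using a d[of "k m"] d[of "k n"] N[of m n] that l2_norm_commute[of \<Omega> "u (k m)" "\<phi> (k m)"] by (simp del: of_nat_Suc)
    qed
    then show "\<exists>N. \<forall>m\<ge>N. \<forall>n\<ge>N. l2_norm \<Omega> (\<lambda>x. u (k m) x - u (k n) x) < e" by blast
  qed
qed

end

section \<open>The energy form and its minimisers\<close>

context bounded_open
begin

definition energy :: "real \<Rightarrow> real \<Rightarrow> ('a \<Rightarrow> real) \<Rightarrow> ('a \<Rightarrow> real) \<Rightarrow> real" where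
  "energy \<alpha> l u v = \<alpha> * dirichlet u v - l * l2_inner \<Omega> u v"

lemma energy_commute: "energy \<alpha> l u v = energy \<alpha> l v u"
  by (simp add: energy_def dirichlet_commute l2_inner_commute)

lemma energy_lin_left:
  assumes "u \<in> H10 \<Omega>" "v \<in> H10 \<Omega>" "w \<in> H10 \<Omega>"
  shows "energy \<alpha> l (\<lambda>x. u x + c * v x) w = energy \<alpha> l u w + c * energy \<alpha> l v w"
  by (simp add: energy_def dirichlet_lin_left[OF assms] l2_inner_lin_left[OF assms[THEN H10_L2]] algebra_simps)

lemma energy_lin_right:
  assumes "u \<in> H10 \<Omega>" "v \<in> H10 \<Omega>" "w \<in> H10 \<Omega>"
  shows "energy \<alpha> l w (\<lambda>x. u x + c * v x) = energy \<alpha> l w u + c * energy \<alpha> l w v"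
  using energy_lin_left[OF assms] by (simp add: energy_commute)

lemma energy_lin_self:
  assumes "u \<in> H10 \<Omega>" "v \<in> H10 \<Omega>"
  shows "energy \<alpha> l (\<lambda>x. u x + c * v x) (\<lambda>x. u x + c * v x)
    = energy \<alpha> l u u + 2 * c * energy \<alpha> l u v + c\<^sup>2 * energy \<alpha> l v v"
  using energy_lin_left[OF assms H10_lin(1)[OF assms, of c], of \<alpha> l c] energy_lin_right[OF assms assms(1)]
    energy_lin_right[OF assms assms(2)] energy_commute[of \<alpha> l v u]
  by (simp add: power2_eq_square algebra_simps)

lemma energy_cmult_self:
  assumes "u \<in> H10 \<Omega>"
  shows "energy \<alpha> l (\<lambda>x. c * u x) (\<lambda>x. c * u x) = c\<^sup>2 * energy \<alpha> l u u"
proof -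
  have *: "(\<lambda>x. u x + (c - 1) * u x) = (\<lambda>x. c * u x)" by (auto simp: algebra_simps)
  show ?thesis using energy_lin_self[OF assms assms, of \<alpha> l "c - 1"]
    unfolding * by (simp add: power2_eq_square algebra_simps)
qed

lemma l2_norm_cmult: "l2_norm \<Omega> (\<lambda>x. c * u x) = \<bar>c\<bar> * l2_norm \<Omega> u" for u :: "'a \<Rightarrow> real"
  using l2_norm_scaleR[of \<Omega> c u] by simp

lemma eigenfunction_iff:
  "eigenfunction \<Omega> \<alpha> l u \<longleftrightarrow>
    u \<in> H10 \<Omega> \<and> \<not> (AE x in M. u x = 0) \<and> (\<forall>\<phi>\<in>H10 \<Omega>. energy \<alpha> l u \<phi> = 0)"
  by (simp add: eigenfunction_def energy_def dirichlet_def l2_inner_def)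

lemma energy_tendsto:
  assumes "\<And>n. u n \<in> H10 \<Omega>" "v \<in> H10 \<Omega>" "(\<lambda>n. h1_dist (u n) v) \<longlonglongrightarrow> 0"
  shows "(\<lambda>n. energy \<alpha> l (u n) (u n)) \<longlonglongrightarrow> energy \<alpha> l v v"
    "(\<lambda>n. l2_norm \<Omega> (u n)) \<longlonglongrightarrow> l2_norm \<Omega> v"
proof -
  note d = h1_dist_tendsto_D[OF assms(3)]
  show 1: "(\<lambda>n. l2_norm \<Omega> (u n)) \<longlonglongrightarrow> l2_norm \<Omega> v"
    by (rule l2_norm_tendsto[OF H10_L2[OF assms(1)] H10_L2[OF assms(2)] d(1)])
  have 2: "(\<lambda>n. l2_norm \<Omega> (wgrad \<Omega> (u n))) \<longlonglongrightarrow> l2_norm \<Omega> (wgrad \<Omega> v)"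
    by (rule l2_norm_tendsto[OF H10_wgrad[OF assms(1)] H10_wgrad[OF assms(2)] d(2)])
  show "(\<lambda>n. energy \<alpha> l (u n) (u n)) \<longlonglongrightarrow> energy \<alpha> l v v"
    unfolding energy_def dirichlet_self l2_norm_power2[symmetric] by (intro tendsto_intros 1 2)
qed

text \<open>A null vector of a semidefinite form lies in its kernel; this turns zero energy into the
  weak eigenvalue equation.\<close>

lemma energy_zero_orthogonal:
  assumes nonneg: "\<And>u. u \<in> H10 \<Omega> \<Longrightarrow> 0 \<le> energy \<alpha> l u u"
    and v: "v \<in> H10 \<Omega>" "energy \<alpha> l v v = 0" and \<phi>: "\<phi> \<in> H10 \<Omega>"
  shows "energy \<alpha> l v \<phi> = 0"
proof -
  have "(energy \<alpha> l v \<phi>)\<^sup>2 \<le> 0 * energy \<alpha> l \<phi> \<phi>"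
  proof (rule quadratic_nonneg_discriminant)
    show "0 \<le> 0 + 2 * t * energy \<alpha> l v \<phi> + t\<^sup>2 * energy \<alpha> l \<phi> \<phi>" for t
      using nonneg[OF H10_lin(1)[OF v(1) \<phi>, of t]] by (simp add: energy_lin_self[OF v(1) \<phi>] v(2))
  qed (rule nonneg[OF \<phi>])
  then show ?thesis by simp
qed

lemma dirichlet_bound:
  assumes "\<alpha> > 0" "energy \<alpha> l u u \<le> E" "l2_norm \<Omega> u \<le> C"
  shows "(l2_norm \<Omega> (wgrad \<Omega> u))\<^sup>2 \<le> (E + \<bar>l\<bar> * C\<^sup>2) / \<alpha>"
proof -
  have "(l2_norm \<Omega> u)\<^sup>2 \<le> C\<^sup>2" using assms(3) by (intro power_mono) (auto simp: l2_norm_nonneg)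
  then have "l * (l2_norm \<Omega> u)\<^sup>2 \<le> \<bar>l\<bar> * C\<^sup>2" by (intro mult_mono) auto
  then have "\<alpha> * (l2_norm \<Omega> (wgrad \<Omega> u))\<^sup>2 \<le> E + \<bar>l\<bar> * C\<^sup>2"
    using assms(2) by (simp add: energy_def dirichlet_self l2_norm_power2)
  then show ?thesis using assms(1) by (simp add: field_simps)
qed

lemma h1_dist_power2_energy:
  assumes "\<alpha> > 0" "u \<in> H10 \<Omega>" "v \<in> H10 \<Omega>"
  shows "(l2_norm \<Omega> (\<lambda>x. wgrad \<Omega> u x - wgrad \<Omega> v x))\<^sup>2
    \<le> (energy \<alpha> l (\<lambda>x. u x - v x) (\<lambda>x. u x - v x) + \<bar>l\<bar> * (l2_norm \<Omega> (\<lambda>x. u x - v x))\<^sup>2) / \<alpha>"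
  using dirichlet_bound[OF assms(1) order_refl order_refl, where l=l and u="\<lambda>x. u x - v x"] l2_norm_wgrad_diff[OF assms(2,3)]
  by simp

text \<open>The parallelogram law with the nonnegative energy of the sum dropped.\<close>

lemma energy_diff_le:
  assumes nonneg: "\<And>u. u \<in> H10 \<Omega> \<Longrightarrow> 0 \<le> energy \<alpha> l u u" and "u \<in> H10 \<Omega>" "v \<in> H10 \<Omega>"
  shows "energy \<alpha> l (\<lambda>x. u x - v x) (\<lambda>x. u x - v x) \<le> 2 * energy \<alpha> l u u + 2 * energy \<alpha> l v v"
  using nonneg[OF H10_lin(1)[OF assms(2,3), of 1]] energy_lin_self[OF assms(2,3), of \<alpha> l 1]
    energy_lin_self[OF assms(2,3), of \<alpha> l "-1"] by simp

text \<open>Rellich makes a subsequence Cauchy in \<open>L2\<close>, and the parallelogram law makes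
  the energies of differences small. This controls the gradients, since \<alpha> times the Dirichlet
  integral is the energy plus \<open>l\<close> times the squared \<open>L2\<close> norm. Convergence
  is therefore strong, and the energy passes to the limit by continuity.\<close>

lemma minimising_subsequence:
  assumes \<alpha>: "\<alpha> > 0" and nonneg: "\<And>u. u \<in> H10 \<Omega> \<Longrightarrow> 0 \<le> energy \<alpha> l u u"
    and u: "\<And>n. u n \<in> H10 \<Omega>" "\<And>n. l2_norm \<Omega> (u n) \<le> C" "(\<lambda>n. energy \<alpha> l (u n) (u n)) \<longlonglongrightarrow> 0"
  obtains k :: "nat \<Rightarrow> nat" and v where "strict_mono k" "v \<in> H10 \<Omega>" "(\<lambda>n. h1_dist (u (k n)) v) \<longlonglongrightarrow> 0"
    "energy \<alpha> l v v = 0"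
proof -
  obtain E where E: "\<And>n. energy \<alpha> l (u n) (u n) \<le> E"
  proof -
    obtain E where "\<forall>n. \<bar>energy \<alpha> l (u n) (u n)\<bar> \<le> E"
      using convergent_imp_bounded[OF u(3)] unfolding bounded_iff by auto
    then show thesis using that abs_le_D1 by blast
  qed
  define G where "G = (E + \<bar>l\<bar> * C\<^sup>2) / \<alpha>"
  have g: "l2_norm \<Omega> (wgrad \<Omega> (u n)) \<le> sqrt \<bar>G\<bar>" for n
    using dirichlet_bound[OF \<alpha> E[of n] u(2)[of n]] by (intro real_le_rsqrt order_trans[OF _ abs_ge_self]) (simp add: G_def)
  have "l2_norm \<Omega> (u n) \<le> max C (sqrt \<bar>G\<bar>)" "l2_norm \<Omega> (wgrad \<Omega> (u n)) \<le> max C (sqrt \<bar>G\<bar>)" for n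
    using u(2)[of n] g[of n] by auto
  from Rellich[of u "max C (sqrt \<bar>G\<bar>)", OF u(1) this] obtain k :: "nat \<Rightarrow> nat" where k: "strict_mono k"
    "\<forall>e>0. \<exists>N. \<forall>m\<ge>N. \<forall>n\<ge>N. l2_norm \<Omega> (\<lambda>x. u (k m) x - u (k n) x) < e" .
  have lim: "(\<lambda>n. energy \<alpha> l (u (k n)) (u (k n))) \<longlonglongrightarrow> 0"
    using LIMSEQ_subseq_LIMSEQ[OF u(3) k(1)] by (simp add: o_def)
  have "\<exists>N. \<forall>m\<ge>N. \<forall>n\<ge>N. h1_dist (u (k m)) (u (k n)) < e" if e: "e > 0" for e
  proof -
    \<comment> \<open>The budget: the energy of a difference is below 4 d and the \<open>L2\<close>
      term at most d, so the total stays under 8 d, which divided by \<alpha> is (e/2)^2.\<close>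
    define d where "d = \<alpha> * (e / 2)\<^sup>2 / 8"
    have d: "d > 0" using e \<alpha> by (simp add: d_def)
    define c where "c = min (e / 2) (sqrt (d / (\<bar>l\<bar> + 1)))"
    have c: "c > 0" "c \<le> e / 2" using d e by (auto simp: c_def intro!: divide_pos_pos)
    have lc: "\<bar>l\<bar> * c\<^sup>2 \<le> d"
    proof -
      have "c\<^sup>2 \<le> (sqrt (d / (\<bar>l\<bar> + 1)))\<^sup>2" using c by (intro power_mono) (auto simp: c_def)
      also have "\<dots> = d / (\<bar>l\<bar> + 1)" using d by simp
      finally have "(\<bar>l\<bar> + 1) * c\<^sup>2 \<le> d" by (simp add: pos_le_divide_eq mult.commute add_nonneg_pos)
      then show ?thesis using zero_le_power2[of c] unfolding distrib_right mult_1_left by linarith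
    qed
    obtain N1 where N1: "\<And>m n. m \<ge> N1 \<Longrightarrow> n \<ge> N1 \<Longrightarrow> l2_norm \<Omega> (\<lambda>x. u (k m) x - u (k n) x) < c"
      using k(2) c(1) by blast
    obtain N2 where N2: "\<And>n. n \<ge> N2 \<Longrightarrow> energy \<alpha> l (u (k n)) (u (k n)) < d"
      using order_tendstoD(2)[OF lim d] unfolding eventually_sequentially by blast
    have "h1_dist (u (k m)) (u (k n)) < e" if mn: "m \<ge> max N1 N2" "n \<ge> max N1 N2" for m n
    proof -
      let ?d = "l2_norm \<Omega> (\<lambda>x. u (k m) x - u (k n) x)"
      have l2: "?d < c" using N1 mn by simp
      have "?d\<^sup>2 \<le> c\<^sup>2" using l2 by (intro power_mono) (auto simp: l2_norm_nonneg)
      then have "\<bar>l\<bar> * ?d\<^sup>2 \<le> \<bar>l\<bar> * c\<^sup>2" by (intro mult_left_mono) auto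
      then have "energy \<alpha> l (\<lambda>x. u (k m) x - u (k n) x) (\<lambda>x. u (k m) x - u (k n) x) + \<bar>l\<bar> * ?d\<^sup>2 < 8 * d"
        using energy_diff_le[OF nonneg u(1) u(1), of "k m" "k n"] N2[of m] N2[of n] mn lc d by simp
      then have "(l2_norm \<Omega> (\<lambda>x. wgrad \<Omega> (u (k m)) x - wgrad \<Omega> (u (k n)) x))\<^sup>2 < 8 * d / \<alpha>"
        using h1_dist_power2_energy[OF \<alpha> u(1) u(1), of "k m" "k n" l] \<alpha>
        by (meson divide_strict_right_mono le_less_trans)
      also have "8 * d / \<alpha> = (e / 2)\<^sup>2" using \<alpha> by (simp add: d_def)
      finally have "l2_norm \<Omega> (\<lambda>x. wgrad \<Omega> (u (k m)) x - wgrad \<Omega> (u (k n)) x) < e / 2"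
        by (rule power2_less_imp_less) (use e in simp)
      then show ?thesis using l2 c(2) by (simp add: h1_dist_def)
    qed
    then show ?thesis by blast
  qed
  from H10_complete[of "\<lambda>n. u (k n)", OF u(1) this] obtain v
    where v: "v \<in> H10 \<Omega>" "(\<lambda>n. h1_dist (u (k n)) v) \<longlonglongrightarrow> 0" .
  have "energy \<alpha> l v v = 0"
    using LIMSEQ_unique[OF energy_tendsto(1)[of "\<lambda>n. u (k n)", OF u(1) v] lim] by simp
  then show ?thesis using that k(1) v by blast
qed

lemma normalise:
  assumes "u \<in> H10 \<Omega>" "l2_norm \<Omega> u > 0"
  shows "(\<lambda>x. inverse (l2_norm \<Omega> u) * u x) \<in> H10 \<Omega>" "l2_norm \<Omega> (\<lambda>x. inverse (l2_norm \<Omega> u) * u x) = 1"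
  using assms H10_cmult(1)[OF assms(1)] by (simp_all add: l2_norm_cmult)

lemma l2_norm_pos:
  assumes "u \<in> L2 \<Omega>" "\<not> (AE x in M. u x = 0)" shows "l2_norm \<Omega> u > 0"
  using l2_inner_zeroI[OF assms(1)] assms(2) l2_norm_nonneg[of \<Omega> u] by fastforce

text \<open>\<open>first_eigenvalue\<close> compares \<open>l0\<close> with eigenvalues only. The
  infimum \<mu> of the Rayleigh quotient is attained by \<open>minimising_subsequence\<close> and
  the minimiser is an eigenfunction, so \<open>l0 \<le> \<mu>\<close>; lowering the parameter can
  only raise the energy.\<close>

lemma first_eigenvalue_energy_nonneg:
  assumes \<alpha>: "\<alpha> > 0" and l0: "first_eigenvalue \<Omega> \<alpha> l0" and u: "u \<in> H10 \<Omega>"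
  shows "0 \<le> energy \<alpha> l0 u u"
proof -
  obtain u0 where u0: "eigenfunction \<Omega> \<alpha> l0 u0" using l0 by (auto simp: first_eigenvalue_def)
  define R where "R = {\<alpha> * dirichlet u u | u. u \<in> H10 \<Omega> \<and> l2_norm \<Omega> u = 1}"
  have u0': "u0 \<in> H10 \<Omega>" "l2_norm \<Omega> u0 > 0" using u0 l2_norm_pos H10_L2 by (auto simp: eigenfunction_iff)
  have ne: "R \<noteq> {}" using normalise[OF u0'] by (auto simp: R_def)
  have bdd: "bdd_below R" by (rule bdd_belowI[of _ 0]) (use \<alpha> in \<open>auto simp: R_def dirichlet_self\<close>)
  define \<mu> where "\<mu> = Inf R"
  \<comment> \<open>By scaling to unit norm; for a function of norm zero only the Dirichlet part of
    the energy remains.\<close>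
  have nonneg: "0 \<le> energy \<alpha> \<mu> v v" if v: "v \<in> H10 \<Omega>" for v
  proof (cases "l2_norm \<Omega> v > 0")
    case False
    then have "l2_norm \<Omega> v = 0" using l2_norm_nonneg[of \<Omega> v] by simp
    then have "l2_inner \<Omega> v v = 0" using l2_norm_power2[of \<Omega> v] by simp
    then show ?thesis using \<alpha> by (simp add: energy_def dirichlet_self)
  next
    case True
    let ?w = "\<lambda>x. inverse (l2_norm \<Omega> v) * v x"
    have "\<alpha> * dirichlet ?w ?w \<in> R" using normalise[OF v True] by (auto simp: R_def)
    then have "\<mu> \<le> \<alpha> * dirichlet ?w ?w" unfolding \<mu>_def by (rule cInf_lower[OF _ bdd])
    then have "0 \<le> energy \<alpha> \<mu> ?w ?w"
      using normalise(2)[OF v True] l2_norm_power2[of \<Omega> ?w] by (simp add: energy_def)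
    then show ?thesis using True by (simp add: energy_cmult_self[OF v] zero_le_mult_iff)
  qed
  have "\<exists>v. v \<in> H10 \<Omega> \<and> l2_norm \<Omega> v = 1 \<and> \<alpha> * dirichlet v v < \<mu> + inverse (real (Suc n))" for n
  proof -
    have "Inf R < \<mu> + inverse (real (Suc n))" unfolding \<mu>_def by simp
    then show ?thesis using cInf_lessD[OF ne] by (auto simp: R_def)
  qed
  then obtain v where v: "\<And>n. v n \<in> H10 \<Omega>" "\<And>n. l2_norm \<Omega> (v n) = 1"
    "\<And>n. \<alpha> * dirichlet (v n) (v n) < \<mu> + inverse (real (Suc n))" by metis
  have "(\<lambda>n. energy \<alpha> \<mu> (v n) (v n)) \<longlonglongrightarrow> 0"
  proof (rule Lim_null_comparison[OF _ LIMSEQ_inverse_real_of_nat])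
    have "norm (energy \<alpha> \<mu> (v n) (v n)) \<le> inverse (real (Suc n))" for n
      using nonneg[OF v(1)[of n]] v(3)[of n] l2_norm_power2[of \<Omega> "v n"] v(2)[of n]
      by (simp add: energy_def del: of_nat_Suc)
    then show "\<forall>\<^sub>F n in sequentially. norm (energy \<alpha> \<mu> (v n) (v n)) \<le> inverse (real (Suc n))" by simp
  qed
  from minimising_subsequence[of \<alpha> \<mu> v 1, OF \<alpha> nonneg v(1) _ this] obtain k :: "nat \<Rightarrow> nat" and w where
    w: "strict_mono k" "w \<in> H10 \<Omega>" "(\<lambda>n. h1_dist (v (k n)) w) \<longlonglongrightarrow> 0" "energy \<alpha> \<mu> w w = 0"
    using v(2) by auto
  have "l2_norm \<Omega> w = 1"
    using LIMSEQ_unique[OF energy_tendsto(2)[of "\<lambda>n. v (k n)", OF v(1) w(2,3)]] v(2) tendsto_const by auto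
  have "\<not> (AE x in M. w x = 0)"
  proof
    assume "AE x in M. w x = 0"
    then have "l2_norm \<Omega> w = l2_norm \<Omega> (\<lambda>x. 0 :: real)"
      using L2_measurable[OF H10_L2[OF w(2)]] by (intro l2_norm_cong_AE) auto
    then show False using \<open>l2_norm \<Omega> w = 1\<close> by (simp add: l2_norm_def l2_inner_def)
  qed
  then have "eigenfunction \<Omega> \<alpha> \<mu> w"
    using w(2) energy_zero_orthogonal[OF nonneg w(2,4)] by (simp add: eigenfunction_iff)
  then have "l0 \<le> \<mu>" using l0 by (auto simp: first_eigenvalue_def)
  then have "l0 * l2_inner \<Omega> u u \<le> \<mu> * l2_inner \<Omega> u u" by (simp add: mult_right_mono l2_inner_self_nonneg)
  then show ?thesis using nonneg[OF u] by (simp add: energy_def)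
qed

lemma first_eigenvalue_nonneg:
  assumes "\<alpha> > 0" "first_eigenvalue \<Omega> \<alpha> l0" shows "0 \<le> l0"
proof -
  obtain u where u: "eigenfunction \<Omega> \<alpha> l0 u" using assms by (auto simp: first_eigenvalue_def)
  then have "energy \<alpha> l0 u u = 0" "l2_norm \<Omega> u > 0" using l2_norm_pos H10_L2 by (auto simp: eigenfunction_iff)
  then have "\<alpha> * (l2_norm \<Omega> (wgrad \<Omega> u))\<^sup>2 = l0 * (l2_norm \<Omega> u)\<^sup>2" by (simp add: energy_def dirichlet_self l2_norm_power2)
  moreover have "0 \<le> \<alpha> * (l2_norm \<Omega> (wgrad \<Omega> u))\<^sup>2" using assms(1) by simp
  ultimately show ?thesis using \<open>l2_norm \<Omega> u > 0\<close> by (simp add: zero_le_mult_iff)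
qed

end

text \<open>Collects what the state equation needs of the eigenvalue. Connectedness and the
  positivity of \<open>u0\<close> are condensed into \<open>simple\<close>, which is phrased with
  zero energy because that is what limits of normalised sequences provide.\<close>

locale simple_eigenvalue = bounded_open +
  fixes \<alpha> l0 :: real and u0 :: "'a \<Rightarrow> real"
  assumes alpha_pos: "\<alpha> > 0" and l0_nonneg: "0 \<le> l0"
    and energy_nonneg: "u \<in> H10 \<Omega> \<Longrightarrow> 0 \<le> energy \<alpha> l0 u u"
    and u0_H10: "u0 \<in> H10 \<Omega>" and u0_norm: "l2_norm \<Omega> u0 = 1"
    and u0_eigen: "\<phi> \<in> H10 \<Omega> \<Longrightarrow> energy \<alpha> l0 u0 \<phi> = 0"
    and simple: "w \<in> H10 \<Omega> \<Longrightarrow> energy \<alpha> l0 w w = 0 \<Longrightarrow> l2_inner \<Omega> w u0 = 0 \<Longrightarrow> l2_norm \<Omega> w = 0"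
begin

text \<open>By compactness: without a gap, unit vectors orthogonal to \<open>u0\<close> with
  energies tending to zero would converge strongly to a unit vector that \<open>simple\<close>
  excludes.\<close>

lemma spectral_gap:
  obtains c where "c > 0" "\<And>u. u \<in> H10 \<Omega> \<Longrightarrow> l2_inner \<Omega> u u0 = 0 \<Longrightarrow> c * (l2_norm \<Omega> u)\<^sup>2 \<le> energy \<alpha> l0 u u"
proof (rule ccontr)
  assume "\<not> thesis"
  then have neg: "\<exists>u. u \<in> H10 \<Omega> \<and> l2_inner \<Omega> u u0 = 0 \<and> energy \<alpha> l0 u u < c * (l2_norm \<Omega> u)\<^sup>2" if "c > 0" for c
    using that \<open>\<And>c. \<lbrakk>0 < c; \<And>u. \<lbrakk>u \<in> H10 \<Omega>; l2_inner \<Omega> u u0 = 0\<rbrakk> \<Longrightarrow> c * (l2_norm \<Omega> u)\<^sup>2 \<le> energy \<alpha> l0 u u\<rbrakk> \<Longrightarrow> thesis\<close>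
    by (meson not_le)
  have "\<exists>u. u \<in> H10 \<Omega> \<and> l2_inner \<Omega> u u0 = 0 \<and> l2_norm \<Omega> u = 1 \<and> energy \<alpha> l0 u u < inverse (real (Suc n))" for n
  proof -
    obtain u where u: "u \<in> H10 \<Omega>" "l2_inner \<Omega> u u0 = 0" "energy \<alpha> l0 u u < inverse (real (Suc n)) * (l2_norm \<Omega> u)\<^sup>2"
      using neg[of "inverse (real (Suc n))"] by auto
    have pos: "l2_norm \<Omega> u > 0"
      using u(3) energy_nonneg[OF u(1)] l2_norm_nonneg[of \<Omega> u] by (cases "l2_norm \<Omega> u = 0") auto
    let ?w = "\<lambda>x. inverse (l2_norm \<Omega> u) * u x"
    have "energy \<alpha> l0 ?w ?w = energy \<alpha> l0 u u / (l2_norm \<Omega> u)\<^sup>2"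
      unfolding energy_cmult_self[OF u(1)] by (simp add: divide_inverse power_inverse)
    also have "\<dots> < inverse (real (Suc n))"
      using u(3) pos by (simp add: pos_divide_less_eq del: of_nat_Suc)
    finally have "energy \<alpha> l0 ?w ?w < inverse (real (Suc n))" .
    moreover have "l2_inner \<Omega> ?w u0 = 0"
      using l2_inner_scaleR_left[of \<Omega> "inverse (l2_norm \<Omega> u)" u u0] u(2) by simp
    ultimately show ?thesis using normalise[OF u(1) pos] by blast
  qed
  then obtain v where v: "\<And>n. v n \<in> H10 \<Omega>" "\<And>n. l2_inner \<Omega> (v n) u0 = 0" "\<And>n. l2_norm \<Omega> (v n) = 1"
    "\<And>n. energy \<alpha> l0 (v n) (v n) < inverse (real (Suc n))" by metis
  have "(\<lambda>n. energy \<alpha> l0 (v n) (v n)) \<longlonglongrightarrow> 0"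
  proof (rule Lim_null_comparison[OF _ LIMSEQ_inverse_real_of_nat])
    show "\<forall>\<^sub>F n in sequentially. norm (energy \<alpha> l0 (v n) (v n)) \<le> inverse (real (Suc n))"
      using energy_nonneg[OF v(1)] v(4) by (intro always_eventually) (simp add: less_imp_le del: of_nat_Suc)
  qed
  from minimising_subsequence[of \<alpha> l0 v 1, OF alpha_pos energy_nonneg v(1) _ this] obtain k :: "nat \<Rightarrow> nat" and w where
    w: "strict_mono k" "w \<in> H10 \<Omega>" "(\<lambda>n. h1_dist (v (k n)) w) \<longlonglongrightarrow> 0" "energy \<alpha> l0 w w = 0"
    using v(3) by auto
  have "(\<lambda>n. l2_inner \<Omega> (v (k n)) u0) \<longlonglongrightarrow> l2_inner \<Omega> w u0"
    by (rule l2_inner_tendsto[OF H10_L2[OF v(1)] H10_L2[OF w(2)] H10_L2[OF u0_H10] h1_dist_tendsto_D(1)[OF w(3)]])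
  then have "l2_inner \<Omega> w u0 = 0" using v(2) by (simp add: LIMSEQ_const_iff)
  then have "l2_norm \<Omega> w = 0" by (rule simple[OF w(2,4)])
  moreover have "l2_norm \<Omega> w = 1"
    using energy_tendsto(2)[of "\<lambda>n. v (k n)", OF v(1) w(2,3)] v(3) by (simp add: LIMSEQ_const_iff)
  ultimately show False by simp
qed

lemma coercive:
  obtains c where "c > 0" "\<And>u. u \<in> H10 \<Omega> \<Longrightarrow> l2_inner \<Omega> u u0 = 0 \<Longrightarrow>
     (l2_norm \<Omega> u + l2_norm \<Omega> (wgrad \<Omega> u))\<^sup>2 \<le> c * energy \<alpha> l0 u u"
proof -
  obtain c where c: "c > 0" "\<And>u. u \<in> H10 \<Omega> \<Longrightarrow> l2_inner \<Omega> u u0 = 0 \<Longrightarrow> c * (l2_norm \<Omega> u)\<^sup>2 \<le> energy \<alpha> l0 u u"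
    using spectral_gap by blast
  \<comment> \<open>The first summand of the constant bounds the values through the gap, the second
    the gradient through \<alpha> |grad u|^2 = energy + l0 |u|^2; both are doubled by (a + b)^2
    \<le> 2 a^2 + 2 b^2.\<close>
  show ?thesis
  proof (rule that[of "2 * (1 / c) + 2 * ((1 + l0 / c) / \<alpha>)"])
    show "0 < 2 * (1 / c) + 2 * ((1 + l0 / c) / \<alpha>)" using c(1) alpha_pos l0_nonneg by (intro add_pos_nonneg) auto
    fix u assume u: "u \<in> H10 \<Omega>" "l2_inner \<Omega> u u0 = 0"
    let ?e = "energy \<alpha> l0 u u"
    have a: "(l2_norm \<Omega> u)\<^sup>2 \<le> 1 / c * ?e" using c(2)[OF u] c(1) by (simp add: field_simps)
    have "\<alpha> * (l2_norm \<Omega> (wgrad \<Omega> u))\<^sup>2 = ?e + l0 * (l2_norm \<Omega> u)\<^sup>2"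
      by (simp add: energy_def dirichlet_self l2_norm_power2)
    also have "\<dots> \<le> ?e + l0 * (1 / c * ?e)" using a l0_nonneg by (intro add_left_mono mult_left_mono) auto
    also have "\<dots> = (1 + l0 / c) * ?e" by (simp add: algebra_simps)
    finally have b: "(l2_norm \<Omega> (wgrad \<Omega> u))\<^sup>2 \<le> (1 + l0 / c) / \<alpha> * ?e" using alpha_pos by (simp add: field_simps)
    have "(l2_norm \<Omega> u + l2_norm \<Omega> (wgrad \<Omega> u))\<^sup>2 \<le> 2 * (l2_norm \<Omega> u)\<^sup>2 + 2 * (l2_norm \<Omega> (wgrad \<Omega> u))\<^sup>2"
      using norm_power2_le_double[of "l2_norm \<Omega> u" "l2_norm \<Omega> (wgrad \<Omega> u)"] by simp
    also have "\<dots> \<le> (2 * (1 / c) + 2 * ((1 + l0 / c) / \<alpha>)) * ?e"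
      using a b by (simp only: distrib_right)
    finally show "(l2_norm \<Omega> u + l2_norm \<Omega> (wgrad \<Omega> u))\<^sup>2 \<le> (2 * (1 / c) + 2 * ((1 + l0 / c) / \<alpha>)) * ?e" .
  qed
qed

text \<open>On the complement \<open>V\<close> of \<open>u0\<close> the energy is an inner product,
  and the solution minimises \<open>J\<close> there: the Riesz representation theorem by direct
  minimisation. \<open>f u0 = 0\<close> is the Fredholm condition, which extends the equation from
  \<open>V\<close> to all of \<open>H10\<close>.\<close>

theorem energy_solvable:
  assumes lin: "\<And>u v c. u \<in> H10 \<Omega> \<Longrightarrow> v \<in> H10 \<Omega> \<Longrightarrow> f (\<lambda>x. u x + c * v x) = f u + c * f v"
    and bdd: "\<And>u. u \<in> H10 \<Omega> \<Longrightarrow> \<bar>f u\<bar> \<le> K * (l2_norm \<Omega> u + l2_norm \<Omega> (wgrad \<Omega> u))"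
    and u0: "f u0 = 0"
  obtains v where "v \<in> H10 \<Omega>" "l2_inner \<Omega> v u0 = 0" "\<And>\<phi>. \<phi> \<in> H10 \<Omega> \<Longrightarrow> energy \<alpha> l0 v \<phi> = f \<phi>"
proof -
  obtain c where c: "c > 0" "\<And>u. u \<in> H10 \<Omega> \<Longrightarrow> l2_inner \<Omega> u u0 = 0 \<Longrightarrow>
     (l2_norm \<Omega> u + l2_norm \<Omega> (wgrad \<Omega> u))\<^sup>2 \<le> c * energy \<alpha> l0 u u" using coercive by blast
  define V where "V = {u \<in> H10 \<Omega>. l2_inner \<Omega> u u0 = 0}"
  define J where "J u = energy \<alpha> l0 u u - 2 * f u" for u
  have V_lin: "(\<lambda>x. u x + c * v x) \<in> V" if "u \<in> V" "v \<in> V" for u v c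
    using that H10_lin(1) l2_inner_lin_left[OF H10_L2 H10_L2 H10_L2[OF u0_H10]] by (auto simp: V_def)
  \<comment> \<open>The zero function, written so that \<open>H10_lin\<close> shows its membership;
    it makes \<open>V\<close> nonempty.\<close>
  have V0: "(\<lambda>x. u0 x + (-1) * u0 x) \<in> V"
    using H10_lin(1)[OF u0_H10 u0_H10, of "-1"] by (simp add: V_def l2_inner_def)
  have low: "- (c * K\<^sup>2) \<le> J u" if u: "u \<in> V" for u
  proof -
    let ?n = "l2_norm \<Omega> u + l2_norm \<Omega> (wgrad \<Omega> u)"
    have "?n\<^sup>2 / c \<le> energy \<alpha> l0 u u" using c(2)[of u] c(1) u by (simp add: V_def field_simps)
    moreover have "2 * f u \<le> 2 * (K * ?n)" using bdd[of u] u by (simp add: V_def)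
    moreover have "2 * (K * ?n) \<le> ?n\<^sup>2 / c + c * K\<^sup>2"
    proof -
      have "0 \<le> (?n - c * K)\<^sup>2 / c" using c(1) by simp
      also have "\<dots> = ?n\<^sup>2 / c + c * K\<^sup>2 - 2 * (K * ?n)" using c(1) by (simp add: power2_eq_square field_simps)
      finally show ?thesis by simp
    qed
    ultimately show ?thesis by (simp add: J_def)
  qed
  define d where "d = Inf (J ` V)"
  have bddV: "bdd_below (J ` V)" using low by (auto intro!: bdd_belowI[of _ "- (c * K\<^sup>2)"])
  have d_le: "d \<le> J u" if "u \<in> V" for u unfolding d_def using that bddV by (auto intro!: cInf_lower)
  have "\<exists>v. v \<in> V \<and> J v < d + inverse (real (Suc n))" for n
  proof -
    have "Inf (J ` V) < d + inverse (real (Suc n))" unfolding d_def by simp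
    then show ?thesis using cInf_lessD[of "J ` V"] V0 by blast
  qed
  then obtain v where v: "\<And>n. v n \<in> V" "\<And>n. J (v n) < d + inverse (real (Suc n))" by metis
  have vH: "v n \<in> H10 \<Omega>" for n using v(1) by (simp add: V_def)
  \<comment> \<open>Parallelogram identity about the midpoint \<open>?h\<close>: the energy of the
    difference equals \<open>2 * J (v m) + 2 * J (v n) - 4 * J ?h\<close>, and \<open>J ?h\<close>
    is at least the infimum \<open>d\<close>.\<close>
  have par: "energy \<alpha> l0 (\<lambda>x. v m x - v n x) (\<lambda>x. v m x - v n x)
      \<le> 2 * inverse (real (Suc m)) + 2 * inverse (real (Suc n))" for m n
  proof -
    let ?p = "\<lambda>x. v m x + 1 * v n x" and ?h = "\<lambda>x. (1/2) * (v m x + 1 * v n x)"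
    have p: "?p \<in> V" by (rule V_lin[OF v(1) v(1)])
    then have pH: "?p \<in> H10 \<Omega>" by (simp add: V_def)
    have eq: "?h = (\<lambda>x. ?p x + (- 1/2) * ?p x)" by (auto simp: algebra_simps)
    have h: "?h \<in> V" unfolding eq by (rule V_lin[OF p p])
    have "energy \<alpha> l0 ?h ?h = (1/4) * energy \<alpha> l0 ?p ?p"
      using energy_cmult_self[OF pH, of \<alpha> l0 "1/2"] by (simp add: power2_eq_square)
    moreover have "f ?h = (1/2) * (f (v m) + f (v n))"
      using lin[OF pH pH, of "-1/2"] lin[OF vH vH, of m 1 n] unfolding eq by simp
    ultimately have "4 * J ?h = energy \<alpha> l0 ?p ?p - 4 * (f (v m) + f (v n))" by (simp add: J_def)
    moreover have "energy \<alpha> l0 ?p ?p = energy \<alpha> l0 (v m) (v m) + 2 * energy \<alpha> l0 (v m) (v n) + energy \<alpha> l0 (v n) (v n)"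
      using energy_lin_self[OF vH vH, of \<alpha> l0 m 1 n] by simp
    moreover have "energy \<alpha> l0 (\<lambda>x. v m x - v n x) (\<lambda>x. v m x - v n x)
        = energy \<alpha> l0 (v m) (v m) - 2 * energy \<alpha> l0 (v m) (v n) + energy \<alpha> l0 (v n) (v n)"
      using energy_lin_self[OF vH vH, of \<alpha> l0 m "-1" n] by simp
    ultimately have "energy \<alpha> l0 (\<lambda>x. v m x - v n x) (\<lambda>x. v m x - v n x) = 2 * J (v m) + 2 * J (v n) - 4 * J ?h"
      by (simp add: J_def)
    then show ?thesis using d_le[OF h] v(2)[of m] v(2)[of n] by linarith
  qed
  have "\<exists>N. \<forall>m\<ge>N. \<forall>n\<ge>N. h1_dist (v m) (v n) < e" if e: "e > 0" for e
  proof -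
    have "e\<^sup>2 / (5 * c) > 0" using e c(1) by simp
    then obtain N where N: "inverse (real (Suc N)) < e\<^sup>2 / (5 * c)" using reals_Archimedean by blast
    have "h1_dist (v m) (v n) < e" if mn: "m \<ge> N" "n \<ge> N" for m n
    proof -
      have i: "inverse (real (Suc m)) \<le> inverse (real (Suc N))" "inverse (real (Suc n)) \<le> inverse (real (Suc N))"
        using mn by (auto intro!: le_imp_inverse_le)
      have D: "(\<lambda>x. v m x - v n x) \<in> V" using V_lin[OF v(1) v(1), of m "-1" n] by simp
      have "(h1_dist (v m) (v n))\<^sup>2 \<le> c * energy \<alpha> l0 (\<lambda>x. v m x - v n x) (\<lambda>x. v m x - v n x)"
        using c(2)[of "\<lambda>x. v m x - v n x"] D l2_norm_wgrad_diff[OF vH vH, of m n] by (simp add: V_def h1_dist_def)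
      also have "\<dots> \<le> c * (4 * inverse (real (Suc N)))" using c(1) par[of m n] i by (intro mult_left_mono) linarith+
      also have "\<dots> < e\<^sup>2" 
      proof -
        have "c * (4 * inverse (real (Suc N))) \<le> c * (5 * inverse (real (Suc N)))" using c(1) by (intro mult_left_mono) auto
        also have "\<dots> < e\<^sup>2" using N c(1) by (simp add: pos_less_divide_eq mult_ac del: of_nat_Suc)
        finally show ?thesis .
      qed
      finally show ?thesis by (rule power2_less_imp_less) (use e in simp)
    qed
    then show ?thesis by blast
  qed
  from H10_complete[of v, OF vH this] obtain w where w: "w \<in> H10 \<Omega>" "(\<lambda>n. h1_dist (v n) w) \<longlonglongrightarrow> 0" .
  have "(\<lambda>n. l2_inner \<Omega> (v n) u0) \<longlonglongrightarrow> l2_inner \<Omega> w u0"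
    by (rule l2_inner_tendsto[OF H10_L2[OF vH] H10_L2[OF w(1)] H10_L2[OF u0_H10] h1_dist_tendsto_D(1)[OF w(2)]])
  moreover have "l2_inner \<Omega> (v n) u0 = 0" for n using v(1)[of n] by (simp add: V_def)
  ultimately have w0: "l2_inner \<Omega> w u0 = 0" by (simp add: LIMSEQ_const_iff)
  then have wV: "w \<in> V" using w(1) by (simp add: V_def)
  have "(\<lambda>n. f (v n) - f w) \<longlonglongrightarrow> 0"
  proof (rule Lim_null_comparison)
    have "f (v n) - f w = f (\<lambda>x. v n x - w x)" for n using lin[OF vH w(1), of n "-1"] by simp
    then have "norm (f (v n) - f w) \<le> K * h1_dist (v n) w" for n
      using bdd[OF H10_diff(1)[OF vH w(1), of n]] l2_norm_wgrad_diff[OF vH w(1), of n] by (simp add: h1_dist_def)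
    then show "\<forall>\<^sub>F n in sequentially. norm (f (v n) - f w) \<le> K * h1_dist (v n) w" by simp
    show "(\<lambda>n. K * h1_dist (v n) w) \<longlonglongrightarrow> 0" using tendsto_mult_left[OF w(2), of K] by simp
  qed
  then have "(\<lambda>n. f (v n)) \<longlonglongrightarrow> f w" by (rule LIM_zero_cancel)
  then have "(\<lambda>n. J (v n)) \<longlonglongrightarrow> J w"
    unfolding J_def by (intro tendsto_diff tendsto_mult_left energy_tendsto(1)[OF vH w])
  moreover have "(\<lambda>n. d + inverse (real (Suc n))) \<longlonglongrightarrow> d + 0"
    by (intro tendsto_add tendsto_const LIMSEQ_inverse_real_of_nat)
  ultimately have Jw: "J w \<le> d + 0" by (rule LIMSEQ_le) (use v(2) less_imp_le in blast)
  have orth: "energy \<alpha> l0 w \<phi> = f \<phi>" if \<phi>: "\<phi> \<in> V" for \<phi>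
  proof -
    have \<phi>H: "\<phi> \<in> H10 \<Omega>" using \<phi> by (simp add: V_def)
    have "(energy \<alpha> l0 w \<phi> - f \<phi>)\<^sup>2 \<le> 0 * energy \<alpha> l0 \<phi> \<phi>"
    proof (rule quadratic_nonneg_discriminant)
      fix t
      have "J (\<lambda>x. w x + t * \<phi> x) = J w + 2 * t * (energy \<alpha> l0 w \<phi> - f \<phi>) + t\<^sup>2 * energy \<alpha> l0 \<phi> \<phi>"
        by (simp add: J_def energy_lin_self[OF w(1) \<phi>H] lin[OF w(1) \<phi>H] algebra_simps)
      then show "0 \<le> 0 + 2 * t * (energy \<alpha> l0 w \<phi> - f \<phi>) + t\<^sup>2 * energy \<alpha> l0 \<phi> \<phi>"
        using Jw d_le[OF V_lin[OF wV \<phi>, of t]] by simp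
    qed (rule energy_nonneg[OF \<phi>H])
    then show ?thesis by simp
  qed
  show ?thesis
  proof (rule that[OF w(1) w0])
    fix \<phi> assume \<phi>: "\<phi> \<in> H10 \<Omega>"
    \<comment> \<open>Removing the \<open>u0\<close> component lands in \<open>V\<close>; on
      \<open>u0\<close> itself both sides of the equation vanish, by \<open>u0_eigen\<close> and by
      the condition on \<open>f\<close>.\<close>
    define t where "t = l2_inner \<Omega> \<phi> u0"
    have "l2_inner \<Omega> u0 u0 = 1" using l2_norm_power2[of \<Omega> u0] u0_norm by simp
    then have "(\<lambda>x. \<phi> x + (- t) * u0 x) \<in> V"
      using H10_lin(1)[OF \<phi> u0_H10, of "- t"] l2_inner_lin_left[OF \<phi>[THEN H10_L2] u0_H10[THEN H10_L2] u0_H10[THEN H10_L2], of "- t"]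
      by (simp add: V_def t_def)
    from orth[OF this] show "energy \<alpha> l0 w \<phi> = f \<phi>"
      using energy_lin_right[OF \<phi> u0_H10 w(1), of \<alpha> l0 "- t"] lin[OF \<phi> u0_H10, of "- t"] u0_eigen[OF w(1)] u0
        energy_commute[of \<alpha> l0 w u0] by simp
  qed
qed

end

section \<open>The modulus of a minimiser\<close>

lemma real_polynomial_antiderivative:
  fixes p :: "real \<Rightarrow> real"
  assumes "real_polynomial_function p"
  obtains P where "real_polynomial_function P" "P 0 = 0" "\<And>s. (P has_real_derivative p s) (at s)"
proof -
  obtain a n where p: "p = (\<lambda>x. \<Sum>i\<le>n. a i * x ^ i)"
    using assms real_polynomial_function_iff_sum by metis
  define P where "P x = (\<Sum>i\<le>n. a i / real (Suc i) * x ^ Suc i)" for x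
  have poly: "real_polynomial_function P"
    unfolding P_def[abs_def]
    by (intro real_polynomial_function_sum real_polynomial_function.intros(4) real_polynomial_function_power
        real_polynomial_function.intros(1,2) bounded_linear_ident) auto
  have der: "(P has_real_derivative p s) (at s)" for s
  proof -
    have "(P has_real_derivative (\<Sum>i\<le>n. a i / real (Suc i) * (real (Suc i) * s ^ i))) (at s)"
      unfolding P_def[abs_def]
      by (rule DERIV_sum) (auto intro!: derivative_eq_intros DERIV_cmult simp del: power_Suc of_nat_Suc)
    then show ?thesis by (simp add: p del: of_nat_Suc)
  qed
  show ?thesis by (rule that[OF poly _ der]) (simp add: P_def)
qed

text \<open>The derivative must stay within [-1, 1] exactly, so that composing with \<open>P\<close>
  does not increase the Dirichlet integral. The regularised modulus \<open>G\<close> has slope at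
  most 1, and shrinking it by \<open>1 - \<eta>\<close> leaves room for the Weierstrass error \<eta>
  in the derivative.\<close>

lemma abs_polynomial_approx:
  assumes R: "R > 0" and e: "e > 0"
  obtains P p where "real_polynomial_function P" "P 0 = 0" "\<And>s. (P has_real_derivative p s) (at s)"
    "\<And>s. s \<in> {-R..R} \<Longrightarrow> \<bar>p s\<bar> \<le> 1" "\<And>s. s \<in> {-R..R} \<Longrightarrow> \<bar>P s - \<bar>s\<bar>\<bar> \<le> e"
proof -
  \<comment> \<open>Half of \<open>e\<close> pays for the regularisation; the factor
    \<open>1 - \<eta>\<close> and the integrated Weierstrass error cost at most
    \<open>\<eta> * R \<le> e / 4\<close> each.\<close>
  define \<delta> where "\<delta> = e / 2"
  define \<eta> where "\<eta> = min 1 (e / (4 * R))"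
  have \<delta>: "\<delta> > 0" and \<eta>: "\<eta> > 0" "\<eta> \<le> 1" "\<eta> * R \<le> e / 4"
    using R e by (auto simp: \<delta>_def \<eta>_def min_def field_simps)
  define G where "G s = sqrt (s\<^sup>2 + \<delta>\<^sup>2) - \<delta>" for s
  define g where "g s = s / sqrt (s\<^sup>2 + \<delta>\<^sup>2)" for s
  have pos: "s\<^sup>2 + \<delta>\<^sup>2 > 0" for s using \<delta> by (simp add: add_nonneg_pos)
  have G': "(G has_real_derivative g s) (at s)" for s
    unfolding G_def[abs_def] g_def using pos[of s]
    by (auto intro!: derivative_eq_intros simp: field_simps)
  have g1: "\<bar>g s\<bar> \<le> 1" for s
  proof -
    have "\<bar>s\<bar> \<le> sqrt (s\<^sup>2 + \<delta>\<^sup>2)" by (intro real_le_rsqrt) simp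
    then show ?thesis using pos[of s] by (simp add: g_def abs_divide)
  qed
  have absG: "\<bar>\<bar>s\<bar> - G s\<bar> \<le> \<delta>" "0 \<le> G s" "G s \<le> \<bar>s\<bar>" for s
  proof -
    have 1: "\<bar>s\<bar> \<le> sqrt (s\<^sup>2 + \<delta>\<^sup>2)" "\<delta> \<le> sqrt (s\<^sup>2 + \<delta>\<^sup>2)" by (auto intro!: real_le_rsqrt)
    have 2: "sqrt (s\<^sup>2 + \<delta>\<^sup>2) \<le> \<bar>s\<bar> + \<delta>" using \<delta> by (intro real_le_lsqrt) (auto simp: power2_sum)
    show "\<bar>\<bar>s\<bar> - G s\<bar> \<le> \<delta>" "0 \<le> G s" "G s \<le> \<bar>s\<bar>" using 1 2 by (auto simp: G_def)
  qed
  have "continuous_on {-R..R} (\<lambda>s. (1 - \<eta>) * g s)"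
    unfolding g_def by (intro continuous_intros ballI) (metis pos less_irrefl real_sqrt_eq_zero_cancel_iff)
  then obtain p where p: "real_polynomial_function p" "\<And>s. s \<in> {-R..R} \<Longrightarrow> \<bar>(1 - \<eta>) * g s - p s\<bar> < \<eta>"
    by (rule Stone_Weierstrass_real_polynomial_function[OF compact_Icc _ \<eta>(1)]) blast
  obtain P where P: "real_polynomial_function P" "P 0 = 0" "\<And>s. (P has_real_derivative p s) (at s)"
    by (rule real_polynomial_antiderivative[OF p(1)]) blast
  show ?thesis
  proof (rule that[OF P])
    fix s assume s: "s \<in> {-R..R}"
    have "\<bar>(1 - \<eta>) * g s\<bar> \<le> 1 - \<eta>" using mult_left_mono[OF g1[of s], of "1 - \<eta>"] \<eta>(2) by (simp add: abs_mult)
    then show "\<bar>p s\<bar> \<le> 1" using p(2)[OF s] by linarith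
    have "norm ((P s - (1 - \<eta>) * G s) - (P 0 - (1 - \<eta>) * G 0)) \<le> \<eta> * norm (s - 0)"
    proof (rule field_differentiable_bound[where S="{-R..R}" and f'="\<lambda>s. p s - (1 - \<eta>) * g s"])
      fix t assume t: "t \<in> {-R..R}"
      show "((\<lambda>s. P s - (1 - \<eta>) * G s) has_field_derivative p t - (1 - \<eta>) * g t) (at t within {-R..R})"
        by (intro derivative_intros has_field_derivative_at_within[OF P(3)] DERIV_cmult has_field_derivative_at_within[OF G'])
      show "norm (p t - (1 - \<eta>) * g t) \<le> \<eta>" using p(2)[OF t] by (simp add: abs_minus_commute)
    qed (use s R in auto)
    then have "\<bar>P s - (1 - \<eta>) * G s\<bar> \<le> \<eta> * \<bar>s\<bar>" using P(2) \<delta> by (simp add: G_def)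
    also have "\<dots> \<le> \<eta> * R" using s \<eta> by (intro mult_left_mono) auto
    finally have 1: "\<bar>P s - (1 - \<eta>) * G s\<bar> \<le> e / 4" using \<eta>(3) by simp
    have "\<eta> * G s \<le> \<eta> * R" using absG(3)[of s] s \<eta> by (intro mult_left_mono) auto
    then have 2: "\<eta> * G s \<le> e / 4" "0 \<le> \<eta> * G s" using \<eta>(3) by (linarith, simp add: absG(2) less_imp_le[OF \<eta>(1)])
    have "P s - \<bar>s\<bar> = (P s - (1 - \<eta>) * G s) - \<eta> * G s - (\<bar>s\<bar> - G s)" by (simp add: algebra_simps)
    then show "\<bar>P s - \<bar>s\<bar>\<bar> \<le> e" using 1 2 absG(1)[of s] unfolding \<delta>_def by linarith
  qed
qed

context bounded_open
begin

lemma l2_norm_mono: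
  fixes f :: "'a \<Rightarrow> 'b::euclidean_space" and g :: "'a \<Rightarrow> 'c::euclidean_space"
  assumes "f \<in> L2 \<Omega>" "g \<in> L2 \<Omega>" "AE x in M. norm (f x) \<le> norm (g x)"
  shows "l2_norm \<Omega> f \<le> l2_norm \<Omega> g"
proof -
  have "(\<integral>x. (norm (f x))\<^sup>2 \<partial>M) \<le> (\<integral>x. (norm (g x))\<^sup>2 \<partial>M)"
  proof (rule integral_mono_AE)
    show "AE x in M. (norm (f x))\<^sup>2 \<le> (norm (g x))\<^sup>2" using assms(3) by eventually_elim (simp add: power_mono)
  qed (use assms L2_power2_integrable in auto)
  then show ?thesis by (simp add: l2_norm_def l2_inner_self)
qed

lemma test_wgrad_norm:
  assumes "\<phi> \<in> test_functions \<Omega>" shows "l2_norm \<Omega> (wgrad \<Omega> \<phi>) = l2_norm \<Omega> (grad \<phi>)"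
  using H10_test[OF assms] test_grad_L2[OF assms] by (intro l2_norm_cong_AE L2_measurable H10_wgrad) auto

text \<open>Polynomial moduli of test functions near \<open>w\<close> have no larger gradients and
  converge to |w| in \<open>L2\<close>, so their energies tend to zero. Strong convergence of such a
  minimising sequence replaces a chain rule for the modulus.\<close>

lemma abs_minimiser:
  assumes \<alpha>: "\<alpha> > 0" and nonneg: "\<And>u. u \<in> H10 \<Omega> \<Longrightarrow> 0 \<le> energy \<alpha> l u u"
    and w: "w \<in> H10 \<Omega>" "energy \<alpha> l w w = 0"
  obtains v where "v \<in> H10 \<Omega>" "energy \<alpha> l v v = 0" "AE x in M. v x = \<bar>w x\<bar>"
proof -
  obtain \<phi> where \<phi>: "\<And>n. \<phi> n \<in> test_functions \<Omega>" "(\<lambda>n. l2_norm \<Omega> (\<lambda>x. \<phi> n x - w x)) \<longlonglongrightarrow> 0"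
    "(\<lambda>n. l2_norm \<Omega> (\<lambda>x. grad (\<phi> n) x - wgrad \<Omega> w x)) \<longlonglongrightarrow> 0" using H10_E[OF w(1)] by blast
  have "\<exists>R>0. \<forall>x. \<bar>\<phi> n x\<bar> \<le> R" for n using test_bounded[OF \<phi>(1)[of n]] by metis
  then obtain R where R: "\<And>n. R n > 0" "\<And>n x. \<bar>\<phi> n x\<bar> \<le> R n" by metis
  have in_R: "\<phi> n x \<in> {- R n..R n}" for n x using R(2)[of n x] by auto
  have "\<exists>P p. real_polynomial_function P \<and> P 0 = 0 \<and> (\<forall>s. (P has_real_derivative p s) (at s)) \<and>
    (\<forall>s\<in>{- R n..R n}. \<bar>p s\<bar> \<le> 1) \<and> (\<forall>s\<in>{- R n..R n}. \<bar>P s - \<bar>s\<bar>\<bar> \<le> inverse (real (Suc n)))" for n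
  proof (rule abs_polynomial_approx[OF R(1)[of n], of "inverse (real (Suc n))"])
    fix P p assume "real_polynomial_function P" "P 0 = 0" "\<And>s. (P has_real_derivative p s) (at s)"
      "\<And>s. s \<in> {- R n..R n} \<Longrightarrow> \<bar>p s\<bar> \<le> 1" "\<And>s. s \<in> {- R n..R n} \<Longrightarrow> \<bar>P s - \<bar>s\<bar>\<bar> \<le> inverse (real (Suc n))"
    then show ?thesis by (intro exI[of _ P] exI[of _ p]) blast
  qed simp
  then obtain P p where P: "\<And>n. real_polynomial_function (P n)" "\<And>n. P n 0 = 0"
    "\<And>n s. (P n has_real_derivative p n s) (at s)"
    "\<And>n s. s \<in> {- R n..R n} \<Longrightarrow> \<bar>p n s\<bar> \<le> 1"
    "\<And>n s. s \<in> {- R n..R n} \<Longrightarrow> \<bar>P n s - \<bar>s\<bar>\<bar> \<le> inverse (real (Suc n))" by metis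
  define \<psi> where "\<psi> n x = P n (\<phi> n x)" for n x
  have \<psi>: "\<psi> n \<in> test_functions \<Omega>" for n unfolding \<psi>_def[abs_def] by (rule test_polynomial[OF \<phi>(1) P(1,2)])
  have "grad (\<psi> n) x = p n (\<phi> n x) *\<^sub>R grad (\<phi> n) x" for n x
    unfolding \<psi>_def[abs_def] by (rule grad_compose[OF test_smooth[OF \<phi>(1)] P(3)])
  then have "norm (grad (\<psi> n) x) \<le> norm (grad (\<phi> n) x)" for n x
    using P(4)[OF in_R, of n x] by (simp add: mult_left_le_one_le)
  then have g: "l2_norm \<Omega> (grad (\<psi> n)) \<le> l2_norm \<Omega> (grad (\<phi> n))" for n
    by (intro l2_norm_mono test_grad_L2 \<psi> \<phi>(1)) simp
  have aw: "(\<lambda>x. \<bar>w x\<bar>) \<in> L2 \<Omega>" using H10_L2[OF w(1)] by (auto simp: L2_def)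
  have a\<phi>: "(\<lambda>x. \<bar>\<phi> n x\<bar>) \<in> L2 \<Omega>" for n using test_L2[OF \<phi>(1)[of n]] by (auto simp: L2_def)
  have lim: "(\<lambda>n. l2_norm \<Omega> (\<lambda>x. \<psi> n x - \<bar>w x\<bar>)) \<longlonglongrightarrow> 0"
  proof (rule Lim_null_comparison)
    have "l2_norm \<Omega> (\<lambda>x. \<psi> n x - \<bar>w x\<bar>) \<le> inverse (real (Suc n)) * sqrt (measure lebesgue \<Omega>) + l2_norm \<Omega> (\<lambda>x. \<phi> n x - w x)" for n
    proof -
      have "l2_norm \<Omega> (\<lambda>x. \<psi> n x - \<bar>w x\<bar>) \<le> l2_norm \<Omega> (\<lambda>x. \<psi> n x - \<bar>\<phi> n x\<bar>) + l2_norm \<Omega> (\<lambda>x. \<bar>\<phi> n x\<bar> - \<bar>w x\<bar>)"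
        by (rule l2_norm_triangle_diff[OF test_L2[OF \<psi>] a\<phi> aw])
      moreover have "l2_norm \<Omega> (\<lambda>x. \<psi> n x - \<bar>\<phi> n x\<bar>) \<le> inverse (real (Suc n)) * sqrt (measure lebesgue \<Omega>)"
        using L2_measurable[OF L2_diff[OF test_L2[OF \<psi>] a\<phi>]] P(5)[OF in_R]
        by (intro l2_norm_le_sup) (auto simp: \<psi>_def simp del: of_nat_Suc)
      moreover have "l2_norm \<Omega> (\<lambda>x. \<bar>\<phi> n x\<bar> - \<bar>w x\<bar>) \<le> l2_norm \<Omega> (\<lambda>x. \<phi> n x - w x)"
        by (intro l2_norm_mono L2_diff a\<phi> aw test_L2[OF \<phi>(1)] H10_L2[OF w(1)]) simp
      ultimately show ?thesis by linarith
    qed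
    then show "\<forall>\<^sub>F n in sequentially. norm (l2_norm \<Omega> (\<lambda>x. \<psi> n x - \<bar>w x\<bar>))
        \<le> inverse (real (Suc n)) * sqrt (measure lebesgue \<Omega>) + l2_norm \<Omega> (\<lambda>x. \<phi> n x - w x)"
      by (simp add: l2_norm_nonneg del: of_nat_Suc)
    show "(\<lambda>n. inverse (real (Suc n)) * sqrt (measure lebesgue \<Omega>) + l2_norm \<Omega> (\<lambda>x. \<phi> n x - w x)) \<longlonglongrightarrow> 0"
      using tendsto_add[OF tendsto_mult_right[OF LIMSEQ_inverse_real_of_nat, of "sqrt (measure lebesgue \<Omega>)"] \<phi>(2)] by simp
  qed
  have nlim: "(\<lambda>n. l2_norm \<Omega> (\<psi> n)) \<longlonglongrightarrow> l2_norm \<Omega> (\<lambda>x. \<bar>w x\<bar>)"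
    by (rule l2_norm_tendsto[OF test_L2[OF \<psi>] aw lim])
  have glim: "(\<lambda>n. l2_norm \<Omega> (grad (\<phi> n))) \<longlonglongrightarrow> l2_norm \<Omega> (wgrad \<Omega> w)"
    by (rule l2_norm_tendsto[OF test_grad_L2[OF \<phi>(1)] H10_wgrad[OF w(1)] \<phi>(3)])
  have nabs: "l2_norm \<Omega> (\<lambda>x. \<bar>w x\<bar>) = l2_norm \<Omega> w" by (simp add: l2_norm_def l2_inner_def)
  have ew: "\<alpha> * (l2_norm \<Omega> (wgrad \<Omega> w))\<^sup>2 - l * (l2_norm \<Omega> (\<lambda>x. \<bar>w x\<bar>))\<^sup>2 = 0"
    using w(2) unfolding nabs by (simp add: energy_def dirichlet_self l2_norm_power2)
  have e0: "(\<lambda>n. energy \<alpha> l (\<psi> n) (\<psi> n)) \<longlonglongrightarrow> 0"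
  proof (rule Lim_null_comparison)
    have "energy \<alpha> l (\<psi> n) (\<psi> n) \<le> \<alpha> * (l2_norm \<Omega> (grad (\<phi> n)))\<^sup>2 - l * (l2_norm \<Omega> (\<psi> n))\<^sup>2" for n
      using g[of n] \<alpha> power_mono[OF g[of n] l2_norm_nonneg, of 2]
      by (simp add: energy_def dirichlet_self l2_norm_power2 test_wgrad_norm[OF \<psi>])
    then show "\<forall>\<^sub>F n in sequentially. norm (energy \<alpha> l (\<psi> n) (\<psi> n)) \<le> \<alpha> * (l2_norm \<Omega> (grad (\<phi> n)))\<^sup>2 - l * (l2_norm \<Omega> (\<psi> n))\<^sup>2"
      using nonneg[OF H10_test(1)[OF \<psi>]] by simp
    have "(\<lambda>n. \<alpha> * (l2_norm \<Omega> (grad (\<phi> n)))\<^sup>2 - l * (l2_norm \<Omega> (\<psi> n))\<^sup>2)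
      \<longlonglongrightarrow> \<alpha> * (l2_norm \<Omega> (wgrad \<Omega> w))\<^sup>2 - l * (l2_norm \<Omega> (\<lambda>x. \<bar>w x\<bar>))\<^sup>2"
      by (intro tendsto_intros glim nlim)
    then show "(\<lambda>n. \<alpha> * (l2_norm \<Omega> (grad (\<phi> n)))\<^sup>2 - l * (l2_norm \<Omega> (\<psi> n))\<^sup>2) \<longlonglongrightarrow> 0" by (simp only: ew)
  qed
  obtain C where C: "\<And>n. l2_norm \<Omega> (\<psi> n) \<le> C"
  proof -
    obtain C where "\<forall>n. \<bar>l2_norm \<Omega> (\<psi> n)\<bar> \<le> C"
      using convergent_imp_bounded[OF nlim] unfolding bounded_iff by auto
    then show thesis using that abs_le_D1 by blast
  qed
  obtain k :: "nat \<Rightarrow> nat" and v where v: "strict_mono k" "v \<in> H10 \<Omega>" "(\<lambda>n. h1_dist (\<psi> (k n)) v) \<longlonglongrightarrow> 0" "energy \<alpha> l v v = 0"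
    by (rule minimising_subsequence[of \<alpha> l \<psi> C, OF \<alpha> nonneg H10_test(1)[OF \<psi>] C e0]) blast
  have "(\<lambda>n. l2_norm \<Omega> (\<lambda>x. v x - \<psi> (k n) x) + l2_norm \<Omega> (\<lambda>x. \<psi> (k n) x - \<bar>w x\<bar>)) \<longlonglongrightarrow> 0 + 0"
    using h1_dist_tendsto_D(1)[OF v(3)] LIMSEQ_subseq_LIMSEQ[OF lim v(1)]
    by (intro tendsto_add) (simp_all add: l2_norm_commute[of \<Omega> v] o_def)
  then have "l2_norm \<Omega> (\<lambda>x. v x - \<bar>w x\<bar>) \<le> 0 + 0"
    by (rule LIMSEQ_le_const) (use l2_norm_triangle_diff[OF H10_L2[OF v(2)] test_L2[OF \<psi>] aw] in blast)
  then have "l2_norm \<Omega> (\<lambda>x. v x - \<bar>w x\<bar>) = 0" using l2_norm_nonneg[of \<Omega> "\<lambda>x. v x - \<bar>w x\<bar>"] by simp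
  then have "AE x in M. v x = \<bar>w x\<bar>"
    using l2_inner_zeroI[OF L2_diff[OF H10_L2[OF v(2)] aw]] by simp
  then show ?thesis using that v by blast
qed

end

section \<open>A barrier\<close>

lemma smooth_I:
  fixes f :: "'a::euclidean_space \<Rightarrow> real"
  assumes "\<And>x. GDERIV f x :> D x" "\<And>b. b \<in> Basis \<Longrightarrow> smooth (\<lambda>x. D x \<bullet> b)"
  shows "smooth f"
proof -
  have "C_k (Suc k) f" for k using C_k_Suc_I[OF assms(1), of k] assms(2) by (auto simp: smooth_def)
  then show ?thesis unfolding smooth_def using C_k_mono by blast
qed

lemma smooth_powr:
  fixes f :: "'a::euclidean_space \<Rightarrow> real"
  assumes "smooth f" "\<And>x. f x > 0"
  shows "smooth (\<lambda>x. f x powr a)"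
  unfolding smooth_def
proof
  fix k
  define D where "D j t = (\<Prod>i<j. a - real i) * t powr (a - real j)" for j t
  have "(D j has_real_derivative D (Suc j) (f x)) (at (f x))" for j x
  proof -
    have "(D j has_real_derivative (\<Prod>i<j. a - real i) * ((a - real j) * f x powr (a - real j - 1))) (at (f x))"
      unfolding D_def[abs_def] by (intro DERIV_cmult has_real_derivative_powr assms(2))
    then show ?thesis by (simp add: D_def algebra_simps)
  qed
  moreover have "C_k k f" using assms(1) by (simp add: smooth_def)
  ultimately have "C_k k (\<lambda>x. D 0 (f x))" by (rule C_k_compose)
  then show "C_k k (\<lambda>x. f x powr a)" by (simp add: D_def)
qed

definition laplacian :: "('a::euclidean_space \<Rightarrow> real) \<Rightarrow> 'a \<Rightarrow> real" where
  "laplacian f x = (\<Sum>b\<in>Basis. grad (\<lambda>y. grad f y \<bullet> b) x \<bullet> b)"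

text \<open>
  The barrier is \<open>\<psi>(|x|\<^sup>2)\<close> with \<open>-\<psi>' = barrier_h\<close>, a cut-off regularisation of the derivative of the
  fundamental solution. The positive part of its Laplacian stays bounded below on the ball while the
  negative part concentrates at the origin as \<open>d\<close> tends to zero.
\<close>

definition cutoff :: "real \<Rightarrow> nat \<Rightarrow> real \<Rightarrow> real" where "cutoff R n s = flat 1 (1 - (s / R\<^sup>2) ^ n)"

definition barrier_h :: "real \<Rightarrow> nat \<Rightarrow> real \<Rightarrow> real \<Rightarrow> real" where
  "barrier_h R n d s = cutoff R n s * (s + d\<^sup>2) powr (- real n / 2)"

definition lap_pos :: "real \<Rightarrow> nat \<Rightarrow> real \<Rightarrow> real \<Rightarrow> real" where
  "lap_pos R n d s = 4 * real n * (s / R\<^sup>2) ^ n * flat [:0, 0, 1:] (1 - (s / R\<^sup>2) ^ n) * (s + d\<^sup>2) powr (- real n / 2)"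

definition lap_neg :: "real \<Rightarrow> nat \<Rightarrow> real \<Rightarrow> real \<Rightarrow> real" where
  "lap_neg R n d s = 2 * real n * cutoff R n s * (s + d\<^sup>2) powr (- real n / 2) * (d\<^sup>2 / (s + d\<^sup>2))"

lemma cutoff_DERIV:
  assumes R: "R > 0"
  shows "(cutoff R n has_real_derivative - (flat [:0, 0, 1:] (1 - (s / R\<^sup>2) ^ n) * (real n * (s / R\<^sup>2) ^ (n - 1) / R\<^sup>2))) (at s)"
proof -
  have "(flat 1 has_real_derivative flat [:0, 0, 1:] t) (at t)" for t
    using flat_DERIV[of 1 t] by (simp add: one_pCons)
  note 1 = this
  have 2: "((\<lambda>s. 1 - (s / R\<^sup>2) ^ n) has_real_derivative - (real n * (s / R\<^sup>2) ^ (n - 1) / R\<^sup>2)) (at s)"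
  proof -
    have "((\<lambda>s. s / R\<^sup>2) has_real_derivative 1 / R\<^sup>2) (at s)" by (rule DERIV_cdivide[OF DERIV_ident])
    from DERIV_diff[OF DERIV_const DERIV_power[OF this, of n]] show ?thesis by simp
  qed
  show ?thesis
    unfolding cutoff_def[abs_def] by (rule DERIV_cong[OF DERIV_chain2[OF 1 2]]) simp
qed

lemma barrier_h_DERIV:
  assumes R: "R > 0" and sd: "s + d\<^sup>2 > 0"
  shows "(barrier_h R n d has_real_derivative
    - (flat [:0, 0, 1:] (1 - (s / R\<^sup>2) ^ n) * (real n * (s / R\<^sup>2) ^ (n - 1) / R\<^sup>2)) * (s + d\<^sup>2) powr (- real n / 2)
    - cutoff R n s * (real n / 2 * (s + d\<^sup>2) powr (- real n / 2) / (s + d\<^sup>2))) (at s)"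
proof -
  have "((\<lambda>s. (s + d\<^sup>2) powr (- real n / 2)) has_real_derivative
      (- real n / 2) * (s + d\<^sup>2) powr (- real n / 2 - 1) * 1) (at s)"
    by (rule DERIV_chain2[where f="\<lambda>t. t powr (- real n / 2)" and g="\<lambda>s. s + d\<^sup>2"])
       (use sd in \<open>auto intro!: has_real_derivative_powr derivative_eq_intros\<close>)
  moreover have "(- real n / 2) * (s + d\<^sup>2) powr (- real n / 2 - 1) * 1
      = - (real n / 2 * (s + d\<^sup>2) powr (- real n / 2) / (s + d\<^sup>2))"
    using sd by (simp add: powr_diff)
  ultimately have "((\<lambda>s. (s + d\<^sup>2) powr (- real n / 2)) has_real_derivative
      - (real n / 2 * (s + d\<^sup>2) powr (- real n / 2) / (s + d\<^sup>2))) (at s)" by (simp only:)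
  from DERIV_mult[OF cutoff_DERIV[OF R] this] show ?thesis
    unfolding barrier_h_def[abs_def] by (rule DERIV_cong) simp
qed

text \<open>The left side is -2 n h - 4 s h', the Laplacian at |x|^2 = s of a radial function with
  gradient -2 h x. The exponent -n/2 is that of the gradient of the fundamental solution, so an
  unregularised power would contribute nothing; the regularisation leaves the factor d^2 / (s +
  d^2), and the derivative of the cutoff gives the positive part.\<close>

lemma barrier_identity:
  assumes n: "n \<ge> 1" and "s \<ge> 0" "d > 0"
  shows "- 2 * real n * barrier_h R n d s - 4 * s *
    (- (flat [:0, 0, 1:] (1 - (s / R\<^sup>2) ^ n) * (real n * (s / R\<^sup>2) ^ (n - 1) / R\<^sup>2)) * (s + d\<^sup>2) powr (- real n / 2)
    - cutoff R n s * (real n / 2 * (s + d\<^sup>2) powr (- real n / 2) / (s + d\<^sup>2))) = lap_pos R n d s - lap_neg R n d s"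
proof -
  have sd: "s + d\<^sup>2 > 0" using assms by (simp add: add_nonneg_pos)
  define P where "P = (s + d\<^sup>2) powr (- real n / 2)"
  define Q where "Q = flat [:0, 0, 1:] (1 - (s / R\<^sup>2) ^ n)"
  have 1: "s * (s / R\<^sup>2) ^ (n - 1) / R\<^sup>2 = (s / R\<^sup>2) ^ n"
    using n by (cases n) (auto simp: field_simps)
  have 2: "d\<^sup>2 / (s + d\<^sup>2) = 1 - s / (s + d\<^sup>2)" using sd by (simp add: field_simps)
  have "lap_pos R n d s - lap_neg R n d s = 4 * real n * (s * (s / R\<^sup>2) ^ (n - 1) / R\<^sup>2) * Q * P
     - 2 * real n * cutoff R n s * P * (1 - s / (s + d\<^sup>2))"
    unfolding lap_pos_def lap_neg_def 1 2 P_def Q_def ..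
  moreover have "barrier_h R n d s = cutoff R n s * P" by (simp add: barrier_h_def P_def)
  moreover define T where "T = s + d\<^sup>2"
  ultimately show ?thesis unfolding P_def[symmetric] Q_def[symmetric]
    unfolding T_def[symmetric] by (simp add: algebra_simps)
qed

lemma flat_nonneg_q: "0 \<le> flat [:0, 0, 1:] t" "t > 0 \<Longrightarrow> 0 < flat [:0, 0, 1:] t"
  by (auto simp: flat_def)

lemma flat_1_bounds: "0 \<le> flat 1 t" "flat 1 t \<le> 1"
  by (auto simp: flat_def)

lemma continuous_on_flat: "continuous_on UNIV (flat p)"
  using DERIV_isCont[OF flat_DERIV] by (simp add: continuous_at_imp_continuous_on)

lemma flat_borel_measurable [measurable]: "flat p \<in> borel_measurable borel"
  by (rule borel_measurable_continuous_onI[OF continuous_on_flat])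

lemma cutoff_zero:
  assumes "R > 0" "s \<ge> R\<^sup>2" shows "(s / R\<^sup>2) ^ n \<ge> 1" "cutoff R n s = 0"
proof -
  have "s / R\<^sup>2 \<ge> 1" using assms by (simp add: le_divide_eq)
  then show "(s / R\<^sup>2) ^ n \<ge> 1" by (rule one_le_power)
  then show "cutoff R n s = 0" by (simp add: cutoff_def flat_def)
qed

lemma lap_zero:
  assumes "R > 0" "s \<ge> R\<^sup>2" shows "lap_pos R n d s = 0" "lap_neg R n d s = 0"
  using cutoff_zero[OF assms, of n] by (simp_all add: lap_pos_def lap_neg_def flat_def)

lemma lap_nonneg: "s \<ge> 0 \<Longrightarrow> 0 \<le> lap_pos R n d s" "s \<ge> 0 \<Longrightarrow> 0 \<le> lap_neg R n d s"
  by (auto simp: lap_pos_def lap_neg_def cutoff_def flat_nonneg_q flat_1_bounds intro!: mult_nonneg_nonneg)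

text \<open>The cutoff is a function of (s/R^2)^n so that its derivative contributes the factor s^n,
  which absorbs the nearly singular power (s + d^2)^(-n/2). Hence the bound is uniform in
  \<open>d\<close>.\<close>

lemma lap_pos_bounded:
  assumes "R > 0"
  obtains C where "C \<ge> 0" "\<And>d s. 0 < d \<Longrightarrow> d \<le> 1 \<Longrightarrow> 0 \<le> s \<Longrightarrow> lap_pos R n d s \<le> C"
proof -
  have "compact (flat [:0, 0, 1:] ` {0..1})"
    by (intro compact_continuous_image continuous_on_subset[OF continuous_on_flat]) auto
  then obtain Q where Q: "\<And>t. t \<in> {0..1} \<Longrightarrow> \<bar>flat [:0, 0, 1:] t\<bar> \<le> Q"
  proof -
    obtain Q where "\<forall>y\<in>flat [:0, 0, 1:] ` {0..1}. norm y \<le> Q"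
      using compact_imp_bounded[OF \<open>compact (flat [:0, 0, 1:] ` {0..1})\<close>] unfolding bounded_iff by blast
    then show thesis by (intro that[of Q]) auto
  qed
  have Q0: "Q \<ge> 0" using Q[of 0] by auto
  define C where "C = 4 * real n * ((R\<^sup>2 + 1) powr (real n / 2) / (R\<^sup>2) ^ n) * Q"
  have C: "C \<ge> 0" unfolding C_def using Q0 by (intro mult_nonneg_nonneg divide_nonneg_nonneg) auto
  show ?thesis
  proof (rule that[OF C])
    fix d s :: real assume d: "0 < d" "d \<le> 1" and s: "0 \<le> s"
    show "lap_pos R n d s \<le> C"
    proof (cases "s \<ge> R\<^sup>2")
      case True then show ?thesis using lap_zero[OF assms True] C by simp
    next
      case False
      define X where "X = s + d\<^sup>2"
      have X: "X > 0" "X \<le> R\<^sup>2 + 1" using d s False power_le_one[of d 2] by (auto simp: X_def add_nonneg_pos)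
      \<comment> \<open>Replacing \<open>s\<close> by the larger \<open>X\<close> lets the powers of
        \<open>X\<close> combine to the positive exponent n/2.\<close>
      have "(s / R\<^sup>2) ^ n \<le> (X / R\<^sup>2) ^ n" using s d by (intro power_mono divide_right_mono) (auto simp: X_def)
      then have "(s / R\<^sup>2) ^ n * X powr (- real n / 2) \<le> (X / R\<^sup>2) ^ n * X powr (- real n / 2)"
        by (rule mult_right_mono) simp
      also have "(X / R\<^sup>2) ^ n * X powr (- real n / 2) = X powr (real n / 2) / (R\<^sup>2) ^ n"
      proof -
        have "X ^ n * X powr (- real n / 2) = X powr (real n + - real n / 2)"
          using X(1) by (simp only: powr_add powr_realpow)
        also have "real n + - real n / 2 = real n / 2" by simp
        finally show ?thesis by (simp add: power_divide)
      qed
      also have "\<dots> \<le> (R\<^sup>2 + 1) powr (real n / 2) / (R\<^sup>2) ^ n"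
        using X by (intro divide_right_mono powr_mono2) auto
      finally have 1: "(s / R\<^sup>2) ^ n * X powr (- real n / 2) \<le> (R\<^sup>2 + 1) powr (real n / 2) / (R\<^sup>2) ^ n" .
      have "(s / R\<^sup>2) ^ n \<le> 1" using s False by (intro power_le_one) (auto simp: divide_le_eq)
      then have "\<bar>flat [:0, 0, 1:] (1 - (s / R\<^sup>2) ^ n)\<bar> \<le> Q" using s by (intro Q) auto
      then have 2: "flat [:0, 0, 1:] (1 - (s / R\<^sup>2) ^ n) \<le> Q" by simp
      have "lap_pos R n d s = 4 * real n * ((s / R\<^sup>2) ^ n * X powr (- real n / 2)) * flat [:0, 0, 1:] (1 - (s / R\<^sup>2) ^ n)"
        by (simp add: lap_pos_def X_def)
      also have "\<dots> \<le> C"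
        unfolding C_def using s by (intro mult_mono mult_left_mono 1 2 flat_nonneg_q) auto
      finally show ?thesis .
    qed
  qed
qed

lemma lap_pos_ge:
  assumes "0 < d" "d \<le> 1" "0 \<le> s" shows "lap_pos R n 1 s \<le> lap_pos R n d s"
proof -
  have "(s + 1\<^sup>2) powr (- real n / 2) \<le> (s + d\<^sup>2) powr (- real n / 2)"
    using assms power_le_one[of d 2] by (intro powr_mono2') (auto simp: add_nonneg_pos)
  then show ?thesis unfolding lap_pos_def using assms(3) by (intro mult_left_mono) (auto simp: flat_nonneg_q)
qed

lemma lap_pos_pos:
  assumes "0 < s" "s < R\<^sup>2" "n \<ge> 1" shows "0 < lap_pos R n 1 s"
proof -
  have "0 < R\<^sup>2" using assms by linarith
  then have "s / R\<^sup>2 < 1" "0 < s / R\<^sup>2" using assms by simp_all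
  then have "(s / R\<^sup>2) ^ n < 1" using assms(3) by (intro power_less_one_iff[THEN iffD2]) auto
  then show ?thesis unfolding lap_pos_def using assms \<open>0 < s / R\<^sup>2\<close>
    by (intro mult_pos_pos flat_nonneg_q(2)) auto
qed

text \<open>Away from the origin the regularisation is felt only through the factor d^2;
  \<open>k\<close> is a lower bound for the squared radius.\<close>

lemma lap_neg_le:
  assumes "0 < d" "0 < k" "k \<le> s"
  shows "lap_neg R n d s \<le> 2 * real n * k powr (- real n / 2) / k * d\<^sup>2"
proof -
  have "(s + d\<^sup>2) powr (- real n / 2) \<le> k powr (- real n / 2)"
    using assms by (intro powr_mono2') (auto simp: add_increasing2)
  moreover have "d\<^sup>2 / (s + d\<^sup>2) \<le> d\<^sup>2 / k"
    using assms by (intro divide_left_mono) (auto simp: add_increasing2 add_pos_pos)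
  moreover have "cutoff R n s \<le> 1" "0 \<le> cutoff R n s" by (auto simp: cutoff_def flat_1_bounds)
  ultimately have "lap_neg R n d s \<le> 2 * real n * 1 * k powr (- real n / 2) * (d\<^sup>2 / k)"
    unfolding lap_neg_def using assms by (intro mult_mono mult_left_mono mult_nonneg_nonneg divide_nonneg_nonneg) auto
  then show ?thesis by simp
qed

lemma lap_neg_bounded:
  assumes "0 < d" "0 \<le> s" shows "lap_neg R n d s \<le> 2 * real n * (d\<^sup>2) powr (- real n / 2)"
proof -
  have "(s + d\<^sup>2) powr (- real n / 2) \<le> (d\<^sup>2) powr (- real n / 2)"
    using assms by (intro powr_mono2') auto
  moreover have "d\<^sup>2 / (s + d\<^sup>2) \<le> 1" using assms by (simp add: divide_le_eq add_nonneg_pos)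
  moreover have "cutoff R n s \<le> 1" "0 \<le> cutoff R n s" by (auto simp: cutoff_def flat_1_bounds)
  ultimately have "lap_neg R n d s \<le> 2 * real n * 1 * (d\<^sup>2) powr (- real n / 2) * 1"
    unfolding lap_neg_def using assms by (intro mult_mono mult_left_mono mult_nonneg_nonneg divide_nonneg_nonneg) auto
  then show ?thesis by simp
qed

text \<open>The function is the integral of \<open>barrier_h\<close> from |x|^2 to R^2, hence
  nonnegative, and zero from radius \<open>R\<close> on. Its gradient is -2 H(x) x with
  \<open>H\<close> a smooth function of |x|^2, so smoothness follows with no special treatment of
  the origin.\<close>

lemma barrier_exists:
  assumes R: "R > 0" and d: "d > 0"
  obtains \<phi> :: "'a::euclidean_space \<Rightarrow> real" where "smooth \<phi>" "\<And>x. norm x \<ge> R \<Longrightarrow> \<phi> x = 0" "\<And>x. 0 \<le> \<phi> x"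
    "\<And>x. laplacian \<phi> x = lap_pos R DIM('a) d ((norm x)\<^sup>2) - lap_neg R DIM('a) d ((norm x)\<^sup>2)"
proof -
  let ?n = "DIM('a)"
  have n: "?n \<ge> 1" by (simp add: Suc_leI)
  let ?b = "barrier_h R ?n d"
  define b' where "b' s = - (flat [:0, 0, 1:] (1 - (s / R\<^sup>2) ^ ?n) * (real ?n * (s / R\<^sup>2) ^ (?n - 1) / R\<^sup>2)) * (s + d\<^sup>2) powr (- real ?n / 2)
    - cutoff R ?n s * (real ?n / 2 * (s + d\<^sup>2) powr (- real ?n / 2) / (s + d\<^sup>2))" for s
  have pos: "s \<ge> 0 \<Longrightarrow> s + d\<^sup>2 > 0" for s using d by (simp add: add_nonneg_pos)
  have b': "s \<ge> 0 \<Longrightarrow> (?b has_real_derivative b' s) (at s)" for s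
    unfolding b'_def by (rule barrier_h_DERIV[OF R pos])
  \<comment> \<open>For negative arguments the base \<open>s + d\<^sup>2\<close> may fail to be
    positive, so the profile is frozen there.\<close>
  define h where "h s = ?b (max 0 s)" for s
  have "continuous_on {0..} ?b"
    using b' DERIV_isCont by (intro continuous_at_imp_continuous_on) fastforce
  then have hc: "continuous_on S h" for S
    unfolding h_def by (rule continuous_on_compose2) (auto intro!: continuous_intros)
  have b0: "0 \<le> ?b s" for s by (simp add: barrier_h_def cutoff_def flat_1_bounds)
  \<comment> \<open>Starting the integral at -1 makes 0 an interior point, so the two-sided
    derivative is available at the origin as well.\<close>
  define g where "g s = integral {-1..s} h" for s
  have g': "(g has_real_derivative h s) (at s)" if "s > -1" for s
  proof -
    have "(g has_real_derivative h s) (at s within {-1..s + 1})"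
      unfolding g_def using that by (intro integral_has_real_derivative hc) auto
    moreover have "at s within {-1..s + 1} = at s" using that by (intro at_within_interior) auto
    ultimately show ?thesis by simp
  qed
  have comb: "g t - g s = integral {s..t} h" if "-1 \<le> s" "s \<le> t" for s t
    using Henstock_Kurzweil_Integration.integral_combine[of "-1" s t h] that
    by (simp add: g_def integrable_continuous_interval hc)
  define \<phi> where "\<phi> x = g (R\<^sup>2) - g ((norm x)\<^sup>2)" for x :: 'a
  define H where "H x = ?b ((norm x)\<^sup>2)" for x :: 'a
  have n2: "GDERIV (\<lambda>x::'a. (norm x)\<^sup>2) x :> 2 *\<^sub>R x" for x
    using smooth_gderiv[OF smooth_norm_power2, of x] by (simp add: grad_norm_power2)
  have D: "GDERIV \<phi> x :> (- 2 * H x) *\<^sub>R x" for x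
  proof -
    have "(g has_real_derivative h ((norm x)\<^sup>2)) (at ((norm x)\<^sup>2))"
      by (rule g') (use zero_le_power2[of "norm x"] in linarith)
    from GDERIV_diff[OF GDERIV_const GDERIV_DERIV_compose[OF n2 this]]
    show ?thesis unfolding \<phi>_def[abs_def] by (simp add: H_def h_def mult.commute)
  qed
  have sH: "smooth H"
  proof -
    have "smooth (\<lambda>x::'a. (norm x)\<^sup>2 + d\<^sup>2)" by (intro smooth_add smooth_norm_power2 smooth_const)
    then have 1: "smooth (\<lambda>x::'a. ((norm x)\<^sup>2 + d\<^sup>2) powr (- real ?n / 2))" by (rule smooth_powr) (simp add: pos)
    have "real_polynomial_function (\<lambda>s. 1 - (s / R\<^sup>2) ^ ?n)"
      by (intro real_polynomial_function_diff real_polynomial_function_power real_polynomial_function_divide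
        real_polynomial_function.intros(1,2) bounded_linear_ident)
    then have "smooth (\<lambda>x::'a. 1 - ((norm x)\<^sup>2 / R\<^sup>2) ^ ?n)" by (rule smooth_polynomial[OF _ smooth_norm_power2])
    then have 2: "smooth (\<lambda>x::'a. flat 1 (1 - ((norm x)\<^sup>2 / R\<^sup>2) ^ ?n))" by (rule smooth_flat)
    show ?thesis unfolding H_def[abs_def] barrier_h_def cutoff_def by (rule smooth_mult[OF 2 1])
  qed
  have s\<phi>: "smooth \<phi>"
  proof (rule smooth_I[OF D])
    fix b :: 'a
    have "smooth (\<lambda>x. - 2 * (H x * (x \<bullet> b)))" by (intro smooth_cmult smooth_mult sH smooth_inner)
    then show "smooth (\<lambda>x. ((- 2 * H x) *\<^sub>R x) \<bullet> b)" by (simp add: mult.assoc)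
  qed
  have gH: "grad H x = b' ((norm x)\<^sup>2) *\<^sub>R (2 *\<^sub>R x)" for x
    unfolding H_def[abs_def] by (subst grad_compose[OF smooth_norm_power2 b']) (auto simp: grad_norm_power2)
  have lap: "laplacian \<phi> x = lap_pos R ?n d ((norm x)\<^sup>2) - lap_neg R ?n d ((norm x)\<^sup>2)" for x
  proof -
    have "grad (\<lambda>y. grad \<phi> y \<bullet> b) x \<bullet> b = - 2 * H x - 4 * b' ((norm x)\<^sup>2) * (x \<bullet> b)\<^sup>2" if b: "b \<in> Basis" for b
    proof -
      have "(\<lambda>y. grad \<phi> y \<bullet> b) = (\<lambda>y. - 2 * (H y * (y \<bullet> b)))" using grad_eqI[OF D] by (simp add: mult.assoc)
      then have "grad (\<lambda>y. grad \<phi> y \<bullet> b) x = (- 2) *\<^sub>R (H x *\<^sub>R b + (x \<bullet> b) *\<^sub>R (b' ((norm x)\<^sup>2) *\<^sub>R (2 *\<^sub>R x)))"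
        using grad_cmult[OF smooth_mult[OF sH smooth_inner[of b]], of "-2" x] grad_mult[OF sH smooth_inner[of b], of x]
          grad_eqI[OF GDERIV_inner[of b x]] gH[of x] by simp
      show ?thesis unfolding \<open>grad (\<lambda>y. grad \<phi> y \<bullet> b) x = _\<close>
        using b by (simp add: inner_add_left power2_eq_square algebra_simps)
    qed
    then have "laplacian \<phi> x = (\<Sum>b\<in>Basis. - 2 * H x - 4 * b' ((norm x)\<^sup>2) * (x \<bullet> b)\<^sup>2)"
      unfolding laplacian_def by (intro sum.cong) auto
    also have "\<dots> = - 2 * real ?n * H x - 4 * b' ((norm x)\<^sup>2) * (\<Sum>b\<in>Basis. (x \<bullet> b)\<^sup>2)"
      by (simp add: sum_subtractf sum_distrib_left)
    also have "(\<Sum>b\<in>Basis. (x \<bullet> b)\<^sup>2) = (norm x)\<^sup>2"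
      by (subst power2_norm_eq_inner, subst euclidean_inner) (simp add: power2_eq_square)
    also have "- 2 * real ?n * H x - 4 * b' ((norm x)\<^sup>2) * (norm x)\<^sup>2
        = - 2 * real ?n * ?b ((norm x)\<^sup>2) - 4 * (norm x)\<^sup>2 * b' ((norm x)\<^sup>2)"
      by (simp add: H_def)
    also have "\<dots> = lap_pos R ?n d ((norm x)\<^sup>2) - lap_neg R ?n d ((norm x)\<^sup>2)"
      unfolding b'_def by (rule barrier_identity[OF n _ d]) simp
    finally show ?thesis .
  qed
  show ?thesis
  proof (rule that[OF s\<phi> _ _ lap])
    show z: "\<phi> x = 0" if "norm x \<ge> R" for x
    proof -
      have s: "R\<^sup>2 \<le> (norm x)\<^sup>2" using that R by (intro power_mono) auto
      have "integral {R\<^sup>2..(norm x)\<^sup>2} h = integral {R\<^sup>2..(norm x)\<^sup>2} (\<lambda>s. 0)"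
      proof (rule Henstock_Kurzweil_Integration.integral_cong)
        fix s assume s: "s \<in> {R\<^sup>2..(norm x)\<^sup>2}"
        then have "0 \<le> s" using zero_le_power2[of R] unfolding atLeastAtMost_iff by linarith
        then have "max 0 s = s" by simp
        then show "h s = 0" using cutoff_zero(2)[OF R, of s ?n] s by (simp add: h_def barrier_h_def)
      qed
      then show ?thesis using comb[of "R\<^sup>2" "(norm x)\<^sup>2"] s zero_le_power2[of R] by (simp add: \<phi>_def)
    qed
    show "0 \<le> \<phi> x" for x
    proof (cases "norm x \<ge> R")
      case True then show ?thesis using z by simp
    next
      case False
      then have s: "(norm x)\<^sup>2 \<le> R\<^sup>2" by (intro power_mono) auto
      have "0 \<le> integral {(norm x)\<^sup>2..R\<^sup>2} h"
        by (intro integral_nonneg integrable_continuous_interval hc) (simp add: h_def b0)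
      moreover have "-1 \<le> (norm x)\<^sup>2" using zero_le_power2[of "norm x"] by linarith
      ultimately show ?thesis using comb[of "(norm x)\<^sup>2" "R\<^sup>2"] s by (simp add: \<phi>_def)
    qed
  qed
qed

section \<open>The strong maximum principle\<close>

lemma laplacian_translate:
  assumes "smooth f" shows "laplacian (\<lambda>x. f (x + a)) x = laplacian f (x + a)"
proof -
  have "(\<lambda>y. grad (\<lambda>x. f (x + a)) y \<bullet> b) = (\<lambda>y. (\<lambda>z. grad f z \<bullet> b) (y + a))" for b
    by (simp add: grad_translate[OF assms])
  then show ?thesis
    unfolding laplacian_def using grad_translate[OF smooth_partial[OF assms]] by (intro sum.cong) auto
qed

lemma AE_locally_imp_AE:
  fixes \<Omega> :: "'a::euclidean_space set"
  assumes "\<And>y. y \<in> \<Omega> \<Longrightarrow> \<exists>r>0. AE z in lborel. z \<in> ball y r \<longrightarrow> P z"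
  shows "AE z in lborel. z \<in> \<Omega> \<longrightarrow> P z"
proof -
  define F where "F = {ball y r | y r. y \<in> \<Omega> \<and> r > 0 \<and> (AE z in lborel. z \<in> ball y r \<longrightarrow> P z)}"
  obtain F' where F': "F' \<subseteq> F" "countable F'" "\<Union>F' = \<Union>F"
  proof (rule Lindelof[of F])
    show "open S" if "S \<in> F" for S using that by (auto simp: F_def)
  qed (rule that)
  have "AE z in lborel. \<forall>B\<in>F'. z \<in> B \<longrightarrow> P z"
    using F'(1) by (subst AE_ball_countable[OF F'(2)]) (auto simp: F_def)
  moreover have "\<Omega> \<subseteq> \<Union>F'"
  proof
    fix y assume "y \<in> \<Omega>"
    then obtain r where "r > 0" "AE z in lborel. z \<in> ball y r \<longrightarrow> P z" using assms by blast
    then have "ball y r \<in> F" "y \<in> ball y r" using \<open>y \<in> \<Omega>\<close> by (auto simp: F_def)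
    then show "y \<in> \<Union>F'" using F'(3) by blast
  qed
  ultimately show ?thesis by (auto elim!: eventually_mono)
qed

lemma emeasure_lborel_open_pos:
  fixes S :: "'a::euclidean_space set"
  assumes "open S" "S \<noteq> {}" shows "emeasure lborel S > 0"
proof -
  obtain x r where r: "r > 0" "ball x r \<subseteq> S" using assms by (meson all_not_in_conv open_contains_ball)
  have "0 < measure lborel (ball x r)" using content_ball_pos[OF r(1)] by simp
  then have "emeasure lborel (ball x r) \<noteq> 0" by (auto simp: measure_def)
  then have "0 < emeasure lborel (ball x r)" by (simp add: zero_less_iff_neq_zero)
  also have "\<dots> \<le> emeasure lborel S" using assms r by (intro emeasure_mono) auto
  finally show ?thesis .
qed

context bounded_open
begin

text \<open>Translates and iterated integrals are taken over \<open>lborel\<close>, where Lebesgue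
  measurability does not suffice. The sign and the vanishing outside hold everywhere, because the
  representative is evaluated at translated arguments.\<close>

lemma borel_representative:
  fixes f :: "'a \<Rightarrow> real"
  assumes f: "f \<in> borel_measurable M" and nn: "AE x in M. 0 \<le> f x"
  obtains g where "g \<in> borel_measurable borel" "\<And>x. 0 \<le> g x" "\<And>x. x \<notin> \<Omega> \<Longrightarrow> g x = 0" "AE x in M. g x = f x"
proof -
  have "(\<lambda>x. indicator \<Omega> x *\<^sub>R f x) \<in> borel_measurable lebesgue"
    using f by (subst (asm) borel_measurable_restrict_space_iff) auto
  from completion_ex_borel_measurable_real[OF this] obtain g
    where [measurable]: "g \<in> borel_measurable borel" and g: "AE x in lborel. indicator \<Omega> x *\<^sub>R f x = g x" by auto
  have [measurable]: "\<Omega> \<in> sets borel" using open_dom by simp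
  show ?thesis
  proof (rule that[of "\<lambda>x. max 0 (g x) * indicator \<Omega> x"])
    have "AE x in M. indicator \<Omega> x *\<^sub>R f x = g x"
      using AE_completion[OF g] by (simp add: AE_M_iff) (auto elim!: eventually_mono)
    then show "AE x in M. max 0 (g x) * indicator \<Omega> x = f x"
      using nn AE_space by eventually_elim auto
  qed auto
qed

text \<open>The equation and l e \<ge> 0 give a nonnegative Dirichlet product with
  \<open>\<psi>\<close>; the weak gradient is then tested against each partial derivative of
  \<open>\<psi>\<close>, which moves the second derivative off \<open>e\<close>.\<close>

lemma superharmonic_weak:
  assumes \<alpha>: "\<alpha> > 0" and l: "0 \<le> l" and e: "e \<in> H10 \<Omega>" "AE x in M. 0 \<le> e x"
    and eig: "\<And>\<phi>. \<phi> \<in> H10 \<Omega> \<Longrightarrow> energy \<alpha> l e \<phi> = 0"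
    and \<psi>: "\<psi> \<in> test_functions \<Omega>" "\<And>x. 0 \<le> \<psi> x"
  shows "l2_inner \<Omega> e (laplacian \<psi>) \<le> 0"
proof -
  note We = H10_wgrad[OF e(1)]
  have "0 \<le> l2_inner \<Omega> e \<psi>"
    unfolding l2_inner_def by (rule integral_nonneg_AE) (use e(2) \<psi>(2) in auto)
  then have "0 \<le> l * l2_inner \<Omega> e \<psi>" using l by simp
  then have "0 \<le> \<alpha> * dirichlet e \<psi>" using eig[OF H10_test(1)[OF \<psi>(1)]] by (simp add: energy_def)
  then have "0 \<le> dirichlet e \<psi>" using \<alpha> by (simp add: zero_le_mult_iff)
  also have "dirichlet e \<psi> = l2_inner \<Omega> (grad \<psi>) (wgrad \<Omega> e)"
    unfolding dirichlet_commute[of e] unfolding dirichlet_def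
    using H10_test[OF \<psi>(1)] We test_grad_L2[OF \<psi>(1)] e(1)
    by (intro l2_inner_cong_AE L2_measurable H10_wgrad) auto
  also have "\<dots> = - l2_inner \<Omega> e (laplacian \<psi>)"
  proof -
    have p: "(\<lambda>x. grad \<psi> x \<bullet> b) \<in> test_functions \<Omega>" if "b \<in> Basis" for b using test_partial[OF \<psi>(1) that] .
    have "l2_inner \<Omega> e (laplacian \<psi>) = (\<Sum>b\<in>Basis. l2_inner \<Omega> e (\<lambda>x. grad (\<lambda>y. grad \<psi> y \<bullet> b) x \<bullet> b))"
      unfolding l2_inner_def laplacian_def inner_real_def sum_distrib_left
      using L2_mult_integrable[OF H10_L2[OF e(1)] test_L2[OF test_partial[OF p]]] by (intro Bochner_Integration.integral_sum) auto
    also have "\<dots> = (\<Sum>b\<in>Basis. - l2_inner \<Omega> (wgrad \<Omega> e) (\<lambda>x. (grad \<psi> x \<bullet> b) *\<^sub>R b))"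
      using H1_wgrad(2)[OF H10_H1[OF e(1)]] p by (intro sum.cong) (auto simp: has_weak_gradient_iff)
    also have "\<dots> = - (\<Sum>b\<in>Basis. l2_inner \<Omega> (wgrad \<Omega> e) (\<lambda>x. (grad \<psi> x \<bullet> b) *\<^sub>R b))" by (simp add: sum_negf)
    also have "(\<Sum>b\<in>Basis. l2_inner \<Omega> (wgrad \<Omega> e) (\<lambda>x. (grad \<psi> x \<bullet> b) *\<^sub>R b))
       = (\<integral>x. (\<Sum>b\<in>Basis. wgrad \<Omega> e x \<bullet> ((grad \<psi> x \<bullet> b) *\<^sub>R b)) \<partial>M)"
      unfolding l2_inner_def using L2_inner_integrable[OF We test_scaleR_L2[OF p]]
      by (intro Bochner_Integration.integral_sum[symmetric]) auto
    also have "\<dots> = l2_inner \<Omega> (grad \<psi>) (wgrad \<Omega> e)"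
      unfolding l2_inner_def by (intro Bochner_Integration.integral_cong refl, subst euclidean_inner) (simp add: mult.commute)
    finally show ?thesis by simp
  qed
  finally show ?thesis by simp
qed

text \<open>The estimate for test functions passes to the limit. Splitting the increment into three
  costs the factor 3, which is harmless because only the order |z|^2 matters later.\<close>

lemma H10_translation_nn:
  assumes e: "e \<in> H10 \<Omega>" and e0: "e0 \<in> borel_measurable borel" "\<And>x. x \<notin> \<Omega> \<Longrightarrow> e0 x = 0" "AE x in M. e0 x = e x"
  shows "(\<integral>\<^sup>+x. ennreal ((e0 (x + z) - e0 x)\<^sup>2) \<partial>lborel) \<le> ennreal (3 * (norm z)\<^sup>2 * (l2_norm \<Omega> (wgrad \<Omega> e))\<^sup>2)"
proof -
  note [measurable] = e0(1)
  obtain \<phi> where \<phi>: "\<And>n. \<phi> n \<in> test_functions \<Omega>" "(\<lambda>n. l2_norm \<Omega> (\<lambda>x. \<phi> n x - e x)) \<longlonglongrightarrow> 0"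
    "(\<lambda>n. l2_norm \<Omega> (\<lambda>x. grad (\<phi> n) x - wgrad \<Omega> e x)) \<longlonglongrightarrow> 0" using H10_E[OF e] by blast
  have e0M: "e0 \<in> borel_measurable M" using e0(1) by (rule borel_measurable_M)
  have le: "(\<integral>\<^sup>+x. ennreal ((e0 (x + z) - e0 x)\<^sup>2) \<partial>lborel)
    \<le> ennreal (3 * (l2_norm \<Omega> (\<lambda>x. \<phi> n x - e x))\<^sup>2 + 3 * (norm z)\<^sup>2 * (l2_norm \<Omega> (grad (\<phi> n)))\<^sup>2 + 3 * (l2_norm \<Omega> (\<lambda>x. \<phi> n x - e x))\<^sup>2)" for n
  proof -
    have [measurable]: "\<phi> n \<in> borel_measurable borel" using smooth_borel_measurable test_smooth \<phi>(1) by blast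
    let ?f = "\<lambda>x. \<phi> n x - e0 x"
    have L: "(\<lambda>x. \<phi> n x - e x) \<in> L2 \<Omega>" by (intro L2_diff test_L2 \<phi>(1) H10_L2 e)
    have fL: "?f \<in> L2 \<Omega>"
    proof (rule L2_I_bound[OF _ L2_power2_integrable[OF L]])
      show "AE x in M. (norm (?f x))\<^sup>2 \<le> (norm (\<phi> n x - e x))\<^sup>2" using e0(3) by eventually_elim simp
    qed (use e0M smooth_measurable_M test_smooth \<phi>(1) in \<open>auto intro!: borel_measurable_diff\<close>)
    have "l2_norm \<Omega> ?f = l2_norm \<Omega> (\<lambda>x. \<phi> n x - e x)"
      using e0(3) by (intro l2_norm_cong_AE L2_measurable fL L) auto
    then have I: "(\<integral>\<^sup>+x. ennreal ((?f x)\<^sup>2) \<partial>lborel) = ennreal ((l2_norm \<Omega> (\<lambda>x. \<phi> n x - e x))\<^sup>2)"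
      using nn_integral_norm_power2[of ?f] fL e0(2) test_zero_outside[OF \<phi>(1)] by simp
    have I2: "(\<integral>\<^sup>+x. ennreal ((?f (x + z))\<^sup>2) \<partial>lborel) = ennreal ((l2_norm \<Omega> (\<lambda>x. \<phi> n x - e x))\<^sup>2)"
      using nn_integral_lborel_translate[of "\<lambda>x. ennreal ((?f x)\<^sup>2)" z] I by simp
    have "ennreal ((e0 (x + z) - e0 x)\<^sup>2) \<le> 3 * ennreal ((?f (x + z))\<^sup>2) + 3 * ennreal ((\<phi> n (x + z) - \<phi> n x)\<^sup>2) + 3 * ennreal ((?f x)\<^sup>2)" for x
    proof -
      have "(b - a - c)\<^sup>2 \<le> 3 * a\<^sup>2 + 3 * b\<^sup>2 + 3 * c\<^sup>2" for a b c :: real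
        using zero_le_power2[of "a + b"] zero_le_power2[of "b + c"] zero_le_power2[of "a - c"]
        by (simp add: power2_eq_square algebra_simps)
      from this[of "\<phi> n (x + z) - \<phi> n x" "?f (x + z)" "- ?f x"]
      have "(e0 (x + z) - e0 x)\<^sup>2 \<le> 3 * (?f (x + z))\<^sup>2 + 3 * (\<phi> n (x + z) - \<phi> n x)\<^sup>2 + 3 * (?f x)\<^sup>2"
        by (simp add: algebra_simps power2_commute[of "e0 x"])
      then have "ennreal ((e0 (x + z) - e0 x)\<^sup>2) \<le> ennreal (3 * (?f (x + z))\<^sup>2 + 3 * (\<phi> n (x + z) - \<phi> n x)\<^sup>2 + 3 * (?f x)\<^sup>2)"
        by (rule ennreal_leI)
      also have "\<dots> = 3 * ennreal ((?f (x + z))\<^sup>2) + 3 * ennreal ((\<phi> n (x + z) - \<phi> n x)\<^sup>2) + 3 * ennreal ((?f x)\<^sup>2)"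
        by (simp add: ennreal_mult)
      finally show ?thesis .
    qed
    then have "(\<integral>\<^sup>+x. ennreal ((e0 (x + z) - e0 x)\<^sup>2) \<partial>lborel)
      \<le> (\<integral>\<^sup>+x. 3 * ennreal ((?f (x + z))\<^sup>2) + 3 * ennreal ((\<phi> n (x + z) - \<phi> n x)\<^sup>2) + 3 * ennreal ((?f x)\<^sup>2) \<partial>lborel)"
      by (intro nn_integral_mono)
    also have "\<dots> = 3 * (\<integral>\<^sup>+x. ennreal ((?f (x + z))\<^sup>2) \<partial>lborel)
       + 3 * (\<integral>\<^sup>+x. ennreal ((\<phi> n (x + z) - \<phi> n x)\<^sup>2) \<partial>lborel) + 3 * (\<integral>\<^sup>+x. ennreal ((?f x)\<^sup>2) \<partial>lborel)"
      by (simp add: nn_integral_add nn_integral_cmult)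
    also have "\<dots> \<le> 3 * ennreal ((l2_norm \<Omega> (\<lambda>x. \<phi> n x - e x))\<^sup>2)
       + 3 * (ennreal ((norm z)\<^sup>2) * ennreal ((l2_norm \<Omega> (grad (\<phi> n)))\<^sup>2)) + 3 * ennreal ((l2_norm \<Omega> (\<lambda>x. \<phi> n x - e x))\<^sup>2)"
      unfolding I I2 using test_translation_nn[OF \<phi>(1), of n z] unfolding test_norm_nn(1)[OF \<phi>(1)]
      by (intro add_mono mult_left_mono) auto
    also have "\<dots> = ennreal (3 * (l2_norm \<Omega> (\<lambda>x. \<phi> n x - e x))\<^sup>2 + 3 * (norm z)\<^sup>2 * (l2_norm \<Omega> (grad (\<phi> n)))\<^sup>2 + 3 * (l2_norm \<Omega> (\<lambda>x. \<phi> n x - e x))\<^sup>2)"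
    proof -
      have three: "3 * ennreal t = ennreal (3 * t)" if "0 \<le> t" for t using that by (simp add: ennreal_mult)
      show ?thesis
        by (simp only: three ennreal_mult[symmetric] ennreal_plus[symmetric] zero_le_power2 mult_nonneg_nonneg
            add_nonneg_nonneg zero_le_numeral mult.assoc)
    qed
    finally show ?thesis .
  qed
  have glim: "(\<lambda>n. l2_norm \<Omega> (grad (\<phi> n))) \<longlonglongrightarrow> l2_norm \<Omega> (wgrad \<Omega> e)"
    by (rule l2_norm_tendsto[OF test_grad_L2[OF \<phi>(1)] H10_wgrad[OF e] \<phi>(3)])
  have "(\<lambda>n. ennreal (3 * (l2_norm \<Omega> (\<lambda>x. \<phi> n x - e x))\<^sup>2 + 3 * (norm z)\<^sup>2 * (l2_norm \<Omega> (grad (\<phi> n)))\<^sup>2 + 3 * (l2_norm \<Omega> (\<lambda>x. \<phi> n x - e x))\<^sup>2))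
     \<longlonglongrightarrow> ennreal (3 * 0\<^sup>2 + 3 * (norm z)\<^sup>2 * (l2_norm \<Omega> (wgrad \<Omega> e))\<^sup>2 + 3 * 0\<^sup>2)"
    by (intro tendsto_ennrealI tendsto_intros \<phi>(2) glim)
  from LIMSEQ_le_const[OF this] show ?thesis using le by simp
qed

text \<open>
  The barrier centred at \<open>x\<close> gives \<open>\<integral>e0 (x + z) P d z dz \<le> \<integral>e0 (x + z) N d z dz\<close> for a superharmonic \<open>e0\<close>. Integrated
  over \<open>x\<close> in the zero set \<open>A\<close>, the right hand side tends to zero with \<open>d\<close>, since \<open>N d\<close> concentrates at the origin
  with bounded mass; \<open>P d\<close> is bounded below by the positive weight \<open>P 1\<close>.
\<close>

lemma zero_spreads:
  assumes \<alpha>: "\<alpha> > 0" and l: "0 \<le> l" and e: "e \<in> H10 \<Omega>" "AE x in M. 0 \<le> e x"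
    and eig: "\<And>\<phi>. \<phi> \<in> H10 \<Omega> \<Longrightarrow> energy \<alpha> l e \<phi> = 0"
    and e0: "e0 \<in> borel_measurable borel" "\<And>x. 0 \<le> e0 x" "\<And>x. x \<notin> \<Omega> \<Longrightarrow> e0 x = 0" "AE x in M. e0 x = e x"
    and R: "R > 0" and A: "A \<in> sets borel" "\<And>x. x \<in> A \<Longrightarrow> cball x R \<subseteq> \<Omega>" "\<And>x. x \<in> A \<Longrightarrow> e0 x = 0"
    and pos: "emeasure lborel A > 0"
  obtains x where "x \<in> A" "AE z in lborel. z \<in> ball x R \<longrightarrow> e0 z = 0"
proof -
  note [measurable] = e0(1) A(1)
  let ?n = "DIM('a)"
  have n: "?n \<ge> 1" by (simp add: Suc_leI)
  have [measurable]: "cball (0::'a) R \<in> sets borel" "ball (0::'a) R \<in> sets borel" by auto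
  define P where "P d z = lap_pos R ?n d ((norm z)\<^sup>2)" for d and z :: 'a
  define N where "N d z = lap_neg R ?n d ((norm z)\<^sup>2)" for d and z :: 'a
  have [measurable]: "P d \<in> borel_measurable borel" "N d \<in> borel_measurable borel" for d
    unfolding P_def[abs_def] N_def[abs_def] lap_pos_def lap_neg_def cutoff_def by measurable
  have P0: "0 \<le> P d z" and N0: "0 \<le> N d z" for d z by (simp_all add: P_def N_def lap_nonneg)
  obtain C1 where C1: "C1 \<ge> 0" "\<And>d z. 0 < d \<Longrightarrow> d \<le> 1 \<Longrightarrow> P d z \<le> C1"
    unfolding P_def by (rule lap_pos_bounded[OF R, of ?n]) auto
  have out: "P d z = 0" "N d z = 0" if "norm z \<ge> R" for d z
  proof -
    have "R\<^sup>2 \<le> (norm z)\<^sup>2" using that R by (intro power_mono) auto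
    then show "P d z = 0" "N d z = 0" using lap_zero[OF R] by (simp_all add: P_def N_def)
  qed
  define CN where "CN d = 2 * real ?n * (d\<^sup>2) powr (- real ?n / 2)" for d
  have N_le: "N d z \<le> CN d" if "0 < d" for d z unfolding N_def CN_def by (rule lap_neg_bounded[OF that]) simp
  define V where "V = measure lborel (cball (0::'a) R)"
  have V: "emeasure lborel (cball (0::'a) R) = ennreal V" "V \<ge> 0"
    using emeasure_eq_ennreal_measure[of lborel "cball (0::'a) R"] emeasure_bounded_finite[of "cball (0::'a) R"]
    by (auto simp: V_def)
  have intg: "integrable lborel f" if "f \<in> borel_measurable borel" "\<And>z. 0 \<le> f z" "\<And>z. f z \<le> C" "\<And>z. norm z \<ge> R \<Longrightarrow> f z = 0"
    for f :: "'a \<Rightarrow> real" and C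
  proof (rule Bochner_Integration.integrable_bound[of lborel "\<lambda>z. C * indicator (cball 0 R) z"])
    show "integrable lborel (\<lambda>z::'a. C * indicator (cball 0 R) z)" using V by simp
    show "AE z in lborel. norm (f z) \<le> norm (C * indicator (cball 0 R) z)"
    proof (rule AE_I2)
      fix z show "norm (f z) \<le> norm (C * indicator (cball 0 R) z)"
      proof (cases "norm z \<ge> R")
        case False
        then have "z \<in> cball 0 R" by auto
        then show ?thesis using that(2,3)[of z] by simp
      qed (simp add: that(4))
    qed
  qed (use that in simp)

  \<comment> \<open>The Laplacian of a compactly supported function integrates to zero, so
    \<open>N d\<close> has the same mass as \<open>P d\<close>, which is bounded on the ball
    uniformly in \<open>d\<close>.\<close>
  have mass: "(\<integral>\<^sup>+z. ennreal (N d z) \<partial>lborel) \<le> ennreal (C1 * V)" if d: "0 < d" "d \<le> 1" for d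
  proof -
    obtain \<phi> :: "'a \<Rightarrow> real" where \<phi>: "smooth \<phi>" "\<And>x. norm x \<ge> R \<Longrightarrow> \<phi> x = 0" "\<And>x. laplacian \<phi> x = P d x - N d x"
      unfolding P_def N_def by (rule barrier_exists[OF R d(1)]) blast
    have t: "\<phi> \<in> test_functions UNIV"
      by (rule test_functionI[OF \<phi>(1) compact_cball[of 0 R]]) (use \<phi>(2) in auto)
    have iP: "integrable lborel (P d)" by (rule intg[where C=C1]) (use P0 C1(2)[OF d] out in auto)
    have iN: "integrable lborel (N d)" by (rule intg[where C="CN d"]) (use N0 N_le[OF d(1)] out in auto)
    have p: "(\<lambda>x. grad \<phi> x \<bullet> b) \<in> test_functions UNIV" if "b \<in> Basis" for b using test_partial[OF t that] .
    have "(\<integral>z. laplacian \<phi> z \<partial>lborel) = (\<Sum>b\<in>Basis. \<integral>z. grad (\<lambda>y. grad \<phi> y \<bullet> b) z \<bullet> b \<partial>lborel)"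
      unfolding laplacian_def using test_integrable_lborel[OF test_partial[OF p]]
      by (intro Bochner_Integration.integral_sum) auto
    also have "\<dots> = 0" using integral_partial_zero[OF p] by simp
    finally have "(\<integral>z. N d z \<partial>lborel) = (\<integral>z. P d z \<partial>lborel)" unfolding \<phi>(3) using iP iN by simp
    also have "\<dots> \<le> (\<integral>z. C1 * indicator (cball (0::'a) R) z \<partial>lborel)"
    proof (rule integral_mono[OF iP])
      show "integrable lborel (\<lambda>z::'a. C1 * indicator (cball 0 R) z)" using V by simp
      fix z show "P d z \<le> C1 * indicator (cball 0 R) z"
        using C1(2)[OF d, of z] out(1)[of z d] by (cases "norm z \<ge> R") (auto simp: indicator_def C1(1))
    qed
    also have "\<dots> = C1 * V" by (simp add: V_def)
    finally have "(\<integral>z. N d z \<partial>lborel) \<le> C1 * V" .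
    then show ?thesis using iN N0 by (simp add: nn_integral_eq_integral ennreal_leI)
  qed

  have e0M: "e0 \<in> borel_measurable M" using e0(1) by (rule borel_measurable_M)
  have ie0: "integrable M e0"
  proof -
    have "integrable M e" by (rule L2_integrable[OF H10_L2[OF e(1)]])
    then show ?thesis using e0M e0(4) by (subst integrable_cong_AE[where g=e]) auto
  qed

  \<comment> \<open>\<open>superharmonic_weak\<close> is tested with the barrier moved to
    \<open>x\<close>, whose support fits into the domain by the hypothesis on \<open>A\<close>. Both
    sides are rewritten in z = y - x over the whole space, \<open>e0\<close> being zero
    outside.\<close>
  have pw: "(\<integral>\<^sup>+z. ennreal (e0 (x + z)) * ennreal (P d z) \<partial>lborel) \<le> (\<integral>\<^sup>+z. ennreal (e0 (x + z)) * ennreal (N d z) \<partial>lborel)"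
    if x: "x \<in> A" and d: "0 < d" "d \<le> 1" for x d
  proof -
    obtain \<phi> :: "'a \<Rightarrow> real" where \<phi>: "smooth \<phi>" "\<And>x. norm x \<ge> R \<Longrightarrow> \<phi> x = 0" "\<And>x. 0 \<le> \<phi> x"
      "\<And>x. laplacian \<phi> x = P d x - N d x"
      unfolding P_def N_def by (rule barrier_exists[OF R d(1)]) blast
    define \<psi> where "\<psi> y = \<phi> (y + - x)" for y
    have \<psi>: "\<psi> \<in> test_functions \<Omega>"
    proof (rule test_functionI[OF _ compact_cball[of x R] A(2)[OF x]])
      show "smooth \<psi>" unfolding \<psi>_def[abs_def] by (rule smooth_translate[OF \<phi>(1)])
      fix y assume "y \<notin> cball x R"
      then show "\<psi> y = 0" unfolding \<psi>_def by (intro \<phi>(2)) (auto simp: dist_norm norm_minus_commute)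
    qed
    have lap: "laplacian \<psi> y = P d (y - x) - N d (y - x)" for y
      unfolding \<psi>_def[abs_def] using laplacian_translate[OF \<phi>(1), of "- x" y] \<phi>(4)[of "y + - x"] by simp
    have ip: "integrable M (\<lambda>y. e0 y * P d (y - x))"
      by (rule Bochner_Integration.integrable_bound[OF integrable_mult_left[OF ie0, of C1]])
         (use e0M C1 d P0 e0(2) in \<open>auto intro!: AE_I2 borel_measurable_times borel_measurable_M mult_left_mono simp: abs_mult\<close>)
    have iN: "integrable M (\<lambda>y. e0 y * N d (y - x))"
    proof (rule Bochner_Integration.integrable_bound[OF integrable_mult_left[OF ie0, of "CN d"]])
      have "0 \<le> CN d" by (simp add: CN_def)
      then show "AE y in M. norm (e0 y * N d (y - x)) \<le> norm (e0 y * CN d)"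
        using N_le[OF d(1)] N0 e0(2) by (auto intro!: AE_I2 mult_left_mono simp: abs_mult)
    qed (use e0M in \<open>auto intro!: borel_measurable_times borel_measurable_M\<close>)
    have "l2_inner \<Omega> e (laplacian \<psi>) \<le> 0"
      by (rule superharmonic_weak[OF \<alpha> l e eig \<psi>]) (auto simp: \<psi>_def \<phi>(3))
    also have "l2_inner \<Omega> e (laplacian \<psi>) = (\<integral>y. e0 y * (P d (y - x) - N d (y - x)) \<partial>M)"
      unfolding l2_inner_def lap inner_real_def
    proof (rule integral_cong_AE)
      have q: "(\<lambda>y. P d (y - x) - N d (y - x)) \<in> borel_measurable M" by (rule borel_measurable_M) measurable
      show "(\<lambda>y. e y * (P d (y - x) - N d (y - x))) \<in> borel_measurable M"
        "(\<lambda>y. e0 y * (P d (y - x) - N d (y - x))) \<in> borel_measurable M"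
        by (intro borel_measurable_times q e0M L2_measurable[OF H10_L2[OF e(1)]])+
      show "AE y in M. e y * (P d (y - x) - N d (y - x)) = e0 y * (P d (y - x) - N d (y - x))"
        using e0(4) by eventually_elim simp
    qed
    also have "\<dots> = (\<integral>y. e0 y * P d (y - x) \<partial>M) - (\<integral>y. e0 y * N d (y - x) \<partial>M)"
      using ip iN by (simp add: right_diff_distrib)
    finally have "(\<integral>y. e0 y * P d (y - x) \<partial>M) \<le> (\<integral>y. e0 y * N d (y - x) \<partial>M)" by simp
    note le = this
    have conv: "ennreal (\<integral>y. e0 y * f (y - x) \<partial>M) = (\<integral>\<^sup>+z. ennreal (e0 (x + z)) * ennreal (f z) \<partial>lborel)"
      if i: "integrable M (\<lambda>y. e0 y * f (y - x))" and f[measurable]: "f \<in> borel_measurable borel" and f0: "\<And>z. 0 \<le> f z"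
      for f :: "'a \<Rightarrow> real"
    proof -
      have "ennreal (\<integral>y. e0 y * f (y - x) \<partial>M) = (\<integral>\<^sup>+y. ennreal (e0 y * f (y - x)) \<partial>M)"
        using i e0(2) f0 by (intro nn_integral_eq_integral[symmetric]) auto
      also have "\<dots> = (\<integral>\<^sup>+y. ennreal (e0 y * f (y - x)) * indicator \<Omega> y \<partial>lborel)"
        by (rule nn_integral_M_eq_lborel) measurable
      also have "\<dots> = (\<integral>\<^sup>+y. ennreal (e0 y * f (y - x)) \<partial>lborel)"
        using e0(3) by (intro nn_integral_cong) (auto simp: indicator_def)
      also have "\<dots> = (\<integral>\<^sup>+z. ennreal (e0 (z + x) * f (z + x - x)) \<partial>lborel)"
        by (rule nn_integral_lborel_translate[of "\<lambda>y. ennreal (e0 y * f (y - x))" x, symmetric]) measurable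
      also have "\<dots> = (\<integral>\<^sup>+z. ennreal (e0 (x + z)) * ennreal (f z) \<partial>lborel)"
        by (simp add: ennreal_mult e0(2) f0 add.commute)
      finally show ?thesis .
    qed
    have cP: "ennreal (\<integral>y. e0 y * P d (y - x) \<partial>M) = (\<integral>\<^sup>+z. ennreal (e0 (x + z)) * ennreal (P d z) \<partial>lborel)"
      by (rule conv[OF ip _ P0]) measurable
    have cN: "ennreal (\<integral>y. e0 y * N d (y - x) \<partial>M) = (\<integral>\<^sup>+z. ennreal (e0 (x + z)) * ennreal (N d z) \<partial>lborel)"
      by (rule conv[OF iN _ N0]) measurable
    show ?thesis unfolding cP[symmetric] cN[symmetric] by (rule ennreal_leI[OF le])
  qed

  define E where "E z = (\<integral>\<^sup>+x. ennreal (e0 (x + z)) * indicator A x \<partial>lborel)" for z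
  have [measurable]: "E \<in> borel_measurable borel" unfolding E_def by measurable
  have swap: "(\<integral>\<^sup>+z. ennreal (f z) * E z \<partial>lborel)
      = (\<integral>\<^sup>+x. (\<integral>\<^sup>+z. ennreal (e0 (x + z)) * ennreal (f z) \<partial>lborel) * indicator A x \<partial>lborel)"
    if f[measurable]: "f \<in> borel_measurable borel" for f :: "'a \<Rightarrow> real"
  proof -
    have "(\<integral>\<^sup>+z. ennreal (f z) * E z \<partial>lborel) = (\<integral>\<^sup>+z. (\<integral>\<^sup>+x. ennreal (f z) * (ennreal (e0 (x + z)) * indicator A x) \<partial>lborel) \<partial>lborel)"
      unfolding E_def by (intro nn_integral_cong nn_integral_cmult[symmetric]) measurable
    also have "\<dots> = (\<integral>\<^sup>+x. (\<integral>\<^sup>+z. ennreal (f z) * (ennreal (e0 (x + z)) * indicator A x) \<partial>lborel) \<partial>lborel)"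
      by (rule lborel_pair.Fubini') measurable
    also have "\<dots> = (\<integral>\<^sup>+x. (\<integral>\<^sup>+z. (ennreal (e0 (x + z)) * ennreal (f z)) * indicator A x \<partial>lborel) \<partial>lborel)"
      by (simp add: ac_simps)
    also have "\<dots> = (\<integral>\<^sup>+x. (\<integral>\<^sup>+z. ennreal (e0 (x + z)) * ennreal (f z) \<partial>lborel) * indicator A x \<partial>lborel)"
      by (intro nn_integral_cong nn_integral_multc) measurable
    finally show ?thesis .
  qed
  have PN: "(\<integral>\<^sup>+z. ennreal (P d z) * E z \<partial>lborel) \<le> (\<integral>\<^sup>+z. ennreal (N d z) * E z \<partial>lborel)" if "0 < d" "d \<le> 1" for d
  proof -
    have "(\<integral>\<^sup>+x. (\<integral>\<^sup>+z. ennreal (e0 (x + z)) * ennreal (P d z) \<partial>lborel) * indicator A x \<partial>lborel)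
      \<le> (\<integral>\<^sup>+x. (\<integral>\<^sup>+z. ennreal (e0 (x + z)) * ennreal (N d z) \<partial>lborel) * indicator A x \<partial>lborel)"
      using pw that by (intro nn_integral_mono) (auto simp: indicator_def)
    then show ?thesis by (simp add: swap)
  qed

  define I0 where "I0 = (\<integral>y. e0 y \<partial>M)"
  have I0: "I0 \<ge> 0" unfolding I0_def by (rule integral_nonneg_AE) (simp add: e0(2))
  have E_le: "E z \<le> ennreal I0" for z
  proof -
    have "E z \<le> (\<integral>\<^sup>+x. ennreal (e0 (x + z)) \<partial>lborel)"
      unfolding E_def by (intro nn_integral_mono) (auto simp: indicator_def)
    also have "\<dots> = (\<integral>\<^sup>+x. ennreal (e0 x) \<partial>lborel)"
      by (rule nn_integral_lborel_translate[of "\<lambda>x. ennreal (e0 x)"]) measurable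
    also have "\<dots> = (\<integral>\<^sup>+x. ennreal (e0 x) * indicator \<Omega> x \<partial>lborel)"
      using e0(3) by (intro nn_integral_cong) (auto simp: indicator_def)
    also have "\<dots> = (\<integral>\<^sup>+x. ennreal (e0 x) \<partial>M)" by (rule nn_integral_M_eq_lborel[symmetric]) measurable
    also have "\<dots> = ennreal I0" unfolding I0_def using ie0 e0(2) by (intro nn_integral_eq_integral) auto
    finally show ?thesis .
  qed
  define C2 where "C2 = measure lebesgue \<Omega> + 3 * (l2_norm \<Omega> (wgrad \<Omega> e))\<^sup>2"
  have C2: "C2 \<ge> 0" by (simp add: C2_def)
  have AO: "A \<subseteq> \<Omega>" using A(2) R by fastforce
  have emA: "emeasure lborel A \<le> ennreal (measure lebesgue \<Omega>)"
  proof -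
    have "emeasure lborel A \<le> emeasure lborel \<Omega>" using AO open_dom by (intro emeasure_mono) auto
    also have "\<dots> = emeasure lebesgue \<Omega>" using open_dom by (simp add: emeasure_completion)
    also have "\<dots> = ennreal (measure lebesgue \<Omega>)" using dom_lmeasurable by (simp add: emeasure_eq_measure2)
    finally show ?thesis .
  qed
  \<comment> \<open>On \<open>A\<close> the value \<open>e0 (x + z)\<close> is an increment, and t
    \<le> k + t^2 / k balances the volume of \<open>A\<close> against the translation estimate: both
    terms become of order \<open>k\<close>, with joint constant \<open>C2\<close>.\<close>
  have E_small: "E z \<le> ennreal (k * C2)" if k: "k > 0" and z: "norm z \<le> k" for z k
  proof -
    have "E z \<le> (\<integral>\<^sup>+x. ennreal k * indicator A x + ennreal (1 / k) * ennreal ((e0 (x + z) - e0 x)\<^sup>2) \<partial>lborel)"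
      unfolding E_def
    proof (intro nn_integral_mono)
      fix x
      show "ennreal (e0 (x + z)) * indicator A x \<le> ennreal k * indicator A x + ennreal (1 / k) * ennreal ((e0 (x + z) - e0 x)\<^sup>2)"
      proof (cases "x \<in> A")
        case True
        have t: "t \<le> k + 1 / k * t\<^sup>2" for t :: real
        proof -
          have "2 * (k * t) \<le> k * k + t\<^sup>2"
            using zero_le_power2[of "t - k"] by (simp add: power2_eq_square algebra_simps)
          moreover have "0 \<le> k * k + t\<^sup>2" using k by simp
          ultimately have "k * t \<le> k * k + t\<^sup>2" by linarith
          then have "t \<le> (k * k + t\<^sup>2) / k" using k by (simp add: le_divide_eq mult.commute)
          then show ?thesis using k by (simp add: add_divide_distrib)
        qed
        have "ennreal (e0 (x + z)) \<le> ennreal (k + 1 / k * (e0 (x + z))\<^sup>2)" by (intro ennreal_leI t)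
        also have "\<dots> = ennreal k + ennreal (1 / k) * ennreal ((e0 (x + z) - e0 x)\<^sup>2)"
          using k A(3)[OF True] by (simp add: ennreal_mult[symmetric] ennreal_plus[symmetric] del: ennreal_plus)
        finally show ?thesis using True by simp
      qed simp
    qed
    also have "\<dots> = ennreal k * emeasure lborel A + ennreal (1 / k) * (\<integral>\<^sup>+x. ennreal ((e0 (x + z) - e0 x)\<^sup>2) \<partial>lborel)"
      by (simp add: nn_integral_add nn_integral_cmult nn_integral_cmult_indicator)
    also have "\<dots> \<le> ennreal k * ennreal (measure lebesgue \<Omega>) + ennreal (1 / k) * ennreal (3 * k\<^sup>2 * (l2_norm \<Omega> (wgrad \<Omega> e))\<^sup>2)"
    proof (intro add_mono mult_left_mono emA)
      have "(\<integral>\<^sup>+x. ennreal ((e0 (x + z) - e0 x)\<^sup>2) \<partial>lborel) \<le> ennreal (3 * (norm z)\<^sup>2 * (l2_norm \<Omega> (wgrad \<Omega> e))\<^sup>2)"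
        by (rule H10_translation_nn[OF e(1) e0(1,3,4)])
      also have "\<dots> \<le> ennreal (3 * k\<^sup>2 * (l2_norm \<Omega> (wgrad \<Omega> e))\<^sup>2)"
        using z k by (intro ennreal_leI mult_right_mono mult_left_mono power_mono) auto
      finally show "(\<integral>\<^sup>+x. ennreal ((e0 (x + z) - e0 x)\<^sup>2) \<partial>lborel) \<le> ennreal (3 * k\<^sup>2 * (l2_norm \<Omega> (wgrad \<Omega> e))\<^sup>2)" .
    qed auto
    also have "\<dots> = ennreal (k * measure lebesgue \<Omega> + 1 / k * (3 * k\<^sup>2 * (l2_norm \<Omega> (wgrad \<Omega> e))\<^sup>2))"
      using k by (simp add: ennreal_mult[symmetric] ennreal_plus[symmetric] del: ennreal_plus)
    also have "k * measure lebesgue \<Omega> + 1 / k * (3 * k\<^sup>2 * (l2_norm \<Omega> (wgrad \<Omega> e))\<^sup>2) = k * C2"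
      using k by (simp add: C2_def power2_eq_square algebra_simps)
    finally show ?thesis .
  qed

  \<comment> \<open>Split at \<open>norm z = k\<close>: inside, \<open>E\<close> is of order
    \<open>k\<close> and \<open>N d\<close> has bounded mass; outside, \<open>N d\<close> is of
    order d^2 and \<open>E\<close> is at most the integral of \<open>e0\<close>.\<close>
  have J: "(\<integral>\<^sup>+z. ennreal (P 1 z) * E z \<partial>lborel) \<le> ennreal (k * C2 * (C1 * V) + B * d\<^sup>2 * (I0 * V))"
    if k: "k > 0" and d: "0 < d" "d \<le> 1" and B: "B = 2 * real ?n * (k\<^sup>2) powr (- real ?n / 2) / k\<^sup>2" for k d B
  proof -
    have B0: "B \<ge> 0" unfolding B by simp
    have "(\<integral>\<^sup>+z. ennreal (P 1 z) * E z \<partial>lborel) \<le> (\<integral>\<^sup>+z. ennreal (P d z) * E z \<partial>lborel)"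
      unfolding P_def by (intro nn_integral_mono mult_right_mono ennreal_leI lap_pos_ge d) auto
    also have "\<dots> \<le> (\<integral>\<^sup>+z. ennreal (N d z) * E z \<partial>lborel)" by (rule PN[OF d])
    also have "\<dots> \<le> (\<integral>\<^sup>+z. ennreal (k * C2) * ennreal (N d z) + ennreal (B * d\<^sup>2 * I0) * indicator (cball 0 R) z \<partial>lborel)"
    proof (intro nn_integral_mono)
      fix z
      show "ennreal (N d z) * E z \<le> ennreal (k * C2) * ennreal (N d z) + ennreal (B * d\<^sup>2 * I0) * indicator (cball 0 R) z"
      proof (cases "norm z \<le> k")
        case True
        have "ennreal (N d z) * E z \<le> ennreal (N d z) * ennreal (k * C2)" by (intro mult_left_mono E_small k True) simp
        then show ?thesis by (simp add: mult.commute add_increasing2)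
      next
        case False
        show ?thesis
        proof (cases "norm z \<ge> R")
          case True then show ?thesis by (simp add: out)
        next
          case R: False
          have "k\<^sup>2 \<le> (norm z)\<^sup>2" using False k by (intro power_mono) auto
          then have "N d z \<le> B * d\<^sup>2" unfolding N_def B using k by (intro lap_neg_le d) auto
          then have "ennreal (N d z) * E z \<le> ennreal (B * d\<^sup>2) * ennreal I0" by (intro mult_mono ennreal_leI E_le) auto
          also have "\<dots> = ennreal (B * d\<^sup>2 * I0)" using B0 I0 by (simp add: ennreal_mult)
          finally show ?thesis using R by (simp add: add_increasing)
        qed
      qed
    qed
    also have "\<dots> = ennreal (k * C2) * (\<integral>\<^sup>+z. ennreal (N d z) \<partial>lborel) + ennreal (B * d\<^sup>2 * I0) * ennreal V"
    proof -
      have "(\<integral>\<^sup>+z. ennreal (k * C2) * ennreal (N d z) + ennreal (B * d\<^sup>2 * I0) * indicator (cball 0 R) z \<partial>lborel)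
        = (\<integral>\<^sup>+z. ennreal (k * C2) * ennreal (N d z) \<partial>lborel) + (\<integral>\<^sup>+z. ennreal (B * d\<^sup>2 * I0) * indicator (cball (0::'a) R) z \<partial>lborel)"
        by (rule nn_integral_add) auto
      also have "(\<integral>\<^sup>+z. ennreal (k * C2) * ennreal (N d z) \<partial>lborel) = ennreal (k * C2) * (\<integral>\<^sup>+z. ennreal (N d z) \<partial>lborel)"
        by (rule nn_integral_cmult) auto
      also have "(\<integral>\<^sup>+z. ennreal (B * d\<^sup>2 * I0) * indicator (cball (0::'a) R) z \<partial>lborel) = ennreal (B * d\<^sup>2 * I0) * ennreal V"
        unfolding V(1)[symmetric] by (rule nn_integral_cmult_indicator) auto
      finally show ?thesis .
    qed
    also have "\<dots> \<le> ennreal (k * C2) * ennreal (C1 * V) + ennreal (B * d\<^sup>2 * I0) * ennreal V"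
      by (intro add_right_mono mult_left_mono mass d) simp
    also have "\<dots> = ennreal (k * C2 * (C1 * V) + B * d\<^sup>2 * (I0 * V))"
    proof -
      have "ennreal (k * C2) * ennreal (C1 * V) = ennreal (k * C2 * (C1 * V))"
        using k C2 C1(1) V(2) by (intro ennreal_mult[symmetric] mult_nonneg_nonneg) auto
      moreover have "ennreal (B * d\<^sup>2 * I0) * ennreal V = ennreal (B * d\<^sup>2 * (I0 * V))"
        using B0 I0 V(2) by (subst ennreal_mult[symmetric]) (auto simp: mult.assoc)
      ultimately show ?thesis using k C2 C1(1) V(2) B0 I0
        by (simp only:) (intro ennreal_plus[symmetric] mult_nonneg_nonneg; simp)
    qed
    finally show ?thesis .
  qed
  have "(\<integral>\<^sup>+z. ennreal (P 1 z) * E z \<partial>lborel) \<le> ennreal t" if t: "t > 0" for t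
  proof -
    \<comment> \<open>\<open>k\<close> is fixed first and bounds the inner part by t/2;
      \<open>B\<close> depends on \<open>k\<close>, and \<open>d\<close> is then taken small for
      that \<open>B\<close>. Smallness of first order in \<open>d\<close> is enough since d^2 \<le>
      d.\<close>
    define k where "k = t / (2 * (C2 * (C1 * V) + 1))"
    have c: "C2 * (C1 * V) \<ge> 0" using C2 C1(1) V(2) by simp
    have k: "k > 0" using t c by (simp add: k_def add_nonneg_pos)
    define B where "B = 2 * real ?n * (k\<^sup>2) powr (- real ?n / 2) / k\<^sup>2"
    have B0: "B \<ge> 0" unfolding B_def by simp
    define d where "d = min 1 (t / (2 * (B * (I0 * V) + 1)))"
    have c': "B * (I0 * V) \<ge> 0" using B0 I0 V(2) by simp
    have d: "0 < d" "d \<le> 1" using t c' by (auto simp: d_def add_nonneg_pos)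
    have "k * C2 * (C1 * V) = t / 2 * (C2 * (C1 * V) / (C2 * (C1 * V) + 1))" by (simp add: k_def)
    also have "\<dots> \<le> t / 2 * 1" using c t by (intro mult_left_mono) (auto simp: divide_le_eq)
    finally have 1: "k * C2 * (C1 * V) \<le> t / 2" by simp
    have "B * d\<^sup>2 * (I0 * V) = d * (d * (B * (I0 * V)))" by (simp add: power2_eq_square mult_ac)
    also have "\<dots> \<le> 1 * (d * (B * (I0 * V)))" using d c' by (intro mult_right_mono) auto
    also have "\<dots> \<le> t / (2 * (B * (I0 * V) + 1)) * (B * (I0 * V))"
      using c' by (simp only: mult_1_left) (intro mult_right_mono, auto simp: d_def)
    also have "\<dots> = t / 2 * (B * (I0 * V) / (B * (I0 * V) + 1))" by simp
    also have "\<dots> \<le> t / 2 * 1" using c' t by (intro mult_left_mono) (auto simp: divide_le_eq)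
    finally have 2: "B * d\<^sup>2 * (I0 * V) \<le> t / 2" by simp
    have "k * C2 * (C1 * V) + B * d\<^sup>2 * (I0 * V) \<le> t" using 1 2 by linarith
    then show ?thesis using J[OF k d B_def] order_trans ennreal_leI by blast
  qed
  then have "(\<integral>\<^sup>+z. ennreal (P 1 z) * E z \<partial>lborel) = 0"
    by (metis (no_types) ennreal_zero_less_one ennreal_less_zero_iff ennreal_le_epsilon add_0 le_zero_eq zero_less_iff_neq_zero)
  then have "AE z in lborel. ennreal (P 1 z) * E z = 0" by (subst (asm) nn_integral_0_iff_AE) auto
  \<comment> \<open>\<open>P 1\<close> is positive inside the ball except at its centre, so it may
    be exchanged for the indicator.\<close>
  then have "AE z in lborel. ennreal (indicator (ball 0 R) z) * E z = 0"
    using AE_lborel_singleton[of 0]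
  proof eventually_elim
    case (elim z)
    show ?case
    proof (cases "z \<in> ball 0 R")
      case True
      then have "0 < (norm z)\<^sup>2" "(norm z)\<^sup>2 < R\<^sup>2" using elim(2) by (auto intro!: power_strict_mono)
      then have "0 < P 1 z" unfolding P_def by (rule lap_pos_pos) (rule n)
      then show ?thesis using elim(1) by auto
    qed simp
  qed
  then have "(\<integral>\<^sup>+z. ennreal (indicator (ball 0 R) z) * E z \<partial>lborel) = 0" by (subst nn_integral_0_iff_AE) auto
  then have "(\<integral>\<^sup>+x. (\<integral>\<^sup>+z. ennreal (e0 (x + z)) * ennreal (indicator (ball 0 R) z) \<partial>lborel) * indicator A x \<partial>lborel) = 0"
    by (subst (asm) swap) auto
  then have ae: "AE x in lborel. (\<integral>\<^sup>+z. ennreal (e0 (x + z)) * ennreal (indicator (ball 0 R) z) \<partial>lborel) * indicator A x = 0"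
    by (subst (asm) nn_integral_0_iff_AE) auto
  have "\<exists>x\<in>A. (\<integral>\<^sup>+z. ennreal (e0 (x + z)) * ennreal (indicator (ball 0 R) z) \<partial>lborel) = 0"
  proof (rule ccontr)
    assume "\<not> ?thesis"
    then have "AE x in lborel. x \<notin> A" using ae by (auto elim!: eventually_mono simp: indicator_def split: if_splits)
    then have "A \<in> null_sets lborel" using A(1) by (simp add: AE_iff_null_sets)
    then show False using pos by auto
  qed
  then obtain x where x: "x \<in> A" "(\<integral>\<^sup>+z. ennreal (e0 (x + z)) * ennreal (indicator (ball 0 R) z) \<partial>lborel) = 0" by blast
  have "(\<integral>\<^sup>+y. ennreal (e0 y) * ennreal (indicator (ball 0 R) (y - x)) \<partial>lborel)
      = (\<integral>\<^sup>+z. ennreal (e0 (z + x)) * ennreal (indicator (ball 0 R) (z + x - x)) \<partial>lborel)"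
    by (rule nn_integral_lborel_translate[of "\<lambda>y. ennreal (e0 y) * ennreal (indicator (ball 0 R) (y - x))" x, symmetric]) measurable
  also have "\<dots> = 0" using x(2) by (simp add: add.commute)
  finally have "AE y in lborel. ennreal (e0 y) * ennreal (indicator (ball 0 R) (y - x)) = 0"
    by (subst (asm) nn_integral_0_iff_AE) auto
  then have "AE y in lborel. y \<in> ball x R \<longrightarrow> e0 y = 0"
  proof eventually_elim
    case (elim y)
    show ?case
    proof
      assume "y \<in> ball x R"
      then have "y - x \<in> ball 0 R" by (simp add: dist_norm norm_minus_commute)
      then have "ennreal (e0 y) = 0" using elim by simp
      then show "e0 y = 0" using e0(2)[of y] by simp
    qed
  qed
  then show ?thesis using that x(1) by blast
qed

text \<open>\<open>Z\<close> consists of the points near which \<open>e\<close> vanishes. By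
  \<open>zero_spreads\<close>, a zero set of positive measure near a point puts that point into
  \<open>Z\<close>, so \<open>Z\<close> and its complement are both open and connectedness leaves
  two cases.\<close>

theorem strong_maximum:
  assumes con: "connected \<Omega>" and \<alpha>: "\<alpha> > 0" and l: "0 \<le> l" and e: "e \<in> H10 \<Omega>" "AE x in M. 0 \<le> e x"
    and eig: "\<And>\<phi>. \<phi> \<in> H10 \<Omega> \<Longrightarrow> energy \<alpha> l e \<phi> = 0"
  shows "(AE x in M. e x = 0) \<or> (AE x in M. 0 < e x)"
proof -
  obtain e0 where e0: "e0 \<in> borel_measurable borel" "\<And>x. 0 \<le> e0 x" "\<And>x. x \<notin> \<Omega> \<Longrightarrow> e0 x = 0" "AE x in M. e0 x = e x"
    using borel_representative[OF L2_measurable[OF H10_L2[OF e(1)]] e(2)] by blast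
  note [measurable] = e0(1)
  define Z where "Z = {y \<in> \<Omega>. \<exists>r>0. AE z in lborel. z \<in> ball y r \<longrightarrow> e0 z = 0}"
  \<comment> \<open>For \<open>x\<close> within R/2 of \<open>y\<close>, the closed ball of radius
    \<open>R\<close> about \<open>x\<close> still lies in the domain, and the open one already
    covers the ball of radius R/2 about \<open>y\<close>.\<close>
  have key: "y \<in> Z" if y: "y \<in> \<Omega>" and R: "R > 0" "cball y (2 * R) \<subseteq> \<Omega>"
    and pos: "emeasure lborel ({x. e0 x = 0} \<inter> ball y (R / 2)) > 0" for y R
  proof -
    obtain x where x: "x \<in> {x. e0 x = 0} \<inter> ball y (R / 2)" "AE z in lborel. z \<in> ball x R \<longrightarrow> e0 z = 0"
    proof (rule zero_spreads[OF \<alpha> l e eig e0 R(1) _ _ _ pos])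
      show "{x. e0 x = 0} \<inter> ball y (R / 2) \<in> sets borel" by measurable
      fix x assume x: "x \<in> {x. e0 x = 0} \<inter> ball y (R / 2)"
      then show "e0 x = 0" by simp
      have "cball x R \<subseteq> cball y (2 * R)"
      proof
        fix z assume "z \<in> cball x R"
        then show "z \<in> cball y (2 * R)" using x dist_triangle[of y z x] R(1) by auto
      qed
      then show "cball x R \<subseteq> \<Omega>" using R(2) by blast
    qed
    have "ball y (R / 2) \<subseteq> ball x R"
    proof
      fix z assume "z \<in> ball y (R / 2)"
      then show "z \<in> ball x R" using x(1) dist_triangle[of x z y] by (auto simp: dist_commute)
    qed
    then have "AE z in lborel. z \<in> ball y (R / 2) \<longrightarrow> e0 z = 0" using x(2) by (auto elim!: eventually_mono)
    then show ?thesis using y R(1) by (auto simp: Z_def intro!: exI[of _ "R / 2"])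
  qed
  have radius: "\<exists>R>0. cball y (2 * R) \<subseteq> \<Omega>" if y: "y \<in> \<Omega>" for y
  proof -
    obtain r where r: "r > 0" "cball y r \<subseteq> \<Omega>" using open_contains_cball_eq[OF open_dom, rule_format, of y] y by auto
    have "cball y (2 * (r / 2)) \<subseteq> \<Omega>" using r(2) by simp
    then show ?thesis using r(1) half_gt_zero by blast
  qed
  have openZ: "open Z"
  proof (rule openI)
    fix y assume "y \<in> Z"
    then obtain r where r: "y \<in> \<Omega>" "r > 0" "AE z in lborel. z \<in> ball y r \<longrightarrow> e0 z = 0" by (auto simp: Z_def)
    obtain s where s: "s > 0" "ball y s \<subseteq> \<Omega>" using openE[OF open_dom r(1)] by auto
    have "ball y (min s r) \<subseteq> Z"
    proof
      fix x assume x: "x \<in> ball y (min s r)"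
      then have "x \<in> \<Omega>" using s by auto
      moreover have "ball x (r - dist y x) \<subseteq> ball y r"
      proof
        fix z assume "z \<in> ball x (r - dist y x)"
        then show "z \<in> ball y r" using dist_triangle[of y z x] by auto
      qed
      then have "AE z in lborel. z \<in> ball x (r - dist y x) \<longrightarrow> e0 z = 0" using r(3) by (auto elim!: eventually_mono)
      moreover have "r - dist y x > 0" using x by auto
      ultimately show "x \<in> Z" by (auto simp: Z_def intro!: exI[of _ "r - dist y x"])
    qed
    then show "\<exists>e>0. ball y e \<subseteq> Z" using r s by (intro exI[of _ "min s r"]) auto
  qed
  have openU: "open (\<Omega> - Z)"
  proof (rule openI)
    fix y assume y: "y \<in> \<Omega> - Z"
    then obtain R where R: "R > 0" "cball y (2 * R) \<subseteq> \<Omega>" using radius by blast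
    have "ball y (R / 2) \<subseteq> \<Omega> - Z"
    proof
      fix x assume x: "x \<in> ball y (R / 2)"
      have "x \<in> cball y (2 * R)" using x R(1) by auto
      then have "x \<in> \<Omega>" using R(2) by blast
      \<comment> \<open>A point of \<open>Z\<close> in this ball would give the zero set positive
        measure near \<open>y\<close>, and \<open>key\<close> would put \<open>y\<close> into
        \<open>Z\<close>.\<close>
      moreover have "x \<notin> Z"
      proof
        assume "x \<in> Z"
        then obtain r where r: "r > 0" "AE z in lborel. z \<in> ball x r \<longrightarrow> e0 z = 0" by (auto simp: Z_def)
        define S where "S = ball x r \<inter> ball y (R / 2)"
        have "x \<in> S" using x r by (simp add: S_def)
        then have "emeasure lborel S > 0" by (intro emeasure_lborel_open_pos) (unfold S_def, blast+)
        also have "emeasure lborel S \<le> emeasure lborel ({x. e0 x = 0} \<inter> ball y (R / 2))"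
          by (rule emeasure_mono_AE) (use r(2) in \<open>auto simp: S_def elim!: eventually_mono\<close>)
        finally show False using key[OF _ R] y by blast
      qed
      ultimately show "x \<in> \<Omega> - Z" by blast
    qed
    then show "\<exists>e>0. ball y e \<subseteq> \<Omega> - Z" using R(1) by (intro exI[of _ "R / 2"]) auto
  qed
  have "Z \<inter> \<Omega> = {} \<or> (\<Omega> - Z) \<inter> \<Omega> = {}"
    by (rule connectedD[OF con openZ openU]) (auto simp: Z_def)
  then show ?thesis
  proof
    assume Z: "Z \<inter> \<Omega> = {}"
    have "AE z in lborel. z \<in> \<Omega> \<longrightarrow> e0 z \<noteq> 0"
    proof (rule AE_locally_imp_AE)
      fix y assume y: "y \<in> \<Omega>"
      then obtain R where R: "R > 0" "cball y (2 * R) \<subseteq> \<Omega>" using radius by blast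
      have "\<not> emeasure lborel ({x. e0 x = 0} \<inter> ball y (R / 2)) > 0" using key[OF y R] y Z by blast
      then have "{x. e0 x = 0} \<inter> ball y (R / 2) \<in> null_sets lborel" by (auto simp: null_sets_def zero_less_iff_neq_zero)
      then have "AE z in lborel. z \<notin> {x. e0 x = 0} \<inter> ball y (R / 2)" by (rule AE_not_in)
      then show "\<exists>r>0. AE z in lborel. z \<in> ball y r \<longrightarrow> e0 z \<noteq> 0"
        using R(1) by (intro exI[of _ "R / 2"]) (auto elim!: eventually_mono)
    qed
    from AE_completion[OF this] have "AE z in M. e0 z \<noteq> 0" by (simp add: AE_M_iff)
    then have "AE z in M. 0 < e z" using e0(4)
    proof eventually_elim
      case (elim z) then show ?case using e0(2)[of z] by simp
    qed
    then show ?thesis ..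
  next
    assume "(\<Omega> - Z) \<inter> \<Omega> = {}"
    then have "AE z in lborel. z \<in> \<Omega> \<longrightarrow> e0 z = 0" by (intro AE_locally_imp_AE) (auto simp: Z_def)
    from AE_completion[OF this] have "AE z in M. e0 z = 0" by (simp add: AE_M_iff)
    then have "AE z in M. e z = 0" using e0(4) by eventually_elim simp
    then show ?thesis ..
  qed
qed

text \<open>|w| + w is a nonnegative null vector. If it is positive almost everywhere then so is
  \<open>w\<close>; if it vanishes then w \<le> 0. Either way \<open>w\<close> has one sign, and
  orthogonality to the positive \<open>u0\<close> forces it to vanish.\<close>

theorem first_eigenvalue_simple:
  assumes con: "connected \<Omega>" and \<alpha>: "\<alpha> > 0" and l: "0 \<le> l"
    and nonneg: "\<And>u. u \<in> H10 \<Omega> \<Longrightarrow> 0 \<le> energy \<alpha> l u u"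
    and u0: "u0 \<in> L2 \<Omega>" "AE x in M. 0 < u0 x"
    and w: "w \<in> H10 \<Omega>" "energy \<alpha> l w w = 0" "l2_inner \<Omega> w u0 = 0"
  shows "l2_norm \<Omega> w = 0"
proof -
  obtain v where v: "v \<in> H10 \<Omega>" "energy \<alpha> l v v = 0" "AE x in M. v x = \<bar>w x\<bar>"
    using abs_minimiser[OF \<alpha> nonneg w(1,2)] by blast
  define e where "e x = v x + 1 * w x" for x
  have e: "e \<in> H10 \<Omega>" unfolding e_def[abs_def] by (rule H10_lin(1)[OF v(1) w(1)])
  have eig: "energy \<alpha> l e \<phi> = 0" if "\<phi> \<in> H10 \<Omega>" for \<phi>
    unfolding e_def[abs_def] energy_lin_left[OF v(1) w(1) that]
    using energy_zero_orthogonal[OF nonneg v(1,2) that] energy_zero_orthogonal[OF nonneg w(1,2) that] by simp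
  have e_eq: "AE x in M. e x = \<bar>w x\<bar> + w x" using v(3) by eventually_elim (simp add: e_def)
  then have e_nn: "AE x in M. 0 \<le> e x" by eventually_elim simp
  have int: "integrable M (\<lambda>x. w x * u0 x)" by (rule L2_mult_integrable[OF H10_L2[OF w(1)] u0(1)])
  have w0: "(\<integral>x. w x * u0 x \<partial>M) = 0" using w(3) by (simp add: l2_inner_def)
  have "AE x in M. w x * u0 x = 0"
    using strong_maximum[OF con \<alpha> l e e_nn eig]
  proof
    assume "AE x in M. 0 < e x"
    then have "AE x in M. 0 \<le> w x * u0 x"
      using e_eq u0(2) by eventually_elim auto
    then show ?thesis using integral_nonneg_eq_0_iff_AE[OF int] w0 by simp
  next
    assume "AE x in M. e x = 0"
    then have nn: "AE x in M. 0 \<le> - (w x * u0 x)"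
      using e_eq u0(2) by eventually_elim (auto simp: mult_le_0_iff)
    have "AE x in M. - (w x * u0 x) = 0"
      by (rule integral_nonneg_eq_0_iff_AE[THEN iffD1, OF _ nn]) (use int w0 in auto)
    then show ?thesis by simp
  qed
  then have "AE x in M. w x = 0" using u0(2) by eventually_elim auto
  then have "l2_norm \<Omega> w = l2_norm \<Omega> (\<lambda>x. 0 :: real)"
    using L2_measurable[OF H10_L2[OF w(1)]] by (intro l2_norm_cong_AE) auto
  then show ?thesis by (simp add: l2_norm_def l2_inner_def)
qed

end

section \<open>The state equation\<close>

context simple_eigenvalue
begin

definition flux :: "('a \<Rightarrow> real) \<Rightarrow> ('a \<Rightarrow> real) \<Rightarrow> real" where
  "flux \<theta> \<phi> = l2_inner \<Omega> (\<lambda>x. \<theta> x *\<^sub>R wgrad \<Omega> u0 x) (wgrad \<Omega> \<phi>)"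

text \<open>Two-sided, so that it applies to \<theta>, to designs and to their differences
  alike.\<close>

definition bdd1 :: "('a \<Rightarrow> real) \<Rightarrow> bool" where
  "bdd1 \<theta> \<longleftrightarrow> \<theta> \<in> borel_measurable M \<and> (AE x in M. \<bar>\<theta> x\<bar> \<le> 1)"

lemma w0_L2: "wgrad \<Omega> u0 \<in> L2 \<Omega>" by (rule H10_wgrad[OF u0_H10])

lemma bdd1_w0_L2: "bdd1 \<theta> \<Longrightarrow> (\<lambda>x. \<theta> x *\<^sub>R wgrad \<Omega> u0 x) \<in> L2 \<Omega>"
  unfolding bdd1_def using L2_mult_bounded[OF w0_L2] by blast

lemma flux_lin:
  assumes "bdd1 \<theta>" "u \<in> H10 \<Omega>" "v \<in> H10 \<Omega>"
  shows "flux \<theta> (\<lambda>x. u x + c * v x) = flux \<theta> u + c * flux \<theta> v"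
proof -
  note L = bdd1_w0_L2[OF assms(1)]
  have "flux \<theta> (\<lambda>x. u x + c * v x) = l2_inner \<Omega> (wgrad \<Omega> (\<lambda>x. u x + c * v x)) (\<lambda>x. \<theta> x *\<^sub>R wgrad \<Omega> u0 x)"
    by (simp add: flux_def l2_inner_commute)
  also have "\<dots> = l2_inner \<Omega> (\<lambda>x. wgrad \<Omega> u x + c *\<^sub>R wgrad \<Omega> v x) (\<lambda>x. \<theta> x *\<^sub>R wgrad \<Omega> u0 x)"
    using H10_lin[OF assms(2,3), of c] assms L
    by (intro l2_inner_cong_AE L2_measurable L2_add L2_scaleR H10_wgrad) auto
  also have "\<dots> = flux \<theta> u + c * flux \<theta> v"
    unfolding flux_def l2_inner_commute[of \<Omega> "\<lambda>x. \<theta> x *\<^sub>R wgrad \<Omega> u0 x"]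
    by (simp only: l2_inner_add_left[OF H10_wgrad[OF assms(2)] L2_scaleR[OF H10_wgrad[OF assms(3)]] L] l2_inner_scaleR_left)
  finally show ?thesis .
qed

lemma flux_bound:
  assumes "bdd1 \<theta>" "u \<in> H10 \<Omega>"
  shows "\<bar>flux \<theta> u\<bar> \<le> l2_norm \<Omega> (\<lambda>x. \<theta> x *\<^sub>R wgrad \<Omega> u0 x) * l2_norm \<Omega> (wgrad \<Omega> u)"
  unfolding flux_def by (rule l2_Cauchy_Schwarz[OF bdd1_w0_L2[OF assms(1)] H10_wgrad[OF assms(2)]])

lemma bdd1_w0_norm: "bdd1 \<theta> \<Longrightarrow> l2_norm \<Omega> (\<lambda>x. \<theta> x *\<^sub>R wgrad \<Omega> u0 x) \<le> l2_norm \<Omega> (wgrad \<Omega> u0)"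
  by (rule l2_norm_mono[OF bdd1_w0_L2 w0_L2])
     (auto simp: bdd1_def mult_left_le_one_le elim!: eventually_mono)

lemma flux_diff:
  assumes "bdd1 X" "bdd1 \<theta>" "bdd1 (\<lambda>x. X x - \<theta> x)" "u \<in> H10 \<Omega>"
  shows "flux (\<lambda>x. X x - \<theta> x) u = flux X u - flux \<theta> u"
  unfolding flux_def scaleR_diff_left
  by (rule l2_inner_diff_left[OF bdd1_w0_L2[OF assms(1)] bdd1_w0_L2[OF assms(2)] H10_wgrad[OF assms(4)]])

lemma lambda1_eq: "lambda1 \<Omega> \<alpha> u0 \<theta> = \<alpha> * flux \<theta> u0"
  by (simp add: lambda1_def flux_def l2_inner_def power2_norm_eq_inner mult.assoc)

lemma state_solution_iff:
  "state_solution \<Omega> \<alpha> l0 u0 \<theta> v \<longleftrightarrow> v \<in> H10 \<Omega> \<and> l2_inner \<Omega> v u0 = 0 \<and>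
    (\<forall>\<phi>\<in>H10 \<Omega>. energy \<alpha> l0 v \<phi> = \<alpha> * flux \<theta> u0 * l2_inner \<Omega> u0 \<phi> - \<alpha> * flux \<theta> \<phi>)"
  unfolding state_solution_def lambda1_eq energy_def dirichlet_def flux_def
  by (auto simp: l2_inner_def mult.assoc)

lemma u0_inner: "l2_inner \<Omega> u0 u0 = 1" using l2_norm_power2[of \<Omega> u0] u0_norm by simp

text \<open>\<open>lambda1\<close> is exactly the multiplier for which the right-hand side vanishes
  on \<open>u0\<close>, the compatibility condition of \<open>energy_solvable\<close>. Hence the
  \<open>SOME\<close> in \<open>state\<close> denotes a solution.\<close>

lemma state_solution_state:
  assumes "bdd1 \<theta>" shows "state_solution \<Omega> \<alpha> l0 u0 \<theta> (state \<Omega> \<alpha> l0 u0 \<theta>)"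
proof -
  define f where "f \<phi> = \<alpha> * flux \<theta> u0 * l2_inner \<Omega> u0 \<phi> - \<alpha> * flux \<theta> \<phi>" for \<phi>
  define K where "K = \<bar>\<alpha> * flux \<theta> u0\<bar> + \<alpha> * l2_norm \<Omega> (\<lambda>x. \<theta> x *\<^sub>R wgrad \<Omega> u0 x)"
  obtain v where v: "v \<in> H10 \<Omega>" "l2_inner \<Omega> v u0 = 0" "\<And>\<phi>. \<phi> \<in> H10 \<Omega> \<Longrightarrow> energy \<alpha> l0 v \<phi> = f \<phi>"
  proof (rule energy_solvable[of f K])
    show "f (\<lambda>x. u x + c * v x) = f u + c * f v" if "u \<in> H10 \<Omega>" "v \<in> H10 \<Omega>" for u v c
      by (simp add: f_def flux_lin[OF assms that] l2_inner_lin_right[OF H10_L2[OF that(1)] H10_L2[OF that(2)] H10_L2[OF u0_H10]]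
          algebra_simps)
    show "\<bar>f u\<bar> \<le> K * (l2_norm \<Omega> u + l2_norm \<Omega> (wgrad \<Omega> u))" if u: "u \<in> H10 \<Omega>" for u
    proof -
      let ?a = "\<bar>\<alpha> * flux \<theta> u0\<bar>" and ?b = "l2_norm \<Omega> (\<lambda>x. \<theta> x *\<^sub>R wgrad \<Omega> u0 x)"
      have "\<bar>f u\<bar> \<le> ?a * \<bar>l2_inner \<Omega> u0 u\<bar> + \<alpha> * \<bar>flux \<theta> u\<bar>"
        using abs_triangle_ineq4[of "\<alpha> * flux \<theta> u0 * l2_inner \<Omega> u0 u" "\<alpha> * flux \<theta> u"] alpha_pos
        by (simp add: f_def abs_mult)
      also have "\<dots> \<le> ?a * l2_norm \<Omega> u + \<alpha> * (?b * l2_norm \<Omega> (wgrad \<Omega> u))"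
        using l2_Cauchy_Schwarz[OF H10_L2[OF u0_H10] H10_L2[OF u]] flux_bound[OF assms u] alpha_pos
        by (intro add_mono mult_left_mono) (auto simp: u0_norm)
      also have "\<dots> \<le> K * (l2_norm \<Omega> u + l2_norm \<Omega> (wgrad \<Omega> u))"
      proof -
        have "0 \<le> \<alpha> * ?b * l2_norm \<Omega> u" "0 \<le> ?a * l2_norm \<Omega> (wgrad \<Omega> u)"
          using alpha_pos by (auto intro!: mult_nonneg_nonneg l2_norm_nonneg)
        then show ?thesis by (simp add: K_def distrib_left distrib_right mult.assoc)
      qed
      finally show ?thesis .
    qed
    show "f u0 = 0" by (simp add: f_def u0_inner)
  qed blast
  then have "state_solution \<Omega> \<alpha> l0 u0 \<theta> v" by (simp add: state_solution_iff f_def)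
  then show ?thesis unfolding state_def by (rule someI[of "state_solution \<Omega> \<alpha> l0 u0 \<theta>"])
qed

text \<open>A duality argument in place of weak compactness. A subsequence violating the claim
  clusters in \<open>L2\<close> around one of its members \<open>h\<close>; solving the equation
  with right-hand side \<open>h\<close> turns the pairing with \<open>h\<close> into an energy
  pairing, which tends to zero, so the norms become too small.\<close>

lemma l2_vanishing:
  assumes w: "\<And>n. w n \<in> H10 \<Omega>" "\<And>n. l2_inner \<Omega> (w n) u0 = 0"
    and C: "\<And>n. l2_norm \<Omega> (w n) + l2_norm \<Omega> (wgrad \<Omega> (w n)) \<le> C"
    and lim: "\<And>\<phi>. \<phi> \<in> H10 \<Omega> \<Longrightarrow> (\<lambda>n. energy \<alpha> l0 (w n) \<phi>) \<longlonglongrightarrow> 0"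
  shows "(\<lambda>n. l2_norm \<Omega> (w n)) \<longlonglongrightarrow> 0"
proof (rule ccontr)
  assume "\<not> (\<lambda>n. l2_norm \<Omega> (w n)) \<longlonglongrightarrow> 0"
  then obtain e where e: "e > 0" "\<And>N. \<exists>n\<ge>N. l2_norm \<Omega> (w n) \<ge> e"
    unfolding lim_sequentially by (auto simp: dist_real_def l2_norm_nonneg not_less)
  have "infinite {n. l2_norm \<Omega> (w n) \<ge> e}"
    unfolding infinite_nat_iff_unbounded_le using e(2) by auto
  from infinite_enumerate[OF this] obtain s :: "nat \<Rightarrow> nat" where s: "strict_mono s" "\<And>n. l2_norm \<Omega> (w (s n)) \<ge> e" by auto
  have b: "l2_norm \<Omega> (w n) \<le> C" "l2_norm \<Omega> (wgrad \<Omega> (w n)) \<le> C" for n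
    using C[of n] l2_norm_nonneg[of \<Omega> "w n"] l2_norm_nonneg[of \<Omega> "wgrad \<Omega> (w n)"] by linarith+
  have C0: "C > 0" using s(2)[of 0] b(1)[of "s 0"] e(1) by linarith
  from Rellich[of "\<lambda>n. w (s n)" C, OF w(1) b] obtain k :: "nat \<Rightarrow> nat" where k: "strict_mono k"
    "\<forall>e>0. \<exists>N. \<forall>m\<ge>N. \<forall>n\<ge>N. l2_norm \<Omega> (\<lambda>x. w (s (k m)) x - w (s (k n)) x) < e" .
  \<comment> \<open>Leaves an error of \<open>d * C = e\<^sup>2 / 2\<close> when one factor in the
    squared norm of a member is replaced by \<open>h\<close>.\<close>
  define d where "d = e\<^sup>2 / (2 * C)"
  have d: "d > 0" using e(1) C0 by (simp add: d_def)
  obtain N where N: "\<And>m n. m \<ge> N \<Longrightarrow> n \<ge> N \<Longrightarrow> l2_norm \<Omega> (\<lambda>x. w (s (k m)) x - w (s (k n)) x) < d"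
    using k(2) d by blast
  define h where "h = w (s (k N))"
  have h: "h \<in> H10 \<Omega>" "l2_inner \<Omega> h u0 = 0" using w by (auto simp: h_def)
  \<comment> \<open>\<open>h\<close> is orthogonal to \<open>u0\<close>, which is the solvability
    condition.\<close>
  obtain \<psi> where \<psi>: "\<psi> \<in> H10 \<Omega>" "\<And>\<phi>. \<phi> \<in> H10 \<Omega> \<Longrightarrow> energy \<alpha> l0 \<psi> \<phi> = l2_inner \<Omega> h \<phi>"
  proof (rule energy_solvable[of "l2_inner \<Omega> h" "l2_norm \<Omega> h"])
    show "l2_inner \<Omega> h (\<lambda>x. u x + c * v x) = l2_inner \<Omega> h u + c * l2_inner \<Omega> h v" if "u \<in> H10 \<Omega>" "v \<in> H10 \<Omega>" for u v c
      by (rule l2_inner_lin_right[OF H10_L2[OF that(1)] H10_L2[OF that(2)] H10_L2[OF h(1)]])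
    show "\<bar>l2_inner \<Omega> h u\<bar> \<le> l2_norm \<Omega> h * (l2_norm \<Omega> u + l2_norm \<Omega> (wgrad \<Omega> u))" if u: "u \<in> H10 \<Omega>" for u
    proof -
      have "\<bar>l2_inner \<Omega> h u\<bar> \<le> l2_norm \<Omega> h * l2_norm \<Omega> u" by (rule l2_Cauchy_Schwarz[OF H10_L2[OF h(1)] H10_L2[OF u]])
      also have "\<dots> \<le> l2_norm \<Omega> h * (l2_norm \<Omega> u + l2_norm \<Omega> (wgrad \<Omega> u))"
        by (intro mult_left_mono) (auto simp: l2_norm_nonneg)
      finally show ?thesis .
    qed
  qed (use h in auto)
  have "(\<lambda>n. energy \<alpha> l0 (w (s (k n))) \<psi>) \<longlonglongrightarrow> 0"
    using LIMSEQ_subseq_LIMSEQ[OF LIMSEQ_subseq_LIMSEQ[OF lim[OF \<psi>(1)] s(1)] k(1)] by (simp add: o_def)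
  moreover have "energy \<alpha> l0 (w (s (k n))) \<psi> = l2_inner \<Omega> h (w (s (k n)))" for n
    using \<psi>(2)[OF w(1)] energy_commute by metis
  ultimately have "(\<lambda>n. l2_inner \<Omega> h (w (s (k n)))) \<longlonglongrightarrow> 0" by simp
  then have "\<forall>\<^sub>F n in sequentially. l2_inner \<Omega> h (w (s (k n))) < e\<^sup>2 / 2" using e(1) by (intro order_tendstoD) auto
  then obtain N' where N': "\<And>n. n \<ge> N' \<Longrightarrow> l2_inner \<Omega> h (w (s (k n))) < e\<^sup>2 / 2"
    unfolding eventually_sequentially by blast
  define n where "n = max N N'"
  let ?v = "w (s (k n))"
  have vL: "?v \<in> L2 \<Omega>" "h \<in> L2 \<Omega>" by (intro H10_L2 w(1) h(1))+
  have "l2_inner \<Omega> ?v ?v = l2_inner \<Omega> h ?v + l2_inner \<Omega> (\<lambda>x. ?v x - h x) ?v"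
    using l2_inner_diff_left[OF vL(1,2,1)] by simp
  also have "l2_inner \<Omega> (\<lambda>x. ?v x - h x) ?v \<le> l2_norm \<Omega> (\<lambda>x. ?v x - h x) * l2_norm \<Omega> ?v"
    using l2_Cauchy_Schwarz[OF L2_diff[OF vL(1,2)] vL(1)] by linarith
  also have "\<dots> \<le> d * C"
    using N[of n N] b(1) d by (intro mult_mono) (auto simp: n_def h_def l2_norm_nonneg less_imp_le)
  also have "\<dots> = e\<^sup>2 / 2" using C0 by (simp add: d_def)
  finally have "l2_inner \<Omega> ?v ?v < e\<^sup>2" using N'[of n] by (simp add: n_def)
  moreover have "e\<^sup>2 \<le> (l2_norm \<Omega> ?v)\<^sup>2" using s(2) e(1) by (intro power_mono) auto
  ultimately show False by (simp add: l2_norm_power2)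
qed

section \<open>The limit of the functional along a weakly converging sequence\<close>

definition defect :: "('a \<Rightarrow> real) \<Rightarrow> real" where
  "defect \<theta> = (\<integral>x. \<theta> x * (1 - \<theta> x) * (norm (wgrad \<Omega> u0 x))\<^sup>2 \<partial>M)"

text \<open>The limit value in energy form, in which it appears as a limit; by
  \<open>state_energy\<close> it is the integral of the theorem (\<open>relaxed_eq\<close>).\<close>

definition relaxed :: "real \<Rightarrow> ('a \<Rightarrow> real) \<Rightarrow> real" where
  "relaxed \<epsilon> \<theta> = \<alpha> * flux \<theta> u0 - \<epsilon> * energy \<alpha> l0 (state \<Omega> \<alpha> l0 u0 \<theta>) (state \<Omega> \<alpha> l0 u0 \<theta>) - \<epsilon> * \<alpha> * defect \<theta>"

lemma flux_integrable:
  assumes "bdd1 \<theta>" "u \<in> H10 \<Omega>"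
  shows "integrable M (\<lambda>x. \<theta> x * (wgrad \<Omega> u x \<bullet> wgrad \<Omega> u0 x))"
  using L2_inner_integrable[OF bdd1_w0_L2[OF assms(1)] H10_wgrad[OF assms(2)]] by (simp add: inner_commute)

lemma flux_alt: "flux \<theta> u = (\<integral>x. \<theta> x * (wgrad \<Omega> u x \<bullet> wgrad \<Omega> u0 x) \<partial>M)"
  by (simp add: flux_def l2_inner_def inner_commute)

lemma state_energy:
  assumes "bdd1 \<theta>"
  shows "energy \<alpha> l0 (state \<Omega> \<alpha> l0 u0 \<theta>) (state \<Omega> \<alpha> l0 u0 \<theta>) = - \<alpha> * flux \<theta> (state \<Omega> \<alpha> l0 u0 \<theta>)"
proof -
  have s: "state \<Omega> \<alpha> l0 u0 \<theta> \<in> H10 \<Omega>" "l2_inner \<Omega> (state \<Omega> \<alpha> l0 u0 \<theta>) u0 = 0"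
    "\<And>\<phi>. \<phi> \<in> H10 \<Omega> \<Longrightarrow> energy \<alpha> l0 (state \<Omega> \<alpha> l0 u0 \<theta>) \<phi> = \<alpha> * flux \<theta> u0 * l2_inner \<Omega> u0 \<phi> - \<alpha> * flux \<theta> \<phi>"
    using state_solution_state[OF assms] unfolding state_solution_iff by blast+
  show ?thesis using s(3)[OF s(1)] s(2) by (simp add: l2_inner_commute)
qed

lemma integral_design_eq:
  assumes "bdd1 \<theta>"
  shows "(\<integral>x. \<theta> x * ((wgrad \<Omega> u0 x + \<epsilon> *\<^sub>R wgrad \<Omega> (state \<Omega> \<alpha> l0 u0 \<theta>) x) \<bullet> wgrad \<Omega> u0 x) \<partial>M)
      = flux \<theta> u0 + \<epsilon> * flux \<theta> (state \<Omega> \<alpha> l0 u0 \<theta>)"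
    "integrable M (\<lambda>x. \<theta> x * ((wgrad \<Omega> u0 x + \<epsilon> *\<^sub>R wgrad \<Omega> (state \<Omega> \<alpha> l0 u0 \<theta>) x) \<bullet> wgrad \<Omega> u0 x))"
proof -
  have s: "state \<Omega> \<alpha> l0 u0 \<theta> \<in> H10 \<Omega>" using state_solution_state[OF assms] by (simp add: state_solution_iff)
  have *: "(\<lambda>x. \<theta> x * ((wgrad \<Omega> u0 x + \<epsilon> *\<^sub>R wgrad \<Omega> (state \<Omega> \<alpha> l0 u0 \<theta>) x) \<bullet> wgrad \<Omega> u0 x))
     = (\<lambda>x. \<theta> x * (wgrad \<Omega> u0 x \<bullet> wgrad \<Omega> u0 x) + \<epsilon> * (\<theta> x * (wgrad \<Omega> (state \<Omega> \<alpha> l0 u0 \<theta>) x \<bullet> wgrad \<Omega> u0 x)))"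
    by (auto simp: inner_add_left algebra_simps)
  show "(\<integral>x. \<theta> x * ((wgrad \<Omega> u0 x + \<epsilon> *\<^sub>R wgrad \<Omega> (state \<Omega> \<alpha> l0 u0 \<theta>) x) \<bullet> wgrad \<Omega> u0 x) \<partial>M)
      = flux \<theta> u0 + \<epsilon> * flux \<theta> (state \<Omega> \<alpha> l0 u0 \<theta>)"
    unfolding * flux_alt using flux_integrable[OF assms u0_H10] flux_integrable[OF assms s] by simp
  show "integrable M (\<lambda>x. \<theta> x * ((wgrad \<Omega> u0 x + \<epsilon> *\<^sub>R wgrad \<Omega> (state \<Omega> \<alpha> l0 u0 \<theta>) x) \<bullet> wgrad \<Omega> u0 x))"
    unfolding * using flux_integrable[OF assms u0_H10] flux_integrable[OF assms s] by simp
qed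

lemma F_eq:
  assumes "bdd1 X"
  shows "F \<Omega> \<alpha> l0 u0 \<epsilon> X = \<alpha> * flux X u0 - \<epsilon> * energy \<alpha> l0 (state \<Omega> \<alpha> l0 u0 X) (state \<Omega> \<alpha> l0 u0 X)"
  unfolding F_def integral_design_eq(1)[OF assms] state_energy[OF assms] by (simp add: algebra_simps)

lemma relaxed_eq:
  assumes "bdd1 \<theta>"
  shows "\<alpha> * (\<integral>x. \<theta> x * ((wgrad \<Omega> u0 x + \<epsilon> *\<^sub>R wgrad \<Omega> (state \<Omega> \<alpha> l0 u0 \<theta>) x) \<bullet> wgrad \<Omega> u0 x)
        - \<epsilon> * \<theta> x * (1 - \<theta> x) * (norm (wgrad \<Omega> u0 x))\<^sup>2 \<partial>M) = relaxed \<epsilon> \<theta>"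
proof -
  have [measurable]: "\<theta> \<in> borel_measurable M" using assms by (simp add: bdd1_def)
  have [measurable]: "wgrad \<Omega> u0 \<in> borel_measurable M" using w0_L2 L2_measurable by blast
  have int: "integrable M (\<lambda>x. \<theta> x * (1 - \<theta> x) * (norm (wgrad \<Omega> u0 x))\<^sup>2)"
  proof (rule Bochner_Integration.integrable_bound)
    show "integrable M (\<lambda>x. 2 * (norm (wgrad \<Omega> u0 x))\<^sup>2)" using L2_power2_integrable[OF w0_L2] by simp
    have "AE x in M. \<bar>\<theta> x\<bar> \<le> 1" using assms by (simp add: bdd1_def)
    then show "AE x in M. norm (\<theta> x * (1 - \<theta> x) * (norm (wgrad \<Omega> u0 x))\<^sup>2) \<le> norm (2 * (norm (wgrad \<Omega> u0 x))\<^sup>2)"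
    proof eventually_elim
      case (elim x)
      have "\<bar>\<theta> x * (1 - \<theta> x)\<bar> \<le> 1 * 2" unfolding abs_mult using elim by (intro mult_mono) auto
      then show ?case by (simp add: abs_mult mult_right_mono)
    qed
  qed measurable
  have "(\<integral>x. \<theta> x * ((wgrad \<Omega> u0 x + \<epsilon> *\<^sub>R wgrad \<Omega> (state \<Omega> \<alpha> l0 u0 \<theta>) x) \<bullet> wgrad \<Omega> u0 x)
        - \<epsilon> * (\<theta> x * (1 - \<theta> x) * (norm (wgrad \<Omega> u0 x))\<^sup>2) \<partial>M)
     = (flux \<theta> u0 + \<epsilon> * flux \<theta> (state \<Omega> \<alpha> l0 u0 \<theta>)) - \<epsilon> * defect \<theta>"
    using integral_design_eq[OF assms, of \<epsilon>] int by (simp add: defect_def)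
  note I = this
  have "\<epsilon> * \<theta> x * (1 - \<theta> x) * (norm (wgrad \<Omega> u0 x))\<^sup>2 = \<epsilon> * (\<theta> x * (1 - \<theta> x) * (norm (wgrad \<Omega> u0 x))\<^sup>2)" for x
    by (simp only: mult.assoc)
  then show ?thesis unfolding relaxed_def state_energy[OF assms] by (simp only: I) (simp add: algebra_simps)
qed

text \<open>
  With \<open>w n = v(X n) - v(\<theta>)\<close>, which tends to zero in \<open>L2\<close>, Cauchy--Schwarz bounds the limit of \<open>energy (w n) (w n)\<close>
  by \<open>\<alpha> * defect \<theta>\<close>. The bound is attained when \<open>(X n - \<theta>) \<nabla>u0\<close> is asymptotically a gradient.
\<close>

lemma design_sequence:
  fixes X :: "nat \<Rightarrow> 'a \<Rightarrow> real"
  assumes \<theta>: "\<theta> \<in> borel_measurable M" "AE x in M. 0 \<le> \<theta> x \<and> \<theta> x \<le> 1"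
    and X: "\<And>n. X n \<in> borel_measurable M" "\<And>n x. X n x \<in> {0, 1}" and ws: "weak_star_tendsto \<Omega> X \<theta>"
    and eps: "\<epsilon> \<ge> 0"
  obtains a where "a \<longlonglongrightarrow> relaxed \<epsilon> \<theta>" "\<And>n. a n \<le> F \<Omega> \<alpha> l0 u0 \<epsilon> (X n)"
    and "\<And>z. (\<And>n. z n \<in> test_functions \<Omega>) \<Longrightarrow> (\<lambda>n. l2_norm \<Omega> (z n)) \<longlonglongrightarrow> 0 \<Longrightarrow>
      (\<lambda>n. l2_norm \<Omega> (\<lambda>x. grad (z n) x - (X n x - \<theta> x) *\<^sub>R wgrad \<Omega> u0 x)) \<longlonglongrightarrow> 0 \<Longrightarrow>
      (\<lambda>n. F \<Omega> \<alpha> l0 u0 \<epsilon> (X n)) \<longlonglongrightarrow> relaxed \<epsilon> \<theta>"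
proof -
  define v where "v = state \<Omega> \<alpha> l0 u0 \<theta>"
  define V where "V n = state \<Omega> \<alpha> l0 u0 (X n)" for n
  define r where "r n x = X n x - \<theta> x" for n x
  define w where "w n x = V n x - v x" for n x
  have [measurable]: "\<theta> \<in> borel_measurable M" "X n \<in> borel_measurable M" for n using \<theta> X by auto
  have [measurable]: "wgrad \<Omega> u0 \<in> borel_measurable M" using w0_L2 L2_measurable by blast
  have "AE x in M. \<bar>\<theta> x\<bar> \<le> 1" using \<theta>(2) by eventually_elim auto
  then have b\<theta>: "bdd1 \<theta>" using \<theta>(1) by (simp add: bdd1_def)
  have bX: "bdd1 (X n)" for n
    unfolding bdd1_def using X(2)[of n] by (auto intro!: AE_I2 X(1)) (metis abs_0 abs_1 insertE order_refl singletonD zero_le_one)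
  have br: "bdd1 (r n)" for n
  proof -
    have "AE x in M. \<bar>r n x\<bar> \<le> 1"
      using \<theta>(2)
    proof eventually_elim
      case (elim x) then show ?case using X(2)[of n x] by (auto simp: r_def)
    qed
    then show ?thesis by (simp add: bdd1_def r_def[abs_def])
  qed
  have v: "v \<in> H10 \<Omega>" "l2_inner \<Omega> v u0 = 0"
    "\<And>\<phi>. \<phi> \<in> H10 \<Omega> \<Longrightarrow> energy \<alpha> l0 v \<phi> = \<alpha> * flux \<theta> u0 * l2_inner \<Omega> u0 \<phi> - \<alpha> * flux \<theta> \<phi>"
    using state_solution_state[OF b\<theta>] unfolding state_solution_iff v_def by blast+
  have V: "V n \<in> H10 \<Omega>" "l2_inner \<Omega> (V n) u0 = 0"
    "\<And>\<phi>. \<phi> \<in> H10 \<Omega> \<Longrightarrow> energy \<alpha> l0 (V n) \<phi> = \<alpha> * flux (X n) u0 * l2_inner \<Omega> u0 \<phi> - \<alpha> * flux (X n) \<phi>" for n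
    using state_solution_state[OF bX[of n]] unfolding state_solution_iff V_def by blast+
  have w: "w n \<in> H10 \<Omega>" for n unfolding w_def[abs_def] by (rule H10_diff(1)[OF V(1) v(1)])
  have wu0: "l2_inner \<Omega> (w n) u0 = 0" for n
    unfolding w_def[abs_def] using l2_inner_diff_left[OF H10_L2[OF V(1)] H10_L2[OF v(1)] H10_L2[OF u0_H10]] V(2) v(2) by simp
  have fr: "flux (r n) \<phi> = flux (X n) \<phi> - flux \<theta> \<phi>" if "\<phi> \<in> H10 \<Omega>" for n \<phi>
    unfolding r_def[abs_def] by (rule flux_diff[OF bX b\<theta> br[unfolded r_def[abs_def]] that])
  have we: "energy \<alpha> l0 (w n) \<phi> = \<alpha> * flux (r n) u0 * l2_inner \<Omega> u0 \<phi> - \<alpha> * flux (r n) \<phi>" if \<phi>: "\<phi> \<in> H10 \<Omega>" for n \<phi>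
  proof -
    have "energy \<alpha> l0 (w n) \<phi> = energy \<alpha> l0 (V n) \<phi> - energy \<alpha> l0 v \<phi>"
      unfolding w_def[abs_def] using energy_lin_left[OF V(1) v(1) \<phi>, of \<alpha> l0 n "-1"] by simp
    then show ?thesis unfolding V(3)[OF \<phi>] v(3)[OF \<phi>] fr[OF \<phi>] fr[OF u0_H10] by (simp add: algebra_simps)
  qed
  have flim: "(\<lambda>n. flux (r n) \<phi>) \<longlonglongrightarrow> 0" if \<phi>: "\<phi> \<in> H10 \<Omega>" for \<phi>
  proof -
    have "integrable M (\<lambda>x. wgrad \<Omega> \<phi> x \<bullet> wgrad \<Omega> u0 x)" by (rule L2_inner_integrable[OF H10_wgrad[OF \<phi>] w0_L2])
    then have "(\<lambda>n. flux (X n) \<phi>) \<longlonglongrightarrow> flux \<theta> \<phi>" using ws unfolding weak_star_tendsto_def flux_alt by blast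
    then have "(\<lambda>n. flux (X n) \<phi> - flux \<theta> \<phi>) \<longlonglongrightarrow> flux \<theta> \<phi> - flux \<theta> \<phi>" by (intro tendsto_intros)
    then show ?thesis by (simp add: fr[OF \<phi>])
  qed
  have elim: "(\<lambda>n. energy \<alpha> l0 (w n) \<phi>) \<longlonglongrightarrow> 0" if \<phi>: "\<phi> \<in> H10 \<Omega>" for \<phi>
  proof -
    have "(\<lambda>n. \<alpha> * flux (r n) u0 * l2_inner \<Omega> u0 \<phi> - \<alpha> * flux (r n) \<phi>) \<longlonglongrightarrow> \<alpha> * 0 * l2_inner \<Omega> u0 \<phi> - \<alpha> * 0"
      by (intro tendsto_intros flim \<phi> u0_H10)
    then show ?thesis by (simp add: we[OF \<phi>])
  qed
  \<comment> \<open>The multiplier term drops out because \<open>w n\<close> is orthogonal to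
    \<open>u0\<close>.\<close>
  have eww: "energy \<alpha> l0 (w n) (w n) = - \<alpha> * flux (r n) (w n)" for n
    using we[OF w, of n n] wu0[of n] by (simp add: l2_inner_commute)
  define S where "S n = (l2_norm \<Omega> (\<lambda>x. r n x *\<^sub>R wgrad \<Omega> u0 x))\<^sup>2" for n
  obtain c where c: "c > 0" "\<And>u. u \<in> H10 \<Omega> \<Longrightarrow> l2_inner \<Omega> u u0 = 0 \<Longrightarrow>
     (l2_norm \<Omega> u + l2_norm \<Omega> (wgrad \<Omega> u))\<^sup>2 \<le> c * energy \<alpha> l0 u u" using coercive by blast
  \<comment> \<open>Coercivity and the flux bound estimate the square of the norm by a multiple of
    the norm itself; cancelling one factor gives a bound uniform in \<open>n\<close>.\<close>
  have wb: "l2_norm \<Omega> (w n) + l2_norm \<Omega> (wgrad \<Omega> (w n)) \<le> c * \<alpha> * l2_norm \<Omega> (wgrad \<Omega> u0)" for n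
  proof -
    let ?t = "l2_norm \<Omega> (w n) + l2_norm \<Omega> (wgrad \<Omega> (w n))"
    have t: "?t \<ge> 0" by (simp add: l2_norm_nonneg)
    have "\<bar>flux (r n) (w n)\<bar> \<le> l2_norm \<Omega> (wgrad \<Omega> u0) * ?t"
      using flux_bound[OF br w, of n n] mult_mono[OF bdd1_w0_norm[OF br[of n]], of "l2_norm \<Omega> (wgrad \<Omega> (w n))" ?t]
      by (simp add: l2_norm_nonneg)
    then have "\<alpha> * - flux (r n) (w n) \<le> \<alpha> * (l2_norm \<Omega> (wgrad \<Omega> u0) * ?t)" using alpha_pos by (intro mult_left_mono) auto
    then have "c * energy \<alpha> l0 (w n) (w n) \<le> c * (\<alpha> * (l2_norm \<Omega> (wgrad \<Omega> u0) * ?t))"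
      using c(1) by (intro mult_left_mono) (auto simp: eww)
    then have "?t * ?t \<le> c * \<alpha> * l2_norm \<Omega> (wgrad \<Omega> u0) * ?t"
      using c(2)[OF w wu0, of n] by (simp add: power2_eq_square mult.assoc)
    then show ?thesis
      using t c(1) alpha_pos by (cases "?t = 0") (auto intro!: mult_nonneg_nonneg simp: l2_norm_nonneg mult_le_cancel_right)
  qed
  have wlim: "(\<lambda>n. l2_norm \<Omega> (w n)) \<longlonglongrightarrow> 0" by (rule l2_vanishing[OF w wu0 wb elim])
  have Slim: "S \<longlonglongrightarrow> defect \<theta>"
  proof -
    have w02: "integrable M (\<lambda>x. (norm (wgrad \<Omega> u0 x))\<^sup>2)" by (rule L2_power2_integrable[OF w0_L2])
    have bnd: "integrable M (\<lambda>x. f x * (norm (wgrad \<Omega> u0 x))\<^sup>2)"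
      if "f \<in> borel_measurable M" "AE x in M. \<bar>f x\<bar> \<le> 1" for f
    proof (rule Bochner_Integration.integrable_bound[OF w02])
      show "AE x in M. norm (f x * (norm (wgrad \<Omega> u0 x))\<^sup>2) \<le> norm ((norm (wgrad \<Omega> u0 x))\<^sup>2)"
        using that(2) by eventually_elim (simp add: abs_mult mult_left_le_one_le)
    qed (use that(1) in measurable)
    have X1: "AE x in M. \<bar>X n x\<bar> \<le> 1" and \<theta>1: "AE x in M. \<bar>\<theta> x\<bar> \<le> 1" for n
      using bX b\<theta> by (auto simp: bdd1_def)
    have m2: "AE x in M. \<bar>f x * g x\<bar> \<le> 1" if "AE x in M. \<bar>f x\<bar> \<le> 1" "AE x in M. \<bar>g x\<bar> \<le> 1" for f g :: "'a \<Rightarrow> real"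
      using that by eventually_elim (metis abs_ge_zero abs_mult mult_le_one)
    have i1: "integrable M (\<lambda>x. X n x * (norm (wgrad \<Omega> u0 x))\<^sup>2)" for n by (rule bnd[OF X(1) X1])
    have i2: "integrable M (\<lambda>x. (X n x * \<theta> x) * (norm (wgrad \<Omega> u0 x))\<^sup>2)" for n
      by (rule bnd[OF _ m2[OF X1 \<theta>1]]) measurable
    have i3: "integrable M (\<lambda>x. (\<theta> x * \<theta> x) * (norm (wgrad \<Omega> u0 x))\<^sup>2)"
      by (rule bnd[OF _ m2[OF \<theta>1 \<theta>1]]) measurable
    have i4: "integrable M (\<lambda>x. \<theta> x * (norm (wgrad \<Omega> u0 x))\<^sup>2)" by (rule bnd[OF \<theta>(1) \<theta>1])
    have "S n = (\<integral>x. X n x * (norm (wgrad \<Omega> u0 x))\<^sup>2 \<partial>M) - 2 * (\<integral>x. X n x * (\<theta> x * (norm (wgrad \<Omega> u0 x))\<^sup>2) \<partial>M)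
        + (\<integral>x. (\<theta> x * \<theta> x) * (norm (wgrad \<Omega> u0 x))\<^sup>2 \<partial>M)" for n
    proof -
      have "S n = (\<integral>x. X n x * (norm (wgrad \<Omega> u0 x))\<^sup>2 - 2 * ((X n x * \<theta> x) * (norm (wgrad \<Omega> u0 x))\<^sup>2)
          + (\<theta> x * \<theta> x) * (norm (wgrad \<Omega> u0 x))\<^sup>2 \<partial>M)"
        unfolding S_def l2_norm_power2 l2_inner_self
      proof (intro Bochner_Integration.integral_cong refl)
        fix x
        have "X n x * X n x = X n x" using X(2)[of n x] by auto
        then have r2: "(r n x)\<^sup>2 = X n x - 2 * (X n x * \<theta> x) + \<theta> x * \<theta> x" by (simp add: r_def power2_eq_square algebra_simps)
        show "(norm (r n x *\<^sub>R wgrad \<Omega> u0 x))\<^sup>2 = X n x * (norm (wgrad \<Omega> u0 x))\<^sup>2 - 2 * ((X n x * \<theta> x) * (norm (wgrad \<Omega> u0 x))\<^sup>2)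
          + (\<theta> x * \<theta> x) * (norm (wgrad \<Omega> u0 x))\<^sup>2"
          unfolding norm_scaleR power_mult_distrib power2_abs r2 by (simp add: algebra_simps)
      qed
      then show ?thesis using i1[of n] i2[of n] i3 by (simp add: mult.assoc)
    qed
    moreover have "(\<lambda>n. (\<integral>x. X n x * (norm (wgrad \<Omega> u0 x))\<^sup>2 \<partial>M) - 2 * (\<integral>x. X n x * (\<theta> x * (norm (wgrad \<Omega> u0 x))\<^sup>2) \<partial>M)
        + (\<integral>x. (\<theta> x * \<theta> x) * (norm (wgrad \<Omega> u0 x))\<^sup>2 \<partial>M))
      \<longlonglongrightarrow> (\<integral>x. \<theta> x * (norm (wgrad \<Omega> u0 x))\<^sup>2 \<partial>M) - 2 * (\<integral>x. \<theta> x * (\<theta> x * (norm (wgrad \<Omega> u0 x))\<^sup>2) \<partial>M)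
        + (\<integral>x. (\<theta> x * \<theta> x) * (norm (wgrad \<Omega> u0 x))\<^sup>2 \<partial>M)"
      by (intro tendsto_intros ws[unfolded weak_star_tendsto_def, rule_format] w02 i4)
    moreover have "(\<integral>x. \<theta> x * (norm (wgrad \<Omega> u0 x))\<^sup>2 \<partial>M) - 2 * (\<integral>x. \<theta> x * (\<theta> x * (norm (wgrad \<Omega> u0 x))\<^sup>2) \<partial>M)
        + (\<integral>x. (\<theta> x * \<theta> x) * (norm (wgrad \<Omega> u0 x))\<^sup>2 \<partial>M) = defect \<theta>"
    proof -
      have "defect \<theta> = (\<integral>x. \<theta> x * (norm (wgrad \<Omega> u0 x))\<^sup>2 - (\<theta> x * \<theta> x) * (norm (wgrad \<Omega> u0 x))\<^sup>2 \<partial>M)"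
        unfolding defect_def by (intro Bochner_Integration.integral_cong) (auto simp: algebra_simps)
      then show ?thesis using i3 i4 by (simp add: mult.assoc)
    qed
    ultimately show ?thesis by (simp add: LIMSEQ_def)
  qed
  have split: "F \<Omega> \<alpha> l0 u0 \<epsilon> (X n) = \<alpha> * flux (X n) u0 - \<epsilon> * (energy \<alpha> l0 v v + 2 * energy \<alpha> l0 (w n) v + energy \<alpha> l0 (w n) (w n))" for n
  proof -
    have "V n = (\<lambda>x. v x + 1 * w n x)" by (auto simp: w_def)
    then have "energy \<alpha> l0 (V n) (V n) = energy \<alpha> l0 v v + 2 * energy \<alpha> l0 (w n) v + energy \<alpha> l0 (w n) (w n)"
      using energy_lin_self[OF v(1) w, of \<alpha> l0 1 n] energy_commute[of \<alpha> l0 v "w n"] by simp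
    then show ?thesis unfolding F_eq[OF bX] V_def[symmetric] by simp
  qed
  have Xlim: "(\<lambda>n. \<alpha> * flux (X n) u0) \<longlonglongrightarrow> \<alpha> * flux \<theta> u0"
  proof -
    have "(\<lambda>n. flux (r n) u0 + flux \<theta> u0) \<longlonglongrightarrow> 0 + flux \<theta> u0" by (intro tendsto_intros flim u0_H10)
    then show ?thesis by (simp add: fr[OF u0_H10] tendsto_mult_left)
  qed
  \<comment> \<open>After Young's inequality half of the Dirichlet term reappears on the right, that
    is half the energy up to the \<open>L2\<close> norm; absorbing it leaves coefficient 1 in front
    of \<open>\<alpha> * S n\<close>.\<close>
  have up: "energy \<alpha> l0 (w n) (w n) \<le> \<alpha> * S n + l0 * (l2_norm \<Omega> (w n))\<^sup>2" for n
  proof -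
    let ?a = "l2_norm \<Omega> (\<lambda>x. r n x *\<^sub>R wgrad \<Omega> u0 x)" and ?D = "l2_norm \<Omega> (wgrad \<Omega> (w n))"
    have e1: "energy \<alpha> l0 (w n) (w n) = \<alpha> * ?D\<^sup>2 - l0 * (l2_norm \<Omega> (w n))\<^sup>2"
      by (simp add: energy_def dirichlet_self l2_norm_power2)
    have "- flux (r n) (w n) \<le> ?a * ?D" using flux_bound[OF br w, of n n] by linarith
    also have "\<dots> \<le> (?a\<^sup>2 + ?D\<^sup>2) / 2" using zero_le_power2[of "?a - ?D"] by (simp add: power2_diff)
    finally have "\<alpha> * - flux (r n) (w n) \<le> \<alpha> * ((?a\<^sup>2 + ?D\<^sup>2) / 2)" using alpha_pos by (intro mult_left_mono) auto
    then have "energy \<alpha> l0 (w n) (w n) \<le> (\<alpha> * S n + \<alpha> * ?D\<^sup>2) / 2" by (simp add: eww S_def algebra_simps)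
    then show ?thesis using e1 by (simp add: field_simps)
  qed
  show ?thesis
  proof (rule that)
    let ?a = "\<lambda>n. \<alpha> * flux (X n) u0 - \<epsilon> * (energy \<alpha> l0 v v + 2 * energy \<alpha> l0 (w n) v + (\<alpha> * S n + l0 * (l2_norm \<Omega> (w n))\<^sup>2))"
    have "?a \<longlonglongrightarrow> \<alpha> * flux \<theta> u0 - \<epsilon> * (energy \<alpha> l0 v v + 2 * 0 + (\<alpha> * defect \<theta> + l0 * 0\<^sup>2))"
      by (intro tendsto_intros Xlim elim[OF v(1)] Slim wlim)
    then show alim: "?a \<longlonglongrightarrow> relaxed \<epsilon> \<theta>" by (simp add: relaxed_def v_def[symmetric] algebra_simps)
    show aF: "?a n \<le> F \<Omega> \<alpha> l0 u0 \<epsilon> (X n)" for n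
      unfolding split using up[of n] eps by (intro diff_left_mono mult_left_mono add_left_mono) auto
    fix z :: "nat \<Rightarrow> 'a \<Rightarrow> real"
    assume z: "\<And>n. z n \<in> test_functions \<Omega>" and zlim: "(\<lambda>n. l2_norm \<Omega> (z n)) \<longlonglongrightarrow> 0"
      and gz: "(\<lambda>n. l2_norm \<Omega> (\<lambda>x. grad (z n) x - (X n x - \<theta> x) *\<^sub>R wgrad \<Omega> u0 x)) \<longlonglongrightarrow> 0"
    let ?q = "\<lambda>n x. r n x *\<^sub>R wgrad \<Omega> u0 x"
    let ?g = "\<lambda>n. grad (z n)"
    note zH = H10_test(1)[OF z]
    have qL: "?q n \<in> L2 \<Omega>" for n by (rule bdd1_w0_L2[OF br])
    have gL: "?g n \<in> L2 \<Omega>" for n by (rule test_grad_L2[OF z])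
    have dlim: "(\<lambda>n. l2_norm \<Omega> (\<lambda>x. ?g n x - ?q n x)) \<longlonglongrightarrow> 0" using gz by (simp add: r_def)
    define \<delta> where "\<delta> n = l2_norm \<Omega> (\<lambda>x. ?g n x - ?q n x)" for n
    have dl: "\<delta> \<longlonglongrightarrow> 0" using dlim by (simp add: \<delta>_def[abs_def])
    define b where "b = l2_norm \<Omega> (wgrad \<Omega> u0)"
    have qb: "l2_norm \<Omega> (?q n) \<le> b" for n unfolding b_def by (rule bdd1_w0_norm[OF br])
    have fz: "flux (r n) (z n) = l2_inner \<Omega> (?g n) (?q n)" for n
      unfolding flux_def l2_inner_commute[of \<Omega> "?q n"]
      using H10_test[OF z] gL qL by (intro l2_inner_cong_AE L2_measurable H10_wgrad) auto
    have fz_ge: "\<bar>flux (r n) (z n) - S n\<bar> \<le> \<delta> n * b" for n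
    proof -
      have "flux (r n) (z n) - S n = l2_inner \<Omega> (\<lambda>x. ?g n x - ?q n x) (?q n)"
        unfolding fz S_def l2_norm_power2 by (rule l2_inner_diff_left[OF gL qL qL, symmetric])
      then have "\<bar>flux (r n) (z n) - S n\<bar> \<le> \<delta> n * l2_norm \<Omega> (?q n)"
        unfolding \<delta>_def using l2_Cauchy_Schwarz[OF L2_diff[OF gL qL] qL, of n n n] by simp
      also have "\<dots> \<le> \<delta> n * b" using qb by (intro mult_left_mono) (auto simp: \<delta>_def l2_norm_nonneg)
      finally show ?thesis .
    qed
    have gn: "(l2_norm \<Omega> (?g n))\<^sup>2 = S n + 2 * (flux (r n) (z n) - S n) + (\<delta> n)\<^sup>2" for n
      unfolding fz S_def \<delta>_def l2_norm_power2
      using l2_inner_commute[of \<Omega> "?g n" "?q n"]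
      by (simp add: l2_inner_diff_left[OF gL qL L2_diff[OF gL qL]] l2_inner_diff_right[OF gL qL gL] l2_inner_diff_right[OF gL qL qL])
    \<comment> \<open>The gradient of \<open>w n\<close> should be close to minus that of
      \<open>z n\<close>; nonnegativity of the Dirichlet integral of their sum turns this into a
      lower bound. The two terms with \<open>flux (r n) (z n)\<close> cancel exactly, and all others
      except \<open>\<alpha> * S n\<close> tend to zero.\<close>
    have low: "energy \<alpha> l0 (w n) (w n) \<ge> \<alpha> * S n - 2 * \<alpha> * flux (r n) u0 * l2_inner \<Omega> u0 (z n) - 2 * l0 * l2_inner \<Omega> (w n) (z n)
       - \<alpha> * (\<delta> n)\<^sup>2 - l0 * (l2_norm \<Omega> (w n))\<^sup>2" for n
    proof -
      have "0 \<le> dirichlet (\<lambda>x. w n x + 1 * z n x) (\<lambda>x. w n x + 1 * z n x)" by (simp add: dirichlet_self)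
      also have "\<dots> = dirichlet (w n) (w n) + 2 * dirichlet (w n) (z n) + dirichlet (z n) (z n)"
        using dirichlet_lin_left[OF w[of n] zH[of n] H10_lin(1)[OF w[of n] zH[of n], of 1], of 1]
          dirichlet_lin_right[OF w[of n] zH[of n] w[of n], of 1] dirichlet_lin_right[OF w[of n] zH[of n] zH[of n], of 1]
          dirichlet_commute[of "z n" "w n"] by simp
      finally have "0 \<le> \<alpha> * (dirichlet (w n) (w n) + 2 * dirichlet (w n) (z n) + dirichlet (z n) (z n))"
        using alpha_pos by simp
      moreover have "\<alpha> * dirichlet (w n) (w n) = energy \<alpha> l0 (w n) (w n) + l0 * (l2_norm \<Omega> (w n))\<^sup>2"
        by (simp add: energy_def l2_norm_power2)
      moreover have "\<alpha> * dirichlet (w n) (z n) = \<alpha> * flux (r n) u0 * l2_inner \<Omega> u0 (z n) - \<alpha> * flux (r n) (z n) + l0 * l2_inner \<Omega> (w n) (z n)"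
        using we[OF zH, of n n] by (simp add: energy_def)
      moreover have "\<alpha> * dirichlet (z n) (z n) = \<alpha> * S n + 2 * \<alpha> * flux (r n) (z n) - 2 * \<alpha> * S n + \<alpha> * (\<delta> n)\<^sup>2"
        unfolding dirichlet_self test_wgrad_norm[OF z] gn by (simp add: algebra_simps)
      ultimately show ?thesis by (simp add: distrib_left)
    qed
    have uz: "(\<lambda>n. l2_inner \<Omega> u0 (z n)) \<longlonglongrightarrow> 0"
    proof (rule Lim_null_comparison[OF _ zlim])
      show "\<forall>\<^sub>F n in sequentially. norm (l2_inner \<Omega> u0 (z n)) \<le> l2_norm \<Omega> (z n)"
        using l2_Cauchy_Schwarz[OF H10_L2[OF u0_H10] test_L2[OF z]] u0_norm by simp
    qed
    have wz: "(\<lambda>n. l2_inner \<Omega> (w n) (z n)) \<longlonglongrightarrow> 0"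
    proof (rule Lim_null_comparison)
      show "\<forall>\<^sub>F n in sequentially. norm (l2_inner \<Omega> (w n) (z n)) \<le> l2_norm \<Omega> (w n) * l2_norm \<Omega> (z n)"
        using l2_Cauchy_Schwarz[OF H10_L2[OF w] test_L2[OF z]] by simp
      show "(\<lambda>n. l2_norm \<Omega> (w n) * l2_norm \<Omega> (z n)) \<longlonglongrightarrow> 0" using tendsto_mult[OF wlim zlim] by simp
    qed
    let ?L = "\<lambda>n. \<alpha> * S n - 2 * \<alpha> * flux (r n) u0 * l2_inner \<Omega> u0 (z n) - 2 * l0 * l2_inner \<Omega> (w n) (z n)
       - \<alpha> * (\<delta> n)\<^sup>2 - l0 * (l2_norm \<Omega> (w n))\<^sup>2"
    let ?u = "\<lambda>n. \<alpha> * flux (X n) u0 - \<epsilon> * (energy \<alpha> l0 v v + 2 * energy \<alpha> l0 (w n) v + ?L n)"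
    have "?u \<longlonglongrightarrow> \<alpha> * flux \<theta> u0 - \<epsilon> * (energy \<alpha> l0 v v + 2 * 0 + (\<alpha> * defect \<theta> - 2 * \<alpha> * 0 * 0 - 2 * l0 * 0 - \<alpha> * 0\<^sup>2 - l0 * 0\<^sup>2))"
      by (intro tendsto_intros Xlim elim[OF v(1)] Slim wlim flim[OF u0_H10] uz wz dl)
    then have ulim: "?u \<longlonglongrightarrow> relaxed \<epsilon> \<theta>" by (simp add: relaxed_def v_def[symmetric] algebra_simps)
    have "F \<Omega> \<alpha> l0 u0 \<epsilon> (X n) \<le> ?u n" for n
      unfolding split using low[of n] eps by (intro diff_left_mono mult_left_mono add_left_mono) auto
    then show "(\<lambda>n. F \<Omega> \<alpha> l0 u0 \<epsilon> (X n)) \<longlonglongrightarrow> relaxed \<epsilon> \<theta>"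
      by (intro tendsto_sandwich[OF _ _ alim ulim] always_eventually allI aF)
  qed
qed

end

section \<open>Laminates\<close>

text \<open>For t \<ge> 0 and \<open>a\<close> in the unit interval, the length of the part of
  [0, t] where \<open>frac\<close> is below \<open>a\<close>: each full period contributes
  \<open>a\<close>, the last one \<open>min (frac t) a\<close>.\<close>

definition sawQ :: "real \<Rightarrow> real \<Rightarrow> real" where
  "sawQ a t = a * of_int \<lfloor>t\<rfloor> + min (frac t) a"

text \<open>A primitive of an indicator has slopes between 0 and 1. Counting whole periods with
  \<open>floor\<close> gives the increments directly, corners included.\<close>

lemma sawQ_increment:
  assumes a: "0 \<le> a" "a \<le> 1" and t: "s \<le> t"
  shows "0 \<le> sawQ a t - sawQ a s" "sawQ a t - sawQ a s \<le> t - s"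
proof -
  have f: "0 \<le> frac s" "frac s < 1" "0 \<le> frac t" "frac t < 1" by (auto simp: frac_lt_1)
  have st: "s = of_int \<lfloor>s\<rfloor> + frac s" "t = of_int \<lfloor>t\<rfloor> + frac t" by (auto simp: frac_def)
  consider "\<lfloor>s\<rfloor> = \<lfloor>t\<rfloor>" | "\<lfloor>s\<rfloor> + 1 \<le> \<lfloor>t\<rfloor>" using floor_mono[OF t] by linarith
  then have "0 \<le> sawQ a t - sawQ a s \<and> sawQ a t - sawQ a s \<le> t - s"
  proof cases
    case 1
    then have "frac s \<le> frac t" using t by (simp add: frac_def)
    then show ?thesis using 1 st by (simp add: sawQ_def min_def)
  next
    case 2
    define k where "k = real_of_int (\<lfloor>t\<rfloor> - \<lfloor>s\<rfloor>)"
    have k: "k \<ge> 1" using 2 by (simp add: k_def)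
    have Q: "sawQ a t - sawQ a s = a * k + min (frac t) a - min (frac s) a" by (simp add: sawQ_def k_def algebra_simps)
    have d: "t - s = k + frac t - frac s" using st by (simp add: k_def)
    have 1: "a \<le> a * k" using a k mult_left_mono[of 1 k a] by simp
    have 2: "(1 - a) * 1 \<le> (1 - a) * k" using a k by (intro mult_left_mono) auto
    then have k': "a * k + 1 - a \<le> k" by (simp add: algebra_simps)
    define p q where "p = min (frac t) a" and "q = min (frac s) a"
    have pq: "0 \<le> p" "p \<le> frac t" "p \<le> a" "0 \<le> q" "q \<le> a" "frac s - q \<le> 1 - a"
      using f a by (auto simp: p_def q_def min_def simp del: frac_ge_0)
    have "0 \<le> a * k + p - q" using pq 1 by linarith
    moreover have "a * k + p - q \<le> k + frac t - frac s" using pq(2,6) k' by linarith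
    ultimately show ?thesis unfolding Q d p_def q_def by blast
  qed
  then show "0 \<le> sawQ a t - sawQ a s" "sawQ a t - sawQ a s \<le> t - s" by auto
qed

lemma sawQ_close: "0 \<le> a \<Longrightarrow> a \<le> 1 \<Longrightarrow> \<bar>sawQ a t - a * t\<bar> \<le> 1"
proof -
  assume a: "0 \<le> a" "a \<le> 1"
  have f: "0 \<le> frac t" "frac t < 1" by (auto simp: frac_lt_1)
  have "sawQ a t - a * t = min (frac t) a - a * frac t" by (simp add: sawQ_def frac_def algebra_simps)
  moreover have "0 \<le> a * frac t" "a * frac t \<le> 1" using a f by (auto intro: mult_le_one)
  moreover have "0 \<le> min (frac t) a" "min (frac t) a \<le> 1"
    using f a by (auto simp: min_def simp del: frac_ge_0)
  ultimately show ?thesis unfolding abs_le_iff by linarith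
qed

text \<open>To the right of every point, corners included, the slope is constant for a while; this
  spares an exceptional set in \<open>saw_quot_tendsto\<close>.\<close>

lemma sawQ_right_increment:
  assumes a: "0 \<le> a" "a \<le> 1"
  obtains d where "d > 0" "\<And>h. 0 < h \<Longrightarrow> h < d \<Longrightarrow> sawQ a (t + h) - sawQ a t = (if frac t < a then h else 0)"
proof -
  have f: "0 \<le> frac t" "frac t < 1" by (auto simp: frac_lt_1)
  define d where "d = (if frac t < a then a - frac t else 1 - frac t)"
  have d: "d > 0" "d \<le> 1 - frac t" using f a by (auto simp: d_def)
  show ?thesis
  proof (rule that[OF d(1)])
    fix h assume h: "0 < h" "h < d"
    have "of_int \<lfloor>t\<rfloor> \<le> t + h" using h(1) of_int_floor_le[of t] by linarith
    moreover have "t + h < of_int \<lfloor>t\<rfloor> + 1" using h d(2) unfolding frac_def by linarith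
    ultimately have "\<lfloor>t + h\<rfloor> = \<lfloor>t\<rfloor>" by (rule floor_unique)
    then have "frac (t + h) = frac t + h" by (simp add: frac_def)
    then show "sawQ a (t + h) - sawQ a t = (if frac t < a then h else 0)"
      using h \<open>\<lfloor>t + h\<rfloor> = \<lfloor>t\<rfloor>\<close> by (auto simp: sawQ_def d_def min_def)
  qed
qed

text \<open>
  The primitive of \<open>s \<mapsto> 1\<^bsub>frac (n s) < a\<^esub> - a\<close>; it has size \<open>1 / n\<close> because the integrand has mean zero
  over each period.
\<close>

definition saw :: "real \<Rightarrow> real \<Rightarrow> real \<Rightarrow> real" where
  "saw n a s = (sawQ a (n * s) - a * (n * s)) / n"

text \<open>Forward difference quotients are continuous, hence within reach of Weierstrass' theorem,
  bounded by 1, and convergent at every point to the discontinuous slope.\<close>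

definition saw_quot :: "real \<Rightarrow> real \<Rightarrow> real \<Rightarrow> real \<Rightarrow> real" where
  "saw_quot n a d s = (saw n a (s + d) - saw n a s) / d"

context
  fixes n a :: real
  assumes n: "n > 0" and a: "0 \<le> a" "a \<le> 1"
begin

lemma saw_small: "\<bar>saw n a s\<bar> \<le> 1 / n"
  using sawQ_close[OF a, of "n * s"] n by (simp add: saw_def abs_divide divide_right_mono)

lemma saw_increment: "s \<le> t \<Longrightarrow> \<bar>saw n a t - saw n a s\<bar> \<le> t - s"
proof -
  assume st: "s \<le> t"
  let ?q = "sawQ a (n * t) - sawQ a (n * s)"
  have q: "0 \<le> ?q" "?q \<le> n * t - n * s" using sawQ_increment[OF a, of "n * s" "n * t"] st n by auto
  have "0 \<le> a * (n * (t - s))" "a * (n * (t - s)) \<le> 1 * (n * (t - s))" using mult_right_mono[OF a(2), of "n * (t - s)"] a n st by auto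
  then have "\<bar>?q - a * (n * (t - s))\<bar> \<le> n * (t - s)" using q by (simp add: algebra_simps abs_le_iff)
  moreover have "saw n a t - saw n a s = (?q - a * (n * (t - s))) / n" unfolding saw_def diff_divide_distrib[symmetric] by (rule arg_cong[of _ _ "\<lambda>x. x / n"]) (simp add: algebra_simps)
  ultimately show ?thesis using n by (simp add: abs_divide pos_divide_le_eq mult.commute)
qed

lemma saw_continuous: "continuous_on S (saw n a)"
proof -
  have "1-lipschitz_on UNIV (saw n a)"
  proof (rule lipschitz_onI)
    fix x y show "dist (saw n a x) (saw n a y) \<le> 1 * dist x y"
      using saw_increment[of x y] saw_increment[of y x] by (cases "x \<le> y") (auto simp: dist_real_def abs_minus_commute)
  qed simp
  then show ?thesis using lipschitz_on_continuous_on continuous_on_subset by blast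
qed

lemma saw_quot_continuous: "d > 0 \<Longrightarrow> continuous_on S (saw_quot n a d)"
  unfolding saw_quot_def
  by (intro continuous_intros saw_continuous continuous_on_compose2[OF saw_continuous[of UNIV]]) auto

lemma saw_quot_bound: "d > 0 \<Longrightarrow> \<bar>saw_quot n a d s\<bar> \<le> 1"
  using saw_increment[of s "s + d"] by (simp add: saw_quot_def abs_divide)

lemma saw_quot_tendsto:
  "(\<lambda>j. saw_quot n a (inverse (real (Suc j))) s) \<longlonglongrightarrow> (if frac (n * s) < a then 1 else 0) - a"
proof -
  obtain d where d: "d > 0" "\<And>h. 0 < h \<Longrightarrow> h < d \<Longrightarrow> sawQ a (n * s + h) - sawQ a (n * s) = (if frac (n * s) < a then h else 0)"
    using sawQ_right_increment[OF a] by blast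
  have "\<forall>\<^sub>F j in sequentially. inverse (real (Suc j)) < d / n"
    using d(1) n by (intro order_tendstoD(2)[OF LIMSEQ_inverse_real_of_nat]) auto
  then have "\<forall>\<^sub>F j in sequentially. (if frac (n * s) < a then 1 else 0) - a = saw_quot n a (inverse (real (Suc j))) s"
  proof eventually_elim
    case (elim j)
    define i where "i = inverse (real (Suc j))"
    have i: "i > 0" "n * i < d" using elim n by (auto simp: i_def pos_less_divide_eq mult.commute)
    have "sawQ a (n * (s + i)) - sawQ a (n * s) = (if frac (n * s) < a then n * i else 0)"
      using d(2)[of "n * i"] i n by (simp add: distrib_left)
    then have "saw n a (s + i) - saw n a s = ((if frac (n * s) < a then n * i else 0) - a * (n * i)) / n"
      by (simp add: saw_def diff_divide_distrib[symmetric] distrib_left)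
    also have "\<dots> = ((if frac (n * s) < a then 1 else 0) - a) * i" using n by (simp add: field_simps)
    finally show ?case unfolding i_def[symmetric] saw_quot_def using i by simp
  qed
  then show ?thesis by (rule Lim_transform_eventually[OF tendsto_const])
qed

text \<open>\<open>p\<close> approximates the difference quotient and \<open>P\<close> is its
  antiderivative. The antiderivative \<open>G\<close> of the quotient itself is a moving average of
  \<open>saw\<close>, so it inherits the bound \<open>1 / n\<close>; the normalisation
  \<open>P 0 = 0\<close> costs a second \<open>1 / n\<close>.\<close>

lemma saw_polynomial:
  assumes B: "B > 0" and d: "d > 0" and t: "t > 0"
  obtains P p where "real_polynomial_function P" "\<And>s. (P has_real_derivative p s) (at s)"
    "\<And>s. s \<in> {-B..B} \<Longrightarrow> \<bar>p s - saw_quot n a d s\<bar> \<le> t" "\<And>s. s \<in> {-B..B} \<Longrightarrow> \<bar>P s\<bar> \<le> 2 / n + t"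
proof -
  \<comment> \<open>One bound controls the error of the derivative, the other the error accumulated
    over a distance of at most \<open>B\<close>.\<close>
  define t' where "t' = min t (t / B)"
  have t': "t' > 0" "t' \<le> t" "t' * B \<le> t" using t B by (auto simp: t'_def min_def field_simps)
  obtain p where p: "real_polynomial_function p" "\<And>s. s \<in> {-B..B} \<Longrightarrow> \<bar>saw_quot n a d s - p s\<bar> < t'"
    using Stone_Weierstrass_real_polynomial_function[OF compact_Icc saw_quot_continuous[OF d] t'(1)] by metis
  obtain P where P: "real_polynomial_function P" "P 0 = 0" "\<And>s. (P has_real_derivative p s) (at s)"
    using real_polynomial_antiderivative[OF p(1)] by metis
  \<comment> \<open>The starting point lies to the left of \<open>-B\<close>, so \<open>I\<close>
    has two-sided derivatives on the whole interval.\<close>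
  define I where "I s = integral {-B-1..s} (saw n a)" for s
  have I': "(I has_real_derivative saw n a s) (at s)" if "s > -B-1" for s
  proof -
    have "(I has_real_derivative saw n a s) (at s within {-B-1..s + 1})"
      unfolding I_def using that by (intro integral_has_real_derivative saw_continuous) auto
    moreover have "at s within {-B-1..s + 1} = at s" using that by (intro at_within_interior) auto
    ultimately show ?thesis by simp
  qed
  define G where "G s = (I (s + d) - I s) / d" for s
  have G': "(G has_real_derivative saw_quot n a d s) (at s)" if "s > -B-1" for s
  proof -
    have "((\<lambda>s. I (s + d)) has_real_derivative saw n a (s + d)) (at s)"
      using DERIV_shift[of I "saw n a (s + d)" s d] I'[of "s + d"] that d by simp
    then show ?thesis unfolding G_def[abs_def] saw_quot_def
      by (intro DERIV_cdivide DERIV_diff I' that)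
  qed
  have Gb: "\<bar>G s\<bar> \<le> 1 / n" if s: "s \<in> {-B..B}" for s
  proof -
    have "norm (I (s + d) - I s) \<le> 1 / n * norm (s + d - s)"
    proof (rule field_differentiable_bound[where S="{s..s+d}" and f'="saw n a"])
      show "(I has_field_derivative saw n a z) (at z within {s..s + d})" if "z \<in> {s..s+d}" for z
        by (rule has_field_derivative_at_within[OF I']) (use that s in auto)
    qed (use saw_small d in auto)
    then show ?thesis using d by (simp add: G_def abs_divide pos_divide_le_eq)
  qed
  show ?thesis
  proof (rule that[OF P(1,3)])
    fix s assume s: "s \<in> {-B..B}"
    show "\<bar>p s - saw_quot n a d s\<bar> \<le> t" using p(2)[OF s] t' by linarith
    have "norm ((P s - G s) - (P 0 - G 0)) \<le> t' * norm (s - 0)"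
    proof (rule field_differentiable_bound[where S="{-B..B}" and f'="\<lambda>s. p s - saw_quot n a d s"])
      fix z assume z: "z \<in> {-B..B}"
      then have "-B-1 < z" by simp
      then show "((\<lambda>s. P s - G s) has_field_derivative p z - saw_quot n a d z) (at z within {-B..B})"
        by (intro DERIV_diff has_field_derivative_at_within[OF P(3)] has_field_derivative_at_within[OF G'])
      show "norm (p z - saw_quot n a d z) \<le> t'" using p(2)[OF z] by (simp add: abs_minus_commute)
    qed (use s B in auto)
    then have "\<bar>P s - G s + G 0\<bar> \<le> t' * \<bar>s\<bar>" using P(2) by simp
    also have "\<dots> \<le> t' * B" using s t' by (intro mult_left_mono) auto
    finally have "\<bar>P s - G s + G 0\<bar> \<le> t" using t' by simp
    moreover have "\<bar>G s\<bar> \<le> 1 / n" "\<bar>G 0\<bar> \<le> 1 / n" using Gb s B by auto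
    ultimately have "\<bar>P s\<bar> \<le> 1 / n + 1 / n + t" by linarith
    then show "\<bar>P s\<bar> \<le> 2 / n + t" by simp
  qed
qed

end

section \<open>Layers along the level sets of a smooth function\<close>

context bounded_open
begin

lemma l2_norm_dominated:
  fixes f :: "nat \<Rightarrow> 'a \<Rightarrow> real"
  assumes [measurable]: "\<And>j. f j \<in> borel_measurable M" and lim: "AE x in M. (\<lambda>j. f j x) \<longlonglongrightarrow> 0"
    and b: "\<And>j. AE x in M. \<bar>f j x\<bar> \<le> C"
  shows "(\<lambda>j. l2_norm \<Omega> (f j)) \<longlonglongrightarrow> 0"
proof -
  have "(\<lambda>j. \<integral>x. (norm (f j x))\<^sup>2 \<partial>M) \<longlonglongrightarrow> (\<integral>x. 0 \<partial>M)"
  proof (rule integral_dominated_convergence[where w="\<lambda>x. C\<^sup>2"])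
    show "AE x in M. (\<lambda>j. (norm (f j x))\<^sup>2) \<longlonglongrightarrow> 0"
      using lim
    proof eventually_elim
      case (elim x)
      then have "(\<lambda>j. (norm (f j x))\<^sup>2) \<longlonglongrightarrow> (norm (0::real))\<^sup>2" by (intro tendsto_intros)
      then show ?case by simp
    qed
    show "AE x in M. norm ((norm (f j x))\<^sup>2) \<le> C\<^sup>2" for j
      using b[of j]
    proof eventually_elim
      case (elim x)
      then have "\<bar>f j x\<bar>\<^sup>2 \<le> C\<^sup>2" by (intro power_mono) auto
      then show ?case by simp
    qed
  qed auto
  then show ?thesis by (simp add: l2_norm_tendsto_0_iff)
qed

lemma l2_norm_sum:
  fixes f :: "'i \<Rightarrow> 'a \<Rightarrow> 'b::euclidean_space"
  assumes "finite I" "\<And>i. i \<in> I \<Longrightarrow> f i \<in> L2 \<Omega>"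
  shows "(\<lambda>x. \<Sum>i\<in>I. f i x) \<in> L2 \<Omega>" "l2_norm \<Omega> (\<lambda>x. \<Sum>i\<in>I. f i x) \<le> (\<Sum>i\<in>I. l2_norm \<Omega> (f i))"
proof -
  have "(\<lambda>x. \<Sum>i\<in>I. f i x) \<in> L2 \<Omega> \<and> l2_norm \<Omega> (\<lambda>x. \<Sum>i\<in>I. f i x) \<le> (\<Sum>i\<in>I. l2_norm \<Omega> (f i))"
    using assms
  proof (induction rule: finite_induct)
    case empty
    have "(\<lambda>x. 0 :: 'b) \<in> L2 \<Omega>" by (rule bounded_L2[where C=0]) auto
    then show ?case by (simp add: l2_norm_def l2_inner_def)
  next
    case (insert i I)
    then show ?case using L2_add[of "f i" \<Omega> "\<lambda>x. \<Sum>i\<in>I. f i x"] l2_norm_triangle[of "f i" \<Omega> "\<lambda>x. \<Sum>i\<in>I. f i x"]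
      by fastforce
  qed
  then show "(\<lambda>x. \<Sum>i\<in>I. f i x) \<in> L2 \<Omega>" "l2_norm \<Omega> (\<lambda>x. \<Sum>i\<in>I. f i x) \<le> (\<Sum>i\<in>I. l2_norm \<Omega> (f i))" by auto
qed

lemma frac_set_measurable:
  assumes "smooth \<phi>" shows "{x \<in> \<Omega>. frac (n * \<phi> x) < a} \<in> sets M"
proof -
  have [measurable]: "\<phi> \<in> borel_measurable M" by (rule smooth_measurable_M[OF assms])
  have "{x \<in> space M. n * \<phi> x - of_int \<lfloor>n * \<phi> x\<rfloor> < a} \<in> sets M" by measurable
  then show ?thesis by (simp add: frac_def)
qed

text \<open>Constant proportion \<open>a\<close> on a fixed set \<open>A\<close>. The test function
  is \<open>P (\<phi> x)\<close> multiplied by a cutoff \<open>\<eta>\<close> close to the indicator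
  of \<open>A\<close>; its gradient is nearly the oscillating field plus a term with
  \<open>grad \<eta>\<close>, small because \<open>P\<close> is. The order of choices matters:
  \<open>\<eta>\<close> fixes the bound \<open>K\<close> of its gradient, then come the frequency
  \<open>n\<close>, the step \<open>d\<close> and the polynomial.\<close>

lemma pattern:
  assumes \<phi>: "smooth \<phi>" "\<And>x. x \<in> \<Omega> \<Longrightarrow> \<bar>\<phi> x\<bar> \<le> B" "\<And>x. x \<in> \<Omega> \<Longrightarrow> norm (grad \<phi> x) \<le> B"
    and B: "B > 0" and A: "A \<in> sets M" and a: "0 \<le> a" "a \<le> 1" and e: "e > 0"
  obtains z C where "z \<in> test_functions \<Omega>" "C \<in> sets M" "\<And>x. \<bar>z x\<bar> \<le> e"
    "l2_norm \<Omega> (\<lambda>x. indicator A x *\<^sub>R ((indicator C x - a) *\<^sub>R grad \<phi> x) - grad z x) \<le> e"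
proof -
  define S where "S = sqrt (measure lebesgue \<Omega>)"
  have S: "S \<ge> 0" by (simp add: S_def)
  have \<phi>M: "\<phi> \<in> borel_measurable M" "grad \<phi> \<in> borel_measurable M"
    by (rule smooth_measurable_M[OF \<phi>(1)], rule grad_measurable_M[OF \<phi>(1)])
  obtain \<eta> where \<eta>: "\<eta> \<in> test_functions \<Omega>" "\<And>x. 0 \<le> \<eta> x" "\<And>x. \<eta> x \<le> 1"
    "(\<integral>x. \<bar>indicator A x - \<eta> x\<bar> \<partial>M) < (e / (3 * B))\<^sup>2"
    by (rule indicator_test_approx[of A "(e / (3 * B))\<^sup>2"]) (use A e B in \<open>auto simp: sets_M_iff\<close>)
  have \<eta>M: "\<eta> \<in> borel_measurable M" by (rule smooth_measurable_M[OF test_smooth[OF \<eta>(1)]])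
  have i\<eta>: "integrable M (\<lambda>x. indicator A x - \<eta> x)" by (rule indicator_diff_integrable[OF A \<eta>M \<eta>(2,3)])
  have i1: "\<bar>indicator A x - \<eta> x\<bar> \<le> 1" for x by (rule abs_indicator_diff_le_1[OF \<eta>(2,3)])
  have \<eta>L: "(\<lambda>x. indicator A x - \<eta> x) \<in> L2 \<Omega>"
    by (rule bounded_L2[where C=1]) (use i\<eta> i1 in auto)
  \<comment> \<open>The difference is bounded by 1, so its square is below its modulus and the
    \<open>L1\<close> bound suffices.\<close>
  have n1: "l2_norm \<Omega> (\<lambda>x. indicator A x - \<eta> x) \<le> e / (3 * B)"
  proof -
    have "(l2_norm \<Omega> (\<lambda>x. indicator A x - \<eta> x))\<^sup>2 = (\<integral>x. (norm (indicator A x - \<eta> x))\<^sup>2 \<partial>M)"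
      by (simp add: l2_norm_power2 l2_inner_self)
    also have "\<dots> \<le> (\<integral>x. \<bar>indicator A x - \<eta> x\<bar> \<partial>M)"
    proof (rule integral_mono)
      show "(norm (indicator A x - \<eta> x))\<^sup>2 \<le> \<bar>indicator A x - \<eta> x\<bar>" for x
        using mult_left_mono[OF i1[of x], of "\<bar>indicator A x - \<eta> x\<bar>"] by (simp add: power2_eq_square abs_mult[symmetric])
    qed (use L2_power2_integrable[OF \<eta>L] i\<eta> in auto)
    finally have "(l2_norm \<Omega> (\<lambda>x. indicator A x - \<eta> x))\<^sup>2 \<le> (e / (3 * B))\<^sup>2" using \<eta>(4) by linarith
    then show ?thesis by (rule power2_le_imp_le) (use e B in simp)
  qed
  obtain K where K: "K > 0" "\<And>x. norm (grad \<eta> x) \<le> K" using test_bounded[OF \<eta>(1)] by metis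
  \<comment> \<open>The size of the oscillation, small compared with the bound \<open>K\<close>
    already fixed; the frequency is \<open>2 / \<kappa>\<close>.\<close>
  define \<kappa> where "\<kappa> = min (e / 2) (e / (6 * K * (S + 1)))"
  have KS: "K * (S + 1) > 0" using K S by (simp add: add_nonneg_pos)
  have \<kappa>: "\<kappa> > 0" "2 * \<kappa> \<le> e" using e KS by (auto simp: \<kappa>_def mult.assoc)
  have \<kappa>K: "2 * \<kappa> * K * S \<le> e / 3"
  proof -
    have "2 * \<kappa> * K * S \<le> 2 * \<kappa> * (K * (S + 1))" using \<kappa>(1) K(1) S by (simp add: mult.assoc)
    also have "\<dots> \<le> 2 * (e / (6 * (K * (S + 1)))) * (K * (S + 1))"
      using KS by (intro mult_right_mono mult_left_mono) (auto simp: \<kappa>_def mult.assoc)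
    also have "\<dots> = e / 3"
    proof -
      have "2 * (e / (6 * t)) * t = e / 3" if "t > 0" for t :: real using that by simp
      then show ?thesis using KS by blast
    qed
    finally show ?thesis .
  qed
  define n where "n = 2 / \<kappa>"
  have n: "n > 0" "2 / n = \<kappa>" using \<kappa> by (auto simp: n_def)
  define C where "C = {x \<in> \<Omega>. frac (n * \<phi> x) < a}"
  have C: "C \<in> sets M" unfolding C_def by (rule frac_set_measurable[OF \<phi>(1)])
  define f where "f j x = saw_quot n a (inverse (real (Suc j))) (\<phi> x) - (indicator C x - a)" for j x
  have gM: "(\<lambda>x. saw_quot n a d (\<phi> x)) \<in> borel_measurable M" if "d > 0" for d
    by (rule borel_measurable_continuous_on[OF saw_quot_continuous[OF n(1) a that] \<phi>M(1)])
  have fM: "f j \<in> borel_measurable M" for j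
    unfolding f_def[abs_def] using gM[of "inverse (real (Suc j))"] C by (auto intro!: borel_measurable_diff)
  have gb: "\<bar>saw_quot n a (inverse (real (Suc j))) s\<bar> \<le> 1" for j s by (rule saw_quot_bound[OF n(1) a]) simp
  have fb: "\<bar>f j x\<bar> \<le> 2" for j x
    using gb[of j "\<phi> x"] a by (auto simp: f_def indicator_def abs_le_iff)
  have "(\<lambda>j. l2_norm \<Omega> (f j)) \<longlonglongrightarrow> 0"
  proof (rule l2_norm_dominated[OF fM, where C=2])
    show "AE x in M. (\<lambda>j. f j x) \<longlonglongrightarrow> 0"
    proof (rule AE_I2)
      fix x assume "x \<in> space M"
      then have "indicator C x = (if frac (n * \<phi> x) < a then 1 else 0 :: real)" by (simp add: C_def indicator_def)
      then show "(\<lambda>j. f j x) \<longlonglongrightarrow> 0"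
        using LIM_zero[OF saw_quot_tendsto[OF n(1) a, of "\<phi> x"]] by (simp add: f_def)
    qed
  qed (use fb in auto)
  then have "\<forall>\<^sub>F j in sequentially. l2_norm \<Omega> (f j) < e / (6 * B)" using e B by (intro order_tendstoD) auto
  then obtain j where j: "l2_norm \<Omega> (f j) < e / (6 * B)" using eventually_happens by fastforce
  define d where "d = inverse (real (Suc j))"
  have d: "d > 0" by (simp add: d_def)
  define \<tau> where "\<tau> = min \<kappa> (e / (6 * B * (S + 1)))"
  have BS: "B * (S + 1) > 0" using B S by (simp add: add_nonneg_pos)
  have \<tau>: "\<tau> > 0" "\<tau> \<le> \<kappa>" using \<kappa> e BS by (auto simp: \<tau>_def mult.assoc)
  have \<tau>B: "B * \<tau> * S \<le> e / 6"
  proof -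
    have "B * \<tau> * S \<le> \<tau> * (B * (S + 1))" using \<tau>(1) B S by (simp add: algebra_simps)
    also have "\<dots> \<le> (e / (6 * (B * (S + 1)))) * (B * (S + 1))"
      using BS by (intro mult_right_mono) (auto simp: \<tau>_def mult.assoc)
    also have "\<dots> = e / 6"
    proof -
      have "e / (6 * t) * t = e / 6" if "t > 0" for t :: real using that by simp
      then show ?thesis using BS by blast
    qed
    finally show ?thesis .
  qed
  obtain P p where P: "real_polynomial_function P" "\<And>s. (P has_real_derivative p s) (at s)"
    "\<And>s. s \<in> {-B..B} \<Longrightarrow> \<bar>p s - saw_quot n a d s\<bar> \<le> \<tau>" "\<And>s. s \<in> {-B..B} \<Longrightarrow> \<bar>P s\<bar> \<le> 2 / n + \<tau>"
    using saw_polynomial[OF n(1) a B d \<tau>(1)] by metis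
  have inB: "\<phi> x \<in> {-B..B}" if "x \<in> \<Omega>" for x using \<phi>(2)[OF that] by auto
  have Pb: "\<bar>P (\<phi> x)\<bar> \<le> 2 * \<kappa>" if "x \<in> \<Omega>" for x using P(4)[OF inB[OF that]] n(2) \<tau>(2) by linarith
  define z where "z x = \<eta> x * P (\<phi> x)" for x
  have sP: "smooth (\<lambda>x. P (\<phi> x))" by (rule smooth_polynomial[OF P(1) \<phi>(1)])
  have z: "z \<in> test_functions \<Omega>" unfolding z_def[abs_def] by (rule test_mult_smooth[OF \<eta>(1) sP])
  have gz: "grad z x = \<eta> x *\<^sub>R (p (\<phi> x) *\<^sub>R grad \<phi> x) + P (\<phi> x) *\<^sub>R grad \<eta> x" for x
    unfolding z_def[abs_def] by (simp add: grad_mult[OF test_smooth[OF \<eta>(1)] sP] grad_compose[OF \<phi>(1) P(2)])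
  have zb: "\<bar>z x\<bar> \<le> e" for x
  proof (cases "x \<in> \<Omega>")
    case True
    have "\<bar>z x\<bar> \<le> 1 * (2 * \<kappa>)" unfolding z_def abs_mult using \<eta>(2,3)[of x] Pb[OF True] by (intro mult_mono) auto
    then show ?thesis using \<kappa>(2) by linarith
  next
    case False then show ?thesis using test_zero_outside[OF z False] e by simp
  qed
  let ?T = "\<lambda>x. indicator A x *\<^sub>R ((indicator C x - a) *\<^sub>R grad \<phi> x) - grad z x"
  let ?h = "\<lambda>x. B * \<bar>indicator A x - \<eta> x\<bar> + (B * \<bar>f j x\<bar> + (B * \<tau> + 2 * \<kappa> * K))"
  have T_le: "norm (?T x) \<le> ?h x" if x: "x \<in> \<Omega>" for x
  proof -
    define c where "c = indicator C x - a"
    have c1: "\<bar>c\<bar> \<le> 1" using a by (auto simp: c_def indicator_def)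
    define q where "q = p (\<phi> x) - saw_quot n a d (\<phi> x)"
    have q: "\<bar>q\<bar> \<le> \<tau>" using P(3)[OF inB[OF x]] by (simp add: q_def)
    have pq: "p (\<phi> x) = c + f j x + q" by (simp add: q_def f_def c_def d_def)
    \<comment> \<open>The discrepancy splits into replacing the indicator by \<open>\<eta>\<close>,
      the exact slope \<open>c\<close> by the quotient (error \<open>f j x\<close>), and the
      quotient by the polynomial (error \<open>q\<close>).\<close>
    have "?T x = ((indicator A x - \<eta> x) * c - \<eta> x * f j x - \<eta> x * q) *\<^sub>R grad \<phi> x - P (\<phi> x) *\<^sub>R grad \<eta> x"
      unfolding gz pq c_def[symmetric] by (simp add: algebra_simps)
    then have "norm (?T x) \<le> \<bar>(indicator A x - \<eta> x) * c - \<eta> x * f j x - \<eta> x * q\<bar> * norm (grad \<phi> x) + \<bar>P (\<phi> x)\<bar> * norm (grad \<eta> x)"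
      by (metis norm_scaleR norm_triangle_ineq4)
    also have "\<dots> \<le> (\<bar>indicator A x - \<eta> x\<bar> + \<bar>f j x\<bar> + \<tau>) * B + 2 * \<kappa> * K"
    proof (intro add_mono mult_mono \<phi>(3)[OF x] Pb[OF x] K(2))
      have "\<bar>(indicator A x - \<eta> x) * c\<bar> \<le> \<bar>indicator A x - \<eta> x\<bar> * 1" unfolding abs_mult using c1 by (intro mult_left_mono) auto
      moreover have "\<bar>\<eta> x * f j x\<bar> \<le> 1 * \<bar>f j x\<bar>" unfolding abs_mult using \<eta>(2,3)[of x] by (intro mult_right_mono) auto
      moreover have "\<bar>\<eta> x * q\<bar> \<le> 1 * \<tau>" unfolding abs_mult using \<eta>(2,3)[of x] q by (intro mult_mono) auto
      moreover have "\<bar>r - s - t\<bar> \<le> R + S + T" if "\<bar>r\<bar> \<le> R * 1" "\<bar>s\<bar> \<le> 1 * S" "\<bar>t\<bar> \<le> 1 * T" for r s t R S T :: real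
        using that by arith
      ultimately show "\<bar>(indicator A x - \<eta> x) * c - \<eta> x * f j x - \<eta> x * q\<bar> \<le> \<bar>indicator A x - \<eta> x\<bar> + \<bar>f j x\<bar> + \<tau>"
        by blast
    qed (use \<tau>(1) \<kappa>(1) in auto)
    also have "\<dots> = ?h x" by (simp add: algebra_simps)
    finally show ?thesis .
  qed
  have TL: "?T \<in> L2 \<Omega>"
  proof (rule L2_diff[OF _ test_grad_L2[OF z]], rule bounded_L2[where C=B])
    show "(\<lambda>x. indicator A x *\<^sub>R ((indicator C x - a) *\<^sub>R grad \<phi> x)) \<in> borel_measurable M"
      using A C \<phi>M(2) by (intro borel_measurable_scaleR borel_measurable_diff borel_measurable_indicator) auto
    show "AE x in M. norm (indicator A x *\<^sub>R ((indicator C x - a) *\<^sub>R grad \<phi> x)) \<le> B"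
    proof (rule AE_I2)
      fix x assume "x \<in> space M"
      then have x: "norm (grad \<phi> x) \<le> B" using \<phi>(3) by simp
      have c: "\<bar>indicator A x * (indicator C x - a)\<bar> \<le> 1" using a by (auto simp: indicator_def)
      have "norm (indicator A x *\<^sub>R ((indicator C x - a) *\<^sub>R grad \<phi> x)) = \<bar>indicator A x * (indicator C x - a)\<bar> * norm (grad \<phi> x)"
        by (simp add: abs_mult)
      also have "\<dots> \<le> 1 * B" using c x by (intro mult_mono) auto
      finally show "norm (indicator A x *\<^sub>R ((indicator C x - a) *\<^sub>R grad \<phi> x)) \<le> B" by simp
    qed
  qed
  have aL: "(\<lambda>x. \<bar>indicator A x - \<eta> x\<bar>) \<in> L2 \<Omega>" using \<eta>L by (auto simp: L2_def)
  have fL: "f j \<in> L2 \<Omega>" by (rule bounded_L2[where C=2]) (use fM fb in auto)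
  then have afL: "(\<lambda>x. \<bar>f j x\<bar>) \<in> L2 \<Omega>" by (auto simp: L2_def)
  define c where "c = B * \<tau> + 2 * \<kappa> * K"
  have c0: "c \<ge> 0" using B \<tau> \<kappa> K by (simp add: c_def)
  have cL: "(\<lambda>x. c) \<in> L2 \<Omega>" by (rule bounded_L2[where C="\<bar>c\<bar>"]) auto
  have cn: "l2_norm \<Omega> (\<lambda>x. c) \<le> c * S" unfolding S_def by (rule l2_norm_le_sup) (use c0 in auto)
  have hL: "(\<lambda>x. B * \<bar>f j x\<bar> + c) \<in> L2 \<Omega>" by (intro L2_add L2_cmult afL cL)
  have "l2_norm \<Omega> ?T \<le> l2_norm \<Omega> ?h"
  proof (rule l2_norm_mono[OF TL])
    show "?h \<in> L2 \<Omega>" unfolding c_def[symmetric] by (intro L2_add[OF L2_cmult[OF aL] hL])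
    show "AE x in M. norm (?T x) \<le> norm (?h x)"
    proof (rule AE_I2)
      fix x assume "x \<in> space M"
      then have "norm (?T x) \<le> ?h x" by (intro T_le) simp
      also have "\<dots> \<le> norm (?h x)" unfolding real_norm_def by (rule abs_ge_self)
      finally show "norm (?T x) \<le> norm (?h x)" .
    qed
  qed
  also have "\<dots> \<le> l2_norm \<Omega> (\<lambda>x. B * \<bar>indicator A x - \<eta> x\<bar>) + l2_norm \<Omega> (\<lambda>x. B * \<bar>f j x\<bar> + c)"
    unfolding c_def[symmetric] by (rule l2_norm_triangle[OF L2_cmult[OF aL] hL])
  also have "\<dots> \<le> l2_norm \<Omega> (\<lambda>x. B * \<bar>indicator A x - \<eta> x\<bar>) + (l2_norm \<Omega> (\<lambda>x. B * \<bar>f j x\<bar>) + l2_norm \<Omega> (\<lambda>x. c))"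
    by (intro add_left_mono l2_norm_triangle L2_cmult afL cL)
  also have "\<dots> = B * l2_norm \<Omega> (\<lambda>x. indicator A x - \<eta> x) + (B * l2_norm \<Omega> (f j) + l2_norm \<Omega> (\<lambda>x. c))"
    using B unfolding l2_norm_cmult by (simp add: l2_norm_def l2_inner_def)
  \<comment> \<open>The shares are e/3 for the cutoff, e/6 for the quotient, and e/6 + e/3 for the
    two parts of \<open>c\<close>.\<close>
  also have "\<dots> \<le> B * (e / (3 * B)) + (B * (e / (6 * B)) + c * S)"
    using B n1 j cn by (intro add_mono mult_left_mono) auto
  also have "\<dots> = e / 3 + e / 6 + (B * \<tau> * S + 2 * \<kappa> * K * S)" using B by (simp add: c_def algebra_simps)
  also have "\<dots> \<le> e" using \<kappa>K \<tau>B by linarith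
  finally show ?thesis using that[OF z C zb] by blast
qed

text \<open>The proportion is rounded down to multiples of \<open>1 / K\<close> on the slices
  \<open>A i\<close>, where \<open>pattern\<close> applies with the constant \<open>a i\<close>. The
  slices are disjoint, so the pieces combine into one set \<open>D\<close> and the rounding error
  \<open>\<rho>\<close> is at most \<open>1 / K\<close>.\<close>

lemma laminate:
  assumes \<phi>: "smooth \<phi>" "\<And>x. x \<in> \<Omega> \<Longrightarrow> \<bar>\<phi> x\<bar> \<le> B" "\<And>x. x \<in> \<Omega> \<Longrightarrow> norm (grad \<phi> x) \<le> B"
    and B: "B > 0" and \<theta>: "\<theta> \<in> borel_measurable M" "AE x in M. 0 \<le> \<theta> x \<and> \<theta> x \<le> 1" and e: "e > 0"
  obtains z C where "z \<in> test_functions \<Omega>" "C \<in> sets M" "\<And>x. \<bar>z x\<bar> \<le> e"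
    "l2_norm \<Omega> (\<lambda>x. (indicator C x - \<theta> x) *\<^sub>R grad \<phi> x - grad z x) \<le> e"
proof -
  note [measurable] = \<theta>(1)
  define S where "S = sqrt (measure lebesgue \<Omega>)"
  have S: "S \<ge> 0" by (simp add: S_def)
  obtain K :: nat where K: "real K > 2 * B * S / e" "K > 0"
    using reals_Archimedean2[of "max 1 (2 * B * S / e)"] by (metis max_less_iff_conj of_nat_0_less_iff zero_less_one order_less_trans)
  have KB: "B / real K * S \<le> e / 2" using K e by (simp add: field_simps)
  define A where "A i = {x \<in> \<Omega>. real i \<le> real K * \<theta> x \<and> real K * \<theta> x < real i + 1}" for i :: nat
  have A: "A i \<in> sets M" for i
  proof -
    have "{x \<in> space M. real i \<le> real K * \<theta> x \<and> real K * \<theta> x < real i + 1} \<in> sets M" by measurable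
    then show ?thesis unfolding A_def space_M .
  qed
  define a where "a i = real i / real K" for i :: nat
  \<comment> \<open>There are \<open>Suc K\<close> slices, the last one for the value 1; together
    they may use half of \<open>e\<close>.\<close>
  define e' where "e' = e / (2 * real (Suc K))"
  have e': "e' > 0" "e' \<le> e" "real (Suc K) * e' = e / 2" using e by (auto simp: e'_def field_simps)
  define Q where "Q i z C \<longleftrightarrow> z \<in> test_functions \<Omega> \<and> C \<in> sets M \<and> (\<forall>x. \<bar>z x\<bar> \<le> e') \<and>
    l2_norm \<Omega> (\<lambda>x. indicator (A i) x *\<^sub>R ((indicator C x - a i) *\<^sub>R grad \<phi> x) - grad z x) \<le> e'" for i z C
  have "\<exists>z C. Q i z C" if "i \<le> K" for i
  proof (rule pattern[OF \<phi> B A[of i] _ _ e'(1), of "a i"])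
    show "0 \<le> a i" "a i \<le> 1" using that K by (auto simp: a_def)
    fix z C assume "z \<in> test_functions \<Omega>" "C \<in> sets M" "\<And>x. \<bar>z x\<bar> \<le> e'"
      "l2_norm \<Omega> (\<lambda>x. indicator (A i) x *\<^sub>R ((indicator C x - a i) *\<^sub>R grad \<phi> x) - grad z x) \<le> e'"
    then have "Q i z C" unfolding Q_def by blast
    then show ?thesis by blast
  qed
  then obtain z C where Q: "\<And>i. i \<le> K \<Longrightarrow> Q i (z i) (C i)" by metis
  have zC: "\<And>i. i \<le> K \<Longrightarrow> z i \<in> test_functions \<Omega>" "\<And>i. i \<le> K \<Longrightarrow> C i \<in> sets M"
    "\<And>i x. i \<le> K \<Longrightarrow> \<bar>z i x\<bar> \<le> e'"
    "\<And>i. i \<le> K \<Longrightarrow> l2_norm \<Omega> (\<lambda>x. indicator (A i) x *\<^sub>R ((indicator (C i) x - a i) *\<^sub>R grad \<phi> x) - grad (z i) x) \<le> e'"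
    using Q unfolding Q_def by blast+
  define D where "D = (\<Union>i\<le>K. A i \<inter> C i)"
  have D: "D \<in> sets M" unfolding D_def using A zC(2) by auto
  define Z where "Z x = (\<Sum>i\<le>K. z i x)" for x
  have Z: "Z \<in> test_functions \<Omega>" unfolding Z_def[abs_def] using zC(1) by (intro test_sum) auto
  have gZ: "grad Z x = (\<Sum>i\<le>K. grad (z i) x)" for x
    unfolding Z_def[abs_def] using zC(1) test_smooth by (intro grad_sum) auto
  have Zb: "\<bar>Z x\<bar> \<le> e" for x
  proof -
    have "\<bar>Z x\<bar> \<le> (\<Sum>i\<le>K. e')" unfolding Z_def by (intro order_trans[OF sum_abs] sum_mono zC(3)) auto
    also have "\<dots> = e / 2" using e'(3) by simp
    finally show ?thesis using e by linarith
  qed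
  let ?T = "\<lambda>i x. indicator (A i) x *\<^sub>R ((indicator (C i) x - a i) *\<^sub>R grad \<phi> x) - grad (z i) x"
  define \<rho> where "\<rho> x = indicator D x - \<theta> x - (\<Sum>i\<le>K. indicator (A i) x * (indicator (C i) x - a i))" for x
  have \<rho>b: "AE x in M. \<bar>\<rho> x\<bar> \<le> 1 / real K"
    using \<theta>(2) AE_space
  proof eventually_elim
    case (elim x)
    define k where "k = nat \<lfloor>real K * \<theta> x\<rfloor>"
    have kt: "0 \<le> real K * \<theta> x" using elim by simp
    have k: "real k \<le> real K * \<theta> x" "real K * \<theta> x < real k + 1" using kt by (auto simp: k_def)
    have "real K * \<theta> x \<le> real K * 1" using elim by (intro mult_left_mono) auto
    then have kK: "k \<le> K" using k(1) by simp
    have iA: "x \<in> A i \<longleftrightarrow> i = k" for i using k elim by (auto simp: A_def)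
    have "(\<Sum>i\<le>K. indicator (A i) x * (indicator (C i) x - a i)) = (\<Sum>i\<le>K. if i = k then indicator (C k) x - a k else 0)"
      by (intro sum.cong) (auto simp: indicator_def iA)
    also have "\<dots> = indicator (C k) x - a k" using kK by simp
    finally have s: "(\<Sum>i\<le>K. indicator (A i) x * (indicator (C i) x - a i)) = indicator (C k) x - a k" .
    have "indicator D x = (indicator (C k) x :: real)" using kK by (auto simp: D_def iA indicator_def)
    then have "\<rho> x = a k - \<theta> x" unfolding \<rho>_def s by simp
    moreover have "a k \<le> \<theta> x" "\<theta> x \<le> a k + 1 / real K" using k K(2) by (auto simp: a_def field_simps)
    ultimately show ?case by (simp add: abs_le_iff)
  qed
  have \<rho>M: "\<rho> \<in> borel_measurable M"
    unfolding \<rho>_def[abs_def] using D A zC(2) \<theta>(1)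
    by (intro borel_measurable_diff borel_measurable_sum borel_measurable_times borel_measurable_indicator borel_measurable_const) auto
  have \<phi>M: "grad \<phi> \<in> borel_measurable M" by (rule grad_measurable_M[OF \<phi>(1)])
  have \<rho>\<phi>: "AE x in M. norm (\<rho> x *\<^sub>R grad \<phi> x) \<le> B / real K"
    using \<rho>b AE_space
  proof eventually_elim
    case (elim x)
    have "\<bar>\<rho> x\<bar> * norm (grad \<phi> x) \<le> 1 / real K * B" using elim \<phi>(3)[of x] by (intro mult_mono) auto
    then show ?case by simp
  qed
  have \<rho>S: "(\<lambda>x. \<rho> x *\<^sub>R grad \<phi> x) \<in> borel_measurable M" by (intro borel_measurable_scaleR \<rho>M \<phi>M)
  have \<rho>L: "(\<lambda>x. \<rho> x *\<^sub>R grad \<phi> x) \<in> L2 \<Omega>" by (rule bounded_L2[OF \<rho>S \<rho>\<phi>])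
  have \<phi>L: "grad \<phi> \<in> L2 \<Omega>" by (rule bounded_L2[OF \<phi>M, where C=B]) (use \<phi>(3) in auto)
  have TL: "?T i \<in> L2 \<Omega>" if "i \<le> K" for i
  proof (rule L2_diff[OF _ test_grad_L2[OF zC(1)[OF that]]])
    have "(\<lambda>x. (indicator (A i) x * (indicator (C i) x - a i)) *\<^sub>R grad \<phi> x) \<in> L2 \<Omega>"
    proof (rule L2_mult_bounded[OF \<phi>L])
      show "(\<lambda>x. indicator (A i) x * (indicator (C i) x - a i)) \<in> borel_measurable M"
        using A zC(2)[OF that] by (intro borel_measurable_diff borel_measurable_times borel_measurable_indicator borel_measurable_const)
      show "AE x in M. \<bar>indicator (A i) x * (indicator (C i) x - a i)\<bar> \<le> 1 + \<bar>a i\<bar>"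
        by (intro AE_I2) (auto simp: indicator_def)
    qed
    then show "(\<lambda>x. indicator (A i) x *\<^sub>R ((indicator (C i) x - a i) *\<^sub>R grad \<phi> x)) \<in> L2 \<Omega>" by simp
  qed
  have eq: "(indicator D x - \<theta> x) *\<^sub>R grad \<phi> x - grad Z x = (\<Sum>i\<le>K. ?T i x) + \<rho> x *\<^sub>R grad \<phi> x" for x
    unfolding gZ \<rho>_def sum_subtractf by (simp add: algebra_simps scaleR_sum_left)
  have "l2_norm \<Omega> (\<lambda>x. (indicator D x - \<theta> x) *\<^sub>R grad \<phi> x - grad Z x)
      \<le> l2_norm \<Omega> (\<lambda>x. \<Sum>i\<le>K. ?T i x) + l2_norm \<Omega> (\<lambda>x. \<rho> x *\<^sub>R grad \<phi> x)"
    unfolding eq by (rule l2_norm_triangle[OF l2_norm_sum(1) \<rho>L]) (use TL in auto)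
  also have "l2_norm \<Omega> (\<lambda>x. \<Sum>i\<le>K. ?T i x) \<le> (\<Sum>i\<le>K. l2_norm \<Omega> (?T i))"
    by (rule l2_norm_sum(2)) (use TL in auto)
  also have "\<dots> \<le> (\<Sum>i\<le>K. e')" by (intro sum_mono zC(4)) auto
  also have "\<dots> = e / 2" using e'(3) by simp
  also have "l2_norm \<Omega> (\<lambda>x. \<rho> x *\<^sub>R grad \<phi> x) \<le> B / real K * S"
    unfolding S_def by (rule l2_norm_le_sup[OF \<rho>S \<rho>\<phi>]) (use B in simp)
  also have "\<dots> \<le> e / 2" by (rule KB)
  finally have "l2_norm \<Omega> (\<lambda>x. (indicator D x - \<theta> x) *\<^sub>R grad \<phi> x - grad Z x) \<le> e" by simp
  then show ?thesis using that[OF Z D Zb] by blast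
qed

end

section \<open>Recovery sequences\<close>

lemma continuous_on_dominated_increment:
  fixes f v :: "real \<Rightarrow> real"
  assumes "continuous_on S v" "\<And>r s. r \<in> S \<Longrightarrow> s \<in> S \<Longrightarrow> \<bar>f r - f s\<bar> \<le> \<bar>v r - v s\<bar>"
  shows "continuous_on S f"
  unfolding continuous_on_iff dist_real_def
proof (intro ballI allI impI)
  fix x e :: real assume x: "x \<in> S" "e > 0"
  then obtain d where "d > 0" "\<And>x'. x' \<in> S \<Longrightarrow> \<bar>x' - x\<bar> < d \<Longrightarrow> \<bar>v x' - v x\<bar> < e"
    using assms(1) unfolding continuous_on_iff dist_real_def by meson
  then show "\<exists>d>0. \<forall>x'\<in>S. \<bar>x' - x\<bar> < d \<longrightarrow> \<bar>f x' - f x\<bar> < e"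
    using assms(2) x(1) by (intro exI[of _ d]) (metis order_le_less_trans)
qed

text \<open>Intersect with balls growing from the origin. The measure cut out is continuous in the
  radius because its increments are dominated by those of the ball volume, so the intermediate value
  theorem applies.\<close>

lemma lmeasurable_subset_of_measure:
  fixes S :: "'a::euclidean_space set"
  assumes S: "S \<in> lmeasurable" "bounded S" and t: "0 \<le> t" "t \<le> measure lebesgue S"
  obtains T where "T \<subseteq> S" "T \<in> lmeasurable" "measure lebesgue T = t"
proof -
  obtain R where R: "R > 0" "S \<subseteq> ball 0 R" using bounded_subset_ballD[OF S(2)] by blast
  define f where "f r = measure lebesgue (S \<inter> ball 0 r)" for r
  define v where "v r = measure lebesgue (ball (0::'a) r)" for r
  have m: "S \<inter> ball 0 r \<in> lmeasurable" for r by (intro fmeasurable_Int_fmeasurable S) auto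
  have step: "0 \<le> f r - f s \<and> f r - f s \<le> v r - v s" if "s \<le> r" for r s
  proof -
    have sub: "ball (0::'a) s \<subseteq> ball 0 r" using that by auto
    have "f r - f s = measure lebesgue ((S \<inter> ball 0 r) - (S \<inter> ball 0 s))"
      unfolding f_def using m sub by (intro measurable_measure_Diff[symmetric]) auto
    moreover have "\<dots> \<le> measure lebesgue (ball 0 r - ball (0::'a) s)"
      using m by (intro measure_mono_fmeasurable) auto
    moreover have "measure lebesgue (ball 0 r - ball (0::'a) s) = v r - v s"
      unfolding v_def using sub by (intro measurable_measure_Diff) auto
    ultimately show ?thesis by simp
  qed
  have "continuous_on {0..R} f"
  proof (rule continuous_on_dominated_increment)
    have c: "continuous_on {0..R} (\<lambda>r. unit_ball_vol DIM('a) * r ^ DIM('a))" by (intro continuous_intros)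
    have "v r = unit_ball_vol DIM('a) * r ^ DIM('a)" if "r \<in> {0..R}" for r
      using that content_ball[of r "0::'a"] by (simp add: v_def)
    then show "continuous_on {0..R} v" by (intro continuous_on_eq[OF c]) simp
    show "\<bar>f r - f s\<bar> \<le> \<bar>v r - v s\<bar>" for r s using step[of r s] step[of s r] by linarith
  qed
  moreover have "f 0 \<le> t" "t \<le> f R" using t R(2) by (auto simp: f_def Int_absorb2)
  ultimately obtain r where "f r = t" using IVT'[of f 0 t R] R(1) by auto
  then show ?thesis using m[of r] that[of "S \<inter> ball 0 r"] by (simp add: f_def)
qed

section \<open>Weak convergence to zero of bounded sequences\<close>

context bounded_open
begin

text \<open>Convergence against a single \<open>g\<close>: for layers it is known at first only for
  special integrands, and is then extended by sums and dominated limits.\<close>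

definition weak_null :: "(nat \<Rightarrow> 'a \<Rightarrow> real) \<Rightarrow> ('a \<Rightarrow> real) \<Rightarrow> bool" where
  "weak_null r g \<longleftrightarrow> (\<lambda>k. \<integral>x. r k x * g x \<partial>M) \<longlonglongrightarrow> 0"

lemma bounded_mult_integrable:
  fixes r g :: "'a \<Rightarrow> real"
  assumes "r \<in> borel_measurable M" "AE x in M. \<bar>r x\<bar> \<le> 1" "integrable M g"
  shows "integrable M (\<lambda>x. r x * g x)" "\<bar>\<integral>x. r x * g x \<partial>M\<bar> \<le> (\<integral>x. \<bar>g x\<bar> \<partial>M)"
proof -
  have b: "AE x in M. norm (r x * g x) \<le> norm (g x)"
    using assms(2) by eventually_elim (simp add: abs_mult mult_left_le_one_le)
  show i: "integrable M (\<lambda>x. r x * g x)"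
    by (rule Bochner_Integration.integrable_bound[OF assms(3) _ b]) (use assms(1,3) in measurable)
  have "\<bar>\<integral>x. r x * g x \<partial>M\<bar> \<le> (\<integral>x. norm (r x * g x) \<partial>M)" using integral_norm_bound[of M "\<lambda>x. r x * g x"] by simp
  also have "\<dots> \<le> (\<integral>x. \<bar>g x\<bar> \<partial>M)" using b i assms(3) by (intro integral_mono_AE) auto
  finally show "\<bar>\<integral>x. r x * g x \<partial>M\<bar> \<le> (\<integral>x. \<bar>g x\<bar> \<partial>M)" .
qed

context
  fixes r :: "nat \<Rightarrow> 'a \<Rightarrow> real"
  assumes r: "\<And>k. r k \<in> borel_measurable M" "\<And>k. AE x in M. \<bar>r k x\<bar> \<le> 1"
begin

lemma weak_null_add:
  assumes "integrable M f" "integrable M g" "weak_null r f" "weak_null r g"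
  shows "weak_null r (\<lambda>x. f x + g x)"
proof -
  have "(\<lambda>k. (\<integral>x. r k x * f x \<partial>M) + (\<integral>x. r k x * g x \<partial>M)) \<longlonglongrightarrow> 0 + 0"
    using assms(3,4) unfolding weak_null_def by (intro tendsto_add)
  moreover have "(\<integral>x. r k x * (f x + g x) \<partial>M) = (\<integral>x. r k x * f x \<partial>M) + (\<integral>x. r k x * g x \<partial>M)" for k
    unfolding distrib_left by (intro Bochner_Integration.integral_add bounded_mult_integrable(1) r assms)
  ultimately show ?thesis by (simp add: weak_null_def)
qed

lemma weak_null_sum:
  assumes "finite I" "\<And>i. i \<in> I \<Longrightarrow> integrable M (f i)" "\<And>i. i \<in> I \<Longrightarrow> weak_null r (f i)"
  shows "weak_null r (\<lambda>x. \<Sum>i\<in>I. f i x)"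
  using assms
proof (induction rule: finite_induct)
  case empty then show ?case by (simp add: weak_null_def)
next
  case (insert i I)
  then have "weak_null r (\<lambda>x. f i x + (\<Sum>i\<in>I. f i x))" by (intro weak_null_add Bochner_Integration.integrable_sum) auto
  then show ?case using insert by simp
qed

text \<open>Since \<open>r k\<close> is bounded by 1, an \<open>L1\<close> error in the integrand
  costs no more than itself, uniformly in \<open>k\<close>, so the limits in \<open>j\<close> and
  \<open>k\<close> may be exchanged.\<close>

lemma weak_null_limit:
  assumes w: "integrable M w" and g: "\<And>j. g j \<in> borel_measurable M" "\<And>j. AE x in M. \<bar>g j x\<bar> \<le> w x"
    and f: "f \<in> borel_measurable M" and lim: "AE x in M. (\<lambda>j. g j x) \<longlonglongrightarrow> f x"
    and null: "\<And>j. weak_null r (g j)"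
  shows "weak_null r f"
proof -
  have gi: "integrable M (g j)" for j
    by (rule Bochner_Integration.integrable_bound[OF w g(1)])
       (use g(2)[of j] in \<open>auto elim!: eventually_mono\<close>)
  have fi: "integrable M f"
    by (rule integrable_dominated_convergence[OF f g(1) w lim]) (use g(2) in auto)
  have "(\<lambda>j. \<integral>x. norm (g j x - f x) \<partial>M) \<longlonglongrightarrow> 0"
  proof -
    have "(\<lambda>j. \<integral>x. norm (g j x - f x) \<partial>M) \<longlonglongrightarrow> (\<integral>x. 0 \<partial>M)"
    proof (rule integral_dominated_convergence[where w="\<lambda>x. w x + \<bar>f x\<bar>"])
      show "AE x in M. (\<lambda>j. norm (g j x - f x)) \<longlonglongrightarrow> 0"
        using lim
      proof eventually_elim
        case (elim x)
        then show ?case by (intro tendsto_norm_zero LIM_zero)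
      qed
      show "AE x in M. norm (norm (g j x - f x)) \<le> w x + \<bar>f x\<bar>" for j
        using g(2)[of j] by eventually_elim simp
    qed (use w fi f g(1) in auto)
    then show ?thesis by simp
  qed
  note L1 = this
  show ?thesis unfolding weak_null_def
  proof (rule LIMSEQ_I)
    fix e :: real assume "e > 0"
    then have e: "e / 2 > 0" by simp
    obtain j where j: "(\<integral>x. norm (g j x - f x) \<partial>M) < e / 2"
      using LIMSEQ_D[OF L1 e] by force
    obtain K where K: "\<And>k. k \<ge> K \<Longrightarrow> \<bar>\<integral>x. r k x * g j x \<partial>M\<bar> < e / 2"
      using LIMSEQ_D[OF null[of j, unfolded weak_null_def] e] by auto
    show "\<exists>K. \<forall>k\<ge>K. norm ((\<integral>x. r k x * f x \<partial>M) - 0) < e"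
    proof (intro exI allI impI)
      fix k assume k: "K \<le> k"
      have "(\<integral>x. r k x * g j x \<partial>M) - (\<integral>x. r k x * f x \<partial>M) = (\<integral>x. r k x * (g j x - f x) \<partial>M)"
        unfolding right_diff_distrib
        by (intro Bochner_Integration.integral_diff[symmetric] bounded_mult_integrable(1) r gi fi)
      moreover have "\<bar>\<integral>x. r k x * (g j x - f x) \<partial>M\<bar> \<le> (\<integral>x. \<bar>g j x - f x\<bar> \<partial>M)"
        by (intro bounded_mult_integrable(2) r Bochner_Integration.integrable_diff gi fi)
      ultimately show "norm ((\<integral>x. r k x * f x \<partial>M) - 0) < e" using j K[OF k] by simp
    qed
  qed
qed

text \<open>Truncating \<open>f\<close> at height \<open>j\<close> bounds the pairing by
  \<open>j\<close> times the \<open>L1\<close> norm of \<open>r k\<close>; the truncation is then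
  removed by \<open>weak_null_limit\<close>.\<close>

lemma weak_null_of_L1_null:
  assumes "(\<lambda>k. \<integral>x. \<bar>r k x\<bar> \<partial>M) \<longlonglongrightarrow> 0" and f: "integrable M f"
  shows "weak_null r f"
proof (rule weak_null_limit[where w="\<lambda>x. \<bar>f x\<bar>" and g="\<lambda>j x. max (- real j) (min (real j) (f x))"])
  have ri: "integrable M (r k)" for k by (rule bounded_integrable[OF r(1), where C=1]) (use r(2) in auto)
  show "weak_null r (\<lambda>x. max (- real j) (min (real j) (f x)))" for j
    unfolding weak_null_def
  proof (rule Lim_null_comparison)
    have b: "\<bar>max (- real j) (min (real j) (f x))\<bar> \<le> real j" for x by (auto simp: abs_le_iff)
    have p: "norm (r k x * max (- real j) (min (real j) (f x))) \<le> real j * \<bar>r k x\<bar>" for k x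
      using mult_left_mono[OF b[of x], of "\<bar>r k x\<bar>"] by (simp add: abs_mult mult.commute)
    have "norm (\<integral>x. r k x * max (- real j) (min (real j) (f x)) \<partial>M) \<le> (\<integral>x. real j * \<bar>r k x\<bar> \<partial>M)" for k
    proof (rule Bochner_Integration.integral_norm_bound_integral)
      show i: "integrable M (\<lambda>x. real j * \<bar>r k x\<bar>)" using ri[of k] by simp
      show "integrable M (\<lambda>x. r k x * max (- real j) (min (real j) (f x)))"
      proof (rule Bochner_Integration.integrable_bound[OF i])
        show "(\<lambda>x. r k x * max (- real j) (min (real j) (f x))) \<in> borel_measurable M"
          using r(1)[of k] borel_measurable_integrable[OF f] by measurable
      qed (use p in auto)
    qed (rule p)
    then show "\<forall>\<^sub>F k in sequentially. norm (\<integral>x. r k x * max (- real j) (min (real j) (f x)) \<partial>M) \<le> real j * (\<integral>x. \<bar>r k x\<bar> \<partial>M)"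
      by simp
    show "(\<lambda>k. real j * (\<integral>x. \<bar>r k x\<bar> \<partial>M)) \<longlonglongrightarrow> 0" using tendsto_mult_left[OF assms(1), of "real j"] by simp
  qed
  show "AE x in M. (\<lambda>j. max (- real j) (min (real j) (f x))) \<longlonglongrightarrow> f x"
  proof (rule AE_I2)
    fix x
    obtain N :: nat where N: "\<bar>f x\<bar> \<le> real N" using real_arch_simple by blast
    have "\<forall>\<^sub>F j in sequentially. f x = max (- real j) (min (real j) (f x))"
      unfolding eventually_sequentially
    proof (intro exI allI impI)
      fix j assume "N \<le> j"
      then have "real N \<le> real j" by simp
      then have "- real j \<le> f x" "f x \<le> real j" using N by linarith+
      then show "f x = max (- real j) (min (real j) (f x))" by simp
    qed
    then show "(\<lambda>j. max (- real j) (min (real j) (f x))) \<longlonglongrightarrow> f x"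
      by (rule Lim_transform_eventually[OF tendsto_const])
  qed
qed (use f in auto)

text \<open>When the field \<open>r k x *\<^sub>R P x\<close> is nearly the gradient of a small
  function, integration by parts kills it against test functions; approximation extends this to
  indicators and then to integrands \<open>(P x \<bullet> b) * h x\<close>. Writing \<open>g\<close>
  as a sum of these divides by |P|^2, hence the condition that \<open>g\<close> vanish where
  \<open>P\<close> does.\<close>

lemma weak_null_of_gradients:
  fixes P :: "'a \<Rightarrow> 'a"
  assumes P: "P \<in> L2 \<Omega>" and z: "\<And>k. z k \<in> test_functions \<Omega>" "(\<lambda>k. l2_norm \<Omega> (z k)) \<longlonglongrightarrow> 0"
    and gz: "(\<lambda>k. l2_norm \<Omega> (\<lambda>x. r k x *\<^sub>R P x - grad (z k) x)) \<longlonglongrightarrow> 0"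
    and g: "integrable M g" and g0: "\<And>x. P x = 0 \<Longrightarrow> g x = 0"
  shows "weak_null r g"
proof -
  note [measurable] = L2_measurable[OF P] borel_measurable_integrable[OF g]
  have rP: "(\<lambda>x. r k x *\<^sub>R P x) \<in> L2 \<Omega>" for k by (rule L2_mult_bounded[OF P r])
  have gL: "grad (z k) \<in> L2 \<Omega>" for k by (rule test_grad_L2[OF z(1)])
  have Pi: "integrable M (\<lambda>x. \<bar>P x \<bullet> b\<bar>)" if "b \<in> Basis" for b
  proof -
    have "integrable M (\<lambda>x. P x \<bullet> b)" by (rule integrable_inner_left[OF L2_integrable[OF P]])
    then show ?thesis by simp
  qed
  have test: "weak_null r (\<lambda>x. (P x \<bullet> b) * \<eta> x)" if b: "b \<in> Basis" and \<eta>: "\<eta> \<in> test_functions \<Omega>" for b \<eta>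
  proof -
    have \<eta>L: "(\<lambda>x. \<eta> x *\<^sub>R b) \<in> L2 \<Omega>" by (rule test_scaleR_L2[OF \<eta>])
    have dL: "(\<lambda>x. grad \<eta> x \<bullet> b) \<in> L2 \<Omega>"
    proof (rule L2_I_bound[OF _ L2_power2_integrable[OF test_grad_L2[OF \<eta>]]])
      show "(\<lambda>x. grad \<eta> x \<bullet> b) \<in> borel_measurable M" using L2_measurable[OF test_grad_L2[OF \<eta>]] by measurable
      show "AE x in M. (norm (grad \<eta> x \<bullet> b))\<^sup>2 \<le> (norm (grad \<eta> x))\<^sup>2"
        using Basis_le_norm[OF b] by (intro AE_I2 power_mono) auto
    qed
    have "l2_inner \<Omega> (grad (z k)) (\<lambda>x. \<eta> x *\<^sub>R b) = - l2_inner \<Omega> (z k) (\<lambda>x. grad \<eta> x \<bullet> b)" for k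
      using has_weak_gradient_test[OF test_smooth[OF z(1)]] \<eta> b unfolding has_weak_gradient_iff by fastforce
    then have eq: "(\<integral>x. r k x * ((P x \<bullet> b) * \<eta> x) \<partial>M) =
        l2_inner \<Omega> (\<lambda>x. r k x *\<^sub>R P x - grad (z k) x) (\<lambda>x. \<eta> x *\<^sub>R b) - l2_inner \<Omega> (z k) (\<lambda>x. grad \<eta> x \<bullet> b)" for k
      using l2_inner_diff_left[OF rP gL \<eta>L, of k k] by (simp add: l2_inner_def mult.assoc mult.commute[of "\<eta> _"])
    show ?thesis unfolding weak_null_def eq
    proof (rule tendsto_eq_rhs[OF tendsto_diff])
      show "(\<lambda>k. l2_inner \<Omega> (\<lambda>x. r k x *\<^sub>R P x - grad (z k) x) (\<lambda>x. \<eta> x *\<^sub>R b)) \<longlonglongrightarrow> 0"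
      proof (rule Lim_null_comparison)
        show "\<forall>\<^sub>F k in sequentially. norm (l2_inner \<Omega> (\<lambda>x. r k x *\<^sub>R P x - grad (z k) x) (\<lambda>x. \<eta> x *\<^sub>R b))
          \<le> l2_norm \<Omega> (\<lambda>x. r k x *\<^sub>R P x - grad (z k) x) * l2_norm \<Omega> (\<lambda>x. \<eta> x *\<^sub>R b)"
          unfolding real_norm_def by (intro always_eventually allI l2_Cauchy_Schwarz L2_diff rP gL \<eta>L)
        show "(\<lambda>k. l2_norm \<Omega> (\<lambda>x. r k x *\<^sub>R P x - grad (z k) x) * l2_norm \<Omega> (\<lambda>x. \<eta> x *\<^sub>R b)) \<longlonglongrightarrow> 0"
          using tendsto_mult_right[OF gz] by simp
      qed
      show "(\<lambda>k. l2_inner \<Omega> (z k) (\<lambda>x. grad \<eta> x \<bullet> b)) \<longlonglongrightarrow> 0"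
      proof (rule Lim_null_comparison)
        show "\<forall>\<^sub>F k in sequentially. norm (l2_inner \<Omega> (z k) (\<lambda>x. grad \<eta> x \<bullet> b)) \<le> l2_norm \<Omega> (z k) * l2_norm \<Omega> (\<lambda>x. grad \<eta> x \<bullet> b)"
          unfolding real_norm_def by (intro always_eventually allI l2_Cauchy_Schwarz test_L2 z(1) dL)
        show "(\<lambda>k. l2_norm \<Omega> (z k) * l2_norm \<Omega> (\<lambda>x. grad \<eta> x \<bullet> b)) \<longlonglongrightarrow> 0"
          using tendsto_mult_right[OF z(2)] by simp
      qed
    qed simp
  qed
  have ind: "weak_null r (\<lambda>x. (P x \<bullet> b) * indicator A x)" if b: "b \<in> Basis" and A: "A \<in> sets M" for b A
  proof -
    from A have A': "A \<in> sets lebesgue" "A \<subseteq> \<Omega>" unfolding sets_M_iff by auto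
    from indicator_test_AE_limit[OF A'] obtain \<eta> where \<eta>: "\<forall>n. \<eta> n \<in> test_functions \<Omega>" "\<forall>n x. 0 \<le> \<eta> n x" "\<forall>n x. \<eta> n x \<le> 1"
      "AE x in M. (\<lambda>n. \<eta> n x) \<longlonglongrightarrow> indicator A x" by metis
    show ?thesis
    proof (rule weak_null_limit[OF Pi[OF b]])
      show "(\<lambda>x. (P x \<bullet> b) * \<eta> j x) \<in> borel_measurable M" for j
        using smooth_measurable_M[OF test_smooth[of "\<eta> j" \<Omega>]] \<eta>(1) by auto
      show "(\<lambda>x. (P x \<bullet> b) * indicator A x) \<in> borel_measurable M" using A by auto
      show "AE x in M. \<bar>(P x \<bullet> b) * \<eta> j x\<bar> \<le> \<bar>P x \<bullet> b\<bar>" for j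
        using \<eta>(2,3) by (intro AE_I2) (simp add: abs_mult mult_right_le_one_le)
      show "AE x in M. (\<lambda>j. (P x \<bullet> b) * \<eta> j x) \<longlonglongrightarrow> (P x \<bullet> b) * indicator A x"
        using \<eta>(4) by eventually_elim (intro tendsto_intros)
      show "weak_null r (\<lambda>x. (P x \<bullet> b) * \<eta> j x)" for j by (rule test[OF b]) (use \<eta>(1) in auto)
    qed
  qed
  have comp: "weak_null r (\<lambda>x. (P x \<bullet> b) * h x)"
    if b: "b \<in> Basis" and h: "h \<in> borel_measurable M" "integrable M (\<lambda>x. (P x \<bullet> b) * h x)" for b and h :: "'a \<Rightarrow> real"
  proof -
    \<comment> \<open>Integrability of \<open>(P x \<bullet> b) * h x\<close> is integrability of
      \<open>h\<close> for this weighted measure, so the induction over integrable functions runs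
      with respect to it although neither factor need be bounded.\<close>
    let ?D = "density M (\<lambda>x. ennreal \<bar>P x \<bullet> b\<bar>)"
    have iD: "integrable ?D f \<longleftrightarrow> integrable M (\<lambda>x. (P x \<bullet> b) * f x)" if "f \<in> borel_measurable M" for f :: "'a \<Rightarrow> real"
    proof -
      have "integrable ?D f \<longleftrightarrow> integrable M (\<lambda>x. \<bar>P x \<bullet> b\<bar> *\<^sub>R f x)" using that by (intro integrable_density) auto
      also have "\<dots> \<longleftrightarrow> integrable M (\<lambda>x. norm (\<bar>P x \<bullet> b\<bar> *\<^sub>R f x))" using that by (intro integrable_norm_iff[symmetric]) measurable
      also have "\<dots> \<longleftrightarrow> integrable M (\<lambda>x. norm ((P x \<bullet> b) * f x))" by (simp add: abs_mult)
      also have "\<dots> \<longleftrightarrow> integrable M (\<lambda>x. (P x \<bullet> b) * f x)" using that by (intro integrable_norm_iff) measurable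
      finally show ?thesis .
    qed
    have "integrable ?D h" using iD h by blast
    then show ?thesis
    proof (induct rule: integrable_induct)
      case (base A c)
      then have "weak_null r (\<lambda>x. (P x \<bullet> b) * indicator A x)" by (intro ind[OF b]) simp
      then have "(\<lambda>k. c * (\<integral>x. r k x * ((P x \<bullet> b) * indicator A x) \<partial>M)) \<longlonglongrightarrow> c * 0"
        unfolding weak_null_def by (intro tendsto_intros)
      moreover have "c * (\<integral>x. r k x * ((P x \<bullet> b) * indicator A x) \<partial>M) = (\<integral>x. r k x * ((P x \<bullet> b) * (indicat_real A x *\<^sub>R c)) \<partial>M)" for k
        unfolding integral_mult_right_zero[symmetric] by (intro Bochner_Integration.integral_cong) auto
      ultimately show ?case unfolding weak_null_def by simp
    next
      case (add f g)
      then have "integrable M (\<lambda>x. (P x \<bullet> b) * f x)" "integrable M (\<lambda>x. (P x \<bullet> b) * g x)"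
        using iD[of f] iD[of g] borel_measurable_integrable[OF add(1)] borel_measurable_integrable[OF add(3)] by simp_all
      from weak_null_add[OF this add(2,4)] show ?case by (simp add: distrib_left)
    next
      case (lim f s)
      have fm: "f \<in> borel_measurable M" "s i \<in> borel_measurable M" for i
        using borel_measurable_integrable[OF lim(5)] borel_measurable_integrable[OF lim(1)] by simp_all
      have "integrable M (\<lambda>x. (P x \<bullet> b) * f x)" using iD[OF fm(1)] lim(5) by blast
      then have w: "integrable M (\<lambda>x. 2 * \<bar>(P x \<bullet> b) * f x\<bar>)" by simp
      show ?case
      proof (rule weak_null_limit[OF w])
        show "(\<lambda>x. (P x \<bullet> b) * s j x) \<in> borel_measurable M" for j using fm(2) by measurable
        show "(\<lambda>x. (P x \<bullet> b) * f x) \<in> borel_measurable M" using fm(1) by measurable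
        show "AE x in M. \<bar>(P x \<bullet> b) * s j x\<bar> \<le> 2 * \<bar>(P x \<bullet> b) * f x\<bar>" for j
        proof (rule AE_I2)
          fix x assume "x \<in> space M"
          then have "\<bar>s j x\<bar> \<le> 2 * \<bar>f x\<bar>" using lim(4)[of x j] by simp
          then have "\<bar>P x \<bullet> b\<bar> * \<bar>s j x\<bar> \<le> \<bar>P x \<bullet> b\<bar> * (2 * \<bar>f x\<bar>)" by (intro mult_left_mono) auto
          then show "\<bar>(P x \<bullet> b) * s j x\<bar> \<le> 2 * \<bar>(P x \<bullet> b) * f x\<bar>" by (simp add: abs_mult)
        qed
        show "AE x in M. (\<lambda>j. (P x \<bullet> b) * s j x) \<longlonglongrightarrow> (P x \<bullet> b) * f x"
          using lim(3) by (intro AE_I2 tendsto_intros) simp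
        show "weak_null r (\<lambda>x. (P x \<bullet> b) * s j x)" for j by (rule lim(2))
      qed
    qed
  qed
  \<comment> \<open>The products \<open>(P x \<bullet> b) * h b x\<close> sum to \<open>g x\<close>
    over the basis; where \<open>P x = 0\<close> the division yields 0, in agreement with
    \<open>g x\<close>.\<close>
  define h where "h b x = (P x \<bullet> b) * g x / (norm (P x))\<^sup>2" for b x
  have hi: "integrable M (\<lambda>x. (P x \<bullet> b) * h b x)" if b: "b \<in> Basis" for b
  proof (rule Bochner_Integration.integrable_bound[OF g])
    show "(\<lambda>x. (P x \<bullet> b) * h b x) \<in> borel_measurable M" unfolding h_def by measurable
    show "AE x in M. norm ((P x \<bullet> b) * h b x) \<le> norm (g x)"
    proof (rule AE_I2)
      fix x
      have "\<bar>P x \<bullet> b\<bar>\<^sup>2 \<le> (norm (P x))\<^sup>2" using Basis_le_norm[OF b, of "P x"] by (intro power_mono) auto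
      then have "(P x \<bullet> b)\<^sup>2 / (norm (P x))\<^sup>2 \<le> 1" by (simp add: divide_le_eq)
      then have "(P x \<bullet> b)\<^sup>2 / (norm (P x))\<^sup>2 * \<bar>g x\<bar> \<le> 1 * \<bar>g x\<bar>" by (intro mult_right_mono) auto
      moreover have "norm ((P x \<bullet> b) * h b x) = (P x \<bullet> b)\<^sup>2 / (norm (P x))\<^sup>2 * \<bar>g x\<bar>"
        by (simp add: h_def abs_mult power2_eq_square)
      ultimately show "norm ((P x \<bullet> b) * h b x) \<le> norm (g x)" by simp
    qed
  qed
  have "weak_null r (\<lambda>x. \<Sum>b\<in>Basis. (P x \<bullet> b) * h b x)"
  proof (rule weak_null_sum)
    fix b :: 'a assume b: "b \<in> Basis"
    show "integrable M (\<lambda>x. (P x \<bullet> b) * h b x)" by (rule hi[OF b])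
    show "weak_null r (\<lambda>x. (P x \<bullet> b) * h b x)" by (rule comp[OF b _ hi[OF b]]) (unfold h_def, measurable)
  qed simp
  moreover have "(\<Sum>b\<in>Basis. (P x \<bullet> b) * h b x) = g x" for x
  proof -
    have "(\<Sum>b\<in>Basis. (P x \<bullet> b) * h b x) = (\<Sum>b\<in>Basis. (P x \<bullet> b) * (P x \<bullet> b)) * g x / (norm (P x))\<^sup>2"
      by (simp add: h_def sum_distrib_right sum_divide_distrib mult.assoc)
    also have "\<dots> = (norm (P x))\<^sup>2 * g x / (norm (P x))\<^sup>2" by (simp add: power2_norm_eq_inner euclidean_inner[of "P x" "P x"])
    also have "\<dots> = g x" using g0[of x] by (cases "P x = 0") auto
    finally show ?thesis .
  qed
  ultimately show ?thesis by simp
qed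

end

section \<open>Volume correction, and layers for functions of \<open>H10\<close>\<close>

lemma indicator_diff_bdd:
  fixes \<theta> :: "'a \<Rightarrow> real"
  assumes "A \<in> sets M" "\<theta> \<in> borel_measurable M" "AE x in M. 0 \<le> \<theta> x \<and> \<theta> x \<le> 1"
  shows "(\<lambda>x. indicator A x - \<theta> x) \<in> borel_measurable M" "AE x in M. \<bar>indicator A x - \<theta> x\<bar> \<le> 1"
proof -
  show "(\<lambda>x. indicator A x - \<theta> x) \<in> borel_measurable M"
    by (intro borel_measurable_diff borel_measurable_indicator assms)
  show "AE x in M. \<bar>indicator A x - \<theta> x\<bar> \<le> 1" using assms(3) by eventually_elim (auto simp: indicator_def)
qed

text \<open>A piece of measure equal to the discrepancy is removed from \<open>B\<close> or added
  from its complement, so the two indicators differ by exactly that much in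
  \<open>L1\<close>.\<close>

lemma adjust_measure:
  assumes B: "B \<in> sets M" and m: "0 \<le> m" "m \<le> measure lebesgue \<Omega>"
  obtains T where "T \<in> sets M" "measure lebesgue T = m"
    "(\<integral>x. \<bar>indicat_real B x - indicator T x\<bar> \<partial>M) = \<bar>measure lebesgue B - m\<bar>"
proof -
  from B have B': "B \<subseteq> \<Omega>" "B \<in> lmeasurable" unfolding sets_M_iff
    using dom_lmeasurable by (auto intro: fmeasurableI2)
  have bdd: "bounded S" if "S \<subseteq> \<Omega>" for S using bounded_dom bounded_subset that by blast
  have meas: "measure M S = measure lebesgue S" if "S \<subseteq> \<Omega>" for S using that by (simp add: measure_restrict_space)
  show ?thesis
  proof (cases "m \<le> measure lebesgue B")
    case True
    obtain T where T: "T \<subseteq> B" "T \<in> lmeasurable" "measure lebesgue T = m"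
      using lmeasurable_subset_of_measure[OF B'(2) bdd[OF B'(1)] m(1) True] by metis
    have "(\<integral>x. \<bar>indicat_real B x - indicator T x\<bar> \<partial>M) = (\<integral>x. indicator (B - T) x \<partial>M)"
      using T(1) by (intro Bochner_Integration.integral_cong) (auto simp: indicator_def)
    also have "\<dots> = measure lebesgue (B - T)" using B'(1) by (simp add: meas Int_absorb2 subset_iff)
    also have "\<dots> = measure lebesgue B - m" using measurable_measure_Diff[of B lebesgue T] B'(2) T by auto
    finally show ?thesis using T B' True by (intro that[of T]) (auto simp: sets_M_iff)
  next
    case False
    have dm: "\<Omega> - B \<in> lmeasurable" using dom_lmeasurable B'(2) by (intro fmeasurable_Diff) auto
    have "measure lebesgue (\<Omega> - B) = measure lebesgue \<Omega> - measure lebesgue B"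
      using dom_lmeasurable B' by (intro measurable_measure_Diff) auto
    then have "m - measure lebesgue B \<le> measure lebesgue (\<Omega> - B)" "0 \<le> m - measure lebesgue B" using m False by auto
    then obtain T where T: "T \<subseteq> \<Omega> - B" "T \<in> lmeasurable" "measure lebesgue T = m - measure lebesgue B"
      using lmeasurable_subset_of_measure[OF dm bdd[of "\<Omega> - B"]] by blast
    have "measure lebesgue (B \<union> T) = m"
    proof -
      have "B \<inter> T = {}" using T(1) by auto
      then show ?thesis using T B'(2) measure_Un3[of B lebesgue T] by simp
    qed
    moreover have "(\<integral>x. \<bar>indicat_real B x - indicator (B \<union> T) x\<bar> \<partial>M) = (\<integral>x. indicator T x \<partial>M)"
      using T(1) by (intro Bochner_Integration.integral_cong) (auto simp: indicator_def)
    moreover have "(\<integral>x. indicator T x \<partial>M) = measure lebesgue T" using T(1) by (simp add: meas Int_absorb2 subset_iff)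
    ultimately show ?thesis using T B' False by (intro that[of "B \<union> T"]) (auto simp: sets_M_iff)
  qed
qed

text \<open>The layers follow a test function near \<open>u\<close>; since the amplitude
  \<open>indicator C x - \<theta> x\<close> is at most 1 in modulus, passing from
  \<open>grad \<phi>\<close> to \<open>wgrad \<Omega> u\<close> costs no more than their
  distance.\<close>

lemma gradient_laminate:
  assumes u: "u \<in> H10 \<Omega>" and \<theta>: "\<theta> \<in> borel_measurable M" "AE x in M. 0 \<le> \<theta> x \<and> \<theta> x \<le> 1" and e: "e > 0"
  obtains z C where "z \<in> test_functions \<Omega>" "C \<in> sets M" "\<And>x. \<bar>z x\<bar> \<le> e"
    "l2_norm \<Omega> (\<lambda>x. (indicator C x - \<theta> x) *\<^sub>R wgrad \<Omega> u x - grad z x) \<le> e"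
proof -
  have e2: "e / 2 > 0" using e by simp
  from H10_test_approx[OF u e2] obtain \<phi> where \<phi>: "\<phi> \<in> test_functions \<Omega>"
    "l2_norm \<Omega> (\<lambda>x. grad \<phi> x - wgrad \<Omega> u x) < e / 2" .
  obtain K where K: "K > 0" "\<And>x. \<bar>\<phi> x\<bar> \<le> K" "\<And>x. norm (grad \<phi> x) \<le> K" using test_bounded[OF \<phi>(1)] by metis
  show ?thesis
  proof (rule laminate[OF test_smooth[OF \<phi>(1)] K(2,3,1) \<theta> e2])
    fix z C assume z: "z \<in> test_functions \<Omega>" and C: "C \<in> sets M" and zb: "\<And>x. \<bar>z x\<bar> \<le> e / 2"
      and n: "l2_norm \<Omega> (\<lambda>x. (indicator C x - \<theta> x) *\<^sub>R grad \<phi> x - grad z x) \<le> e / 2"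
    note c = indicator_diff_bdd[OF C \<theta>]
    note L = H10_wgrad[OF u] test_grad_L2[OF \<phi>(1)] test_grad_L2[OF z]
    let ?a = "\<lambda>x. (indicator C x - \<theta> x) *\<^sub>R wgrad \<Omega> u x" and ?b = "\<lambda>x. (indicator C x - \<theta> x) *\<^sub>R grad \<phi> x"
    have ab: "?a \<in> L2 \<Omega>" "?b \<in> L2 \<Omega>" by (intro L2_mult_bounded[OF _ c] L)+
    have "l2_norm \<Omega> (\<lambda>x. ?a x - ?b x) \<le> l2_norm \<Omega> (\<lambda>x. wgrad \<Omega> u x - grad \<phi> x)"
    proof (rule l2_norm_mono[OF L2_diff[OF ab] L2_diff[OF L(1,2)]])
      show "AE x in M. norm (?a x - ?b x) \<le> norm (wgrad \<Omega> u x - grad \<phi> x)"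
        using c(2) unfolding scaleR_diff_right[symmetric] norm_scaleR
        by eventually_elim (simp add: mult_left_le_one_le)
    qed
    then have "l2_norm \<Omega> (\<lambda>x. ?a x - ?b x) \<le> e / 2" using \<phi>(2) l2_norm_commute[of \<Omega> "grad \<phi>" "wgrad \<Omega> u"] by simp
    then have "l2_norm \<Omega> (\<lambda>x. ?a x - grad z x) \<le> e"
      using l2_norm_triangle_diff[OF ab L(3)] n by linarith
    moreover have "\<bar>z x\<bar> \<le> e" for x using zb[of x] e by linarith
    ultimately show ?thesis using that[OF z C] by blast
  qed
qed

lemma linear_laminate:
  assumes \<theta>: "\<theta> \<in> borel_measurable M" "AE x in M. 0 \<le> \<theta> x \<and> \<theta> x \<le> 1" and e: "e > 0"
  obtains z C where "z \<in> test_functions \<Omega>" "C \<in> sets M" "\<And>x. \<bar>z x\<bar> \<le> e"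
    "l2_norm \<Omega> (\<lambda>x. (indicator C x - \<theta> x) *\<^sub>R b - grad z x) \<le> e"
proof -
  obtain R where R: "R > 0" "\<And>x. x \<in> \<Omega> \<Longrightarrow> norm x \<le> R" using bounded_dom unfolding bounded_pos by blast
  define B where "B = R * norm b + norm b + 1"
  have B: "B > 0" using R(1) by (simp add: B_def add_nonneg_pos)
  have "\<bar>x \<bullet> b\<bar> \<le> B" if "x \<in> \<Omega>" for x
  proof -
    have "\<bar>x \<bullet> b\<bar> \<le> norm x * norm b" by (rule Cauchy_Schwarz_ineq2)
    also have "\<dots> \<le> R * norm b" using R(2)[OF that] by (intro mult_right_mono) auto
    finally show ?thesis by (simp add: B_def add_increasing2)
  qed
  moreover have gb: "grad (\<lambda>x. x \<bullet> b) = (\<lambda>x. b)" by (intro ext grad_eqI GDERIV_inner)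
  moreover have "norm b \<le> B" using R(1) by (simp add: B_def)
  ultimately have b: "\<And>x. x \<in> \<Omega> \<Longrightarrow> \<bar>x \<bullet> b\<bar> \<le> B" "\<And>x. x \<in> \<Omega> \<Longrightarrow> norm (grad (\<lambda>x. x \<bullet> b) x) \<le> B" by auto
  show ?thesis by (rule laminate[OF smooth_inner b B \<theta> e]) (assumption+, rule that, simp_all add: gb)
qed

text \<open>
  Layers transversal to \<open>\<nabla>u\<close> say nothing about the set where \<open>\<nabla>u\<close> vanishes, which might have positive measure;
  layers in a fixed direction \<open>b\<close> are used there.
\<close>

lemma recovery_sequence:
  assumes u: "u \<in> H10 \<Omega>" and \<theta>: "\<theta> \<in> U_ad_closure \<Omega> m" and m: "0 \<le> m" "m \<le> measure lebesgue \<Omega>"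
  obtains X z where "\<And>n. X n \<in> U_ad \<Omega> m" "weak_star_tendsto \<Omega> X \<theta>" "\<And>n. z n \<in> test_functions \<Omega>"
    "(\<lambda>n. l2_norm \<Omega> (z n)) \<longlonglongrightarrow> 0"
    "(\<lambda>n. l2_norm \<Omega> (\<lambda>x. grad (z n) x - (X n x - \<theta> x) *\<^sub>R wgrad \<Omega> u x)) \<longlonglongrightarrow> 0"
proof -
  have \<theta>M: "\<theta> \<in> borel_measurable M" and \<theta>1: "AE x in M. 0 \<le> \<theta> x \<and> \<theta> x \<le> 1" and \<theta>m: "(\<integral>x. \<theta> x \<partial>M) = m"
    using \<theta> by (auto simp: U_ad_closure_def)
  note [measurable] = \<theta>M
  have \<theta>i: "integrable M \<theta>" 
  proof (rule bounded_integrable[OF \<theta>M])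
    show "AE x in M. norm (\<theta> x) \<le> 1" using \<theta>1 by eventually_elim simp
  qed
  let ?w = "wgrad \<Omega> u"
  have wL: "?w \<in> L2 \<Omega>" by (rule H10_wgrad[OF u])
  note [measurable] = L2_measurable[OF wL]
  define e where "e k = inverse (real (Suc k))" for k
  have e: "e k > 0" for k by (simp add: e_def)
  have elim: "e \<longlonglongrightarrow> 0" unfolding e_def[abs_def] by (rule LIMSEQ_inverse_real_of_nat)
  define Q where "Q k P z C \<longleftrightarrow> z \<in> test_functions \<Omega> \<and> C \<in> sets M \<and> (\<forall>x. \<bar>z x\<bar> \<le> e k) \<and>
    l2_norm \<Omega> (\<lambda>x. (indicator C x - \<theta> x) *\<^sub>R P x - grad z x) \<le> e k" for k :: nat and P :: "'a \<Rightarrow> 'a" and z C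
  \<comment> \<open>The uniform bounds \<open>e k\<close> make the test functions vanish in
    \<open>L2\<close>, so every family satisfying \<open>Q\<close> meets the hypotheses of
    \<open>weak_null_of_gradients\<close>.\<close>
  have Qnull: "weak_null (\<lambda>k x. indicator (C k) x - \<theta> x) g"
    if Q: "\<And>k. Q k P (z k) (C k)" and P: "P \<in> L2 \<Omega>" and g: "integrable M g" "\<And>x. P x = 0 \<Longrightarrow> g x = 0" for P z C g
  proof (rule weak_null_of_gradients[where z=z and P=P])
    have C: "C k \<in> sets M" for k using Q by (simp add: Q_def)
    then show "(\<lambda>x. indicator (C k) x - \<theta> x) \<in> borel_measurable M" for k by auto
    show "AE x in M. \<bar>indicator (C k) x - \<theta> x\<bar> \<le> 1" for k using \<theta>1 by eventually_elim (auto simp: indicator_def)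
    show z: "z k \<in> test_functions \<Omega>" for k using Q by (simp add: Q_def)
    have zb: "\<bar>z k x\<bar> \<le> e k" for k x using Q by (simp add: Q_def)
    show "(\<lambda>k. l2_norm \<Omega> (z k)) \<longlonglongrightarrow> 0"
    proof (rule Lim_null_comparison)
      have "l2_norm \<Omega> (z k) \<le> e k * sqrt (measure lebesgue \<Omega>)" for k
        by (rule l2_norm_le_sup[OF L2_measurable[OF test_L2[OF z]]]) (use zb e[of k] in \<open>auto simp: less_imp_le\<close>)
      then show "\<forall>\<^sub>F k in sequentially. norm (l2_norm \<Omega> (z k)) \<le> e k * sqrt (measure lebesgue \<Omega>)"
        by (simp add: l2_norm_nonneg)
      show "(\<lambda>k. e k * sqrt (measure lebesgue \<Omega>)) \<longlonglongrightarrow> 0" using tendsto_mult_right[OF elim] by simp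
    qed
    show "(\<lambda>k. l2_norm \<Omega> (\<lambda>x. (indicator (C k) x - \<theta> x) *\<^sub>R P x - grad (z k) x)) \<longlonglongrightarrow> 0"
      by (rule Lim_null_comparison[OF _ elim]) (use Q in \<open>auto simp: Q_def l2_norm_nonneg\<close>)
  qed (use P g in auto)
  have "\<exists>z C. Q k ?w z C" for k
  proof (rule gradient_laminate[OF u \<theta>M \<theta>1 e[of k]])
    fix z C assume "z \<in> test_functions \<Omega>" "C \<in> sets M" "\<And>x. \<bar>z x\<bar> \<le> e k"
      "l2_norm \<Omega> (\<lambda>x. (indicator C x - \<theta> x) *\<^sub>R ?w x - grad z x) \<le> e k"
    then have "Q k ?w z C" unfolding Q_def by blast
    then show ?thesis by blast
  qed
  then obtain z C where zC: "\<And>k. Q k ?w (z k) (C k)" by metis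
  obtain b :: 'a where b: "b \<in> Basis" using nonempty_Basis by blast
  have "\<exists>z C. Q k (\<lambda>x. b) z C" for k
  proof (rule linear_laminate[OF \<theta>M \<theta>1 e[of k]])
    fix z C assume "z \<in> test_functions \<Omega>" "C \<in> sets M" "\<And>x. \<bar>z x\<bar> \<le> e k"
      "l2_norm \<Omega> (\<lambda>x. (indicator C x - \<theta> x) *\<^sub>R b - grad z x) \<le> e k"
    then have "Q k (\<lambda>x. b) z C" unfolding Q_def by blast
    then show ?thesis by blast
  qed
  then obtain y D where yD: "\<And>k. Q k (\<lambda>x. b) (y k) (D k)" by metis
  have CM: "C k \<in> sets M" "D k \<in> sets M" for k using zC yD by (auto simp: Q_def)
  have z: "z k \<in> test_functions \<Omega>" "\<And>x. \<bar>z k x\<bar> \<le> e k" for k using zC by (auto simp: Q_def)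
  define S where "S = {x \<in> \<Omega>. ?w x = 0}"
  have S: "S \<in> sets M"
  proof -
    have "{x \<in> space M. ?w x = 0} \<in> sets M" by measurable
    then show ?thesis unfolding S_def space_M .
  qed
  \<comment> \<open>On \<open>S\<close> the gradient of \<open>u\<close> is zero, so exchanging
    \<open>C k\<close> for \<open>D k\<close> there leaves the relation with
    \<open>grad (z k)\<close> intact while securing weak convergence on \<open>S\<close>.\<close>
  define B where "B k = (C k - S) \<union> (D k \<inter> S)" for k
  have B: "B k \<in> sets M" for k unfolding B_def using CM S by auto
  have Bnull: "weak_null (\<lambda>k x. indicator (B k) x - \<theta> x) g" if g: "integrable M g" for g
  proof -
    define g1 g2 where "g1 x = (if ?w x = 0 then 0 else g x)" and "g2 x = (if ?w x = 0 then g x else 0)" for x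
    note [measurable] = borel_measurable_integrable[OF g]
    have g12: "integrable M g1" "integrable M g2"
      unfolding g1_def[abs_def] g2_def[abs_def] by (auto intro!: Bochner_Integration.integrable_bound[OF g])
    have bL: "(\<lambda>x. b) \<in> L2 \<Omega>" by (rule bounded_L2[where C="norm b"]) auto
    have "weak_null (\<lambda>k x. indicator (C k) x - \<theta> x) g1" by (rule Qnull[OF zC wL g12(1)]) (simp add: g1_def)
    moreover have "weak_null (\<lambda>k x. indicator (D k) x - \<theta> x) g2" by (rule Qnull[OF yD bL g12(2)]) (use b in auto)
    ultimately have "(\<lambda>k. (\<integral>x. (indicator (C k) x - \<theta> x) * g1 x \<partial>M) + (\<integral>x. (indicator (D k) x - \<theta> x) * g2 x \<partial>M)) \<longlonglongrightarrow> 0 + 0"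
      unfolding weak_null_def by (rule tendsto_add)
    moreover have "(\<integral>x. (indicator (B k) x - \<theta> x) * g x \<partial>M)
       = (\<integral>x. (indicator (C k) x - \<theta> x) * g1 x \<partial>M) + (\<integral>x. (indicator (D k) x - \<theta> x) * g2 x \<partial>M)" for k
    proof -
      note r = indicator_diff_bdd[OF _ \<theta>M \<theta>1]
      have "(\<integral>x. (indicator (B k) x - \<theta> x) * g x \<partial>M)
         = (\<integral>x. (indicator (C k) x - \<theta> x) * g1 x + (indicator (D k) x - \<theta> x) * g2 x \<partial>M)"
        by (intro Bochner_Integration.integral_cong refl) (auto simp: g1_def g2_def B_def S_def indicator_def)
      also have "\<dots> = (\<integral>x. (indicator (C k) x - \<theta> x) * g1 x \<partial>M) + (\<integral>x. (indicator (D k) x - \<theta> x) * g2 x \<partial>M)"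
        by (intro Bochner_Integration.integral_add bounded_mult_integrable(1) r CM g12)
      finally show ?thesis .
    qed
    ultimately show ?thesis by (simp add: weak_null_def)
  qed
  have ind: "integrable M (indicat_real A)" "integral\<^sup>L M (indicator A) = measure lebesgue A" if "A \<in> sets M" for A
  proof -
    have "A \<subseteq> \<Omega>" using that by (simp add: sets_M_iff)
    then show "integral\<^sup>L M (indicator A) = measure lebesgue A"
      using that by (simp add: measure_restrict_space Int_absorb2)
    show "integrable M (indicat_real A)"
      by (rule bounded_integrable[OF borel_measurable_indicator[OF that], where C=1]) (auto simp: indicator_def)
  qed
  \<comment> \<open>Testing with the constant 1 shows that the volumes tend to
    \<open>m\<close>.\<close>
  have "weak_null (\<lambda>k x. indicator (B k) x - \<theta> x) (\<lambda>x. 1)"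
    by (rule Bnull) (rule bounded_integrable[where C=1], auto)
  then have Bm: "(\<lambda>k. measure lebesgue (B k) - m) \<longlonglongrightarrow> 0"
    unfolding weak_null_def using ind[OF B] \<theta>i \<theta>m by simp
  have "\<exists>T. T \<in> sets M \<and> measure lebesgue T = m \<and>
    (\<integral>x. \<bar>indicat_real (B k) x - indicator T x\<bar> \<partial>M) = \<bar>measure lebesgue (B k) - m\<bar>" for k
    using adjust_measure[OF B[of k] m] by metis
  then obtain T where T: "\<And>k. T k \<in> sets M" "\<And>k. measure lebesgue (T k) = m"
    "\<And>k. (\<integral>x. \<bar>indicat_real (B k) x - indicator (T k) x\<bar> \<partial>M) = \<bar>measure lebesgue (B k) - m\<bar>" by metis
  define s where "s k x = indicat_real (B k) x - indicator (T k) x" for k x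
  have s: "s k \<in> borel_measurable M" "AE x in M. \<bar>s k x\<bar> \<le> 1" for k
    unfolding s_def[abs_def] using B T(1) by (auto simp: indicator_def)
  have sL1: "(\<lambda>k. \<integral>x. \<bar>s k x\<bar> \<partial>M) \<longlonglongrightarrow> 0"
    unfolding s_def T(3) using tendsto_rabs[OF Bm] by simp
  have snull: "weak_null s g" if "integrable M g" for g by (rule weak_null_of_L1_null[OF s sL1 that])
  have sabs: "weak_null (\<lambda>k x. \<bar>s k x\<bar>) g" if "integrable M g" for g
    by (rule weak_null_of_L1_null[OF _ _ _ that]) (use s sL1 in auto)
  define X where "X k = indicat_real (T k)" for k
  have XU: "X k \<in> U_ad \<Omega> m" for k
    unfolding U_ad_def X_def using T(1)[of k] T(2)[of k] by (auto simp: sets_M_iff)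
  have ws: "weak_star_tendsto \<Omega> X \<theta>"
    unfolding weak_star_tendsto_def
  proof (intro allI impI)
    fix g :: "'a \<Rightarrow> real" assume g: "integrable M g"
    have "AE x in M. \<bar>\<theta> x\<bar> \<le> 1" using \<theta>1 by eventually_elim simp
    then have i: "integrable M (\<lambda>x. X k x * g x)" "integrable M (\<lambda>x. \<theta> x * g x)" "integrable M (\<lambda>x. indicator (B k) x * g x)" for k
      using T(1) B g \<theta>M by (auto intro!: bounded_mult_integrable(1) simp: X_def)
    have eq: "(\<integral>x. X k x * g x \<partial>M) = (\<integral>x. (indicator (B k) x - \<theta> x) * g x \<partial>M) - (\<integral>x. s k x * g x \<partial>M) + (\<integral>x. \<theta> x * g x \<partial>M)" for k
      using i by (simp add: left_diff_distrib s_def X_def[symmetric])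
    have "(\<lambda>k. (\<integral>x. (indicator (B k) x - \<theta> x) * g x \<partial>M) - (\<integral>x. s k x * g x \<partial>M) + (\<integral>x. \<theta> x * g x \<partial>M))
      \<longlonglongrightarrow> 0 - 0 + (\<integral>x. \<theta> x * g x \<partial>M)"
      using Bnull[OF g] snull[OF g] unfolding weak_null_def by (intro tendsto_intros)
    then show "(\<lambda>n. \<integral>x. X n x * g x \<partial>M) \<longlonglongrightarrow> (\<integral>x. \<theta> x * g x \<partial>M)" unfolding eq by simp
  qed
  have zlim: "(\<lambda>k. l2_norm \<Omega> (z k)) \<longlonglongrightarrow> 0"
  proof (rule Lim_null_comparison)
    have "l2_norm \<Omega> (z k) \<le> e k * sqrt (measure lebesgue \<Omega>)" for k
      by (rule l2_norm_le_sup[OF L2_measurable[OF test_L2[OF z(1)]]]) (use z(2) e[of k] in \<open>auto simp: less_imp_le\<close>)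
    then show "\<forall>\<^sub>F k in sequentially. norm (l2_norm \<Omega> (z k)) \<le> e k * sqrt (measure lebesgue \<Omega>)"
      by (simp add: l2_norm_nonneg)
    show "(\<lambda>k. e k * sqrt (measure lebesgue \<Omega>)) \<longlonglongrightarrow> 0" using tendsto_mult_right[OF elim] by simp
  qed
  have slim: "(\<lambda>k. l2_norm \<Omega> (\<lambda>x. s k x *\<^sub>R ?w x)) \<longlonglongrightarrow> 0"
  proof -
    \<comment> \<open>\<open>s k x\<close> takes values in {-1, 0, 1}, so its square is its modulus,
      and the claim becomes weak nullity of the modulus against the integrable weight
      |?w|^2.\<close>
    have "(norm (s k x *\<^sub>R ?w x))\<^sup>2 = \<bar>s k x\<bar> * (norm (?w x))\<^sup>2" for k x
      by (auto simp: s_def indicator_def power_mult_distrib)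
    then show ?thesis using sabs[OF L2_power2_integrable[OF wL]]
      unfolding l2_norm_tendsto_0_iff weak_null_def by simp
  qed
  show ?thesis
  proof (rule that[OF XU ws z(1) zlim])
    show "(\<lambda>k. l2_norm \<Omega> (\<lambda>x. grad (z k) x - (X k x - \<theta> x) *\<^sub>R ?w x)) \<longlonglongrightarrow> 0"
    proof (rule Lim_null_comparison)
      let ?d = "\<lambda>k x. (indicator (C k) x - \<theta> x) *\<^sub>R ?w x - grad (z k) x"
      have dL: "?d k \<in> L2 \<Omega>" for k
      proof (intro L2_diff test_grad_L2 z(1) L2_mult_bounded[OF wL])
        show "(\<lambda>x. indicator (C k) x - \<theta> x) \<in> borel_measurable M" using CM by auto
        show "AE x in M. \<bar>indicator (C k) x - \<theta> x\<bar> \<le> 1" using \<theta>1 by eventually_elim (auto simp: indicator_def)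
      qed
      have sL: "(\<lambda>x. s k x *\<^sub>R ?w x) \<in> L2 \<Omega>" for k by (rule L2_mult_bounded[OF wL s])
      \<comment> \<open>Off \<open>S\<close> the sets \<open>B k\<close> and \<open>C k\<close>
        agree; on \<open>S\<close> all terms with \<open>?w x\<close> vanish.\<close>
      have pt: "grad (z k) x - (X k x - \<theta> x) *\<^sub>R ?w x = s k x *\<^sub>R ?w x - ?d k x" if "x \<in> \<Omega>" for k x
        using that by (cases "?w x = 0") (auto simp: s_def X_def B_def S_def indicator_def algebra_simps)
      have "l2_norm \<Omega> (\<lambda>x. grad (z k) x - (X k x - \<theta> x) *\<^sub>R ?w x) = l2_norm \<Omega> (\<lambda>x. s k x *\<^sub>R ?w x - ?d k x)" for k
        unfolding l2_norm_def l2_inner_def by (intro arg_cong[of _ _ sqrt] Bochner_Integration.integral_cong) (auto simp: pt)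
      moreover have "l2_norm \<Omega> (\<lambda>x. s k x *\<^sub>R ?w x - ?d k x) \<le> l2_norm \<Omega> (\<lambda>x. s k x *\<^sub>R ?w x) + e k" for k
      proof -
        have "l2_norm \<Omega> (\<lambda>x. s k x *\<^sub>R ?w x - ?d k x) = l2_norm \<Omega> (\<lambda>x. s k x *\<^sub>R ?w x + (-1) *\<^sub>R ?d k x)"
          unfolding scaleR_minus1_left diff_conv_add_uminus[of "s k _ *\<^sub>R ?w _"] ..
        also have "\<dots> \<le> l2_norm \<Omega> (\<lambda>x. s k x *\<^sub>R ?w x) + l2_norm \<Omega> (\<lambda>x. (-1) *\<^sub>R ?d k x)"
          by (intro l2_norm_triangle sL L2_scaleR dL)
        also have "l2_norm \<Omega> (\<lambda>x. (-1) *\<^sub>R ?d k x) = l2_norm \<Omega> (?d k)" unfolding l2_norm_scaleR by simp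
        finally show ?thesis using zC[of k] by (simp add: Q_def)
      qed
      ultimately show "\<forall>\<^sub>F k in sequentially. norm (l2_norm \<Omega> (\<lambda>x. grad (z k) x - (X k x - \<theta> x) *\<^sub>R ?w x))
        \<le> l2_norm \<Omega> (\<lambda>x. s k x *\<^sub>R ?w x) + e k"
        by (simp add: l2_norm_nonneg)
      show "(\<lambda>k. l2_norm \<Omega> (\<lambda>x. s k x *\<^sub>R ?w x) + e k) \<longlonglongrightarrow> 0" using tendsto_add[OF slim elim] by simp
    qed
  qed
qed

end

theorem theorem3p1:
  fixes \<Omega> :: "'a::euclidean_space set"
    and \<alpha> \<epsilon> m l\<^sub>0 :: real
    and u\<^sub>0 \<theta> :: "'a \<Rightarrow> real"
  assumes "open \<Omega>" and "connected \<Omega>" and "\<Omega> \<noteq> {}" and "bounded \<Omega>"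
    and "\<alpha> > 0" and "\<epsilon> > 0" and "0 < m" and "m < measure lebesgue \<Omega>"
    and "first_eigenvalue \<Omega> \<alpha> l\<^sub>0"
    and "eigenfunction \<Omega> \<alpha> l\<^sub>0 u\<^sub>0"
    and "AE x in lebesgue_on \<Omega>. u\<^sub>0 x > 0"
    and "(\<integral>x. (u\<^sub>0 x)\<^sup>2 \<partial>lebesgue_on \<Omega>) = 1"
    and "\<theta> \<in> U_ad_closure \<Omega> m"
  shows "F_bar \<Omega> \<alpha> l\<^sub>0 u\<^sub>0 \<epsilon> m \<theta> =
    ereal (\<alpha> * (\<integral>x.
        \<theta> x * ((wgrad \<Omega> u\<^sub>0 x + \<epsilon> *\<^sub>R wgrad \<Omega> (state \<Omega> \<alpha> l\<^sub>0 u\<^sub>0 \<theta>) x) \<bullet> wgrad \<Omega> u\<^sub>0 x)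
        - \<epsilon> * \<theta> x * (1 - \<theta> x) * (norm (wgrad \<Omega> u\<^sub>0 x))\<^sup>2
      \<partial>lebesgue_on \<Omega>))"
proof -
  interpret bounded_open \<Omega> using assms(1,4) by unfold_locales
  have u: "u\<^sub>0 \<in> H10 \<Omega>" "\<And>\<phi>. \<phi> \<in> H10 \<Omega> \<Longrightarrow> energy \<alpha> l\<^sub>0 u\<^sub>0 \<phi> = 0"
    using assms(10) by (auto simp: eigenfunction_iff)
  have l0: "0 \<le> l\<^sub>0" by (rule first_eigenvalue_nonneg[OF assms(5,9)])
  note nonneg = first_eigenvalue_energy_nonneg[OF assms(5,9)]
  have un: "l2_norm \<Omega> u\<^sub>0 = 1" using assms(12) by (simp add: l2_norm_def l2_inner_self)
  \<comment> \<open>Connectedness and the positivity of the eigenfunction enter here, through the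
    simplicity assumption of the locale.\<close>
  interpret simple_eigenvalue \<Omega> \<alpha> l\<^sub>0 u\<^sub>0
    by unfold_locales
      (use assms(5) l0 nonneg u un first_eigenvalue_simple[OF assms(2,5) l0 nonneg H10_L2[OF u(1)] assms(11)] in blast)+
  have \<theta>: "\<theta> \<in> borel_measurable M" "AE x in M. 0 \<le> \<theta> x \<and> \<theta> x \<le> 1"
    using assms(13) by (auto simp: U_ad_closure_def)
  have "AE x in M. \<bar>\<theta> x\<bar> \<le> 1" using \<theta>(2) by eventually_elim simp
  with \<theta>(1) have b: "bdd1 \<theta>" by (simp add: bdd1_def)
  have U: "X n \<in> borel_measurable M" "X n x \<in> {0, 1}" if XU: "\<forall>n. X n \<in> U_ad \<Omega> m" for X :: "nat \<Rightarrow> 'a \<Rightarrow> real" and n x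
  proof -
    obtain B where B: "X n = indicat_real B" "B \<subseteq> \<Omega>" "B \<in> sets lebesgue" using spec[OF XU, of n] unfolding U_ad_def by auto
    then have "B \<in> sets M" by (simp add: sets_M_iff)
    then show "X n \<in> borel_measurable M" "X n x \<in> {0, 1}" by (simp_all add: B(1) indicator_def)
  qed
  define E where "E = {liminf (\<lambda>n. ereal (F \<Omega> \<alpha> l\<^sub>0 u\<^sub>0 \<epsilon> (X n))) | X. (\<forall>n. X n \<in> U_ad \<Omega> m) \<and> weak_star_tendsto \<Omega> X \<theta>}"
  have eps: "0 \<le> \<epsilon>" using assms(6) by simp
  \<comment> \<open>Every competitor stays above a sequence converging to the relaxed value; this
    rests on the upper bound for the energy, which holds whatever the shape of the designs.\<close>
  have low: "ereal (relaxed \<epsilon> \<theta>) \<le> y" if yE: "y \<in> E" for y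
  proof -
    obtain X where X: "\<forall>n. X n \<in> U_ad \<Omega> m" "weak_star_tendsto \<Omega> X \<theta>" "y = liminf (\<lambda>n. ereal (F \<Omega> \<alpha> l\<^sub>0 u\<^sub>0 \<epsilon> (X n)))"
      using yE unfolding E_def by blast
    show ?thesis
    proof (rule design_sequence[OF \<theta> U[OF X(1)] X(2) eps])
      fix a assume a: "a \<longlonglongrightarrow> relaxed \<epsilon> \<theta>" "\<And>n. a n \<le> F \<Omega> \<alpha> l\<^sub>0 u\<^sub>0 \<epsilon> (X n)"
      have "ereal (relaxed \<epsilon> \<theta>) = liminf (\<lambda>n. ereal (a n))"
        using a(1) by (intro lim_imp_Liminf[symmetric]) (auto simp: tendsto_ereal)
      also have "\<dots> \<le> y" unfolding X(3) by (intro Liminf_mono always_eventually allI) (simp add: a(2))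
      finally show ?thesis .
    qed
  qed
  \<comment> \<open>The infimum is attained: along the recovery sequence \<open>F\<close> itself
    converges to the relaxed value.\<close>
  have "ereal (relaxed \<epsilon> \<theta>) \<in> E"
  proof (rule recovery_sequence[OF u(1) assms(13)])
    show "0 \<le> m" "m \<le> measure lebesgue \<Omega>" using assms(7,8) by auto
    fix X z assume X: "\<And>n. X n \<in> U_ad \<Omega> m" "weak_star_tendsto \<Omega> X \<theta>" and z: "\<And>n. z n \<in> test_functions \<Omega>"
      "(\<lambda>n. l2_norm \<Omega> (z n)) \<longlonglongrightarrow> 0"
      "(\<lambda>n. l2_norm \<Omega> (\<lambda>x. grad (z n) x - (X n x - \<theta> x) *\<^sub>R wgrad \<Omega> u\<^sub>0 x)) \<longlonglongrightarrow> 0"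
    have XU: "\<forall>n. X n \<in> U_ad \<Omega> m" using X(1) by blast
    have "(\<lambda>n. F \<Omega> \<alpha> l\<^sub>0 u\<^sub>0 \<epsilon> (X n)) \<longlonglongrightarrow> relaxed \<epsilon> \<theta>"
    proof (rule design_sequence[OF \<theta> U[OF XU] X(2) eps])
      assume "\<And>z. (\<And>n. z n \<in> test_functions \<Omega>) \<Longrightarrow> (\<lambda>n. l2_norm \<Omega> (z n)) \<longlonglongrightarrow> 0 \<Longrightarrow>
        (\<lambda>n. l2_norm \<Omega> (\<lambda>x. grad (z n) x - (X n x - \<theta> x) *\<^sub>R wgrad \<Omega> u\<^sub>0 x)) \<longlonglongrightarrow> 0 \<Longrightarrow>
        (\<lambda>n. F \<Omega> \<alpha> l\<^sub>0 u\<^sub>0 \<epsilon> (X n)) \<longlonglongrightarrow> relaxed \<epsilon> \<theta>"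
      from this[OF z] show ?thesis .
    qed
    then have "liminf (\<lambda>n. ereal (F \<Omega> \<alpha> l\<^sub>0 u\<^sub>0 \<epsilon> (X n))) = ereal (relaxed \<epsilon> \<theta>)"
      by (intro lim_imp_Liminf) (auto simp: tendsto_ereal)
    then show ?thesis unfolding E_def using XU X(2) by (intro CollectI exI[of _ X]) simp
  qed
  then have "Inf E = ereal (relaxed \<epsilon> \<theta>)" using low by (intro Inf_eqI) auto
  then show ?thesis unfolding F_bar_def E_def relaxed_eq[OF b] .
qed

end
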